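(* Let $\mathbf X_1,\dots,\mathbf X_n$ be independent observations of $\mathbf X\sim EC_d(\boldsymbol\mu,\boldsymbol\Sigma,\xi)$ and assume (A1) and (A2). Let $\widehat{\mathbf S}$ be the sample spatial-sign covariance matrix. Then for any $\alpha>0$ there exists a positive constant $C_S$ such that, for all sufficiently large $n$ and any $\delta\in(0,1)$, $$\|\widehat{\mathbf S}-\mathbf S\|_2\le \|\mathbf S\|_2\sqrt{\frac{4(1+r^*(\mathbf S))(\log d+\log(1/\alpha))}{n}}+C_S\, n^{-\frac12(1+\delta)}$$ with probability larger than $1-\alpha$.
   Context: A $d$-dimensional random vector $\mathbf X$ follows the elliptical distribution $EC_d(\boldsymbol\mu,\boldsymbol\Sigma,\xi)$ if $\mathbf X\overset{d}{=}\boldsymbol\mu+\xi\mathbf A\mathbf U$, where $\boldsymbol\mu\in\mathbb R^d$, $\mathbf U$ is uniform on the unit sphere of $\mathbb R^q$, $\xi\ge0$ is a scalar random variable independent of $\mathbf U$ with $P(\xi=0)=0$ and $E\xi^2=q$, and $\mathbf A\in\mathbb R^{d\times q}$ is deterministic with $\mathbf A\mathbf A^T=\boldsymbol\Sigma$, $\operatorname{rank}(\boldsymbol\Sigma)=q\le d$. The spatial sign function is $U(\mathbf x)=\mathbf x/\|\mathbf x\|_2$ for $\mathbf x\neq 0$ and $U(\mathbf 0)=\mathbf 0$. The spatial-sign covariance matrix is $\mathbf S=E[U(\mathbf X-\boldsymbol\mu)U(\mathbf X-\boldsymbol\mu)^T]$ (so $\operatorname{tr}(\mathbf S)=1$). The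 spatial median is $\hat{\boldsymbol\mu}=\arg\min_{\boldsymbol\mu\in\mathbb R^d}\sum_{i=1}^n\|\mathbf X_i-\boldsymbol\mu\|_2$, and the sample spatial-sign covariance matrix is $\widehat{\mathbf S}=\frac1n\sum_{i=1}^nU(\mathbf X_i-\hat{\boldsymbol\mu})U(\mathbf X_i-\hat{\boldsymbol\mu})^T$. Let $r_i=\|\mathbf X_i-\boldsymbol\mu\|_2$, $\zeta_k=E(r_i^{-k})$, $\nu_i=\zeta_1^{-1}r_i^{-1}$. The dimension $d$ (and $\boldsymbol\Sigma$) may vary with $n$. Assumptions: (A1) there is $\zeta\in(0,\infty)$ with $\zeta_k\zeta_1^{-k}<\zeta$ for $k=1,2,3,4$ and all $d$; (A2) $\limsup_d\|\mathbf S\|_2<1-\psi<1$ for some constant $\psi>0$. The effective rank is $r^*(\mathbf S)=\operatorname{tr}(\mathbf S)/\|\mathbf S\|_2=1/\lambda_1(\mathbf S)$. $\|\cdot\|_2$ on matrices is the spectral norm. *)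

theory Defs
  imports "HOL-Probability.Probability"
begin

text \<open>Vectors of R^d are represented as functions nat => real, only the
 coordinates below d matter; d x q matrices as nat => nat => real.\<close>

definition vnorm :: "nat \<Rightarrow> (nat \<Rightarrow> real) \<Rightarrow> real" where
  "vnorm d x = sqrt (\<Sum>j<d. (x j)\<^sup>2)"

definition ssign :: "nat \<Rightarrow> (nat \<Rightarrow> real) \<Rightarrow> (nat \<Rightarrow> real)" where
  "ssign d x = (\<lambda>j. if vnorm d x = 0 then 0 else x j / vnorm d x)"

abbreviation Rvec :: "nat \<Rightarrow> (nat \<Rightarrow> real) measure" where
  "Rvec d \<equiv> PiM {..<d} (\<lambda>_. borel)"

definition specnorm :: "nat \<Rightarrow> (nat \<Rightarrow> nat \<Rightarrow> real) \<Rightarrow> real" where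
  "specnorm d M = Sup {vnorm d (\<lambda>i. \<Sum>j<d. M i j * x j) | x. vnorm d x = 1}"

definition mtrace :: "nat \<Rightarrow> (nat \<Rightarrow> nat \<Rightarrow> real) \<Rightarrow> real" where
  "mtrace d M = (\<Sum>i<d. M i i)"

definition eff_rank :: "nat \<Rightarrow> (nat \<Rightarrow> nat \<Rightarrow> real) \<Rightarrow> real" where
  "eff_rank d M = mtrace d M / specnorm d M"

definition cols_indep :: "nat \<Rightarrow> (nat \<Rightarrow> nat \<Rightarrow> real) \<Rightarrow> nat set \<Rightarrow> bool" where
  "cols_indep m M J = (\<forall>c. (\<forall>i<m. (\<Sum>j\<in>J. c j * M i j) = 0) \<longrightarrow> (\<forall>j\<in>J. c j = 0))"

definition mat_rank :: "nat \<Rightarrow> nat \<Rightarrow> (nat \<Rightarrow> nat \<Rightarrow> real) \<Rightarrow> nat" where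
  "mat_rank m k M = Max {card J | J. J \<subseteq> {..<k} \<and> cols_indep m M J}"

text \<open>Uniform distribution on the unit sphere of R^q (normalized surface measure),
 obtained as the radial projection of the uniform distribution on the unit ball
 (cone-measure construction).\<close>
definition sphere_unif :: "nat \<Rightarrow> (nat \<Rightarrow> real) measure" where
  "sphere_unif q = distr
     (uniform_measure (PiM {..<q} (\<lambda>_. lborel)) {x \<in> space (Rvec q). vnorm q x \<le> 1})
     (Rvec q) (\<lambda>x. restrict (\<lambda>j. x j / vnorm q x) {..<q})"

definition ell_law :: "nat \<Rightarrow> nat \<Rightarrow> (nat \<Rightarrow> real) \<Rightarrow> (nat \<Rightarrow> nat \<Rightarrow> real)
     \<Rightarrow> real measure \<Rightarrow> (nat \<Rightarrow> real) measure" where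
  "ell_law d q mu A nu = distr (nu \<Otimes>\<^sub>M sphere_unif q) (Rvec d)
     (\<lambda>(r, u). restrict (\<lambda>i. mu i + r * (\<Sum>j<q. A i j * u j)) {..<d})"

definition sscm :: "nat \<Rightarrow> (nat \<Rightarrow> real) \<Rightarrow> (nat \<Rightarrow> real) measure \<Rightarrow> (nat \<Rightarrow> nat \<Rightarrow> real)" where
  "sscm d mu P = (\<lambda>i j. \<integral>x. ssign d (x - mu) i * ssign d (x - mu) j \<partial>P)"

definition zeta :: "nat \<Rightarrow> (nat \<Rightarrow> real) \<Rightarrow> (nat \<Rightarrow> real) measure \<Rightarrow> nat \<Rightarrow> real" where
  "zeta d mu P k = (\<integral>x. inverse (vnorm d (x - mu)) ^ k \<partial>P)"

definition sample_sscm :: "nat \<Rightarrow> nat \<Rightarrow> (nat \<Rightarrow> nat \<Rightarrow> real) \<Rightarrow> (nat \<Rightarrow> real) \<Rightarrow> (nat \<Rightarrow> nat \<Rightarrow> real)" where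
  "sample_sscm d n x m = (\<lambda>i j. (1 / real n) * (\<Sum>k<n. ssign d (x k - m) i * ssign d (x k - m) j))"

definition is_spatial_median :: "nat \<Rightarrow> nat \<Rightarrow> (nat \<Rightarrow> nat \<Rightarrow> real) \<Rightarrow> (nat \<Rightarrow> real) \<Rightarrow> bool" where
  "is_spatial_median d n x m =
     (\<forall>m'. (\<Sum>k<n. vnorm d (x k - m)) \<le> (\<Sum>k<n. vnorm d (x k - m')))"

end

theory Submission imports Defs "HOL-Real_Asymp.Real_Asymp" begin

text \<open>The direction of X - mu is that of A z for a standard Gaussian vector z. Write l for the spectral norm
  of S, L = log d + log (1 / \<alpha>), and S' for the sample matrix centred at the true mu.

  Replacing mu by the spatial median costs only O(1 / n). The objective is convex, and (A1), (A2) bound its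
  Hessian at mu below by a multiple of \<open>\<zeta>\<^sub>1\<close>, so the median lies within a multiple of
  1 / (\<open>\<zeta>\<^sub>1\<close> sqrt n) of mu. The term of first order in this
  displacement is multiplied by sample means of odd functions of X - mu, which are again of order 1 / sqrt n.

  The deviation S' - S is at most 2 sqrt (l L / n) + O(1 / n), for one of three reasons. If n l is large compared
  with L, a trace moment of order about L has the sharp constant. If l L is bounded below, Chebyshev's
  inequality in Hilbert-Schmidt norm suffices. Otherwise l = O(1 / sqrt n), the effective rank is so large that
  A z has almost constant norm, and a Gaussian covariance bound gives norm S' at most 1.4 l + O(1 / n), where
  1.4 l is at most 2 sqrt (l L / n) because n l < 2 L.\<close>

section \<open>Vectors and quadratic forms\<close>

text \<open>The dimension may grow arbitrarily fast with n, while C may depend only on \<alpha> and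
  on the constants of (A1) and (A2). A Bernstein bound leaves a term of order L / n, and L contains
  log d, so that term cannot be absorbed into C / n. This is why no single concentration inequality
  covers all ratios of n l to L, and why every remainder below depends on the confidence level but
  not on d. Small L is not asymptotic either: for d = 2 and \<alpha> = 1 one has L = ln 2, and even
  there the moment method must fail with probability below \<alpha>, with room left for the median.
  This forces explicit constants; the budget is 0.97 \<alpha> for the deviation and 6 \<epsilon>
  with \<epsilon> = \<alpha> / 1000 for the median. As the trace of S is 1, the main term of the
  claim is sqrt (4 (l + l^2) L / n), which dominates 2 sqrt (l L / n). An error O(1 / n) serves
  every \<delta> < 1 at once, because (1 + \<delta>) / 2 < 1.\<close>

definition ip :: "nat \<Rightarrow> (nat \<Rightarrow> real) \<Rightarrow> (nat \<Rightarrow> real) \<Rightarrow> real" where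
  "ip d x y = (\<Sum>j<d. x j * y j)"

definition qform :: "nat \<Rightarrow> (nat \<Rightarrow> nat \<Rightarrow> real) \<Rightarrow> (nat \<Rightarrow> real) \<Rightarrow> real" where
  "qform d M v = (\<Sum>i<d. \<Sum>j<d. v i * M i j * v j)"

lemma vnorm_L2: "vnorm d x = L2_set x {..<d}"
  by (simp add: vnorm_def L2_set_def)

lemma vnorm_nonneg [simp]: "0 \<le> vnorm d x"
  by (simp add: vnorm_L2)

lemma vnorm_sq: "(vnorm d x)\<^sup>2 = ip d x x"
  by (simp add: vnorm_def ip_def sum_nonneg power2_eq_square)

lemma vnorm_sq_sum: "(vnorm d x)\<^sup>2 = (\<Sum>j<d. (x j)\<^sup>2)"
  by (simp add: vnorm_def sum_nonneg)

lemma vnorm_triangle: "vnorm d (\<lambda>j. x j + y j) \<le> vnorm d x + vnorm d y"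
  by (simp add: vnorm_L2 L2_set_triangle_ineq)

lemma vnorm_scale: "vnorm d (\<lambda>j. c * x j) = \<bar>c\<bar> * vnorm d x"
proof -
  have "(\<Sum>j<d. (c * x j)\<^sup>2) = c\<^sup>2 * (\<Sum>j<d. (x j)\<^sup>2)"
    by (simp add: power_mult_distrib sum_distrib_left)
  then show ?thesis by (simp add: vnorm_def real_sqrt_mult)
qed

lemma vnorm_cong: "(\<And>j. j < d \<Longrightarrow> x j = y j) \<Longrightarrow> vnorm d x = vnorm d y"
  by (simp add: vnorm_def)

lemma ip_commute: "ip d x y = ip d y x"
  by (simp add: ip_def mult.commute)

lemma ip_add_left: "ip d (\<lambda>j. x j + y j) z = ip d x z + ip d y z"
  by (simp add: ip_def distrib_right sum.distrib)

lemma ip_diff_left: "ip d (\<lambda>j. x j - y j) z = ip d x z - ip d y z"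
  by (simp add: ip_def left_diff_distrib sum_subtractf)

lemma ip_scale_left: "ip d (\<lambda>j. c * x j) z = c * ip d x z"
  by (simp add: ip_def sum_distrib_left mult.assoc)

lemma ip_scale_right: "ip d z (\<lambda>j. c * x j) = c * ip d z x"
  by (simp add: ip_def sum_distrib_left algebra_simps)

lemma sum_mult_le_sqrt:
  fixes f g :: "'a \<Rightarrow> real"
  shows "\<bar>\<Sum>i\<in>I. f i * g i\<bar> \<le> sqrt (\<Sum>i\<in>I. (f i)\<^sup>2) * sqrt (\<Sum>i\<in>I. (g i)\<^sup>2)"
proof -
  have "\<bar>\<Sum>i\<in>I. f i * g i\<bar> \<le> (\<Sum>i\<in>I. \<bar>f i\<bar> * \<bar>g i\<bar>)"
    by (rule order_trans[OF sum_abs]) (simp add: abs_mult)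
  also have "\<dots> \<le> L2_set f I * L2_set g I" by (rule L2_set_mult_ineq)
  finally show ?thesis by (simp add: L2_set_def)
qed

lemma ip_Cauchy_Schwarz: "\<bar>ip d x y\<bar> \<le> vnorm d x * vnorm d y"
  unfolding ip_def vnorm_def by (rule sum_mult_le_sqrt)

lemma ip_sq_le: "(ip d x y)\<^sup>2 \<le> (vnorm d x)\<^sup>2 * (vnorm d y)\<^sup>2"
  using power_mono[OF ip_Cauchy_Schwarz[of d x y], of 2] by (simp add: power_mult_distrib)

lemma vnorm_diff_sq:
  "(vnorm d (\<lambda>j. x j - y j))\<^sup>2 = (vnorm d x)\<^sup>2 - 2 * ip d x y + (vnorm d y)\<^sup>2"
  by (simp add: vnorm_sq ip_def algebra_simps sum.distrib sum_subtractf sum_distrib_left)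

lemma vnorm_add_sq:
  "(vnorm d (\<lambda>j. x j + y j))\<^sup>2 = (vnorm d x)\<^sup>2 + 2 * ip d x y + (vnorm d y)\<^sup>2"
  by (simp add: vnorm_sq ip_def algebra_simps sum.distrib sum_distrib_left)

lemma vnorm_zero_iff: "vnorm d x = 0 \<longleftrightarrow> (\<forall>j<d. x j = 0)"
  by (auto simp: vnorm_L2 L2_set_eq_0_iff)

lemma ssign_scaled: "vnorm d x * ssign d x j = x j" if "j < d"
  using that vnorm_zero_iff[of d x] by (auto simp: ssign_def)

lemma vnorm_ssign: "vnorm d (ssign d x) = (if vnorm d x = 0 then 0 else 1)"
proof (cases "vnorm d x = 0")
  case True then show ?thesis by (simp add: ssign_def vnorm_zero_iff)
next
  case False
  have "vnorm d (ssign d x) = vnorm d (\<lambda>j. (1 / vnorm d x) * x j)"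
    by (rule vnorm_cong) (use False in \<open>simp add: ssign_def\<close>)
  then show ?thesis using False by (simp only: vnorm_scale) simp
qed

lemma vnorm_ssign_le: "vnorm d (ssign d x) \<le> 1"
  by (simp add: vnorm_ssign)

lemma abs_ssign_le: "\<bar>ssign d x j\<bar> \<le> 1" if "j < d"
proof -
  have "(ssign d x j)\<^sup>2 \<le> (\<Sum>j<d. (ssign d x j)\<^sup>2)"
    using that by (intro member_le_sum) auto
  also have "\<dots> = (vnorm d (ssign d x))\<^sup>2" by (simp add: vnorm_sq_sum)
  also have "\<dots> \<le> 1" by (simp add: vnorm_ssign)
  finally show ?thesis by (simp add: abs_square_le_1)
qed

lemma qform_diff: "qform d (\<lambda>i j. M i j - N i j) v = qform d M v - qform d N v"
  by (simp add: qform_def algebra_simps sum_subtractf)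

lemma qform_scaleM: "qform d (\<lambda>i j. c * M i j) v = c * qform d M v"
  by (simp add: qform_def algebra_simps sum_distrib_left)

lemma qform_sum: "qform d (\<lambda>i j. \<Sum>k\<in>K. M k i j) v = (\<Sum>k\<in>K. qform d (M k) v)"
proof -
  have "qform d (\<lambda>i j. \<Sum>k\<in>K. M k i j) v = (\<Sum>i<d. \<Sum>j<d. \<Sum>k\<in>K. v i * M k i j * v j)"
    by (simp add: qform_def sum_distrib_left sum_distrib_right)
  also have "\<dots> = (\<Sum>i<d. \<Sum>k\<in>K. \<Sum>j<d. v i * M k i j * v j)"
    by (intro sum.cong refl sum.swap)
  also have "\<dots> = (\<Sum>k\<in>K. \<Sum>i<d. \<Sum>j<d. v i * M k i j * v j)" by (rule sum.swap)
  finally show ?thesis by (simp add: qform_def)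
qed

lemma qform_outer: "qform d (\<lambda>i j. u i * u j) v = (ip d u v)\<^sup>2"
  by (simp add: qform_def ip_def power2_eq_square sum_product algebra_simps)

lemma qform_scale: "qform d M (\<lambda>j. c * v j) = c\<^sup>2 * qform d M v"
  by (simp add: qform_def power2_eq_square sum_distrib_left algebra_simps)

lemma qform_ip: "qform d M v = ip d v (\<lambda>i. \<Sum>j<d. M i j * v j)"
  by (simp add: qform_def ip_def sum_distrib_left mult.assoc)

text \<open>Cauchy-Schwarz over index pairs. Second moments of the entries thus control all
  directions v at once, without a net.\<close>

lemma qform_le_frobenius:
  "\<bar>qform d M v\<bar> \<le> sqrt (\<Sum>i<d. \<Sum>j<d. (M i j)\<^sup>2) * (vnorm d v)\<^sup>2"
proof -
  have "qform d M v = (\<Sum>c\<in>{..<d}\<times>{..<d}. M (fst c) (snd c) * (v (fst c) * v (snd c)))"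
    by (simp add: qform_def sum.cartesian_product split_def algebra_simps)
  moreover have "(\<Sum>c\<in>{..<d}\<times>{..<d}. (v (fst c) * v (snd c))\<^sup>2) = ((vnorm d v)\<^sup>2)\<^sup>2"
    unfolding vnorm_sq_sum
    by (simp add: power2_eq_square[of "sum _ _"] sum_product sum.cartesian_product split_def power_mult_distrib)
  ultimately show ?thesis
    using sum_mult_le_sqrt[of "\<lambda>c. M (fst c) (snd c)" "\<lambda>c. v (fst c) * v (snd c)" "{..<d}\<times>{..<d}"]
    by (simp only: sum.cartesian_product split_def) (simp only: real_sqrt_abs abs_of_nonneg zero_le_power2)
qed

lemma vnorm_matvec_le:
  "vnorm d (\<lambda>i. \<Sum>j<d. M i j * x j) \<le> sqrt (\<Sum>i<d. \<Sum>j<d. (M i j)\<^sup>2) * vnorm d x"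
proof -
  have "(\<Sum>j<d. M i j * x j)\<^sup>2 \<le> (\<Sum>j<d. (M i j)\<^sup>2) * (vnorm d x)\<^sup>2" for i
    using ip_sq_le[of d "M i" x] by (simp add: ip_def vnorm_sq_sum)
  then have "(\<Sum>i<d. (\<Sum>j<d. M i j * x j)\<^sup>2) \<le> (\<Sum>i<d. (\<Sum>j<d. (M i j)\<^sup>2) * (vnorm d x)\<^sup>2)"
    by (intro sum_mono)
  also have "\<dots> = (\<Sum>i<d. \<Sum>j<d. (M i j)\<^sup>2) * (vnorm d x)\<^sup>2" by (simp add: sum_distrib_right)
  finally have "sqrt (\<Sum>i<d. (\<Sum>j<d. M i j * x j)\<^sup>2) \<le> sqrt ((\<Sum>i<d. \<Sum>j<d. (M i j)\<^sup>2) * (vnorm d x)\<^sup>2)"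
    by simp
  then show ?thesis by (simp add: vnorm_def[of d "\<lambda>i. \<Sum>j<d. M i j * x j"] real_sqrt_mult)
qed

lemma specnorm_bdd: "bdd_above {vnorm d (\<lambda>i. \<Sum>j<d. M i j * x j) | x. vnorm d x = 1}"
proof (rule bdd_aboveI)
  fix w assume "w \<in> {vnorm d (\<lambda>i. \<Sum>j<d. M i j * x j) | x. vnorm d x = 1}"
  then obtain x where "vnorm d x = 1" "w = vnorm d (\<lambda>i. \<Sum>j<d. M i j * x j)" by blast
  then show "w \<le> sqrt (\<Sum>i<d. \<Sum>j<d. (M i j)\<^sup>2)"
    using vnorm_matvec_le[of d M x] by simp
qed

lemma unit_vector_exists: "d \<ge> 1 \<Longrightarrow> vnorm d (\<lambda>j. if j = 0 then 1 else 0) = 1"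
  by (simp add: vnorm_def if_distrib[of "\<lambda>x. x\<^sup>2"] sum.delta cong: if_cong)

lemma vnorm_matvec_le_specnorm:
  "vnorm d (\<lambda>i. \<Sum>j<d. M i j * x j) \<le> specnorm d M * vnorm d x"
proof (cases "vnorm d x = 0")
  case True
  then show ?thesis using vnorm_matvec_le[of d M x] by simp
next
  case False
  define y where "y = (\<lambda>j. (1 / vnorm d x) * x j)"
  have "vnorm d y = 1" using False by (simp only: y_def vnorm_scale) simp
  then have *: "vnorm d (\<lambda>i. \<Sum>j<d. M i j * y j) \<le> specnorm d M"
    unfolding specnorm_def by (intro cSup_upper specnorm_bdd) auto
  have "vnorm d (\<lambda>i. \<Sum>j<d. M i j * y j) = vnorm d (\<lambda>i. (1 / vnorm d x) * (\<Sum>j<d. M i j * x j))"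
    by (simp add: y_def sum_distrib_left algebra_simps)
  also have "\<dots> = vnorm d (\<lambda>i. \<Sum>j<d. M i j * x j) / vnorm d x"
    by (simp only: vnorm_scale) simp
  finally show ?thesis using * False vnorm_nonneg[of d x]
    by (simp only: less_le pos_divide_le_eq) (simp add: pos_divide_le_eq less_le)
qed

lemma specnorm_nonneg: "d \<ge> 1 \<Longrightarrow> 0 \<le> specnorm d M"
  using vnorm_matvec_le_specnorm[of d M "\<lambda>j. if j = 0 then 1 else 0"] unit_vector_exists[of d]
    order_trans[OF vnorm_nonneg] by simp

lemma qform_le_specnorm: "\<bar>qform d M v\<bar> \<le> specnorm d M * (vnorm d v)\<^sup>2"
proof -
  have "\<bar>qform d M v\<bar> \<le> vnorm d v * vnorm d (\<lambda>i. \<Sum>j<d. M i j * v j)"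
    unfolding qform_ip by (rule ip_Cauchy_Schwarz)
  also have "\<dots> \<le> vnorm d v * (specnorm d M * vnorm d v)"
    by (intro mult_left_mono vnorm_matvec_le_specnorm) simp
  finally show ?thesis by (simp add: power2_eq_square algebra_simps)
qed

text \<open>Polarisation: the form at y + x minus the form at y - x is 4 <y, M x>, the cross terms
  being equal by symmetry, and the parallelogram law turns the two bounds into 4 b. It is applied
  once, at the very end; everything before that concerns quadratic forms at unit vectors.\<close>

lemma specnorm_le:
  assumes d: "d \<ge> 1" and sym: "\<And>i j. i < d \<Longrightarrow> j < d \<Longrightarrow> M i j = M j i"
    and b: "\<And>v. vnorm d v = 1 \<Longrightarrow> \<bar>qform d M v\<bar> \<le> b"
  shows "specnorm d M \<le> b"
proof -
  have b0: "0 \<le> b" using b[OF unit_vector_exists[OF d]] by linarith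
  have bq: "\<bar>qform d M v\<bar> \<le> b * (vnorm d v)\<^sup>2" for v
  proof (cases "vnorm d v = 0")
    case True then show ?thesis using qform_le_frobenius[of d M v] by simp
  next
    case False
    define c where "c = 1 / vnorm d v"
    have c: "c > 0" using False vnorm_nonneg[of d v] by (simp add: c_def less_le)
    have "vnorm d (\<lambda>j. c * v j) = 1" using False by (simp only: vnorm_scale) (simp add: c_def)
    then have "\<bar>qform d M (\<lambda>j. c * v j)\<bar> \<le> b" by (rule b)
    then have "c\<^sup>2 * \<bar>qform d M v\<bar> \<le> b" by (simp add: qform_scale abs_mult)
    then show ?thesis using False by (simp add: c_def field_simps)
  qed
  have bil: "ip d y (\<lambda>i. \<Sum>j<d. M i j * x j) \<le> b" if x: "vnorm d x = 1" and y: "vnorm d y = 1" for x y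
  proof -
    have swap: "(\<Sum>i<d. \<Sum>j<d. x i * M i j * y j) = (\<Sum>i<d. \<Sum>j<d. y i * M i j * x j)"
    proof -
      have "(\<Sum>i<d. \<Sum>j<d. x i * M i j * y j) = (\<Sum>i<d. \<Sum>j<d. y j * M j i * x i)"
        by (intro sum.cong refl) (metis sym lessThan_iff mult.commute mult.left_commute mult.assoc)
      also have "\<dots> = (\<Sum>j<d. \<Sum>i<d. y j * M j i * x i)" by (rule sum.swap)
      finally show ?thesis .
    qed
    have "qform d M (\<lambda>j. y j + x j) = qform d M y + qform d M x
        + (\<Sum>i<d. \<Sum>j<d. y i * M i j * x j) + (\<Sum>i<d. \<Sum>j<d. x i * M i j * y j)"
      by (simp add: qform_def algebra_simps sum.distrib)
    moreover have "qform d M (\<lambda>j. y j - x j) = qform d M y + qform d M x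
        - (\<Sum>i<d. \<Sum>j<d. y i * M i j * x j) - (\<Sum>i<d. \<Sum>j<d. x i * M i j * y j)"
      by (simp add: qform_def algebra_simps sum.distrib sum_subtractf)
    ultimately have "4 * (\<Sum>i<d. \<Sum>j<d. y i * M i j * x j)
        = qform d M (\<lambda>j. y j + x j) - qform d M (\<lambda>j. y j - x j)" using swap by linarith
    also have "\<dots> \<le> b * (vnorm d (\<lambda>j. y j + x j))\<^sup>2 + b * (vnorm d (\<lambda>j. y j - x j))\<^sup>2"
      using bq[of "\<lambda>j. y j + x j"] bq[of "\<lambda>j. y j - x j"] by linarith
    also have "\<dots> = 4 * b"
      unfolding vnorm_add_sq vnorm_diff_sq x y by (simp add: algebra_simps)
    finally show ?thesis by (simp add: ip_def mult.assoc flip: sum_distrib_left)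
  qed
  show ?thesis unfolding specnorm_def
  proof (rule cSup_least)
    show "{vnorm d (\<lambda>i. \<Sum>j<d. M i j * x j) |x. vnorm d x = 1} \<noteq> {}"
      using unit_vector_exists[OF d] by auto
  next
    fix w assume "w \<in> {vnorm d (\<lambda>i. \<Sum>j<d. M i j * x j) |x. vnorm d x = 1}"
    then obtain x where x: "vnorm d x = 1" and w: "w = vnorm d (\<lambda>i. \<Sum>j<d. M i j * x j)" by auto
    define z where "z = (\<lambda>i. \<Sum>j<d. M i j * x j)"
    show "w \<le> b"
    proof (cases "vnorm d z = 0")
      case True then show ?thesis using w b0 by (simp add: z_def)
    next
      case False
      define y where "y = (\<lambda>j. (1 / vnorm d z) * z j)"
      have "vnorm d y = 1" using False by (simp only: y_def vnorm_scale) simp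
      from bil[OF x this] have "ip d y z \<le> b" by (simp add: z_def)
      moreover have "ip d y z = vnorm d z"
        using False by (simp only: y_def ip_scale_left vnorm_sq[symmetric]) (simp add: power2_eq_square)
      ultimately show ?thesis using w by (simp add: z_def)
    qed
  qed
qed

section \<open>Matrices with cut-off entries\<close>

text \<open>Entries outside the d x d block are set to 0, so that the unit laws for
  \<open>cutm\<close> matrices are equations between functions and can rewrite inside
  powers.\<close>

definition mm :: "nat \<Rightarrow> (nat \<Rightarrow> nat \<Rightarrow> real) \<Rightarrow> (nat \<Rightarrow> nat \<Rightarrow> real) \<Rightarrow> nat \<Rightarrow> nat \<Rightarrow> real" where
  "mm d A B = (\<lambda>i j. if i < d \<and> j < d then (\<Sum>k<d. A i k * B k j) else 0)"

definition idm :: "nat \<Rightarrow> nat \<Rightarrow> nat \<Rightarrow> real" where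
  "idm d = (\<lambda>i j. if i < d \<and> i = j then 1 else 0)"

definition mpow :: "nat \<Rightarrow> (nat \<Rightarrow> nat \<Rightarrow> real) \<Rightarrow> nat \<Rightarrow> nat \<Rightarrow> nat \<Rightarrow> real" where
  "mpow d A k = (mm d A ^^ k) (idm d)"

text \<open>The Hilbert-Schmidt inner product tr (A' B), where A' is the transpose. With
  \<open>idm d\<close> in one argument it is the trace, so the trace inequalities below are stated
  with it.\<close>

definition hs :: "nat \<Rightarrow> (nat \<Rightarrow> nat \<Rightarrow> real) \<Rightarrow> (nat \<Rightarrow> nat \<Rightarrow> real) \<Rightarrow> real" where
  "hs d A B = (\<Sum>i<d. \<Sum>j<d. A i j * B i j)"

definition cutm :: "nat \<Rightarrow> (nat \<Rightarrow> nat \<Rightarrow> real) \<Rightarrow> bool" where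
  "cutm d A \<longleftrightarrow> (\<forall>i j. i < d \<and> j < d \<or> A i j = 0)"

definition symm :: "(nat \<Rightarrow> nat \<Rightarrow> real) \<Rightarrow> bool" where
  "symm A \<longleftrightarrow> (\<forall>i j. A i j = A j i)"

lemma mm_assoc: "mm d (mm d A B) C = mm d A (mm d B C)"
proof (intro ext)
  fix i j
  have "(\<Sum>k<d. (\<Sum>l<d. A i l * B l k) * C k j) = (\<Sum>l<d. A i l * (\<Sum>k<d. B l k * C k j))"
  proof -
    have "(\<Sum>k<d. (\<Sum>l<d. A i l * B l k) * C k j) = (\<Sum>k<d. \<Sum>l<d. A i l * B l k * C k j)"
      by (simp add: sum_distrib_right)
    also have "\<dots> = (\<Sum>l<d. \<Sum>k<d. A i l * B l k * C k j)" by (rule sum.swap)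
    finally show ?thesis by (simp add: sum_distrib_left mult.assoc)
  qed
  then show "mm d (mm d A B) C i j = mm d A (mm d B C) i j"
    by (simp add: mm_def)
qed

lemma cutm_mm [simp]: "cutm d (mm d A B)"
  by (simp add: cutm_def mm_def)

lemma cutm_idm [simp]: "cutm d (idm d)"
  by (simp add: cutm_def idm_def)

lemma mm_idm_left: "cutm d A \<Longrightarrow> mm d (idm d) A = A"
  by (intro ext) (auto simp: mm_def idm_def cutm_def if_distrib[of "\<lambda>x. x * _"] cong: if_cong)

lemma mm_idm_right: "cutm d A \<Longrightarrow> mm d A (idm d) = A"
  by (intro ext) (auto simp: mm_def idm_def cutm_def if_distrib[of "\<lambda>x. _ * x"] sum.delta' cong: if_cong)

lemma cutm_mpow [simp]: "cutm d (mpow d A k)"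
  by (cases k) (simp_all add: mpow_def)

lemma mpow_0 [simp]: "mpow d A 0 = idm d"
  by (simp add: mpow_def)

lemma mpow_Suc: "mpow d A (Suc k) = mm d A (mpow d A k)"
  by (simp add: mpow_def)

lemma mpow_add: "mpow d A (j + k) = mm d (mpow d A j) (mpow d A k)"
  by (induction j) (simp_all add: mpow_Suc mm_assoc mm_idm_left)

lemma mpow_1: "cutm d A \<Longrightarrow> mpow d A (Suc 0) = A"
  by (simp add: mpow_Suc mm_idm_right)

lemma mpow_Suc': "cutm d A \<Longrightarrow> mpow d A (Suc k) = mm d (mpow d A k) A"
  using mpow_add[of d A k 1] by (simp add: mpow_1)

lemma cutm_diff: "cutm d A \<Longrightarrow> cutm d B \<Longrightarrow> cutm d (\<lambda>i j. A i j - B i j)"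
  by (auto simp: cutm_def) metis+

lemma symm_idm [simp]: "symm (idm d)"
  by (auto simp: symm_def idm_def)

lemma mm_transpose: "symm A \<Longrightarrow> symm B \<Longrightarrow> mm d A B i j = mm d B A j i"
  by (auto simp: symm_def mm_def mult.commute)

lemma symm_mpow: assumes "symm A" "cutm d A" shows "symm (mpow d A k)"
proof (induction k)
  case (Suc k)
  then show ?case unfolding symm_def
    using mm_transpose[OF \<open>symm A\<close> Suc] mpow_Suc[of d A k] mpow_Suc'[OF \<open>cutm d A\<close>, of k]
    by metis
qed simp

lemma hs_commute: "hs d A B = hs d B A"
  by (simp add: hs_def mult.commute)

lemma hs_self_nonneg [simp]: "0 \<le> hs d A A"
  by (simp add: hs_def sum_nonneg)

lemma hs_diff_right: "hs d A (\<lambda>i j. B i j - C i j) = hs d A B - hs d A C"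
  by (simp add: hs_def right_diff_distrib sum_subtractf)

lemma hs_diff_left: "hs d (\<lambda>i j. B i j - C i j) A = hs d B A - hs d C A"
  by (simp add: hs_def left_diff_distrib sum_subtractf)

lemma hs_add_left: "hs d (\<lambda>i j. B i j + C i j) A = hs d B A + hs d C A"
  by (simp add: hs_def distrib_right sum.distrib)

lemma hs_scale_left: "hs d (\<lambda>i j. c * B i j) A = c * hs d B A"
  by (simp add: hs_def sum_distrib_left mult.assoc)

lemma hs_sum_right: "hs d A (\<lambda>i j. \<Sum>k\<in>K. B k i j) = (\<Sum>k\<in>K. hs d A (B k))"
proof -
  have "hs d A (\<lambda>i j. \<Sum>k\<in>K. B k i j) = (\<Sum>i<d. \<Sum>j<d. \<Sum>k\<in>K. A i j * B k i j)"
    by (simp add: hs_def sum_distrib_left)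
  also have "\<dots> = (\<Sum>i<d. \<Sum>k\<in>K. \<Sum>j<d. A i j * B k i j)" by (intro sum.cong refl sum.swap)
  also have "\<dots> = (\<Sum>k\<in>K. \<Sum>i<d. \<Sum>j<d. A i j * B k i j)" by (rule sum.swap)
  finally show ?thesis by (simp add: hs_def)
qed

lemma hs_sum_left: "hs d (\<lambda>i j. \<Sum>k\<in>K. B k i j) A = (\<Sum>k\<in>K. hs d (B k) A)"
  using hs_sum_right[of d A B K] by (simp add: hs_commute)

lemma hs_mm_left: assumes "symm P" shows "hs d A (mm d P B) = hs d (mm d P A) B"
proof -
  have "hs d A (mm d P B) = (\<Sum>i<d. \<Sum>j<d. \<Sum>k<d. A i j * P i k * B k j)"
    by (simp add: hs_def mm_def sum_distrib_left mult.assoc)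
  also have "\<dots> = (\<Sum>i<d. \<Sum>k<d. \<Sum>j<d. A i j * P i k * B k j)" by (intro sum.cong refl sum.swap)
  also have "\<dots> = (\<Sum>k<d. \<Sum>i<d. \<Sum>j<d. A i j * P i k * B k j)" by (rule sum.swap)
  also have "\<dots> = (\<Sum>k<d. \<Sum>j<d. \<Sum>i<d. A i j * P i k * B k j)" by (intro sum.cong refl sum.swap)
  also have "\<dots> = hs d (mm d P A) B"
    using assms by (simp add: hs_def mm_def sum_distrib_left sum_distrib_right symm_def mult_ac)
  finally show ?thesis .
qed

lemma hs_mm_right: assumes "symm P" shows "hs d A (mm d B P) = hs d (mm d A P) B"
proof -
  have "hs d A (mm d B P) = (\<Sum>i<d. \<Sum>j<d. \<Sum>k<d. A i j * B i k * P k j)"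
    by (simp add: hs_def mm_def sum_distrib_left mult.assoc)
  also have "\<dots> = (\<Sum>i<d. \<Sum>k<d. \<Sum>j<d. A i j * B i k * P k j)" by (intro sum.cong refl sum.swap)
  also have "\<dots> = hs d (mm d A P) B"
    using assms by (simp add: hs_def mm_def sum_distrib_left sum_distrib_right symm_def mult_ac)
  finally show ?thesis .
qed

lemma hs_Cauchy_Schwarz: "\<bar>hs d A B\<bar> \<le> sqrt (hs d A A) * sqrt (hs d B B)"
  using sum_mult_le_sqrt[of "\<lambda>c. A (fst c) (snd c)" "\<lambda>c. B (fst c) (snd c)" "{..<d}\<times>{..<d}"]
  by (simp add: hs_def sum.cartesian_product split_def power2_eq_square)

lemma hs_le_mean: "hs d A B \<le> (hs d A A + hs d B B) / 2"
proof -
  have "0 \<le> hs d (\<lambda>i j. A i j - B i j) (\<lambda>i j. A i j - B i j)" by simp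
  then show ?thesis by (simp add: hs_diff_left hs_diff_right hs_commute[of d B A])
qed

section \<open>Trace inequalities for powers of two symmetric matrices\<close>

abbreviation sandwich :: "nat \<Rightarrow> (nat \<Rightarrow> nat \<Rightarrow> real) \<Rightarrow> nat \<Rightarrow> (nat \<Rightarrow> nat \<Rightarrow> real) \<Rightarrow> (nat \<Rightarrow> nat \<Rightarrow> real) \<Rightarrow> nat \<Rightarrow> nat \<Rightarrow> nat \<Rightarrow> real" where
  "sandwich d D a Y E b \<equiv> mm d (mpow d D a) (mm d Y (mpow d E b))"

text \<open>Symmetry moves powers of D across the inner product on the left and powers of E on the
  right. Hence tr (Y' D^a Y E^b) is an inner product of two sandwiches for every splitting of a and
  of b.\<close>

lemma hs_sandwich:
  assumes "symm D" "symm E" "cutm d D" "cutm d E"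
  shows "hs d (sandwich d D i Y E j) (sandwich d D k Y E l) = hs d Y (sandwich d D (i + k) Y E (j + l))"
proof -
  have "hs d (sandwich d D i Y E j) (sandwich d D k Y E l)
      = hs d (mm d Y (mpow d E j)) (mm d (mpow d D i) (sandwich d D k Y E l))"
    using symm_mpow assms by (simp add: hs_mm_left)
  also have "\<dots> = hs d (mm d Y (mpow d E j)) (sandwich d D (i + k) Y E l)"
    by (simp add: mpow_add mm_assoc)
  also have "\<dots> = hs d Y (mm d (sandwich d D (i + k) Y E l) (mpow d E j))"
    using symm_mpow assms by (simp add: hs_mm_right)
  also have "mm d (sandwich d D (i + k) Y E l) (mpow d E j) = sandwich d D (i + k) Y E (l + j)"
    by (simp add: mpow_add mm_assoc)
  finally show ?thesis by (simp add: add.commute)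
qed

text \<open>A maximum principle. After subtracting the chord, take the least index at which the
  maximum is attained: a positive maximum is interior and its left neighbour is strictly smaller,
  which contradicts midpoint convexity.\<close>

lemma discrete_convex_interpolation:
  fixes g :: "nat \<Rightarrow> real"
  assumes p: "p \<ge> 1"
    and cvx: "\<And>i. 1 \<le> i \<Longrightarrow> i < p \<Longrightarrow> g i \<le> (g (i - 1) + g (i + 1)) / 2"
    and i: "i \<le> p"
  shows "real p * g i \<le> (real p - real i) * g 0 + real i * g p"
proof -
  define h where "h = (\<lambda>i. real p * g i - (real p - real i) * g 0 - real i * g p)"
  have h0: "h 0 = 0" and hp: "h p = 0" by (auto simp: h_def)
  have hc: "h i \<le> (h (i - 1) + h (i + 1)) / 2" if "1 \<le> i" "i < p" for i
  proof -
    have "real p * g i \<le> real p * ((g (i - 1) + g (i + 1)) / 2)"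
      by (intro mult_left_mono cvx that) simp
    then show ?thesis using that by (simp add: h_def of_nat_diff field_simps)
  qed
  have "h i \<le> 0"
  proof (rule ccontr)
    assume neg: "\<not> h i \<le> 0"
    define mx where "mx = Max (h ` {..p})"
    have mx: "h k \<le> mx" if "k \<le> p" for k using that by (simp add: mx_def)
    have "mx \<in> h ` {..p}" unfolding mx_def by (intro Max_in) auto
    then have ex: "\<exists>k. k \<le> p \<and> h k = mx" by auto
    define k where "k = (LEAST k. k \<le> p \<and> h k = mx)"
    have k: "k \<le> p" "h k = mx" using LeastI_ex[OF ex] by (auto simp: k_def)
    have mpos: "mx > 0" using mx[OF i] neg by linarith
    have k1: "1 \<le> k" using k h0 mpos by (cases k) auto
    have kp: "k < p" using k hp mpos by (cases "k = p") auto
    have "h (k - 1) < mx"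
    proof -
      have "h (k - 1) \<noteq> mx" using not_less_Least[of "k - 1" "\<lambda>k. k \<le> p \<and> h k = mx"] k1 k
        by (simp add: k_def[symmetric])
      then show ?thesis using mx[of "k - 1"] k by linarith
    qed
    moreover have "h (k + 1) \<le> mx" using kp by (intro mx) simp
    ultimately show False using hc[OF k1 kp] k by argo
  qed
  then show ?thesis by (simp add: h_def)
qed

lemma sum_even_odd: "(\<Sum>a\<le>2 * p. f a) = (\<Sum>i\<le>p. f (2 * i)) + (\<Sum>i<p. f (2 * i + 1))" for f :: "nat \<Rightarrow> real"
  by (induction p) (simp_all add: algebra_simps)

text \<open>The hypothesis compares only with values at even indices, which is what Cauchy-Schwarz
  delivers. The even values lie below their chord and are paired as 2 i and 2 (p - i); each odd
  value lies below the mean of its even neighbours. The second bound uses the chord at index 2 (p -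
  1).\<close>

lemma midpoint_sequence_bounds:
  fixes f :: "nat \<Rightarrow> real"
  assumes mid: "\<And>i k. i \<le> p \<Longrightarrow> k \<le> p \<Longrightarrow> f (i + k) \<le> (f (2 * i) + f (2 * k)) / 2"
  shows "(\<Sum>a\<le>2 * p. f a) \<le> (2 * real p + 1) / 2 * (f 0 + f (2 * p))"
    and "p \<ge> 1 \<Longrightarrow> 2 * real p * f (2 * p - 1) \<le> f 0 + (2 * real p - 1) * f (2 * p)"
proof -
  have int: "real p * f (2 * i) \<le> (real p - real i) * f 0 + real i * f (2 * p)" if "p \<ge> 1" "i \<le> p" for i
  proof -
    have "f (2 * i) \<le> (f (2 * (i - 1)) + f (2 * (i + 1))) / 2" if "1 \<le> i" "i < p" for i
    proof -
      have "i - 1 + (i + 1) = 2 * i" using that by simp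
      then show ?thesis using mid[of "i - 1" "i + 1"] that by (simp add: mult_2)
    qed
    then show ?thesis using discrete_convex_interpolation[of p "\<lambda>i. f (2 * i)" i] that by simp
  qed
  show "2 * real p * f (2 * p - 1) \<le> f 0 + (2 * real p - 1) * f (2 * p)" if "p \<ge> 1"
  proof -
    have "f (2 * p - 1) \<le> (f (2 * (p - 1)) + f (2 * p)) / 2"
      using mid[of "p - 1" p] that by (simp add: mult_2)
    then have "2 * real p * f (2 * p - 1) \<le> real p * f (2 * (p - 1)) + real p * f (2 * p)"
      using mult_left_mono[of _ _ "2 * real p"] by (fastforce simp: field_simps)
    moreover have "real p * f (2 * (p - 1)) \<le> f 0 + (real p - 1) * f (2 * p)"
      using int[of "p - 1"] that by (simp add: of_nat_diff)
    ultimately show ?thesis by (simp add: algebra_simps)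
  qed
  show "(\<Sum>a\<le>2 * p. f a) \<le> (2 * real p + 1) / 2 * (f 0 + f (2 * p))"
  proof (cases "p = 0")
    case False
    then have p: "p \<ge> 1" by simp
    have pair: "f (2 * i) + f (2 * (p - i)) \<le> f 0 + f (2 * p)" if "i \<le> p" for i
    proof -
      have "real p * (f (2 * i) + f (2 * (p - i))) \<le> real p * (f 0 + f (2 * p))"
        using int[OF p that] int[OF p, of "p - i"] that by (simp add: of_nat_diff algebra_simps)
      then show ?thesis using p by simp
    qed
    have flip: "(\<Sum>i\<le>p. f (2 * (p - i))) = (\<Sum>i\<le>p. f (2 * i))"
      using sum.atLeastAtMost_rev[of "\<lambda>i. f (2 * i)" 0 p] by (simp add: atMost_atLeast0)
    have "2 * (\<Sum>i\<le>p. f (2 * i)) = (\<Sum>i\<le>p. f (2 * i) + f (2 * (p - i)))"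
      by (simp add: sum.distrib flip)
    also have "\<dots> \<le> (\<Sum>i\<le>p. f 0 + f (2 * p))" by (intro sum_mono pair) auto
    finally have even: "2 * (\<Sum>i\<le>p. f (2 * i)) \<le> (real p + 1) * (f 0 + f (2 * p))"
      by (simp add: add.commute)
    have "2 * (\<Sum>i<p. f (2 * i + 1)) \<le> (\<Sum>i<p. f (2 * i) + f (2 * (i + 1)))"
      unfolding sum_distrib_left
    proof (rule sum_mono)
      fix i assume "i \<in> {..<p}"
      moreover have e: "i + (i + 1) = 2 * i + 1" by simp
      ultimately have "f (2 * i + 1) \<le> (f (2 * i) + f (2 * (i + 1))) / 2"
        using mid[of i "i + 1", unfolded e] by auto
      then show "2 * f (2 * i + 1) \<le> f (2 * i) + f (2 * (i + 1))" by argo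
    qed
    also have "\<dots> = 2 * (\<Sum>i\<le>p. f (2 * i)) - f 0 - f (2 * p)"
    proof -
      have "(\<Sum>i\<le>p. f (2 * i)) = (\<Sum>i<p. f (2 * i)) + f (2 * p)"
        by (simp add: lessThan_Suc_atMost[symmetric])
      moreover have "(\<Sum>i\<le>p. f (2 * i)) = f 0 + (\<Sum>i<p. f (2 * (i + 1)))"
        using sum.lessThan_Suc_shift[of "\<lambda>i. f (2 * i)" p] by (simp add: lessThan_Suc_atMost[symmetric])
      ultimately show ?thesis by (simp add: sum.distrib)
    qed
    finally have odd: "2 * (\<Sum>i<p. f (2 * i + 1)) \<le> 2 * (\<Sum>i\<le>p. f (2 * i)) - f 0 - f (2 * p)" .
    have "2 * (x + y) \<le> 2 * c - (a + b)" if "2 * y \<le> 2 * x - a - b" "2 * x \<le> c" for x y c a b :: real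
      using that by argo
    from this[OF odd even]
    show ?thesis unfolding sum_even_odd by (simp add: algebra_simps)
  qed simp
qed

text \<open>AM-GM in Hilbert-Schmidt norm for the sandwiches with i and with k, whose squared norms
  are the terms of index 2 i and 2 k. Convexity in the exponent is obtained without diagonalising D
  and E.\<close>

lemma sandwich_midpoint:
  fixes Y :: "nat \<Rightarrow> nat \<Rightarrow> real"
  assumes "symm D" "symm E" "cutm d D" "cutm d E" "i \<le> p" "k \<le> p"
  defines "f \<equiv> \<lambda>a. hs d Y (sandwich d D a Y E (2 * p - a))"
  shows "f (i + k) \<le> (f (2 * i) + f (2 * k)) / 2"
proof -
  have e: "f (i' + k') = hs d (sandwich d D i' Y E (p - i')) (sandwich d D k' Y E (p - k'))"
    if "i' \<le> p" "k' \<le> p" for i' k'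
  proof -
    have "2 * p - (i' + k') = (p - i') + (p - k')" using that by simp
    then show ?thesis using hs_sandwich[OF assms(1-4), of i' Y "p - i'" k' "p - k'"]
      by (simp add: f_def)
  qed
  show ?thesis
    using e[of i k] e[of i i] e[of k k] assms(5,6)
      hs_le_mean[of d "sandwich d D i Y E (p - i)" "sandwich d D k Y E (p - k)"]
    by (simp add: mult_2)
qed

lemma mpow_telescope:
  assumes "cutm d D" "cutm d E"
  shows "mpow d D m i j - mpow d E m i j
    = (\<Sum>a<m. sandwich d D a (\<lambda>i j. D i j - E i j) E (m - 1 - a) i j)"
proof (induction m arbitrary: i j)
  case 0 then show ?case by simp
next
  case (Suc m)
  have mmsub: "mm d (mpow d D m) (mm d (\<lambda>i j. D i j - E i j) (idm d)) i j = mpow d D (Suc m) i j - mm d (mpow d D m) E i j"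
  proof -
    have c: "cutm d (\<lambda>i j. D i j - E i j)" using assms by (rule cutm_diff)
    show ?thesis unfolding mm_idm_right[OF c] mpow_Suc'[OF assms(1)]
      by (simp add: mm_def right_diff_distrib sum_subtractf)
  qed
  have step: "mm d (sandwich d D a (\<lambda>i j. D i j - E i j) E b) E
     = sandwich d D a (\<lambda>i j. D i j - E i j) E (Suc b)" for a b
    by (simp add: mpow_Suc' assms mm_assoc)
  have "mm d (mpow d D m) E i j - mpow d E (Suc m) i j = mm d (\<lambda>i j. mpow d D m i j - mpow d E m i j) E i j"
    unfolding mpow_Suc'[OF assms(2)] by (simp add: mm_def left_diff_distrib sum_subtractf)
  also have "\<dots> = mm d (\<lambda>i j. \<Sum>a<m. sandwich d D a (\<lambda>i j. D i j - E i j) E (m - 1 - a) i j) E i j"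
    by (simp only: Suc)
  also have "\<dots> = (\<Sum>a<m. mm d (sandwich d D a (\<lambda>i j. D i j - E i j) E (m - 1 - a)) E i j)"
  proof -
    have "(\<Sum>k<d. (\<Sum>a<m. F a k) * G k) = (\<Sum>a<m. \<Sum>k<d. F a k * G k)" for F :: "nat \<Rightarrow> nat \<Rightarrow> real" and G
    proof -
      have "(\<Sum>k<d. (\<Sum>a<m. F a k) * G k) = (\<Sum>k<d. \<Sum>a<m. F a k * G k)" by (simp add: sum_distrib_right)
      also have "\<dots> = (\<Sum>a<m. \<Sum>k<d. F a k * G k)" by (rule sum.swap)
      finally show ?thesis .
    qed
    then show ?thesis unfolding mm_def[of d _ E] by auto
  qed
  also have "\<dots> = (\<Sum>a<m. sandwich d D a (\<lambda>i j. D i j - E i j) E (m - a) i j)"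
    by (intro sum.cong refl) (simp only: step, auto simp: Suc_diff_Suc)
  finally show ?case using mmsub by simp
qed

text \<open>Telescoping gives 2 p + 1 terms tr (Y D^a Y E^(2 p - a)), and midpoint convexity in a
  bounds their sum by the two endpoint values. This mean value trace inequality takes the place of
  the scalar estimate of x^k - y^k when D and E do not commute.\<close>

lemma trace_power_difference_le:
  assumes s: "symm D" "symm E" "cutm d D" "cutm d E"
  defines "Y \<equiv> \<lambda>i j. D i j - E i j"
  shows "hs d Y (mpow d D (2 * p + 1)) - hs d Y (mpow d E (2 * p + 1))
    \<le> (2 * real p + 1) / 2 * (hs d (mm d Y Y) (mpow d D (2 * p)) + hs d (mm d Y Y) (mpow d E (2 * p)))"
proof -
  have Y: "symm Y" "cutm d Y" using s unfolding Y_def by (auto simp: symm_def intro: cutm_diff)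
  define f where "f = (\<lambda>a. hs d Y (sandwich d D a Y E (2 * p - a)))"
  have "hs d Y (mpow d D (2 * p + 1)) - hs d Y (mpow d E (2 * p + 1))
      = hs d Y (\<lambda>i j. \<Sum>a<2 * p + 1. sandwich d D a Y E (2 * p - a) i j)"
    unfolding hs_diff_right[symmetric] mpow_telescope[OF s(3,4)] Y_def by simp
  also have "\<dots> = (\<Sum>a\<le>2 * p. f a)"
    by (simp only: hs_sum_right f_def) (simp add: lessThan_Suc_atMost)
  also have "\<dots> \<le> (2 * real p + 1) / 2 * (f 0 + f (2 * p))"
    by (rule midpoint_sequence_bounds(1)) (unfold f_def, rule sandwich_midpoint[OF s])
  also have "f 0 = hs d (mm d Y Y) (mpow d E (2 * p))"
    by (simp add: f_def mm_idm_left hs_mm_left[OF Y(1)])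
  also have "f (2 * p) = hs d (mm d Y Y) (mpow d D (2 * p))"
    by (simp add: f_def mm_idm_right[OF Y(2)] hs_mm_right[OF Y(1)])
  finally show ?thesis by (simp add: add.commute)
qed

text \<open>Convexity of D -> tr D^(2 p): its graph lies above the tangent at E. The tangent is read
  off the sequence tr (E^a D^(2 p - a)), whose last step contains tr (Y E^(2 p - 1)).\<close>

lemma trace_power_tangent:
  assumes s: "symm D" "symm E" "cutm d D" "cutm d E"
  defines "Y \<equiv> \<lambda>i j. D i j - E i j"
  assumes p: "p \<ge> 1"
  shows "hs d (idm d) (mpow d E (2 * p)) + 2 * real p * hs d Y (mpow d E (2 * p - 1))
     \<le> hs d (idm d) (mpow d D (2 * p))"
proof -
  define f where "f = (\<lambda>a. hs d (idm d) (sandwich d E a (idm d) D (2 * p - a)))"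
  have f0: "f 0 = hs d (idm d) (mpow d D (2 * p))" by (simp add: f_def mm_idm_left)
  have f1: "f (2 * p) = hs d (idm d) (mpow d E (2 * p))" by (simp add: f_def mm_idm_left mm_idm_right)
  have "f (2 * p - 1) = hs d (idm d) (mm d (mpow d E (2 * p - 1)) D)"
    using p by (simp add: f_def mpow_1 s mm_idm_left)
  also have "\<dots> = hs d D (mpow d E (2 * p - 1))"
    by (simp add: hs_mm_right s mm_idm_left)
  also have "\<dots> = hs d Y (mpow d E (2 * p - 1)) + hs d E (mpow d E (2 * p - 1))"
    by (simp add: Y_def hs_diff_left)
  also have "hs d E (mpow d E (2 * p - 1)) = hs d (idm d) (mpow d E (2 * p))"
  proof -
    have "mpow d E (2 * p) = mm d E (mpow d E (2 * p - 1))"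
      using mpow_Suc[of d E "2 * p - 1"] p by simp
    then show ?thesis by (simp add: hs_mm_left s mm_idm_right)
  qed
  finally have f2: "f (2 * p - 1) = hs d Y (mpow d E (2 * p - 1)) + f (2 * p)" using f1 by simp
  have "2 * real p * f (2 * p - 1) \<le> f 0 + (2 * real p - 1) * f (2 * p)"
    by (rule midpoint_sequence_bounds(2)[OF _ p]) (unfold f_def, rule sandwich_midpoint, use s in auto)
  then show ?thesis using f0 f1 f2 by (simp add: algebra_simps)
qed

definition trp :: "nat \<Rightarrow> (nat \<Rightarrow> nat \<Rightarrow> real) \<Rightarrow> nat \<Rightarrow> real" where
  "trp d D k = hs d (idm d) (mpow d D k)"

lemma trp_even: assumes "symm D" "cutm d D"
  shows "trp d D (2 * k) = hs d (mpow d D k) (mpow d D k)"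
  using symm_mpow[OF assms] by (simp add: trp_def mult_2 mpow_add hs_mm_left mm_idm_right)

lemma trp_even_nonneg: "symm D \<Longrightarrow> cutm d D \<Longrightarrow> 0 \<le> trp d D (2 * k)"
  by (simp add: trp_even)

lemma trp_0: "trp d D 0 = real d"
proof -
  have "hs d (idm d) (idm d) = (\<Sum>i<d. \<Sum>j<d. if i = j then 1 else 0)"
    unfolding hs_def by (intro sum.cong refl) (auto simp: idm_def)
  then show ?thesis by (simp add: trp_def)
qed

lemma hs_mpow_split: assumes "symm D" "cutm d D"
  shows "hs d Q (mpow d D (j + k)) = hs d (mm d Q (mpow d D k)) (mpow d D j)"
  using symm_mpow[OF assms] by (simp add: mpow_add hs_mm_right)

text \<open>Splitting the even power writes the left side as the sum of the form Q over the columns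
  of D^k, so an upper bound for the form is enough.\<close>

lemma hs_le_trp_even:
  assumes "symm D" "cutm d D" and q: "\<And>v. qform d Q v \<le> l * (vnorm d v)\<^sup>2"
  shows "hs d Q (mpow d D (2 * k)) \<le> l * trp d D (2 * k)"
proof -
  let ?P = "mpow d D k"
  have "hs d Q (mpow d D (2 * k)) = hs d (mm d Q ?P) ?P"
    using hs_mpow_split[OF assms(1,2), of Q k k] by (simp add: mult_2)
  also have "\<dots> = (\<Sum>j<d. qform d Q (\<lambda>i. ?P i j))"
  proof -
    have "hs d (mm d Q ?P) ?P = (\<Sum>i<d. \<Sum>j<d. \<Sum>l<d. ?P i j * Q i l * ?P l j)"
      by (simp add: hs_def mm_def sum_distrib_left sum_distrib_right mult_ac)
    also have "\<dots> = (\<Sum>j<d. \<Sum>i<d. \<Sum>l<d. ?P i j * Q i l * ?P l j)" by (rule sum.swap)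
    finally show ?thesis by (simp add: qform_def)
  qed
  also have "\<dots> \<le> (\<Sum>j<d. l * (vnorm d (\<lambda>i. ?P i j))\<^sup>2)" by (intro sum_mono q)
  also have "\<dots> = l * (\<Sum>j<d. \<Sum>i<d. ?P i j * ?P i j)"
    unfolding vnorm_sq_sum by (simp add: sum_distrib_left power2_eq_square)
  also have "\<dots> = l * hs d ?P ?P" unfolding hs_def by (subst sum.swap) simp
  finally show ?thesis by (simp add: trp_even assms)
qed

text \<open>An odd power cannot be split evenly, so it is split as k + 1 and k, and Cauchy-Schwarz
  applies; the contraction stays with the factor D^(k + 1).\<close>

lemma hs_contraction_le:
  assumes "symm D" "cutm d D" and q: "\<And>v. vnorm d (\<lambda>i. \<Sum>j<d. Q i j * v j) \<le> vnorm d v"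
  shows "hs d Q (mpow d D (2 * k + 1)) \<le> sqrt (trp d D (2 * k + 2)) * sqrt (trp d D (2 * k))"
proof -
  let ?P = "mpow d D (k + 1)"
  have "hs d (mm d Q ?P) (mm d Q ?P) = (\<Sum>j<d. (vnorm d (\<lambda>i. \<Sum>l<d. Q i l * ?P l j))\<^sup>2)"
    unfolding hs_def vnorm_sq_sum by (subst sum.swap) (simp add: mm_def power2_eq_square)
  also have "\<dots> \<le> (\<Sum>j<d. (vnorm d (\<lambda>l. ?P l j))\<^sup>2)"
    by (intro sum_mono power_mono q) auto
  also have "\<dots> = hs d ?P ?P"
    unfolding hs_def vnorm_sq_sum by (subst sum.swap) (simp add: power2_eq_square)
  finally have 1: "hs d (mm d Q ?P) (mm d Q ?P) \<le> trp d D (2 * (k + 1))"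
    by (simp only: trp_even assms)
  have "hs d Q (mpow d D (2 * k + 1)) = hs d (mm d Q ?P) (mpow d D k)"
    using hs_mpow_split[OF assms(1,2), of Q k "k + 1"] by (simp add: mult_2)
  also have "\<dots> \<le> sqrt (hs d (mm d Q ?P) (mm d Q ?P)) * sqrt (hs d (mpow d D k) (mpow d D k))"
    using hs_Cauchy_Schwarz[of d "mm d Q ?P" "mpow d D k"] by linarith
  also have "\<dots> \<le> sqrt (trp d D (2 * k + 2)) * sqrt (trp d D (2 * k))"
    using 1 trp_even_nonneg[OF assms(1,2), of "k + 1"] trp_even_nonneg[OF assms(1,2), of k] by (intro mult_mono) (simp_all add: trp_even[OF assms(1,2), symmetric])
  finally show ?thesis .
qed

section \<open>Trace moments of sums of independent rank-one matrices\<close>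

text \<open>A class closed under sums, products and measurable substitution. It makes every
  polynomial in the summands integrable by introduction rules alone.\<close>

definition bmeas :: "'a measure \<Rightarrow> ('a \<Rightarrow> real) \<Rightarrow> bool" where
  "bmeas M F \<longleftrightarrow> F \<in> borel_measurable M \<and> (\<exists>B. \<forall>x\<in>space M. \<bar>F x\<bar> \<le> B)"

lemma bmeasI: "F \<in> borel_measurable M \<Longrightarrow> (\<And>x. x \<in> space M \<Longrightarrow> \<bar>F x\<bar> \<le> B) \<Longrightarrow> bmeas M F"
  by (auto simp: bmeas_def)

lemma bmeas_const [simp]: "bmeas M (\<lambda>_. c)"
  by (auto simp: bmeas_def)

lemma bmeas_add: assumes "bmeas M F" "bmeas M G" shows "bmeas M (\<lambda>x. F x + G x)"
proof -
  obtain A B where "\<forall>x\<in>space M. \<bar>F x\<bar> \<le> A" "\<forall>x\<in>space M. \<bar>G x\<bar> \<le> B"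
    using assms by (auto simp: bmeas_def)
  then have "\<forall>x\<in>space M. \<bar>F x + G x\<bar> \<le> A + B"
    by (meson abs_triangle_ineq add_mono order_trans)
  then show ?thesis using assms by (auto simp: bmeas_def)
qed

lemma bmeas_mult: assumes "bmeas M F" "bmeas M G" shows "bmeas M (\<lambda>x. F x * G x)"
proof -
  obtain A B where A: "\<forall>x\<in>space M. \<bar>F x\<bar> \<le> A" and B: "\<forall>x\<in>space M. \<bar>G x\<bar> \<le> B"
    using assms by (auto simp: bmeas_def)
  have "\<forall>x\<in>space M. \<bar>F x * G x\<bar> \<le> A * B"
  proof
    fix x assume "x \<in> space M"
    with A B show "\<bar>F x * G x\<bar> \<le> A * B"
      unfolding abs_mult by (intro mult_mono) (auto intro: order_trans[OF abs_ge_zero])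
  qed
  then show ?thesis using assms by (auto simp: bmeas_def)
qed

lemma bmeas_diff: assumes "bmeas M F" "bmeas M G" shows "bmeas M (\<lambda>x. F x - G x)"
  using bmeas_add[OF assms(1) bmeas_mult[OF bmeas_const[of M "-1"] assms(2)]] by simp

lemma bmeas_sum: "(\<And>i. i \<in> I \<Longrightarrow> bmeas M (F i)) \<Longrightarrow> bmeas M (\<lambda>x. \<Sum>i\<in>I. F i x)"
  by (induction I rule: infinite_finite_induct) (auto intro: bmeas_add)

lemma bmeas_comp: "bmeas N F \<Longrightarrow> g \<in> measurable M N \<Longrightarrow> bmeas M (\<lambda>x. F (g x))"
  unfolding bmeas_def by (metis measurable_compose measurable_space)

lemma bmeas_integrable: "bmeas M F \<Longrightarrow> finite_measure M \<Longrightarrow> integrable M F"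
  unfolding bmeas_def using finite_measure.integrable_const_bound[of M F] by (auto intro!: AE_I2)

lemma bmeas_mm:
  assumes "\<And>j k. bmeas M (\<lambda>x. A x j k)" "\<And>j k. bmeas M (\<lambda>x. B x j k)"
  shows "bmeas M (\<lambda>x. mm d (A x) (B x) j k)"
  by (cases "j < d \<and> k < d") (auto simp: mm_def intro!: bmeas_sum bmeas_mult assms)

lemma bmeas_mpow:
  assumes "\<And>j k. bmeas M (\<lambda>x. A x j k)"
  shows "bmeas M (\<lambda>x. mpow d (A x) m j k)"
  by (induction m arbitrary: j k) (auto simp: mpow_Suc intro!: bmeas_mm assms)

lemma bmeas_hs:
  assumes "\<And>j k. bmeas M (\<lambda>x. A x j k)" "\<And>j k. bmeas M (\<lambda>x. B x j k)"
  shows "bmeas M (\<lambda>x. hs d (A x) (B x))"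
  unfolding hs_def by (intro bmeas_sum bmeas_mult assms)

text \<open>The numbers \<open>mu k\<close> = <D^k v, v> are the moments of the spectral measure of
  D at v. Cauchy-Schwarz makes the even ones log-convex, which yields (mu 1)^(2 p) <= mu (2 p)
  without a spectral decomposition; the Frobenius norm of D^p then bounds mu (2 p).\<close>

lemma qform_power_le_trp:
  assumes s: "symm D" "cutm d D" and v: "vnorm d v = 1"
  shows "(qform d D v)^(2 * p) \<le> trp d D (2 * p)"
proof -
  define w where "w = (\<lambda>k i. \<Sum>j<d. mpow d D k i j * v j)"
  define mu where "mu = (\<lambda>k. ip d (w k) v)"
  have ww: "ip d (w i) (w k) = mu (i + k)" for i k
  proof -
    have "mu (i + k) = (\<Sum>a<d. \<Sum>j<d. (\<Sum>l<d. mpow d D i a l * mpow d D k l j) * v j * v a)"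
      by (simp add: mu_def w_def ip_def mpow_add mm_def sum_distrib_left sum_distrib_right mult_ac)
    also have "\<dots> = (\<Sum>a<d. \<Sum>j<d. \<Sum>l<d. mpow d D i l a * v a * (mpow d D k l j * v j))"
      using symm_mpow[OF s, of i] by (simp add: symm_def sum_distrib_left sum_distrib_right mult_ac)
    also have "\<dots> = (\<Sum>a<d. \<Sum>l<d. \<Sum>j<d. mpow d D i l a * v a * (mpow d D k l j * v j))"
      by (intro sum.cong refl sum.swap)
    also have "\<dots> = (\<Sum>l<d. \<Sum>a<d. \<Sum>j<d. mpow d D i l a * v a * (mpow d D k l j * v j))"
      by (rule sum.swap)
    also have "\<dots> = ip d (w i) (w k)"
      by (simp add: ip_def w_def sum_product)
    finally show ?thesis by simp
  qed
  have w0: "w 0 i = v i" if "i < d" for i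
    using that by (simp add: w_def idm_def if_distrib[of "\<lambda>x. x * _"] cong: if_cong)
  have mu0: "mu 0 = 1" using v by (simp add: mu_def ip_def w0 flip: vnorm_sq_sum power2_eq_square)
  have mu1: "mu 1 = qform d D v"
    by (simp add: mu_def w_def mpow_1[OF s(2)] ip_def qform_def sum_distrib_left sum_distrib_right mult_ac)
  have nn: "0 \<le> mu (2 * k)" for k
  proof -
    have "mu (2 * k) = (vnorm d (w k))\<^sup>2" using ww[of k k] by (simp add: vnorm_sq mult_2)
    then show ?thesis by simp
  qed
  have lc: "(mu (2 * Suc k))\<^sup>2 \<le> mu (2 * k) * mu (2 * Suc (Suc k))" for k
    using ip_sq_le[of d "w k" "w (Suc (Suc k))"] ww[of k "Suc (Suc k)"] ww[of k k] ww[of "Suc (Suc k)" "Suc (Suc k)"]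
    by (simp add: vnorm_sq mult_2)
  \<comment> \<open>By log-convexity the ratio of consecutive even moments does not fall below mu 2.
    If mu (2 k + 2) vanishes no division is possible, but then the next claim is trivial.\<close>
  have step: "mu 2 * mu (2 * k) \<le> mu (2 * Suc k)" for k
  proof (induction k)
    case 0 then show ?case using mu0 by (simp add: numeral_2_eq_2)
  next
    case (Suc k)
    show ?case
    proof (cases "mu (2 * Suc k) = 0")
      case True then show ?thesis using nn[of "Suc (Suc k)"] by simp
    next
      case False
      then have pos: "mu (2 * Suc k) > 0" using nn[of "Suc k"] by simp
      have "mu 2 * mu (2 * Suc k) * mu (2 * Suc k) \<le> mu 2 * (mu (2 * k) * mu (2 * Suc (Suc k)))"
        using mult_left_mono[OF lc nn[of 1]] by (simp add: power2_eq_square mult_ac)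
      also have "\<dots> \<le> mu (2 * Suc k) * mu (2 * Suc (Suc k))"
        using mult_right_mono[OF Suc nn[of "Suc (Suc k)"]] by (simp add: mult_ac)
      finally have "(mu 2 * mu (2 * Suc k)) * mu (2 * Suc k) \<le> mu (2 * Suc (Suc k)) * mu (2 * Suc k)"
        by (simp add: mult_ac)
      then show ?thesis using pos by simp
    qed
  qed
  have "(mu 1)\<^sup>2 \<le> mu 2"
    using ip_sq_le[of d "w 1" "w 0", unfolded vnorm_sq ww] mu0 by (simp add: numeral_2_eq_2)
  then have "((mu 1)\<^sup>2)^p \<le> (mu 2)^p" by (intro power_mono) auto
  also have "\<dots> \<le> mu (2 * p)"
  proof (induction p)
    case (Suc p)
    have "mu 2 ^ Suc p \<le> mu 2 * mu (2 * p)" using Suc nn[of 1] by (simp add: mult_left_mono)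
    then show ?case using step[of p] by linarith
  qed (simp add: mu0)
  also have "\<dots> \<le> trp d D (2 * p)"
  proof -
    have "mu (2 * p) = (vnorm d (w p))\<^sup>2" using ww[of p p] by (simp add: vnorm_sq mult_2)
    also have "\<dots> \<le> (sqrt (\<Sum>i<d. \<Sum>j<d. (mpow d D p i j)\<^sup>2) * vnorm d v)\<^sup>2"
      unfolding w_def by (intro power_mono vnorm_matvec_le) simp
    also have "\<dots> = trp d D (2 * p)"
      using v by (simp add: trp_even[OF s] hs_def power2_eq_square sum_nonneg)
    finally show ?thesis .
  qed
  finally show ?thesis unfolding mu1 power_mult[symmetric] .
qed

text \<open>\<open>\<phi>\<close> is the direction of an observation, and zero at the centre; in
  both cases \<open>proj\<close> is idempotent, on which the moment recursion rests.
  \<open>S\<close> is cut off to fit \<open>mm\<close>.\<close>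

locale indep_directions = prob_space M for M :: "'a measure" +
  fixes n d :: nat and N :: "'b measure" and X :: "nat \<Rightarrow> 'a \<Rightarrow> 'b"
    and \<phi> :: "'b \<Rightarrow> nat \<Rightarrow> real" and S :: "nat \<Rightarrow> nat \<Rightarrow> real"
  assumes indep: "indep_vars (\<lambda>_. N) X {..<n}"
    and \<phi>_meas: "\<And>j. j < d \<Longrightarrow> (\<lambda>x. \<phi> x j) \<in> borel_measurable N"
    and \<phi>_norm: "\<And>x. vnorm d (\<phi> x) \<in> {0, 1}"
    and S_eq: "\<And>i j k. i < n \<Longrightarrow> j < d \<Longrightarrow> k < d \<Longrightarrow> expectation (\<lambda>\<omega>. \<phi> (X i \<omega>) j * \<phi> (X i \<omega>) k) = S j k"
    and S_cut: "cutm d S"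
    and n_pos: "n \<ge> 1"
begin

definition proj :: "'b \<Rightarrow> nat \<Rightarrow> nat \<Rightarrow> real" where
  "proj x = (\<lambda>j k. if j < d \<and> k < d then \<phi> x j * \<phi> x k else 0)"

definition cen :: "'b \<Rightarrow> nat \<Rightarrow> nat \<Rightarrow> real" where
  "cen x = (\<lambda>j k. proj x j k - S j k)"

definition dev :: "nat set \<Rightarrow> (nat \<Rightarrow> 'b) \<Rightarrow> nat \<Rightarrow> nat \<Rightarrow> real" where
  "dev I f = (\<lambda>j k. \<Sum>i\<in>I. cen (f i) j k)"

lemma X_measurable: "i < n \<Longrightarrow> X i \<in> measurable M N"
  using indep by (auto simp: indep_vars_def)

lemma abs_\<phi>_le: "j < d \<Longrightarrow> \<bar>\<phi> x j\<bar> \<le> 1"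
proof -
  assume "j < d"
  then have "(\<phi> x j)\<^sup>2 \<le> (vnorm d (\<phi> x))\<^sup>2" unfolding vnorm_sq_sum by (intro member_le_sum) auto
  also have "\<dots> \<le> 1" using \<phi>_norm[of x] by auto
  finally show ?thesis by (simp add: abs_square_le_1)
qed

lemma bmeas_\<phi>: "j < d \<Longrightarrow> bmeas N (\<lambda>x. \<phi> x j)"
  by (rule bmeasI[OF \<phi>_meas abs_\<phi>_le])

lemma bmeas_proj: "bmeas N (\<lambda>x. proj x j k)"
  by (cases "j < d \<and> k < d") (auto simp: proj_def intro!: bmeas_mult bmeas_\<phi>)

lemma bmeas_cen: "bmeas N (\<lambda>x. cen x j k)"
  unfolding cen_def by (intro bmeas_diff bmeas_proj bmeas_const)

lemma bmeas_dev: "I \<subseteq> {..<n} \<Longrightarrow> bmeas M (\<lambda>\<omega>. dev I (\<lambda>i. X i \<omega>) j k)"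
  unfolding dev_def by (intro bmeas_sum bmeas_comp[OF bmeas_cen] X_measurable) auto

lemma bmeas_dev_PiM: "bmeas (PiM I (\<lambda>_. N)) (\<lambda>f. dev I f j k)"
  unfolding dev_def by (intro bmeas_sum bmeas_comp[OF bmeas_cen]) measurable

lemma int_bmeas [intro]: "bmeas M F \<Longrightarrow> integrable M F"
  by (rule bmeas_integrable) unfold_locales

lemma E_proj: "i < n \<Longrightarrow> expectation (\<lambda>\<omega>. proj (X i \<omega>) j k) = S j k"
proof (cases "j < d \<and> k < d")
  case True
  then show "i < n \<Longrightarrow> ?thesis" using S_eq by (simp add: proj_def)
next
  case False
  then have "S j k = 0" using S_cut unfolding cutm_def by blast
  then show ?thesis using False by (auto simp: proj_def)
qed

lemma E_cen: "i < n \<Longrightarrow> expectation (\<lambda>\<omega>. cen (X i \<omega>) j k) = 0"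
proof -
  assume i: "i < n"
  have "integrable M (\<lambda>\<omega>. proj (X i \<omega>) j k)"
    by (intro int_bmeas bmeas_comp[OF bmeas_proj] X_measurable i)
  then show ?thesis using E_proj[OF i] by (simp add: cen_def prob_space)
qed

lemma symm_S: "symm S"
proof -
  have "S j k = S k j" for j k
  proof -
    have "(\<lambda>\<omega>. proj (X 0 \<omega>) j k) = (\<lambda>\<omega>. proj (X 0 \<omega>) k j)" by (auto simp: proj_def mult.commute)
    then show ?thesis using E_proj[of 0 j k] E_proj[of 0 k j] n_pos by simp
  qed
  then show ?thesis by (simp add: symm_def)
qed

lemma symm_cen: "symm (cen x)"
  using symm_S by (auto simp: symm_def cen_def proj_def)

lemma cutm_cen: "cutm d (cen x)"
  using S_cut by (auto simp: cutm_def cen_def proj_def)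

lemma symm_dev: "symm (dev I f)"
  unfolding symm_def dev_def using symm_cen by (auto intro!: sum.cong simp: symm_def)

lemma cutm_dev: "cutm d (dev I f)"
  unfolding cutm_def dev_def using cutm_cen by (auto intro!: sum.neutral simp: cutm_def)

text \<open>S is a mean of projections P, hence S^2 <= S. With w = S v, every realisation satisfies
  <w, P v> <= (|w|^2 + <v, P v>) / 2, and taking means turns the left side into |w|^2.\<close>

lemma matvec_S_le: "(vnorm d (\<lambda>i. \<Sum>j<d. S i j * v j))\<^sup>2 \<le> qform d S v"
proof -
  define w where "w = (\<lambda>i. \<Sum>j<d. S i j * v j)"
  let ?P = "\<lambda>\<omega>. proj (X 0 \<omega>)"
  have n0: "0 < n" using n_pos by simp
  have I: "integrable M (\<lambda>\<omega>. ?P \<omega> i j)" for i j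
    by (intro int_bmeas bmeas_comp[OF bmeas_proj] X_measurable n0)
  have pw: "ip d w (\<lambda>i. \<Sum>j<d. ?P \<omega> i j * v j) \<le> ((vnorm d w)\<^sup>2 + qform d (?P \<omega>) v) / 2" for \<omega>
  proof -
    define u where "u = \<phi> (X 0 \<omega>)"
    have P: "(\<Sum>j<d. ?P \<omega> i j * v j) = ip d u v * u i" if "i < d" for i
      using that by (simp add: proj_def u_def ip_def sum_distrib_left mult_ac)
    have "ip d w (\<lambda>i. \<Sum>j<d. ?P \<omega> i j * v j) = ip d u v * ip d w u"
      using P by (simp add: ip_def sum_distrib_left mult_ac)
    also have "\<dots> \<le> ((ip d w u)\<^sup>2 + (ip d u v)\<^sup>2) / 2"
      using sum_squares_bound[of "ip d u v" "ip d w u"] by (simp add: algebra_simps)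
    also have "(ip d w u)\<^sup>2 \<le> (vnorm d w)\<^sup>2"
      using ip_sq_le[of d w u] \<phi>_norm[of "X 0 \<omega>"] by (auto simp: u_def)
    also have "(ip d u v)\<^sup>2 = qform d (?P \<omega>) v"
      unfolding qform_outer[symmetric] by (simp add: qform_def proj_def u_def)
    finally show ?thesis by simp
  qed
  have "expectation (\<lambda>\<omega>. ip d w (\<lambda>i. \<Sum>j<d. ?P \<omega> i j * v j)) \<le> expectation (\<lambda>\<omega>. ((vnorm d w)\<^sup>2 + qform d (?P \<omega>) v) / 2)"
    by (rule integral_mono) (use pw I in \<open>auto simp: ip_def qform_def\<close>)
  moreover have "expectation (\<lambda>\<omega>. ip d w (\<lambda>i. \<Sum>j<d. ?P \<omega> i j * v j)) = ip d w w"
    using I by (simp add: ip_def E_proj n0 w_def)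
  moreover have "expectation (\<lambda>\<omega>. ((vnorm d w)\<^sup>2 + qform d (?P \<omega>) v) / 2) = ((vnorm d w)\<^sup>2 + qform d S v) / 2"
    using I by (simp add: qform_def E_proj n0 prob_space)
  ultimately show ?thesis by (simp add: w_def[symmetric] vnorm_sq[symmetric])
qed

text \<open>|(1 - 2 S) v|^2 = |v|^2 - 4 <v, S v> + 4 |S v|^2, and S^2 <= S. This matrix will appear
  as the coefficient of D in the sum of the squared summands.\<close>

lemma reflection_contraction:
  "vnorm d (\<lambda>i. \<Sum>j<d. (idm d i j - 2 * S i j) * v j) \<le> vnorm d v"
proof -
  define w where "w = (\<lambda>i. \<Sum>j<d. S i j * v j)"
  have eq1: "vnorm d (\<lambda>i. \<Sum>j<d. (idm d i j - 2 * S i j) * v j) = vnorm d (\<lambda>i. v i - 2 * w i)"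
    by (rule vnorm_cong)
      (simp add: left_diff_distrib sum_subtractf idm_def w_def sum_distrib_left mult.assoc
        if_distrib[of "\<lambda>x. x * _"] cong: if_cong)
  have eq2: "(vnorm d (\<lambda>i. v i - 2 * w i))\<^sup>2 = (vnorm d v)\<^sup>2 - 4 * qform d S v + 4 * (vnorm d w)\<^sup>2"
    unfolding vnorm_diff_sq by (simp only: vnorm_scale ip_scale_right) (simp add: qform_ip w_def power_mult_distrib)
  have "(vnorm d (\<lambda>i. \<Sum>j<d. (idm d i j - 2 * S i j) * v j))\<^sup>2 \<le> (vnorm d v)\<^sup>2"
    unfolding eq1 eq2 using matvec_S_le[of v, folded w_def] by simp
  then show ?thesis by (rule power2_le_imp_le) simp
qed

text \<open>P^2 = P for P = \<open>cen x\<close> + S, expanded. A squared summand is thus again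
  affine in the summand.\<close>

lemma cen_square:
  "mm d (cen x) (cen x) j k
    = cen x j k + S j k - mm d S S j k - mm d S (cen x) j k - mm d (cen x) S j k"
proof -
  have "mm d (proj x) (proj x) j k = proj x j k"
  proof (cases "j < d \<and> k < d")
    case True
    have "(\<Sum>l<d. \<phi> x j * \<phi> x l * (\<phi> x l * \<phi> x k)) = \<phi> x j * \<phi> x k * (vnorm d (\<phi> x))\<^sup>2"
      unfolding vnorm_sq_sum by (simp add: sum_distrib_left power2_eq_square mult_ac)
    also have "\<dots> = \<phi> x j * \<phi> x k"
      using \<phi>_norm[of x] True by (auto simp: vnorm_zero_iff)
    finally show ?thesis using True by (simp add: mm_def proj_def)
  qed (auto simp: mm_def proj_def)
  then have "mm d (\<lambda>j k. cen x j k + S j k) (\<lambda>j k. cen x j k + S j k) j k = cen x j k + S j k"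
    by (simp add: cen_def)
  then show ?thesis using S_cut cutm_cen[of x]
    by (cases "j < d \<and> k < d") (auto simp: mm_def cutm_def algebra_simps sum.distrib)
qed

lemma indep_product:
  assumes i: "i < n" and f: "bmeas N f" and G: "bmeas (PiM ({..<n} - {i}) (\<lambda>_. N)) G"
  shows "expectation (\<lambda>\<omega>. f (X i \<omega>) * G (\<lambda>l\<in>{..<n} - {i}. X l \<omega>))
     = expectation (\<lambda>\<omega>. f (X i \<omega>)) * expectation (\<lambda>\<omega>. G (\<lambda>l\<in>{..<n} - {i}. X l \<omega>))"
proof -
  let ?J = "{..<n} - {i}"
  have iv: "indep_var (PiM {i} (\<lambda>_. N)) (\<lambda>\<omega>. restrict (\<lambda>l. X l \<omega>) {i}) (PiM ?J (\<lambda>_. N)) (\<lambda>\<omega>. restrict (\<lambda>l. X l \<omega>) ?J)"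
    by (rule indep_var_restrict[OF indep]) (use i in auto)
  have fm: "(\<lambda>g. f (g i)) \<in> borel_measurable (PiM {i} (\<lambda>_. N))"
    using f by (intro measurable_compose[OF measurable_component_singleton]) (auto simp: bmeas_def)
  have Gm: "G \<in> borel_measurable (PiM ?J (\<lambda>_. N))" using G by (simp add: bmeas_def)
  have "indep_var borel ((\<lambda>g. f (g i)) \<circ> (\<lambda>\<omega>. restrict (\<lambda>l. X l \<omega>) {i})) borel (G \<circ> (\<lambda>\<omega>. restrict (\<lambda>l. X l \<omega>) ?J))"
    by (rule indep_var_compose[OF iv fm Gm])
  then have iv2: "indep_var borel (\<lambda>\<omega>. f (X i \<omega>)) borel (\<lambda>\<omega>. G (\<lambda>l\<in>?J. X l \<omega>))"
    by (simp add: o_def)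
  have rm: "(\<lambda>\<omega>. \<lambda>l\<in>?J. X l \<omega>) \<in> measurable M (PiM ?J (\<lambda>_. N))"
    by (intro measurable_restrict X_measurable) auto
  show ?thesis
    by (rule indep_var_lebesgue_integral[OF iv2])
       (auto intro!: bmeas_comp[OF f X_measurable[OF i]] bmeas_comp[OF G rm])
qed

text \<open>The power of the deviation without summand i is independent of X i, so F may be replaced
  by its mean, entry by entry.\<close>

lemma E_hs_indep:
  assumes i: "i < n" and F: "\<And>j k. bmeas N (\<lambda>x. F x j k)"
  shows "expectation (\<lambda>\<omega>. hs d (F (X i \<omega>)) (mpow d (dev ({..<n} - {i}) (\<lambda>l. X l \<omega>)) m))
     = expectation (\<lambda>\<omega>. hs d (\<lambda>j k. expectation (\<lambda>\<omega>. F (X i \<omega>) j k)) (mpow d (dev ({..<n} - {i}) (\<lambda>l. X l \<omega>)) m))"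
proof -
  let ?J = "{..<n} - {i}"
  have dr: "dev ?J (\<lambda>l\<in>?J. X l \<omega>) = dev ?J (\<lambda>l. X l \<omega>)" for \<omega>
    by (intro ext) (auto simp: dev_def intro!: sum.cong)
  have G: "bmeas (PiM ?J (\<lambda>_. N)) (\<lambda>f. mpow d (dev ?J f) m j k)" for j k
    by (intro bmeas_mpow bmeas_dev_PiM)
  have GM: "bmeas M (\<lambda>\<omega>. mpow d (dev ?J (\<lambda>l. X l \<omega>)) m j k)" for j k
    by (intro bmeas_mpow bmeas_dev) auto
  have FM: "bmeas M (\<lambda>\<omega>. F (X i \<omega>) j k)" for j k
    by (intro bmeas_comp[OF F] X_measurable i)
  have "expectation (\<lambda>\<omega>. F (X i \<omega>) j k * mpow d (dev ?J (\<lambda>l. X l \<omega>)) m j k)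
     = expectation (\<lambda>\<omega>. F (X i \<omega>) j k) * expectation (\<lambda>\<omega>. mpow d (dev ?J (\<lambda>l. X l \<omega>)) m j k)" for j k
    using indep_product[OF i F[of j k] G[of j k]] by (simp only: dr)
  then show ?thesis
    unfolding hs_def using int_bmeas[OF bmeas_mult[OF FM GM]] int_bmeas[OF GM] by simp
qed

abbreviation D :: "'a \<Rightarrow> nat \<Rightarrow> nat \<Rightarrow> real" where
  "D \<omega> \<equiv> dev {..<n} (\<lambda>i. X i \<omega>)"

definition tmom :: "nat \<Rightarrow> real" where
  "tmom k = expectation (\<lambda>\<omega>. trp d (D \<omega>) k)"

lemma bmeas_trp: "I \<subseteq> {..<n} \<Longrightarrow> bmeas M (\<lambda>\<omega>. trp d (dev I (\<lambda>i. X i \<omega>)) k)"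
  unfolding trp_def by (intro bmeas_hs bmeas_mpow bmeas_dev bmeas_const)

lemma tmom_even_nonneg: "0 \<le> tmom (2 * k)"
  unfolding tmom_def by (intro integral_nonneg_AE AE_I2 trp_even_nonneg symm_dev cutm_dev)

lemma E_cen_mpow: "i < n \<Longrightarrow> expectation (\<lambda>\<omega>. hs d (cen (X i \<omega>)) (mpow d (dev ({..<n} - {i}) (\<lambda>l. X l \<omega>)) m)) = 0"
  by (subst E_hs_indep) (auto simp: bmeas_cen E_cen hs_def)

lemma dev_diff: "i < n \<Longrightarrow> dev {..<n} f j k - dev ({..<n} - {i}) f j k = cen (f i) j k"
  unfolding dev_def by (simp add: sum.remove[of "{..<n}" i])

text \<open>Jensen's inequality: adding an independent centred summand does not lower the trace
  moment. The tangent inequality is taken at the sum without summand i, and its linear term has mean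
  zero.\<close>

lemma tmom_leave_one_out:
  assumes i: "i < n"
  shows "expectation (\<lambda>\<omega>. trp d (dev ({..<n} - {i}) (\<lambda>l. X l \<omega>)) (2 * p)) \<le> tmom (2 * p)"
proof (cases "p = 0")
  case True then show ?thesis by (simp add: tmom_def trp_0)
next
  case False
  let ?E = "\<lambda>\<omega>. dev ({..<n} - {i}) (\<lambda>l. X l \<omega>)"
  have cE: "bmeas M (\<lambda>\<omega>. hs d (cen (X i \<omega>)) (mpow d (?E \<omega>) m))" for m
    by (intro bmeas_hs bmeas_comp[OF bmeas_cen] bmeas_mpow bmeas_dev X_measurable i) auto
  have tE: "bmeas M (\<lambda>\<omega>. trp d (?E \<omega>) k)" for k by (intro bmeas_trp) auto
  have "expectation (\<lambda>\<omega>. trp d (?E \<omega>) (2 * p) + 2 * real p * hs d (cen (X i \<omega>)) (mpow d (?E \<omega>) (2 * p - 1)))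
      \<le> tmom (2 * p)"
    unfolding tmom_def
  proof (rule integral_mono)
    fix \<omega>
    show "trp d (?E \<omega>) (2 * p) + 2 * real p * hs d (cen (X i \<omega>)) (mpow d (?E \<omega>) (2 * p - 1)) \<le> trp d (D \<omega>) (2 * p)"
      using trace_power_tangent[where D = "D \<omega>" and E = "?E \<omega>" and p = p, OF symm_dev symm_dev cutm_dev cutm_dev] False
      by (simp add: trp_def dev_diff[OF i])
  qed (intro int_bmeas bmeas_add bmeas_mult bmeas_const cE tE bmeas_trp order_refl)+
  then show ?thesis using int_bmeas[OF tE] int_bmeas[OF cE] E_cen_mpow[OF i] by simp
qed

text \<open>The idempotence identity summed over i. Against a power of D, the products S D and D S
  have the same trace, so the random part of the sum of squares is (1 - 2 S) D. The quadratic
  variation is therefore n (S - S^2) plus a contraction of the deviation itself, which closes the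
  recursion.\<close>

lemma hs_sum_squares:
  "(\<Sum>i<n. hs d (mm d (cen (f i)) (cen (f i))) (mpow d (dev {..<n} f) (2 * p)))
   = hs d (\<lambda>j k. idm d j k - 2 * S j k) (mpow d (dev {..<n} f) (2 * p + 1))
     + real n * hs d (\<lambda>j k. S j k - mm d S S j k) (mpow d (dev {..<n} f) (2 * p))"
proof -
  let ?D = "dev {..<n} f" and ?P = "mpow d (dev {..<n} f) (2 * p)"
  have sD: "symm ?D" "cutm d ?D" by (rule symm_dev, rule cutm_dev)
  have mml: "mm d S ?D j k = (\<Sum>i<n. mm d S (cen (f i)) j k)" for j k
    by (cases "j < d \<and> k < d") (auto simp: mm_def dev_def sum_distrib_left sum.swap[of _ _ "{..<d}"])
  have mmr: "mm d ?D S j k = (\<Sum>i<n. mm d (cen (f i)) S j k)" for j k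
    by (cases "j < d \<and> k < d") (auto simp: mm_def dev_def sum_distrib_right sum.swap[of _ _ "{..<d}"])
  have "(\<Sum>i<n. hs d (mm d (cen (f i)) (cen (f i))) ?P)
      = hs d (\<lambda>j k. \<Sum>i<n. mm d (cen (f i)) (cen (f i)) j k) ?P" by (simp only: hs_sum_left)
  also have "(\<lambda>j k. \<Sum>i<n. mm d (cen (f i)) (cen (f i)) j k)
      = (\<lambda>j k. ?D j k - mm d S ?D j k - mm d ?D S j k + real n * (S j k - mm d S S j k))"
    unfolding cen_square mml mmr
    by (intro ext) (simp add: dev_def sum.distrib sum_subtractf algebra_simps)
  also have "hs d \<dots> ?P = hs d ?D ?P - hs d (mm d S ?D) ?P - hs d (mm d ?D S) ?P
      + real n * hs d (\<lambda>j k. S j k - mm d S S j k) ?P"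
    by (simp only: hs_add_left hs_diff_left hs_scale_left)
  also have "hs d ?D ?P = hs d (idm d) (mpow d ?D (2 * p + 1))"
    using hs_mm_left[OF sD(1), of d "idm d" ?P] by (simp add: mpow_Suc mm_idm_right sD)
  also have "hs d (mm d S ?D) ?P = hs d S (mpow d ?D (2 * p + 1))"
    using hs_mm_right[OF sD(1), of d S ?P] by (simp add: mpow_Suc' sD)
  also have "hs d (mm d ?D S) ?P = hs d S (mpow d ?D (2 * p + 1))"
    using hs_mm_left[OF sD(1), of d S ?P] by (simp add: mpow_Suc)
  finally show ?thesis by (simp add: hs_diff_left hs_scale_left)
qed

text \<open>tr D^(2 p + 2) is the sum over i of tr (Y_i D^(2 p + 1)). Subtracting the power with
  summand i left out changes nothing in mean, and the mean value trace inequality then pairs Y_i^2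
  with D^(2 p) and with the power without summand i. In the second pairing Y_i^2 may be replaced by
  its mean S - S^2 <= l; in the first, the sum of the Y_i^2 is known up to D. The parameter c is the
  AM-GM weight that separates the geometric mean of two consecutive even trace moments.\<close>

lemma tmom_recursion:
  assumes l: "\<And>v. qform d S v \<le> l * (vnorm d v)\<^sup>2" and l0: "0 \<le> l" and c: "c > 0"
  shows "tmom (2 * p + 2) \<le> (2 * real p + 1) * (real n * l * tmom (2 * p)
      + (c * tmom (2 * p + 2) + tmom (2 * p) / c) / 4)"
proof -
  let ?E = "\<lambda>i \<omega>. dev ({..<n} - {i}) (\<lambda>l. X l \<omega>)"
  let ?Y = "\<lambda>i \<omega>. cen (X i \<omega>)"
  have bY: "bmeas M (\<lambda>\<omega>. ?Y i \<omega> j k)" if "i < n" for i j k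
    by (intro bmeas_comp[OF bmeas_cen] X_measurable that)
  have bYY: "bmeas M (\<lambda>\<omega>. mm d (?Y i \<omega>) (?Y i \<omega>) j k)" if "i < n" for i j k
    by (intro bmeas_mm bY that)
  have bD: "bmeas M (\<lambda>\<omega>. mpow d (D \<omega>) m j k)" for m j k by (intro bmeas_mpow bmeas_dev order_refl)
  have bE: "bmeas M (\<lambda>\<omega>. mpow d (?E i \<omega>) m j k)" for i m j k by (intro bmeas_mpow bmeas_dev) auto
  have qS: "qform d (\<lambda>j k. S j k - mm d S S j k) v \<le> l * (vnorm d v)\<^sup>2" for v
  proof -
    have "qform d (mm d S S) v = (vnorm d (\<lambda>i. \<Sum>j<d. S i j * v j))\<^sup>2"
    proof -
      have "qform d (mm d S S) v = (\<Sum>i<d. \<Sum>j<d. \<Sum>l<d. v i * S l i * (S l j * v j))"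
        using symm_S by (simp add: qform_def mm_def symm_def sum_distrib_left sum_distrib_right mult_ac)
      also have "\<dots> = (\<Sum>i<d. \<Sum>l<d. \<Sum>j<d. v i * S l i * (S l j * v j))" by (intro sum.cong refl sum.swap)
      also have "\<dots> = (\<Sum>l<d. \<Sum>i<d. \<Sum>j<d. v i * S l i * (S l j * v j))" by (rule sum.swap)
      also have "\<dots> = (vnorm d (\<lambda>i. \<Sum>j<d. S i j * v j))\<^sup>2"
        unfolding vnorm_sq ip_def sum_product by (simp add: mult_ac)
      finally show ?thesis .
    qed
    then show ?thesis using l[of v] zero_le_power2[of "vnorm d (\<lambda>i. \<Sum>j<d. S i j * v j)"] unfolding qform_diff by argo
  qed
  have exYY: "expectation (\<lambda>\<omega>. mm d (?Y i \<omega>) (?Y i \<omega>) j k) = S j k - mm d S S j k" if i: "i < n" for i j k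
  proof -
    have a: "integrable M (\<lambda>\<omega>. mm d S (?Y i \<omega>) j k)" "integrable M (\<lambda>\<omega>. mm d (?Y i \<omega>) S j k)"
      by (intro int_bmeas bmeas_mm bY i bmeas_const)+
    have "expectation (\<lambda>\<omega>. mm d S (?Y i \<omega>) j k) = 0" "expectation (\<lambda>\<omega>. mm d (?Y i \<omega>) S j k) = 0"
      by (cases "j < d \<and> k < d", use int_bmeas[OF bY[OF i]] in \<open>auto simp: mm_def E_cen[OF i]\<close>)+
    then show ?thesis unfolding cen_square using a int_bmeas[OF bY[OF i]] by (simp add: E_cen[OF i] prob_space)
  qed
  have one: "expectation (\<lambda>\<omega>. hs d (?Y i \<omega>) (mpow d (D \<omega>) (2 * p + 1)))
      \<le> (2 * real p + 1) / 2 * (expectation (\<lambda>\<omega>. hs d (mm d (?Y i \<omega>) (?Y i \<omega>)) (mpow d (D \<omega>) (2 * p))) + l * tmom (2 * p))"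
    if i: "i < n" for i
  proof -
    have "expectation (\<lambda>\<omega>. hs d (?Y i \<omega>) (mpow d (D \<omega>) (2 * p + 1)))
       = expectation (\<lambda>\<omega>. hs d (?Y i \<omega>) (mpow d (D \<omega>) (2 * p + 1)) - hs d (?Y i \<omega>) (mpow d (?E i \<omega>) (2 * p + 1)))"
      using int_bmeas[OF bmeas_hs[OF bY[OF i] bD]] int_bmeas[OF bmeas_hs[OF bY[OF i] bE]]
        E_cen_mpow[OF i, of "2 * p + 1"] by simp
    also have "\<dots> \<le> expectation (\<lambda>\<omega>. (2 * real p + 1) / 2 *
         (hs d (mm d (?Y i \<omega>) (?Y i \<omega>)) (mpow d (D \<omega>) (2 * p)) + hs d (mm d (?Y i \<omega>) (?Y i \<omega>)) (mpow d (?E i \<omega>) (2 * p))))"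
    proof (rule integral_mono)
      fix \<omega>
      show "hs d (?Y i \<omega>) (mpow d (D \<omega>) (2 * p + 1)) - hs d (?Y i \<omega>) (mpow d (?E i \<omega>) (2 * p + 1))
        \<le> (2 * real p + 1) / 2 *
         (hs d (mm d (?Y i \<omega>) (?Y i \<omega>)) (mpow d (D \<omega>) (2 * p)) + hs d (mm d (?Y i \<omega>) (?Y i \<omega>)) (mpow d (?E i \<omega>) (2 * p)))"
        using trace_power_difference_le[where D = "D \<omega>" and E = "?E i \<omega>" and p = p, OF symm_dev symm_dev cutm_dev cutm_dev]
        by (simp only: dev_diff[OF i])
    qed (intro int_bmeas bmeas_add bmeas_diff bmeas_mult bmeas_const bmeas_hs bY bYY bD bE i)+
    also have "\<dots> = (2 * real p + 1) / 2 * (expectation (\<lambda>\<omega>. hs d (mm d (?Y i \<omega>) (?Y i \<omega>)) (mpow d (D \<omega>) (2 * p)))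
         + expectation (\<lambda>\<omega>. hs d (mm d (?Y i \<omega>) (?Y i \<omega>)) (mpow d (?E i \<omega>) (2 * p))))"
      using int_bmeas[OF bmeas_hs[OF bYY[OF i] bD]] int_bmeas[OF bmeas_hs[OF bYY[OF i] bE]] by simp
    also have "expectation (\<lambda>\<omega>. hs d (mm d (?Y i \<omega>) (?Y i \<omega>)) (mpow d (?E i \<omega>) (2 * p)))
       = expectation (\<lambda>\<omega>. hs d (\<lambda>j k. S j k - mm d S S j k) (mpow d (?E i \<omega>) (2 * p)))"
      by (subst E_hs_indep[OF i, of "\<lambda>x. mm d (cen x) (cen x)"]) (auto intro!: bmeas_mm bmeas_cen simp: exYY[OF i])
    also have "\<dots> \<le> expectation (\<lambda>\<omega>. l * trp d (?E i \<omega>) (2 * p))"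
      by (rule integral_mono)
         (auto intro!: int_bmeas bmeas_hs bE bmeas_const bmeas_mult bmeas_trp hs_le_trp_even[OF symm_dev cutm_dev qS] simp del: integrable_mult_right_iff)
    also have "\<dots> \<le> l * tmom (2 * p)"
      using mult_left_mono[OF tmom_leave_one_out[OF i] l0] by simp
    finally show ?thesis by (simp add: mult_left_mono)
  qed
  have "tmom (2 * p + 2) = expectation (\<lambda>\<omega>. \<Sum>i<n. hs d (?Y i \<omega>) (mpow d (D \<omega>) (2 * p + 1)))"
  proof -
    have "trp d (D \<omega>) (2 * p + 2) = (\<Sum>i<n. hs d (?Y i \<omega>) (mpow d (D \<omega>) (2 * p + 1)))" for \<omega>
    proof -
      have "trp d (D \<omega>) (2 * p + 2) = hs d (D \<omega>) (mpow d (D \<omega>) (2 * p + 1))"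
        using hs_mm_left[OF symm_dev, of d "idm d" "{..<n}" "\<lambda>i. X i \<omega>" "mpow d (D \<omega>) (2 * p + 1)"]
        by (simp add: trp_def mpow_Suc mm_idm_right cutm_dev)
      then show ?thesis unfolding hs_sum_left[symmetric] dev_def .
    qed
    then show ?thesis by (simp add: tmom_def)
  qed
  also have "\<dots> = (\<Sum>i<n. expectation (\<lambda>\<omega>. hs d (?Y i \<omega>) (mpow d (D \<omega>) (2 * p + 1))))"
    by (intro Bochner_Integration.integral_sum int_bmeas bmeas_hs bY bD) auto
  also have "\<dots> \<le> (\<Sum>i<n. (2 * real p + 1) / 2 * (expectation (\<lambda>\<omega>. hs d (mm d (?Y i \<omega>) (?Y i \<omega>)) (mpow d (D \<omega>) (2 * p))) + l * tmom (2 * p)))"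
    by (intro sum_mono one) auto
  also have "\<dots> = (2 * real p + 1) / 2 * ((\<Sum>i<n. expectation (\<lambda>\<omega>. hs d (mm d (?Y i \<omega>) (?Y i \<omega>)) (mpow d (D \<omega>) (2 * p)))) + n * l * tmom (2 * p))"
    by (simp only: sum_distrib_left[symmetric] sum.distrib) simp
  also have "(\<Sum>i<n. expectation (\<lambda>\<omega>. hs d (mm d (?Y i \<omega>) (?Y i \<omega>)) (mpow d (D \<omega>) (2 * p))))
      = expectation (\<lambda>\<omega>. \<Sum>i<n. hs d (mm d (?Y i \<omega>) (?Y i \<omega>)) (mpow d (D \<omega>) (2 * p)))"
    by (intro Bochner_Integration.integral_sum[symmetric] int_bmeas bmeas_hs bYY bD) auto
  also have "\<dots> \<le> expectation (\<lambda>\<omega>. (c * trp d (D \<omega>) (2 * p + 2) + (1 / c) * trp d (D \<omega>) (2 * p)) / 2 + real n * (l * trp d (D \<omega>) (2 * p)))"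
  proof (rule integral_mono)
    show "integrable M (\<lambda>\<omega>. (c * trp d (D \<omega>) (2 * p + 2) + (1 / c) * trp d (D \<omega>) (2 * p)) / 2 + real n * (l * trp d (D \<omega>) (2 * p)))"
      unfolding divide_inverse
      by (intro int_bmeas bmeas_add bmeas_mult bmeas_const bmeas_trp order_refl)
    show "integrable M (\<lambda>\<omega>. \<Sum>i<n. hs d (mm d (?Y i \<omega>) (?Y i \<omega>)) (mpow d (D \<omega>) (2 * p)))"
      by (intro int_bmeas bmeas_sum bmeas_hs bYY bD) auto
    fix \<omega>
    have nn: "0 \<le> trp d (D \<omega>) (2 * p + 2)" "0 \<le> trp d (D \<omega>) (2 * p)"
      using trp_even_nonneg[OF symm_dev cutm_dev, of "{..<n}" "\<lambda>i. X i \<omega>" "p + 1"]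
        trp_even_nonneg[OF symm_dev cutm_dev, of "{..<n}" "\<lambda>i. X i \<omega>" p] by simp_all
    have amgm: "sqrt x * sqrt y \<le> (c * x + (1 / c) * y) / 2" if "0 \<le> x" "0 \<le> y" for x y
    proof -
      have "2 * (sqrt (c * x) * sqrt (y / c)) \<le> (sqrt (c * x))\<^sup>2 + (sqrt (y / c))\<^sup>2"
        using sum_squares_bound[of "sqrt (c * x)" "sqrt (y / c)"] by simp
      moreover have "sqrt (c * x) * sqrt (y / c) = sqrt x * sqrt y"
        using c by (simp add: real_sqrt_mult real_sqrt_divide)
      ultimately show ?thesis using that c by simp
    qed
    show "(\<Sum>i<n. hs d (mm d (?Y i \<omega>) (?Y i \<omega>)) (mpow d (D \<omega>) (2 * p)))
      \<le> (c * trp d (D \<omega>) (2 * p + 2) + (1 / c) * trp d (D \<omega>) (2 * p)) / 2 + real n * (l * trp d (D \<omega>) (2 * p))"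
      unfolding hs_sum_squares
      by (intro add_mono mult_left_mono order_trans[OF hs_contraction_le amgm] hs_le_trp_even symm_dev cutm_dev reflection_contraction qS nn) auto
  qed
  also have "\<dots> = (c * tmom (2 * p + 2) + tmom (2 * p) / c) / 2 + real n * l * tmom (2 * p)"
    unfolding tmom_def using int_bmeas[OF bmeas_trp[OF order_refl]] by simp
  finally have "tmom (2 * p + 2) \<le> (2 * real p + 1) / 2 * (((c * tmom (2 * p + 2) + tmom (2 * p) / c) / 2
      + real n * l * tmom (2 * p)) + real n * l * tmom (2 * p))"
    by (simp add: mult_left_mono)
  then show ?thesis by (simp add: field_simps)
qed

end

section \<open>Numerical estimates for the moment order\<close>

definition odd_prod :: "nat \<Rightarrow> real" where
  "odd_prod p = (\<Prod>k<p. 2 * real k + 1)"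

lemma odd_prod_Suc [simp]: "odd_prod (Suc p) = (2 * real p + 1) * odd_prod p"
  by (simp add: odd_prod_def)

lemma odd_prod_0 [simp]: "odd_prod 0 = 1"
  by (simp add: odd_prod_def)

lemma odd_prod_pos: "odd_prod p > 0"
  unfolding odd_prod_def by (intro prod_pos) auto

text \<open>\<open>odd_prod p\<close> is the double factorial (2 p - 1)!!, the moment of order 2 p
  of a standard normal variable. With x = p + 2, the ratio of consecutive left sides is at most (2 x
  - 1)(x + 1) / (4 x^2), whose maximum 9 / 16 is attained at x = 2. At p = 0 the left side is e^2 /
  8, just below 0.95.\<close>

lemma odd_prod_exp_bound:
  "odd_prod (Suc p) * exp (real p + 2) / (4 * (real p + 2)) ^ Suc p \<le> 0.95 * (9 / 16) ^ p"
proof (induction p)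
  case 0
  have "exp (2::real) = exp 1 * exp 1" by (simp flip: exp_add)
  also have "\<dots> \<le> (272 / 100) * (272 / 100)" using e_less_272 by (intro mult_mono) auto
  finally show ?case by simp
next
  case (Suc p)
  define x where "x = real p + 2"
  have x: "x \<ge> 2" by (simp add: x_def)
  let ?k = "Suc p"
  \<comment> \<open>Equivalent to (x / (x + 1))^(x + 1) <= 1 / e; the exponent p + 3 below is x +
    1.\<close>
  have ineq: "exp 1 * (x / (x + 1)) ^ ?k \<le> ((x + 1) / x)\<^sup>2"
  proof -
    have "ln (x / (x + 1)) \<le> x / (x + 1) - 1" using x by (intro ln_le_minus_one) simp
    also have "\<dots> = - (1 / (x + 1))" using x by (simp add: field_simps)
    finally have "(x + 1) * ln (x / (x + 1)) \<le> -1" using x by (simp add: field_simps)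
    moreover have "ln ((x / (x + 1)) ^ (p + 3)) = (x + 1) * ln (x / (x + 1))"
      using x by (simp add: ln_realpow x_def algebra_simps)
    ultimately have "ln ((x / (x + 1)) ^ (p + 3)) \<le> -1" by simp
    moreover have "(x / (x + 1)) ^ (p + 3) > 0" using x by simp
    ultimately have "(x / (x + 1)) ^ (p + 3) \<le> exp (-1)"
      by (metis exp_le_cancel_iff exp_ln)
    then have "(x / (x + 1)) ^ ?k * (x / (x + 1))\<^sup>2 \<le> exp (-1)"
      by (simp only: power_add[symmetric]) (simp add: numeral_eq_Suc)
    then have "exp 1 * ((x / (x + 1)) ^ ?k * (x / (x + 1))\<^sup>2) \<le> exp 1 * exp (-1)"
      by (intro mult_left_mono) auto
    then have "exp 1 * (x / (x + 1)) ^ ?k * (x / (x + 1))\<^sup>2 \<le> 1"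
      by (simp add: mult.assoc flip: exp_add)
    moreover have "(x / (x + 1))\<^sup>2 > 0" using x by simp
    ultimately have "exp 1 * (x / (x + 1)) ^ ?k \<le> 1 / (x / (x + 1))\<^sup>2"
      by (simp only: pos_le_divide_eq)
    then show ?thesis by (simp add: power_divide)
  qed
  have ratio: "(2 * x - 1) / (4 * (x + 1)) * (exp 1 * (x / (x + 1)) ^ ?k) \<le> 9 / 16"
  proof -
    have "(2 * x - 1) / (4 * (x + 1)) * (exp 1 * (x / (x + 1)) ^ ?k) \<le> (2 * x - 1) / (4 * (x + 1)) * ((x + 1) / x)\<^sup>2"
      using x by (intro mult_left_mono ineq) auto
    also have "\<dots> = (2 * x - 1) * (x + 1) / (4 * x\<^sup>2)"
      using x by (simp add: power2_eq_square divide_simps)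
    also have "\<dots> \<le> 9 / 16"
    proof -
      have "0 \<le> (x - 2)\<^sup>2" by simp
      then have "16 * ((2 * x - 1) * (x + 1)) \<le> 9 * (4 * x\<^sup>2)"
        by (simp add: power2_eq_square algebra_simps)
      then show ?thesis using x by (simp add: divide_le_eq)
    qed
    finally show ?thesis .
  qed
  have "odd_prod (Suc (Suc p)) * exp (real (Suc p) + 2) / (4 * (real (Suc p) + 2)) ^ Suc (Suc p)
      = ((2 * x - 1) / (4 * (x + 1)) * (exp 1 * (x / (x + 1)) ^ ?k)) * (odd_prod ?k * exp x / (4 * x) ^ ?k)"
  proof -
    have e: "exp (x + 1) = exp 1 * exp x" by (simp add: add.commute flip: exp_add)
    have o: "odd_prod (Suc (Suc p)) = (2 * x - 1) * odd_prod ?k" by (simp add: x_def algebra_simps)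
    have s: "real (Suc p) + 2 = x + 1" by (simp add: x_def)
    have "((2 * x - 1) / (4 * (x + 1)) * (exp 1 * (x / (x + 1)) ^ ?k)) * (odd_prod ?k * exp x / (4 * x) ^ ?k)
      = (2 * x - 1) * exp 1 * odd_prod ?k * exp x * (x ^ ?k / (4 * x) ^ ?k) / (4 * (x + 1) * (x + 1) ^ ?k)"
      by (simp only: power_divide times_divide_eq_left times_divide_eq_right divide_divide_eq_left mult_ac)
    also have "x ^ ?k / (4 * x) ^ ?k = 1 / 4 ^ ?k" using x by (simp add: power_mult_distrib del: power_Suc)
    also have "(2 * x - 1) * exp 1 * odd_prod ?k * exp x * (1 / 4 ^ ?k) / (4 * (x + 1) * (x + 1) ^ ?k)
      = (2 * x - 1) * odd_prod ?k * (exp 1 * exp x) / (4 * (x + 1)) ^ Suc ?k"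
      by (simp only: power_mult_distrib power_Suc divide_divide_eq_left times_divide_eq_left times_divide_eq_right mult_1_right mult_ac)
    finally show ?thesis by (simp only: e o s)
  qed
  also have "\<dots> \<le> (9 / 16) * (0.95 * (9 / 16) ^ p)"
    using Suc ratio odd_prod_pos[of ?k] x
    by (intro mult_mono) (auto simp: x_def intro!: mult_nonneg_nonneg divide_nonneg_nonneg less_imp_le[OF odd_prod_pos])
  finally show ?case by simp
qed

text \<open>At deviation level 2 sqrt (l L / n), Gaussian moments of order 2 p give the factor (2 p
  - 1)!! / (4 L)^p, to be compared with e^(-L). The best p would lie near 2 L, but p = floor L
  already reaches e^(-L) with the geometric gain (9 / 16)^(p - 1), and a smaller p weakens the
  condition under which the moment bound holds. For L < 1 the choice is p = 1.\<close>

lemma moment_order_bound: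
  fixes L :: real
  assumes L: "L \<ge> ln 2"
  obtains p :: nat where "p \<ge> 1" "2 * real p - 1 \<le> 2 * L" "L \<le> real p + 1"
    "odd_prod p / (4 * L) ^ p \<le> 0.95 * (9 / 16) ^ (p - 1) * exp (- L)"
proof (cases "L < 1")
  case True
  have L23: "L \<ge> 2 / 3" using L ln2_ge_two_thirds by linarith
  \<comment> \<open>For p = 1 the claim is exp L <= 3.8 L, where 3.8 = 4 * 0.95. Expanding at ln 2
    gives exp L = 2 exp t with t <= 1 / 3.\<close>
  define t where "t = L - ln 2"
  have t: "0 \<le> t" "t \<le> 1 / 3" using L True ln2_ge_two_thirds by (auto simp: t_def)
  have "exp L = 2 * exp t" by (simp add: t_def exp_diff)
  also have "\<dots> \<le> 2 * (1 + t + t\<^sup>2)" using t by (intro mult_left_mono exp_bound) auto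
  also have "\<dots> \<le> 3.8 * L"
  proof -
    have "t\<^sup>2 \<le> (1 / 3) * t" unfolding power2_eq_square using t by (intro mult_right_mono) auto
    moreover have "L \<ge> 2 / 3 + t" using ln2_ge_two_thirds by (simp add: t_def)
    ultimately show ?thesis using t by argo
  qed
  finally have "exp L \<le> 3.8 * L" .
  then have "1 / (4 * L) \<le> 0.95 * exp (- L)"
    using L23 by (simp add: exp_minus field_simps)
  then show ?thesis using that[of 1] L23 True by simp
next
  case False
  define p where "p = nat \<lfloor>L\<rfloor>"
  have p: "p \<ge> 1" "real p \<le> L" "L < real p + 1" using False by (auto simp: p_def le_nat_floor)
  have L0: "L > 0" using False by simp
  \<comment> \<open>The function x -> exp x / x^p increases for x >= p, so L may be replaced by p +
    1, the argument at which the double factorial has been estimated.\<close>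
  have pow: "exp L / (4 * L) ^ p \<le> exp (real p + 1) / (4 * (real p + 1)) ^ p"
  proof -
    have "real p * ln ((real p + 1) / L) \<le> real p * ((real p + 1) / L - 1)"
      using L0 p by (intro mult_left_mono ln_le_minus_one) auto
    also have "\<dots> = real p / L * (real p + 1 - L)" using L0 by (simp add: field_simps)
    also have "\<dots> \<le> 1 * (real p + 1 - L)" using p L0 by (intro mult_right_mono) auto
    finally have "ln (((real p + 1) / L) ^ p) \<le> real p + 1 - L" using L0 p by (simp add: ln_realpow)
    moreover have "((real p + 1) / L) ^ p > 0" using L0 p by simp
    ultimately have "((real p + 1) / L) ^ p \<le> exp (real p + 1 - L)"
      by (metis exp_le_cancel_iff exp_ln)
    then have "(real p + 1) ^ p * exp L \<le> exp (real p + 1) * L ^ p"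
      using L0 by (simp add: power_divide exp_diff field_simps)
    then show ?thesis unfolding power_mult_distrib using L0 by (simp add: field_simps)
  qed
  obtain k where k: "p = Suc k" using p by (cases p) auto
  have "odd_prod p / (4 * L) ^ p = odd_prod p * (exp L / (4 * L) ^ p) * exp (- L)"
    by (simp add: exp_minus)
  also have "\<dots> \<le> odd_prod p * (exp (real p + 1) / (4 * (real p + 1)) ^ p) * exp (- L)"
    using odd_prod_pos[of p] by (intro mult_right_mono mult_left_mono pow) auto
  also have "\<dots> = (odd_prod (Suc k) * exp (real k + 2) / (4 * (real k + 2)) ^ Suc k) * exp (- L)"
    by (simp add: k add_ac)
  also have "\<dots> \<le> (0.95 * (9 / 16) ^ k) * exp (- L)"
    by (intro mult_right_mono odd_prod_exp_bound) auto
  finally show ?thesis using that[of p] p k by auto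
qed

section \<open>Gaussian comparison of the trace moments and the resulting tail bound\<close>

context indep_directions
begin

text \<open>\<kappa> is the loss against the Gaussian recursion factor (2 p + 1) n l. The weight c
  is chosen so that the higher moment on the right is the fraction (\<kappa> - 1) / (2 \<kappa>) of
  the left side and can be moved there; \<open>cond\<close> makes the other AM-GM term at most
  (\<kappa> - 1) / 2 times the main one.\<close>

lemma tmom_step:
  assumes l: "\<And>v. qform d S v \<le> l * (vnorm d v)\<^sup>2" and l0: "0 \<le> l" and \<kappa>: "\<kappa> > 1"
    and cond: "(2 * real p + 1) * \<kappa> \<le> 4 * (\<kappa> - 1)\<^sup>2 * (real n * l)"
  shows "tmom (2 * p + 2) \<le> (2 * real p + 1) * (\<kappa> * real n * l) * tmom (2 * p)"
proof -
  define P where "P = 2 * real p + 1"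
  define R where "R = real n * l"
  define a where "a = tmom (2 * p + 2)"
  define b where "b = tmom (2 * p)"
  have P: "P > 0" by (simp add: P_def)
  have b0: "b \<ge> 0" by (simp add: b_def tmom_even_nonneg)
  have R0: "R \<ge> 0" using l0 by (simp add: R_def)
  define c where "c = 2 * (\<kappa> - 1) / (P * \<kappa>)"
  have c: "c > 0" using \<kappa> P by (simp add: c_def)
  have "a \<le> P * (R * b + (c * a + b / c) / 4)"
    unfolding a_def b_def P_def R_def by (rule tmom_recursion[OF l l0 c])
  then have "a - P * c / 4 * a \<le> P * R * b + P * (1 / (4 * c)) * b"
    by (simp add: algebra_simps add_divide_distrib)
  moreover have "P * c / 4 = (\<kappa> - 1) / (2 * \<kappa>)" using P \<kappa> by (simp add: c_def field_simps)
  ultimately have 1: "a - (\<kappa> - 1) / (2 * \<kappa>) * a \<le> P * R * b + P * (1 / (4 * c)) * b" by simp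
  have "1 / (4 * c) = (P * \<kappa>) / (8 * (\<kappa> - 1))" using \<kappa> P by (simp add: c_def)
  also have "\<dots> \<le> (4 * (\<kappa> - 1)\<^sup>2 * R) / (8 * (\<kappa> - 1))"
    using cond \<kappa> unfolding P_def[symmetric] R_def[symmetric] by (intro divide_right_mono) auto
  also have "\<dots> = (\<kappa> - 1) / 2 * R"
  proof -
    define u where "u = \<kappa> - 1"
    have "u \<noteq> 0" using \<kappa> by (simp add: u_def)
    then show ?thesis unfolding u_def[symmetric] by (simp add: power2_eq_square)
  qed
  finally have "P * (1 / (4 * c)) * b \<le> P * ((\<kappa> - 1) / 2 * R) * b"
    using P b0 by (intro mult_right_mono mult_left_mono) auto
  with 1 have "a - (\<kappa> - 1) / (2 * \<kappa>) * a \<le> P * R * b + P * ((\<kappa> - 1) / 2 * R) * b" by linarith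
  moreover have "a - (\<kappa> - 1) / (2 * \<kappa>) * a = (\<kappa> + 1) / 2 * (a / \<kappa>)" using \<kappa> by (simp add: field_simps)
  moreover have "P * R * b + P * ((\<kappa> - 1) / 2 * R) * b = (\<kappa> + 1) / 2 * (P * R * b)" by (simp add: field_simps)
  ultimately have "(\<kappa> + 1) / 2 * (a / \<kappa>) \<le> (\<kappa> + 1) / 2 * (P * R * b)" by linarith
  then have "a / \<kappa> \<le> P * R * b" by (rule mult_left_le_imp_le) (use \<kappa> in simp)
  then have "a \<le> P * R * b * \<kappa>" using \<kappa> by (simp add: pos_divide_le_eq)
  then show ?thesis unfolding a_def b_def P_def R_def by (simp add: mult_ac)
qed

lemma tmom_bound:
  assumes l: "\<And>v. qform d S v \<le> l * (vnorm d v)\<^sup>2" and l0: "0 \<le> l" and \<kappa>: "\<kappa> > 1"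
    and cond: "(2 * real p - 1) * \<kappa> \<le> 4 * (\<kappa> - 1)\<^sup>2 * (real n * l)"
  shows "tmom (2 * p) \<le> real d * odd_prod p * (\<kappa> * real n * l) ^ p"
  using cond
proof (induction p)
  case 0 then show ?case by (simp add: tmom_def trp_0 prob_space)
next
  case (Suc p)
  have nn: "(\<kappa> * real n * l) \<ge> 0" using \<kappa> l0 by simp
  have "(2 * real p - 1) * \<kappa> \<le> 4 * (\<kappa> - 1)\<^sup>2 * (real n * l)" using Suc.prems \<kappa> by (simp add: algebra_simps)
  then have IH: "tmom (2 * p) \<le> real d * odd_prod p * (\<kappa> * real n * l) ^ p" by (rule Suc.IH)
  have "tmom (2 * p + 2) \<le> (2 * real p + 1) * (\<kappa> * real n * l) * tmom (2 * p)"
    by (rule tmom_step[OF l l0 \<kappa>]) (use Suc.prems in \<open>simp add: algebra_simps\<close>)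
  also have "\<dots> \<le> (2 * real p + 1) * (\<kappa> * real n * l) * (real d * odd_prod p * (\<kappa> * real n * l) ^ p)"
    using nn by (intro mult_left_mono IH) auto
  finally show ?case by (simp add: mult_ac)
qed

text \<open>Markov's inequality for the trace moment of order 2 p, at the level n b whose square is
  4 n l L. The factor d is the trace moment of order 0; it is cancelled later by e^(-L) = \<alpha> /
  d.\<close>

lemma deviation_tail:
  assumes l: "\<And>v. qform d S v \<le> l * (vnorm d v)\<^sup>2" and l0: "0 < l" and \<kappa>: "\<kappa> > 1"
    and cond: "(2 * real p - 1) * \<kappa> \<le> 4 * (\<kappa> - 1)\<^sup>2 * (real n * l)"
    and L: "L > 0"
  defines "b \<equiv> 2 * sqrt (l * L / real n)"
  obtains G where "G \<in> sets M" "prob G \<ge> 1 - real d * (odd_prod p * (\<kappa> / (4 * L)) ^ p)"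
    "\<And>\<omega> v. \<omega> \<in> G \<Longrightarrow> vnorm d v = 1 \<Longrightarrow> \<bar>qform d (D \<omega>) v\<bar> \<le> real n * b"
proof -
  define G where "G = {\<omega>\<in>space M. trp d (D \<omega>) (2 * p) < (real n * b) ^ (2 * p)}"
  have b0: "b > 0" using l0 L n_pos by (simp add: b_def)
  have bm: "bmeas M (\<lambda>\<omega>. trp d (D \<omega>) (2 * p))" by (rule bmeas_trp) simp
  then have [measurable]: "(\<lambda>\<omega>. trp d (D \<omega>) (2 * p)) \<in> borel_measurable M" by (simp add: bmeas_def)
  have G: "G \<in> sets M" unfolding G_def by measurable
  let ?B = "{\<omega>\<in>space M. (real n * b) ^ (2 * p) \<le> trp d (D \<omega>) (2 * p)}"
  have "prob ?B \<le> tmom (2 * p) / (real n * b) ^ (2 * p)"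
    unfolding tmom_def
    by (rule integral_Markov_inequality_measure[where A = "space M" and u = "\<lambda>\<omega>. trp d (D \<omega>) (2 * p)", simplified])
       (use int_bmeas[OF bm] b0 n_pos trp_even_nonneg[OF symm_dev cutm_dev] in auto)
  also have "\<dots> \<le> (real d * odd_prod p * (\<kappa> * real n * l) ^ p) / (real n * b) ^ (2 * p)"
    using tmom_bound[OF l _ \<kappa> cond] l0 b0 by (intro divide_right_mono) auto
  also have "\<dots> = real d * odd_prod p * (\<kappa> * real n * l) ^ p / (4 * (real n * l * L)) ^ p"
  proof -
    have "(real n * b)\<^sup>2 = 4 * (real n * l * L)"
      using l0 L n_pos by (simp add: b_def power_mult_distrib) (simp add: power2_eq_square)
    then show ?thesis by (simp only: power_mult)
  qed
  also have "\<dots>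
      = real d * (odd_prod p * ((\<kappa> * real n * l) / (4 * (real n * l * L))) ^ p)"
    by (simp only: power_divide times_divide_eq_right mult.assoc)
  also have "(\<kappa> * real n * l) / (4 * (real n * l * L)) = \<kappa> / (4 * L)"
    using l0 n_pos by simp
  finally have pB: "prob ?B \<le> real d * (odd_prod p * (\<kappa> / (4 * L)) ^ p)" .
  have "prob G = 1 - prob ?B"
  proof -
    have "?B \<in> events" by measurable
    moreover have "G = space M - ?B" by (auto simp: G_def)
    ultimately show ?thesis using prob_compl by simp
  qed
  moreover have "\<bar>qform d (D \<omega>) v\<bar> \<le> real n * b" if "\<omega> \<in> G" "vnorm d v = 1" for \<omega> v
  proof (rule ccontr)
    assume "\<not> \<bar>qform d (D \<omega>) v\<bar> \<le> real n * b"
    then have "(real n * b) ^ (2 * p) \<le> \<bar>qform d (D \<omega>) v\<bar> ^ (2 * p)"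
      using b0 by (intro power_mono) auto
    also have "\<dots> = (qform d (D \<omega>) v) ^ (2 * p)" by (simp add: power_even_abs)
    also have "\<dots> \<le> trp d (D \<omega>) (2 * p)"
      by (rule qform_power_le_trp[OF symm_dev cutm_dev that(2)])
    finally show False using that(1) by (simp add: G_def)
  qed
  ultimately show ?thesis using that[OF G] pB by auto
qed

text \<open>For L < 22 the order p may be 1 and offers no geometric gain, so \<kappa> = 1.01; with 2
  p - 1 <= 2 L the moment condition then reads n l >= 5050 L. For L >= 22 one has p >= 21, and (1.65
  * 9 / 16)^20 < 1 / 2 absorbs the loss of \<kappa> = 1.65, for which n l >= 2 L is enough. In both
  cases the failure probability is at most 0.95 * 1.02 \<alpha> < 0.97 \<alpha>.\<close>

lemma spectral_deviation:
  assumes l: "\<And>v. qform d S v \<le> l * (vnorm d v)\<^sup>2" and l0: "0 < l"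
    and L: "L \<ge> ln 2" and \<alpha>: "\<alpha> > 0" and Ld: "L = ln (real d) + ln (1 / \<alpha>)" and d: "d \<ge> 1"
    and regime: "L < 22 \<and> 5050 * L \<le> real n * l \<or> 22 \<le> L \<and> 2 * L \<le> real n * l"
  defines "b \<equiv> 2 * sqrt (l * L / real n)"
  obtains G where "G \<in> sets M" "prob G \<ge> 1 - 0.97 * \<alpha>"
    "\<And>\<omega> v. \<omega> \<in> G \<Longrightarrow> vnorm d v = 1 \<Longrightarrow> \<bar>qform d (D \<omega>) v\<bar> \<le> real n * b"
proof -
  obtain p :: nat where p: "p \<ge> 1" "2 * real p - 1 \<le> 2 * L" "L \<le> real p + 1"
    and op: "odd_prod p / (4 * L) ^ p \<le> 0.95 * (9 / 16) ^ (p - 1) * exp (- L)"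
    using moment_order_bound[OF L] by blast
  have L0: "L > 0" using L ln2_ge_two_thirds by linarith
  define \<kappa> :: real where "\<kappa> = (if L < 22 then 1.01 else 1.65)"
  have \<kappa>: "\<kappa> > 1" by (simp add: \<kappa>_def)
  have cond: "(2 * real p - 1) * \<kappa> \<le> 4 * (\<kappa> - 1)\<^sup>2 * (real n * l)"
  proof -
    have "(2 * real p - 1) * \<kappa> \<le> 2 * L * \<kappa>" using p \<kappa> by (intro mult_right_mono) auto
    also have "\<dots> \<le> 4 * (\<kappa> - 1)\<^sup>2 * (real n * l)"
    proof -
      define R where "R = real n * l"
      show ?thesis using regime L0 unfolding R_def[symmetric] by (auto simp: \<kappa>_def power2_eq_square)
    qed
    finally show ?thesis .
  qed
  have small: "\<kappa> * (\<kappa> * (9 / 16)) ^ (p - 1) \<le> 1.02"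
  proof (cases "L < 22")
    case True
    then have "(\<kappa> * (9 / 16)) ^ (p - 1) \<le> 1" by (intro power_le_one) (auto simp: \<kappa>_def)
    then show ?thesis using True by (simp add: \<kappa>_def)
  next
    case False
    then have "p - 1 \<ge> 20" using p(3) by linarith
    then have "(\<kappa> * (9 / 16)) ^ (p - 1) \<le> (\<kappa> * (9 / 16)) ^ 20"
      using False by (intro power_decreasing) (auto simp: \<kappa>_def)
    also have "\<dots> \<le> 0.5" using False by (simp add: \<kappa>_def power_numeral_reduce)
    finally show ?thesis using False by (simp add: \<kappa>_def)
  qed
  have "real d * (odd_prod p * (\<kappa> / (4 * L)) ^ p) = real d * \<kappa> ^ p * (odd_prod p / (4 * L) ^ p)"
    by (simp add: power_divide)
  also have "\<dots> \<le> real d * \<kappa> ^ p * (0.95 * (9 / 16) ^ (p - 1) * exp (- L))"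
    using \<kappa> by (intro mult_left_mono op) auto
  also have "\<dots> = 0.95 * (\<kappa> * (\<kappa> * (9 / 16)) ^ (p - 1)) * (real d * exp (- L))"
  proof -
    have "\<kappa> ^ p = \<kappa> * \<kappa> ^ (p - 1)" using p(1) by (cases p) auto
    then show ?thesis by (simp only: power_mult_distrib mult_ac)
  qed
  also have "real d * exp (- L) = \<alpha>"
    using d \<alpha> by (simp add: Ld exp_diff exp_minus ln_div)
  also have "0.95 * (\<kappa> * (\<kappa> * (9 / 16)) ^ (p - 1)) * \<alpha> \<le> 0.95 * 1.02 * \<alpha>"
    using \<alpha> by (intro mult_right_mono mult_left_mono small) auto
  also have "\<dots> \<le> 0.97 * \<alpha>" using \<alpha> by simp
  finally have fail: "real d * (odd_prod p * (\<kappa> / (4 * L)) ^ p) \<le> 0.97 * \<alpha>" .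
  obtain G where "G \<in> sets M" "prob G \<ge> 1 - real d * (odd_prod p * (\<kappa> / (4 * L)) ^ p)"
    "\<And>\<omega> v. \<omega> \<in> G \<Longrightarrow> vnorm d v = 1 \<Longrightarrow> \<bar>qform d (D \<omega>) v\<bar> \<le> real n * b"
    unfolding b_def using deviation_tail[OF l l0 \<kappa> cond L0] by blast
  then show ?thesis using that fail by force
qed

end

section \<open>Standard Gaussian vectors\<close>

abbreviation stdn :: "real measure" where
  "stdn \<equiv> density lborel (\<lambda>x. ennreal (std_normal_density x))"

definition gauss :: "nat \<Rightarrow> (nat \<Rightarrow> real) measure" where
  "gauss q = PiM {..<q} (\<lambda>_. stdn)"

lemma prob_space_stdn: "prob_space stdn"
  by (rule prob_space_normal_density) simp

interpretation stdn: prob_space stdn by (rule prob_space_stdn)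

interpretation stdn_prod: product_prob_space "\<lambda>_::nat. stdn" UNIV ..

interpretation lborel_psf: product_sigma_finite "\<lambda>_::nat. lborel :: real measure"
  by standard

lemma prob_space_gauss: "prob_space (gauss q)"
  unfolding gauss_def by (intro prob_space_PiM prob_space_stdn)

interpretation gauss: prob_space "gauss q" for q by (rule prob_space_gauss)

lemma sets_gauss [measurable_cong]: "sets (gauss q) = sets (Rvec q)"
  unfolding gauss_def by (intro sets_PiM_cong) auto

lemma space_gauss: "space (gauss q) = space (Rvec q)"
  by (rule sets_eq_imp_space_eq[OF sets_gauss])

lemma sets_PiM_lborel [measurable_cong]: "sets (PiM {..<q} (\<lambda>_. lborel :: real measure)) = sets (Rvec q)"
  by (intro sets_PiM_cong) auto

lemma space_PiM_lborel: "space (PiM {..<q} (\<lambda>_. lborel :: real measure)) = space (Rvec q)"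
  by (rule sets_eq_imp_space_eq[OF sets_PiM_lborel])

lemma coord_measurable: "j < q \<Longrightarrow> (\<lambda>z. z j) \<in> borel_measurable (Rvec q)"
  by (rule measurable_component_singleton) simp

lemma ip_measurable [measurable]: "(\<lambda>z. ip q a z) \<in> borel_measurable (Rvec q)"
  unfolding ip_def by (intro borel_measurable_sum borel_measurable_times coord_measurable) auto

lemma vnorm_measurable [measurable]: "vnorm q \<in> borel_measurable (Rvec q)"
  unfolding vnorm_def[abs_def]
  by (intro borel_measurable_sqrt borel_measurable_sum borel_measurable_power coord_measurable measurable_compose[OF _ borel_measurable_sqrt]) auto

lemma restrict_affine_measurable [measurable]:
  "(\<lambda>z. \<lambda>j\<in>{..<q}. t j + c * z j) \<in> measurable (Rvec q) (Rvec q)"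
  by (intro measurable_restrict borel_measurable_add borel_measurable_times coord_measurable) auto

lemma PiM_lborel_affine:
  assumes c: "c \<noteq> 0"
  shows "density (distr (PiM {..<q} (\<lambda>_. lborel)) (Rvec q) (\<lambda>z. \<lambda>j\<in>{..<q}. t j + c * z j)) (\<lambda>_. ennreal (\<bar>c\<bar> ^ q))
    = PiM {..<q} (\<lambda>_. lborel :: real measure)"
proof (rule lborel_psf.PiM_eqI)
  fix A :: "nat \<Rightarrow> real set" assume A: "\<And>i. i \<in> {..<q} \<Longrightarrow> A i \<in> sets lborel"
  let ?T = "\<lambda>z. \<lambda>j\<in>{..<q}. t j + c * z j"
  have box: "Pi\<^sub>E {..<q} A \<in> sets (Rvec q)" using A by (intro sets_PiM_I_finite) auto
  have pre: "?T -` Pi\<^sub>E {..<q} A \<inter> space (PiM {..<q} (\<lambda>_. lborel :: real measure)) = Pi\<^sub>E {..<q} (\<lambda>j. (\<lambda>x. t j + c * x) -` A j)"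
    by (auto simp: space_PiM PiE_def Pi_def extensional_def)
  have one: "ennreal \<bar>c\<bar> * emeasure lborel ((\<lambda>x. t j + c * x) -` A j) = emeasure lborel (A j)" if "j < q" for j
  proof -
    have "emeasure lborel (A j) = emeasure (density (distr lborel borel (\<lambda>x. t j + c * x)) (\<lambda>_. ennreal \<bar>c\<bar>)) (A j)"
      using lborel_real_affine[OF c, of "t j"] by simp
    also have "\<dots> = ennreal \<bar>c\<bar> * emeasure lborel ((\<lambda>x. t j + c * x) -` A j)"
      using A[of j] that by (subst emeasure_density_const) (auto simp: emeasure_distr)
    finally show ?thesis by simp
  qed
  have "emeasure (density (distr (PiM {..<q} (\<lambda>_. lborel)) (Rvec q) ?T) (\<lambda>_. ennreal (\<bar>c\<bar> ^ q))) (Pi\<^sub>E {..<q} A)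
     = ennreal (\<bar>c\<bar> ^ q) * emeasure (PiM {..<q} (\<lambda>_. lborel)) (Pi\<^sub>E {..<q} (\<lambda>j. (\<lambda>x. t j + c * x) -` A j))"
    using box by (subst emeasure_density_const) (auto simp: emeasure_distr pre)
  also have "\<dots> = ennreal \<bar>c\<bar> ^ q * (\<Prod>j<q. emeasure lborel ((\<lambda>x. t j + c * x) -` A j))"
  proof (subst lborel_psf.emeasure_PiM)
    fix j assume "j \<in> {..<q}"
    then have [measurable]: "A j \<in> sets borel" using A by simp
    show "(\<lambda>x. t j + c * x) -` A j \<in> sets lborel"
      using measurable_sets[of "\<lambda>x. t j + c * x" borel borel "A j"] by simp
  qed (simp_all add: ennreal_power)
  also have "\<dots> = (\<Prod>j<q. ennreal \<bar>c\<bar> * emeasure lborel ((\<lambda>x. t j + c * x) -` A j))"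
    by (simp add: prod.distrib)
  also have "\<dots> = (\<Prod>j<q. emeasure lborel (A j))" by (intro prod.cong one) auto
  finally show "emeasure (density (distr (PiM {..<q} (\<lambda>_. lborel)) (Rvec q) ?T) (\<lambda>_. ennreal (\<bar>c\<bar> ^ q))) (Pi\<^sub>E {..<q} A)
     = (\<Prod>i\<in>{..<q}. emeasure lborel (A i))" by simp
qed (simp_all only: sets_density sets_distr sets_PiM_lborel sets_gauss[unfolded gauss_def] finite_lessThan)

lemma nn_integral_PiM_lborel_affine:
  assumes c: "c \<noteq> 0" and [measurable]: "f \<in> borel_measurable (Rvec q)"
  shows "(\<integral>\<^sup>+z. f z \<partial>PiM {..<q} (\<lambda>_. lborel))
    = ennreal (\<bar>c\<bar> ^ q) * (\<integral>\<^sup>+z. f (\<lambda>j\<in>{..<q}. t j + c * z j) \<partial>PiM {..<q} (\<lambda>_. lborel))"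
  by (subst PiM_lborel_affine[OF c, of q t, symmetric])
     (simp add: nn_integral_density nn_integral_distr nn_integral_cmult)

lemma prod_std_normal_density:
  "(\<Prod>j<q. std_normal_density (z j)) = (1 / sqrt (2 * pi)) ^ q * exp (- (vnorm q z)\<^sup>2 / 2)"
  unfolding vnorm_sq_sum normal_density_def
  by (simp add: prod.distrib exp_sum[symmetric] sum_negf[symmetric] sum_divide_distrib power_divide prod_dividef)

lemma gauss_density:
  "gauss q = density (PiM {..<q} (\<lambda>_. lborel)) (\<lambda>z. ennreal (\<Prod>j<q. std_normal_density (z j)))"
  unfolding gauss_def
proof (rule stdn_prod.PiM_eqI[symmetric])
  fix A :: "nat \<Rightarrow> real set" assume A: "\<And>i. i \<in> {..<q} \<Longrightarrow> A i \<in> sets stdn"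
  have box: "Pi\<^sub>E {..<q} A \<in> sets (PiM {..<q} (\<lambda>_. lborel))" using A by (intro sets_PiM_I_finite) auto
  have m: "(\<lambda>z. ennreal (\<Prod>j<q. std_normal_density (z j))) \<in> borel_measurable (PiM {..<q} (\<lambda>_. lborel))"
  proof (intro measurable_compose[OF _ measurable_ennreal] borel_measurable_prod)
    fix j assume "j \<in> {..<q}"
    then have "(\<lambda>z. z j) \<in> measurable (PiM {..<q} (\<lambda>_. lborel)) (lborel :: real measure)"
      by (rule measurable_component_singleton)
    then show "(\<lambda>z. std_normal_density (z j)) \<in> borel_measurable (PiM {..<q} (\<lambda>_. lborel))"
      by (rule measurable_compose) simp
  qed
  have "emeasure (density (PiM {..<q} (\<lambda>_. lborel)) (\<lambda>z. ennreal (\<Prod>j<q. std_normal_density (z j)))) (Pi\<^sub>E {..<q} A)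
      = (\<integral>\<^sup>+z. ennreal (\<Prod>j<q. std_normal_density (z j)) * indicator (Pi\<^sub>E {..<q} A) z \<partial>PiM {..<q} (\<lambda>_. lborel))"
    using m box by (rule emeasure_density)
  also have "\<dots> = (\<integral>\<^sup>+z. (\<Prod>j<q. ennreal (std_normal_density (z j)) * indicator (A j) (z j)) \<partial>PiM {..<q} (\<lambda>_. lborel))"
  proof (rule nn_integral_cong)
    fix z :: "nat \<Rightarrow> real" assume z: "z \<in> space (PiM {..<q} (\<lambda>_. lborel))"
    have "indicator (Pi\<^sub>E {..<q} A) z = (\<Prod>j<q. indicator (A j) (z j) :: ennreal)"
    proof (cases "\<forall>j<q. z j \<in> A j")
      case True
      then show ?thesis using z by (auto simp: indicator_def space_PiM PiE_def Pi_def)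
    next
      case False
      then obtain j where "j < q" "z j \<notin> A j" by auto
      then have "(\<Prod>j<q. indicator (A j) (z j) :: ennreal) = 0" by (intro prod_zero) (auto simp: indicator_def)
      then show ?thesis using \<open>j < q\<close> \<open>z j \<notin> A j\<close> by (auto simp: indicator_def PiE_def Pi_def)
    qed
    then show "ennreal (\<Prod>j<q. std_normal_density (z j)) * indicator (Pi\<^sub>E {..<q} A) z
      = (\<Prod>j<q. ennreal (std_normal_density (z j)) * indicator (A j) (z j))"
      by (simp add: prod.distrib prod_ennreal)
  qed
  also have "\<dots> = (\<Prod>j<q. \<integral>\<^sup>+x. ennreal (std_normal_density x) * indicator (A j) x \<partial>lborel)"
    using A by (intro lborel_psf.product_nn_integral_prod) auto
  also have "\<dots> = (\<Prod>j<q. emeasure stdn (A j))"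
    using A by (intro prod.cong refl) (auto simp: emeasure_density)
  finally show "emeasure (density (PiM {..<q} (\<lambda>_. lborel)) (\<lambda>z. ennreal (\<Prod>j<q. std_normal_density (z j)))) (Pi\<^sub>E {..<q} A)
      = (\<Prod>i\<in>{..<q}. emeasure stdn (A i))" .
qed (simp_all only: sets_density sets_distr sets_PiM_lborel sets_gauss[unfolded gauss_def] finite_lessThan)

lemma nn_integral_gauss:
  assumes [measurable]: "f \<in> borel_measurable (Rvec q)"
  shows "(\<integral>\<^sup>+z. f z \<partial>gauss q) = ennreal ((1 / sqrt (2 * pi)) ^ q) *
     (\<integral>\<^sup>+z. ennreal (exp (- (vnorm q z)\<^sup>2 / 2)) * f z \<partial>PiM {..<q} (\<lambda>_. lborel))"
  unfolding gauss_density prod_std_normal_density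
  by (subst nn_integral_density) (auto simp: ennreal_mult mult.assoc nn_integral_cmult)

text \<open>The Cameron-Martin formula, from |v + z|^2 = |v|^2 + 2 <v, z> + |z|^2. It gives the
  price of shifting a Gaussian direction towards a prescribed v.\<close>

lemma gauss_shift:
  assumes [measurable]: "f \<in> borel_measurable (Rvec q)"
  shows "(\<integral>\<^sup>+z. f z \<partial>gauss q)
    = (\<integral>\<^sup>+z. ennreal (exp (- ip q v z - (vnorm q v)\<^sup>2 / 2)) * f (\<lambda>j\<in>{..<q}. v j + z j) \<partial>gauss q)"
proof -
  let ?T = "\<lambda>z. \<lambda>j\<in>{..<q}. v j + z j"
  have T[measurable]: "?T \<in> measurable (Rvec q) (Rvec q)" using restrict_affine_measurable[where c = 1 and t = v and q = q] by simp
  have nT: "(vnorm q (?T z))\<^sup>2 = (vnorm q v)\<^sup>2 + 2 * ip q v z + (vnorm q z)\<^sup>2" for z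
  proof -
    have "vnorm q (?T z) = vnorm q (\<lambda>j. v j + z j)" by (rule vnorm_cong) simp
    then show ?thesis by (simp add: vnorm_add_sq)
  qed
  have ex: "ennreal (exp (- (vnorm q (?T z))\<^sup>2 / 2))
     = ennreal (exp (- (vnorm q z)\<^sup>2 / 2)) * ennreal (exp (- ip q v z - (vnorm q v)\<^sup>2 / 2))" for z
    unfolding nT by (simp add: exp_add[symmetric] ennreal_mult[symmetric] field_simps)
  have "(\<integral>\<^sup>+z. f z \<partial>gauss q) = ennreal ((1 / sqrt (2 * pi)) ^ q) *
     (\<integral>\<^sup>+z. ennreal (exp (- (vnorm q z)\<^sup>2 / 2)) * f z \<partial>PiM {..<q} (\<lambda>_. lborel))"
    by (rule nn_integral_gauss) measurable
  also have "(\<integral>\<^sup>+z. ennreal (exp (- (vnorm q z)\<^sup>2 / 2)) * f z \<partial>PiM {..<q} (\<lambda>_. lborel))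
    = (\<integral>\<^sup>+z. ennreal (exp (- (vnorm q (?T z))\<^sup>2 / 2)) * f (?T z) \<partial>PiM {..<q} (\<lambda>_. lborel))"
    by (subst nn_integral_PiM_lborel_affine[where c = 1 and t = v]) simp_all
  also have "\<dots> = (\<integral>\<^sup>+z. ennreal (exp (- (vnorm q z)\<^sup>2 / 2)) *
        (ennreal (exp (- ip q v z - (vnorm q v)\<^sup>2 / 2)) * f (?T z)) \<partial>PiM {..<q} (\<lambda>_. lborel))"
    by (simp only: ex mult.assoc)
  also have "ennreal ((1 / sqrt (2 * pi)) ^ q) * \<dots> =
     (\<integral>\<^sup>+z. ennreal (exp (- ip q v z - (vnorm q v)\<^sup>2 / 2)) * f (?T z) \<partial>gauss q)"
    by (subst nn_integral_gauss) simp_all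
  finally show ?thesis .
qed

lemma gauss_uminus:
  assumes [measurable]: "f \<in> borel_measurable (Rvec q)"
  shows "(\<integral>\<^sup>+z. f z \<partial>gauss q) = (\<integral>\<^sup>+z. f (\<lambda>j\<in>{..<q}. - z j) \<partial>gauss q)"
proof -
  let ?T = "\<lambda>z. \<lambda>j\<in>{..<q}. - z j"
  have T[measurable]: "?T \<in> measurable (Rvec q) (Rvec q)" using restrict_affine_measurable[where c = "-1" and t = "\<lambda>_. 0" and q = q] by simp
  have nT: "vnorm q (?T z) = vnorm q z" for z
    by (simp add: vnorm_def)
  have "(\<integral>\<^sup>+z. f z \<partial>gauss q) = ennreal ((1 / sqrt (2 * pi)) ^ q) *
     (\<integral>\<^sup>+z. ennreal (exp (- (vnorm q z)\<^sup>2 / 2)) * f z \<partial>PiM {..<q} (\<lambda>_. lborel))"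
    by (rule nn_integral_gauss) measurable
  also have "(\<integral>\<^sup>+z. ennreal (exp (- (vnorm q z)\<^sup>2 / 2)) * f z \<partial>PiM {..<q} (\<lambda>_. lborel))
    = (\<integral>\<^sup>+z. ennreal (exp (- (vnorm q z)\<^sup>2 / 2)) * f (?T z) \<partial>PiM {..<q} (\<lambda>_. lborel))"
    using nT by (subst nn_integral_PiM_lborel_affine[where c = "-1" and t = "\<lambda>_. 0"]) simp_all
  also have "ennreal ((1 / sqrt (2 * pi)) ^ q) * \<dots> = (\<integral>\<^sup>+z. f (?T z) \<partial>gauss q)"
    by (subst nn_integral_gauss) simp_all
  finally show ?thesis .
qed

lemma gauss_coord: "j < q \<Longrightarrow> distr (gauss q) borel (\<lambda>z. z j) = stdn"
  using distr_PiM_component[of "{..<q}" "\<lambda>_. stdn" j] prob_space_stdn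
  by (simp add: gauss_def cong: distr_cong)

lemma gauss_indep: "prob_space.indep_vars (gauss q) (\<lambda>_. borel) (\<lambda>j z. z j) {..<q}"
proof (cases "q = 0")
  case True
  then show ?thesis by (simp add: gauss.indep_vars_def gauss.indep_sets_def)
next
  case False
  have rv: "\<And>i. i \<in> {..<q} \<Longrightarrow> (\<lambda>z. z i) \<in> borel_measurable (gauss q)"
    using coord_measurable by (simp add: measurable_cong_sets[OF sets_gauss refl])
  have "distr (gauss q) (PiM {..<q} (\<lambda>_. borel)) (\<lambda>z. \<lambda>j\<in>{..<q}. z j) = distr (gauss q) (gauss q) (\<lambda>z. z)"
    by (rule distr_cong) (auto simp: sets_gauss space_gauss space_PiM)
  also have "\<dots> = gauss q" by simp
  also have "gauss q = PiM {..<q} (\<lambda>i. distr (gauss q) borel (\<lambda>z. z i))"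
    unfolding gauss_def by (intro PiM_cong refl) (metis gauss_coord gauss_def lessThan_iff)
  finally show ?thesis
    using prob_space.indep_vars_iff_distr_eq_PiM'[where M = "gauss q" and I = "{..<q}" and M' = "\<lambda>_. borel" and X = "\<lambda>j z. z j", OF prob_space_gauss] rv False by auto
qed

text \<open>The sum of independent normal terms runs over the coordinates with a j \<noteq> 0 only,
  because a normal density needs a positive standard deviation.\<close>

lemma gauss_ip_distributed:
  assumes a: "vnorm q a > 0"
  shows "distributed (gauss q) lborel (\<lambda>z. ip q a z) (\<lambda>x. ennreal (normal_density 0 (vnorm q a) x))"
proof -
  define I where "I = {j. j < q \<and> a j \<noteq> 0}"
  have fin: "finite I" by (simp add: I_def)
  have ne: "I \<noteq> {}" using a vnorm_zero_iff[of q a] by (auto simp: I_def)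
  have std: "distributed (gauss q) lborel (\<lambda>z. z j) (\<lambda>x. ennreal (std_normal_density x))" if "j < q" for j
    unfolding distributed_def using gauss_coord[OF that] coord_measurable[OF that]
    by (auto simp: measurable_cong_sets[OF sets_gauss refl] measurable_lborel1 cong: distr_cong)
  have sc: "distributed (gauss q) lborel (\<lambda>z. a j * z j) (\<lambda>x. ennreal (normal_density 0 \<bar>a j\<bar> x))" if "j \<in> I" for j
    using gauss.normal_density_affine[OF std, of j "a j" 0] that by (simp add: I_def)
  have iv: "prob_space.indep_vars (gauss q) (\<lambda>_. borel) (\<lambda>j z. a j * z j) I"
  proof -
    have "prob_space.indep_vars (gauss q) (\<lambda>_. borel) (\<lambda>j z. z j) I"
      by (rule gauss.indep_vars_subset[OF gauss_indep]) (auto simp: I_def)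
    then show ?thesis by (rule gauss.indep_vars_compose2[where Y = "\<lambda>j x. a j * x"]) auto
  qed
  have "distributed (gauss q) lborel (\<lambda>z. \<Sum>j\<in>I. a j * z j) (\<lambda>x. ennreal (normal_density (\<Sum>j\<in>I. 0) (sqrt (\<Sum>j\<in>I. \<bar>a j\<bar>\<^sup>2)) x))"
    by (rule gauss.sum_indep_normal[OF fin ne iv]) (use sc in \<open>auto simp: I_def\<close>)
  moreover have "(\<lambda>z. \<Sum>j\<in>I. a j * z j) = (\<lambda>z. ip q a z)"
    unfolding ip_def I_def by (intro ext sum.mono_neutral_left) auto
  moreover have "sqrt (\<Sum>j\<in>I. \<bar>a j\<bar>\<^sup>2) = vnorm q a"
    unfolding vnorm_def I_def power2_abs by (intro arg_cong[of _ _ sqrt] sum.mono_neutral_left) auto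
  ultimately show ?thesis by simp
qed

lemma gauss_ip_even_moment:
  shows "integrable (gauss q) (\<lambda>z. (ip q a z) ^ (2 * k))"
    and "k \<ge> 1 \<Longrightarrow> (\<integral>z. (ip q a z) ^ (2 * k) \<partial>gauss q) = fact (2 * k) / (2 ^ k * fact k) * (vnorm q a) ^ (2 * k)"
proof -
  have "integrable (gauss q) (\<lambda>z. (ip q a z) ^ (2 * k)) \<and>
    (k \<ge> 1 \<longrightarrow> (\<integral>z. (ip q a z) ^ (2 * k) \<partial>gauss q) = fact (2 * k) / (2 ^ k * fact k) * (vnorm q a) ^ (2 * k))"
  proof (cases "vnorm q a = 0")
    case True
    then have "ip q a z = 0" for z by (simp add: ip_def vnorm_zero_iff)
    then show ?thesis using True by (auto simp: power_0_left)
  next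
    case False
    then have a: "vnorm q a > 0" using vnorm_nonneg[of q a] by linarith
    note D = gauss_ip_distributed[OF a]
    have "integrable (gauss q) (\<lambda>z. (ip q a z) ^ (2 * k))"
      using distributed_integrable[OF D, of "\<lambda>x. x ^ (2 * k)"] integrable_normal_moment[of "vnorm q a" 0 "2 * k"] a
      by simp
    moreover have "(\<integral>z. (ip q a z) ^ (2 * k) \<partial>gauss q) = fact (2 * k) / (2 ^ k * fact k) * (vnorm q a) ^ (2 * k)"
    proof -
      have "(\<integral>z. (ip q a z) ^ (2 * k) \<partial>gauss q) = (\<integral>x. normal_density 0 (vnorm q a) x * x ^ (2 * k) \<partial>lborel)"
        using distributed_integral[OF D, of "\<lambda>x. x ^ (2 * k)"] by simp
      also have "\<dots> = fact (2 * k) / ((2 / (vnorm q a)\<^sup>2) ^ k * fact k)"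
        using integral_normal_moment_even[of "vnorm q a" 0 k] a by simp
      finally show ?thesis using a by (simp add: power_divide power_mult)
    qed
    ultimately show ?thesis by blast
  qed
  then show "integrable (gauss q) (\<lambda>z. (ip q a z) ^ (2 * k))"
    and "k \<ge> 1 \<Longrightarrow> (\<integral>z. (ip q a z) ^ (2 * k) \<partial>gauss q) = fact (2 * k) / (2 ^ k * fact k) * (vnorm q a) ^ (2 * k)"
    by auto
qed

lemma gauss_ip_sq:
  "integrable (gauss q) (\<lambda>z. (ip q a z)\<^sup>2)" "(\<integral>z. (ip q a z)\<^sup>2 \<partial>gauss q) = (vnorm q a)\<^sup>2"
  using gauss_ip_even_moment[where k = 1 and q = q and a = a] by (simp_all add: fact_numeral)

lemma gauss_ip_4:
  "integrable (gauss q) (\<lambda>z. (ip q a z)^4)" "(\<integral>z. (ip q a z)^4 \<partial>gauss q) = 3 * (vnorm q a)^4"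
  using gauss_ip_even_moment[where k = 2 and q = q and a = a] by (simp_all add: fact_numeral)

text \<open>Up to the factor 1 / sqrt c, the tilted density is again a centred normal density, of
  variance \<sigma>^2 / c with c = 1 - 2 s \<sigma>^2.\<close>

lemma gauss_ip_exp_sq:
  assumes s: "2 * s * (vnorm q a)\<^sup>2 < 1"
  shows "(\<integral>\<^sup>+z. ennreal (exp (s * (ip q a z)\<^sup>2)) \<partial>gauss q) = ennreal (1 / sqrt (1 - 2 * s * (vnorm q a)\<^sup>2))"
proof (cases "vnorm q a = 0")
  case True
  then have "ip q a z = 0" for z by (simp add: ip_def vnorm_zero_iff)
  then show ?thesis using True by (simp add: gauss.emeasure_space_1)
next
  case False
  define \<sigma> where "\<sigma> = vnorm q a"
  have \<sigma>: "\<sigma> > 0" using False vnorm_nonneg[of q a] by (simp add: \<sigma>_def less_le)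
  define c where "c = 1 - 2 * s * \<sigma>\<^sup>2"
  have c: "c > 0" using s by (simp add: c_def \<sigma>_def)
  have dens: "normal_density 0 \<sigma> x * exp (s * x\<^sup>2) = 1 / sqrt c * normal_density 0 (\<sigma> / sqrt c) x" for x
  proof -
    have e: "exp (- x\<^sup>2 / (2 * \<sigma>\<^sup>2)) * exp (s * x\<^sup>2) = exp (- x\<^sup>2 / (2 * (\<sigma> / sqrt c)\<^sup>2))"
      using \<sigma> c by (simp add: exp_add[symmetric] power_divide c_def field_simps)
    have "normal_density 0 \<sigma> x * exp (s * x\<^sup>2) = 1 / sqrt (2 * pi * \<sigma>\<^sup>2) * (exp (- x\<^sup>2 / (2 * \<sigma>\<^sup>2)) * exp (s * x\<^sup>2))"
      by (simp add: normal_density_def)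
    also have "\<dots> = 1 / sqrt c * normal_density 0 (\<sigma> / sqrt c) x"
      unfolding e using \<sigma> c by (simp add: normal_density_def real_sqrt_mult real_sqrt_divide power_divide)
    finally show ?thesis .
  qed
  have "(\<integral>\<^sup>+z. ennreal (exp (s * (ip q a z)\<^sup>2)) \<partial>gauss q)
      = (\<integral>\<^sup>+x. ennreal (normal_density 0 \<sigma> x) * ennreal (exp (s * x\<^sup>2)) \<partial>lborel)"
    using distributed_nn_integral[OF gauss_ip_distributed, of q a "\<lambda>x. ennreal (exp (s * x\<^sup>2))"] \<sigma>
    by (simp add: \<sigma>_def)
  also have "\<dots> = (\<integral>\<^sup>+x. ennreal (1 / sqrt c) * ennreal (normal_density 0 (\<sigma> / sqrt c) x) \<partial>lborel)"
    using c by (simp add: ennreal_mult[symmetric] dens)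
  also have "\<dots> = ennreal (1 / sqrt c) * (\<integral>\<^sup>+x. ennreal (normal_density 0 (\<sigma> / sqrt c) x) \<partial>lborel)"
    by (rule nn_integral_cmult) simp
  also have "(\<integral>\<^sup>+x. ennreal (normal_density 0 (\<sigma> / sqrt c) x) \<partial>lborel) = 1"
    using prob_space.emeasure_space_1[OF prob_space_normal_density[of "\<sigma> / sqrt c" 0]] \<sigma> c
    by (simp add: emeasure_density)
  finally show ?thesis by (simp add: c_def \<sigma>_def)
qed

text \<open>Polarisation: (a + b)^4 + (a - b)^4 - 2 a^4 - 2 b^4 = 12 a^2 b^2 reduces the mixed
  moment to fourth moments of single linear forms.\<close>

lemma gauss_ip_sq_ip_sq:
  "integrable (gauss q) (\<lambda>z. (ip q a z)\<^sup>2 * (ip q b z)\<^sup>2)"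
  "(\<integral>z. (ip q a z)\<^sup>2 * (ip q b z)\<^sup>2 \<partial>gauss q) = (vnorm q a)\<^sup>2 * (vnorm q b)\<^sup>2 + 2 * (ip q a b)\<^sup>2"
proof -
  have pol: "(ip q a z)\<^sup>2 * (ip q b z)\<^sup>2 =
    ((ip q (\<lambda>j. a j + b j) z)^4 + (ip q (\<lambda>j. a j - b j) z)^4 - 2 * (ip q a z)^4 - 2 * (ip q b z)^4) / 12" for z
    unfolding ip_add_left ip_diff_left by (simp add: field_simps power2_eq_square power4_eq_xxxx)
  show "integrable (gauss q) (\<lambda>z. (ip q a z)\<^sup>2 * (ip q b z)\<^sup>2)"
    unfolding pol by (intro integrable_divide Bochner_Integration.integrable_diff Bochner_Integration.integrable_add integrable_mult_right gauss_ip_4)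
  have "(\<integral>z. (ip q a z)\<^sup>2 * (ip q b z)\<^sup>2 \<partial>gauss q) =
    (3 * (vnorm q (\<lambda>j. a j + b j))^4 + 3 * (vnorm q (\<lambda>j. a j - b j))^4 - 2 * (3 * (vnorm q a)^4) - 2 * (3 * (vnorm q b)^4)) / 12"
    unfolding pol using gauss_ip_4 by simp
  also have "\<dots> = (3 * ((vnorm q (\<lambda>j. a j + b j))\<^sup>2)\<^sup>2 + 3 * ((vnorm q (\<lambda>j. a j - b j))\<^sup>2)\<^sup>2 - 6 * (vnorm q a)^4 - 6 * (vnorm q b)^4) / 12"
    by simp
  also have "\<dots> = (vnorm q a)\<^sup>2 * (vnorm q b)\<^sup>2 + 2 * (ip q a b)\<^sup>2"
    unfolding vnorm_add_sq vnorm_diff_sq by (simp add: field_simps power2_eq_square power4_eq_xxxx)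
  finally show "(\<integral>z. (ip q a z)\<^sup>2 * (ip q b z)\<^sup>2 \<partial>gauss q) = (vnorm q a)\<^sup>2 * (vnorm q b)\<^sup>2 + 2 * (ip q a b)\<^sup>2" .
qed

definition mv :: "nat \<Rightarrow> (nat \<Rightarrow> nat \<Rightarrow> real) \<Rightarrow> (nat \<Rightarrow> real) \<Rightarrow> nat \<Rightarrow> real" where
  "mv q A z = (\<lambda>i. ip q (A i) z)"

definition adj :: "nat \<Rightarrow> (nat \<Rightarrow> nat \<Rightarrow> real) \<Rightarrow> (nat \<Rightarrow> real) \<Rightarrow> nat \<Rightarrow> real" where
  "adj d A v = (\<lambda>k. \<Sum>i<d. A i k * v i)"

text \<open>The squared Frobenius norm, that is tr (A A') and the mean of |A z|^2.\<close>

definition frob :: "nat \<Rightarrow> nat \<Rightarrow> (nat \<Rightarrow> nat \<Rightarrow> real) \<Rightarrow> real" where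
  "frob d q A = (\<Sum>i<d. (vnorm q (A i))\<^sup>2)"

lemma ip_mv_adj: "ip d v (mv q A z) = ip q (adj d A v) z"
proof -
  have "ip d v (mv q A z) = (\<Sum>i<d. \<Sum>k<q. v i * A i k * z k)"
    by (simp add: ip_def mv_def sum_distrib_left mult.assoc)
  also have "\<dots> = (\<Sum>k<q. \<Sum>i<d. v i * A i k * z k)" by (rule sum.swap)
  finally show ?thesis by (simp add: ip_def adj_def sum_distrib_left sum_distrib_right mult_ac)
qed

lemma mv_measurable: "(\<lambda>z. mv q A z i) \<in> borel_measurable (Rvec q)"
  by (simp add: mv_def)

lemma vnorm_mv_measurable [measurable]: "(\<lambda>z. vnorm d (mv q A z)) \<in> borel_measurable (Rvec q)"
  unfolding vnorm_def by (intro measurable_compose[OF _ borel_measurable_sqrt] borel_measurable_sum borel_measurable_power mv_measurable)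

lemma frob_nonneg: "0 \<le> frob d q A"
  by (simp add: frob_def sum_nonneg)

subsection \<open>Small ball and lower tail of the norm of a Gaussian vector\<close>

lemma gauss_mv_sq:
  "integrable (gauss q) (\<lambda>z. (vnorm d (mv q A z))\<^sup>2)" "(\<integral>z. (vnorm d (mv q A z))\<^sup>2 \<partial>gauss q) = frob d q A"
  unfolding vnorm_sq_sum[of d] mv_def frob_def using gauss_ip_sq by simp_all

text \<open>With the weights |A i|^2 / \<open>frob d q A\<close> the exponent is a convex
  combination of normalised squares of single Gaussian variables, so convexity of exp reduces the
  claim to dimension one. The bound does not depend on the shape of A.\<close>

lemma gauss_mv_laplace:
  assumes s: "s \<ge> 0" and f: "frob d q A > 0"
  shows "(\<integral>\<^sup>+z. ennreal (exp (- s * (vnorm d (mv q A z))\<^sup>2 / frob d q A)) \<partial>gauss q) \<le> ennreal (1 / sqrt (1 + 2 * s))"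
proof -
  let ?w = "\<lambda>i. (vnorm q (A i))\<^sup>2 / frob d q A"
  let ?y = "\<lambda>i z. - s * (ip q (A i) z)\<^sup>2 / (vnorm q (A i))\<^sup>2"
  have w: "(\<Sum>i<d. ?w i) = 1" "\<And>i. 0 \<le> ?w i" using f by (auto simp: frob_def sum_divide_distrib[symmetric])
  have pw: "exp (- s * (vnorm d (mv q A z))\<^sup>2 / frob d q A) \<le> (\<Sum>i<d. ?w i * exp (?y i z))" for z
  proof -
    have e: "- s * (vnorm d (mv q A z))\<^sup>2 / frob d q A = (\<Sum>i<d. ?w i *\<^sub>R ?y i z)"
    proof -
      have "?w i * ?y i z = - s * (ip q (A i) z)\<^sup>2 / frob d q A" for i
      proof (cases "vnorm q (A i) = 0")
        case True
        then have "ip q (A i) z = 0" by (simp add: ip_def vnorm_zero_iff)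
        then show ?thesis using True by simp
      qed simp
      then show ?thesis
        by (simp add: vnorm_sq_sum mv_def sum_divide_distrib sum_distrib_left sum_negf)
    qed
    show ?thesis unfolding e
      using convex_on_sum[OF _ _ convex_on_exp[of 1], of "{..<d}" ?w "\<lambda>i. ?y i z"] w f
      by (cases "d = 0") (auto simp: frob_def)
  qed
  have one: "(\<integral>\<^sup>+z. ennreal (?w i * exp (?y i z)) \<partial>gauss q) \<le> ennreal (?w i * (1 / sqrt (1 + 2 * s)))" for i
  proof (cases "vnorm q (A i) = 0")
    case False
    have "ennreal (?w i * exp (?y i z)) = ennreal (?w i) * ennreal (exp ((- s / (vnorm q (A i))\<^sup>2) * (ip q (A i) z)\<^sup>2))" for z
      using w(2)[of i] by (subst ennreal_mult[symmetric]) auto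
    then have "(\<integral>\<^sup>+z. ennreal (?w i * exp (?y i z)) \<partial>gauss q) = (\<integral>\<^sup>+z. ennreal (?w i) * ennreal (exp ((- s / (vnorm q (A i))\<^sup>2) * (ip q (A i) z)\<^sup>2)) \<partial>gauss q)"
      by (intro nn_integral_cong) blast
    also have "\<dots> = ennreal (?w i) * (\<integral>\<^sup>+z. ennreal (exp ((- s / (vnorm q (A i))\<^sup>2) * (ip q (A i) z)\<^sup>2)) \<partial>gauss q)"
      by (intro nn_integral_cmult) measurable
    also have "\<dots> = ennreal (?w i) * ennreal (1 / sqrt (1 + 2 * s))"
      using s False by (subst gauss_ip_exp_sq) auto
    also have "\<dots> = ennreal (?w i * (1 / sqrt (1 + 2 * s)))"
      using w(2)[of i] s by (intro ennreal_mult[symmetric]) auto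
    finally show ?thesis by simp
  qed simp
  have "(\<integral>\<^sup>+z. ennreal (exp (- s * (vnorm d (mv q A z))\<^sup>2 / frob d q A)) \<partial>gauss q)
      \<le> (\<integral>\<^sup>+z. (\<Sum>i<d. ennreal (?w i * exp (?y i z))) \<partial>gauss q)"
  proof (rule nn_integral_mono)
    fix z
    have "ennreal (exp (- s * (vnorm d (mv q A z))\<^sup>2 / frob d q A)) \<le> ennreal (\<Sum>i<d. ?w i * exp (?y i z))"
      by (rule ennreal_leI[OF pw])
    also have "\<dots> = (\<Sum>i<d. ennreal (?w i * exp (?y i z)))"
      by (rule sum_ennreal[symmetric], rule mult_nonneg_nonneg[OF w(2)]) simp
    finally show "ennreal (exp (- s * (vnorm d (mv q A z))\<^sup>2 / frob d q A)) \<le> (\<Sum>i<d. ennreal (?w i * exp (?y i z)))" .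
  qed
  also have "\<dots> = (\<Sum>i<d. \<integral>\<^sup>+z. ennreal (?w i * exp (?y i z)) \<partial>gauss q)"
    by (intro nn_integral_sum) measurable
  also have "\<dots> \<le> (\<Sum>i<d. ennreal (?w i * (1 / sqrt (1 + 2 * s))))" by (intro sum_mono one)
  also have "\<dots> = ennreal (\<Sum>i<d. ?w i * (1 / sqrt (1 + 2 * s)))"
    by (rule sum_ennreal, rule mult_nonneg_nonneg[OF w(2)]) (use s in simp)
  also have "(\<Sum>i<d. ?w i * (1 / sqrt (1 + 2 * s))) = 1 / sqrt (1 + 2 * s)"
    unfolding sum_distrib_right[symmetric] w by simp
  finally show ?thesis .
qed

text \<open>Markov's inequality for the Laplace transform at s = 1 / \<epsilon>; the constant comes
  from e / sqrt 2 < 2.\<close>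

lemma gauss_small_ball:
  assumes e: "\<epsilon> > 0" and f: "frob d q A > 0"
  shows "measure (gauss q) {z\<in>space (gauss q). (vnorm d (mv q A z))\<^sup>2 \<le> \<epsilon> * frob d q A} \<le> 2 * sqrt \<epsilon>"
proof -
  let ?S = "{z\<in>space (gauss q). (vnorm d (mv q A z))\<^sup>2 \<le> \<epsilon> * frob d q A}"
  let ?g = "\<lambda>z. ennreal (exp (- (1 / \<epsilon>) * (vnorm d (mv q A z))\<^sup>2 / frob d q A))"
  have "emeasure (gauss q) ?S \<le> (\<integral>\<^sup>+z. ennreal (exp 1) * ?g z \<partial>gauss q)"
  proof -
    have [measurable]: "?S \<in> sets (gauss q)" by measurable
    have "emeasure (gauss q) ?S = (\<integral>\<^sup>+z. indicator ?S z \<partial>gauss q)" by simp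
    also have "\<dots> \<le> (\<integral>\<^sup>+z. ennreal (exp 1) * ?g z \<partial>gauss q)"
    proof (rule nn_integral_mono)
      fix z
      have "1 \<le> ennreal (exp 1) * ?g z" if "z \<in> ?S"
      proof -
        have "1 + (- (1 / \<epsilon>) * (vnorm d (mv q A z))\<^sup>2 / frob d q A) \<ge> 0"
          using that e f by (simp add: field_simps)
        then have "1 \<le> exp (1 + (- (1 / \<epsilon>) * (vnorm d (mv q A z))\<^sup>2 / frob d q A))" by simp
        then show ?thesis by (simp only: exp_add ennreal_mult[symmetric] exp_ge_zero) (simp flip: ennreal_1 add: ennreal_leI)
      qed
      then show "indicator ?S z \<le> ennreal (exp 1) * ?g z" by (auto simp: indicator_def)
    qed
    finally show ?thesis .
  qed
  also have "\<dots> = ennreal (exp 1) * (\<integral>\<^sup>+z. ?g z \<partial>gauss q)" by (intro nn_integral_cmult) measurable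
  also have "\<dots> \<le> ennreal (exp 1) * ennreal (1 / sqrt (1 + 2 * (1 / \<epsilon>)))"
    using e by (intro mult_left_mono gauss_mv_laplace f) auto
  also have "\<dots> = ennreal (exp 1 / sqrt (1 + 2 / \<epsilon>))"
    using e by (subst ennreal_mult[symmetric]) auto
  also have "\<dots> \<le> ennreal (2 * sqrt \<epsilon>)"
  proof (rule ennreal_leI)
    have "exp (1::real) * exp 1 \<le> (272 / 100) * (272 / 100)" using e_less_272 by (intro mult_mono) auto
    then have "exp 1 / sqrt 2 \<le> (2::real)"
      using real_le_rsqrt[of "exp 1 / 2" 2] by (simp add: divide_le_eq power2_eq_square)
    have "sqrt (2 / \<epsilon>) \<le> sqrt (1 + 2 / \<epsilon>)" by simp
    then have "exp 1 / sqrt (1 + 2 / \<epsilon>) \<le> exp 1 / sqrt (2 / \<epsilon>)"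
      using e by (intro divide_left_mono) (auto simp: add_pos_pos)
    also have "\<dots> = exp 1 / sqrt 2 * sqrt \<epsilon>" by (simp add: real_sqrt_divide)
    also have "\<dots> \<le> 2 * sqrt \<epsilon>" using \<open>exp 1 / sqrt 2 \<le> 2\<close> by (intro mult_right_mono) (use e in auto)
    finally show "exp 1 / sqrt (1 + 2 / \<epsilon>) \<le> 2 * sqrt \<epsilon>" .
  qed
  finally show ?thesis using e by (simp add: gauss.emeasure_eq_measure)
qed

text \<open>E (x g x) = E (g' x) for g x = (m x + b) E x. Minus the normal density times g is an
  antiderivative of the difference times the density, and it vanishes at both ends.\<close>

lemma stdn_integration_by_parts:
  fixes m b c s :: real
  assumes s: "s \<ge> 0" and m: "m \<ge> 0" and nn: "\<And>x. 0 \<le> m * x\<^sup>2 + 2 * b * x + c"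
  defines "E \<equiv> \<lambda>x. exp (- s * (m * x\<^sup>2 + 2 * b * x + c))"
  shows "(\<integral>x. x * ((m * x + b) * E x) \<partial>stdn) = (\<integral>x. m * E x - 2 * s * (m * x + b)\<^sup>2 * E x \<partial>stdn)"
proof -
  have E: "0 \<le> E x" "E x \<le> 1" for x using s nn[of x] by (auto simp: E_def)
  have [measurable]: "E \<in> borel_measurable borel" unfolding E_def by measurable
  have i2: "integrable stdn (\<lambda>x. x\<^sup>2)"
    using integrable_std_normal_moment[of 2] by (subst integrable_density) auto
  have i1: "integrable stdn (\<lambda>x. 1 + x\<^sup>2)" using i2 by simp
  have bnd1: "\<bar>x * ((m * x + b) * E x)\<bar> \<le> (m + \<bar>b\<bar>) * (1 + x\<^sup>2)" for x
  proof -
    have "\<bar>x\<bar> \<le> 1 + x\<^sup>2" using sum_squares_bound[of "\<bar>x\<bar>" 1] by (simp add: abs_le_iff) (smt (verit) zero_le_power2 power2_abs)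
    then have "\<bar>b * x\<bar> \<le> \<bar>b\<bar> * (1 + x\<^sup>2)" unfolding abs_mult by (intro mult_left_mono) auto
    moreover have "m * x\<^sup>2 \<le> m * (1 + x\<^sup>2)" using m by (intro mult_left_mono) auto
    moreover have "\<bar>x * (m * x + b)\<bar> \<le> m * x\<^sup>2 + \<bar>b * x\<bar>"
      using m abs_triangle_ineq[of "m * x\<^sup>2" "b * x"] by (simp add: algebra_simps power2_eq_square abs_mult)
    ultimately have "\<bar>x * (m * x + b)\<bar> \<le> (m + \<bar>b\<bar>) * (1 + x\<^sup>2)" by (simp add: algebra_simps)
    moreover have "\<bar>x * ((m * x + b) * E x)\<bar> \<le> \<bar>x * (m * x + b)\<bar> * 1"
      unfolding mult.assoc[symmetric] abs_mult[of _ "E x"] using E[of x] by (intro mult_left_mono) auto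
    ultimately show ?thesis by simp
  qed
  have int1: "integrable stdn (\<lambda>x. x * ((m * x + b) * E x))"
    by (rule Bochner_Integration.integrable_bound[OF integrable_mult_right[OF i1, of "m + \<bar>b\<bar>"]])
       (use bnd1 m in \<open>auto intro!: AE_I2 simp: abs_mult\<close>)
  have bnd2: "\<bar>m * E x - 2 * s * (m * x + b)\<^sup>2 * E x\<bar> \<le> (m + 4 * s * (m\<^sup>2 + b\<^sup>2)) * (1 + x\<^sup>2)" for x
  proof -
    have "(m * x + b)\<^sup>2 \<le> 2 * m\<^sup>2 * x\<^sup>2 + 2 * b\<^sup>2"
      using zero_le_power2[of "m * x - b"] by (simp add: power2_eq_square algebra_simps)
    also have "\<dots> \<le> 2 * (m\<^sup>2 + b\<^sup>2) * (1 + x\<^sup>2)" by (simp add: algebra_simps)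
    finally have "2 * s * (m * x + b)\<^sup>2 \<le> 2 * s * (2 * (m\<^sup>2 + b\<^sup>2) * (1 + x\<^sup>2))" using s by (intro mult_left_mono) auto
    moreover have "m \<le> m * (1 + x\<^sup>2)" using m by (simp add: algebra_simps)
    ultimately have 1: "m + 2 * s * (m * x + b)\<^sup>2 \<le> (m + 4 * s * (m\<^sup>2 + b\<^sup>2)) * (1 + x\<^sup>2)" by (simp add: algebra_simps)
    have "\<bar>m * E x - 2 * s * (m * x + b)\<^sup>2 * E x\<bar> = \<bar>m - 2 * s * (m * x + b)\<^sup>2\<bar> * E x"
      using E[of x] by (simp add: abs_mult left_diff_distrib[symmetric])
    also have "\<dots> \<le> \<bar>m - 2 * s * (m * x + b)\<^sup>2\<bar> * 1" using E[of x] by (intro mult_left_mono) auto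
    also have "\<dots> \<le> m + 2 * s * (m * x + b)\<^sup>2" using m s by (simp add: abs_le_iff)
    finally show ?thesis using 1 by linarith
  qed
  have int2: "integrable stdn (\<lambda>x. m * E x - 2 * s * (m * x + b)\<^sup>2 * E x)"
    by (rule Bochner_Integration.integrable_bound[OF integrable_mult_right[OF i1, of "m + 4 * s * (m\<^sup>2 + b\<^sup>2)"]])
       (use bnd2 m s in \<open>auto intro!: AE_I2 simp: abs_mult\<close>)
  let ?\<phi> = std_normal_density
  define F where "F = (\<lambda>x. - ?\<phi> x * ((m * x + b) * E x))"
  define f where "f = (\<lambda>x. ?\<phi> x * (x * ((m * x + b) * E x) - (m * E x - 2 * s * (m * x + b)\<^sup>2 * E x)))"
  have F': "(F has_real_derivative f x) (at x)" for x
  proof -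
    have d1: "(?\<phi> has_real_derivative (- x * ?\<phi> x)) (at x)"
    proof -
      have "((\<lambda>x. exp (- x\<^sup>2 / 2)) has_real_derivative (- x * exp (- x\<^sup>2 / 2))) (at x)"
        by (auto intro!: derivative_eq_intros)
      from DERIV_cmult[OF this, of "1 / sqrt (2 * pi)"] show ?thesis
        unfolding std_normal_density_def by (simp add: mult_ac)
    qed
    have d2: "(E has_real_derivative (- 2 * s * (m * x + b) * E x)) (at x)"
      unfolding E_def by (auto intro!: derivative_eq_intros simp: algebra_simps)
    have d3: "((\<lambda>x. m * x + b) has_real_derivative m) (at x)" by (auto intro!: derivative_eq_intros)
    show ?thesis unfolding F_def f_def
      by (rule DERIV_cong[OF DERIV_mult[OF DERIV_minus[OF d1] DERIV_mult[OF d3 d2]]])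
         (simp add: algebra_simps power2_eq_square)
  qed
  have contf: "isCont f x" for x
    unfolding f_def E_def std_normal_density_def by (intro continuous_intros) auto
  have intf: "integrable lborel f"
    using Bochner_Integration.integrable_diff[OF int1 int2] unfolding f_def
    by (subst (asm) integrable_density) (auto simp: mult.commute)
  have limF: "(F \<longlongrightarrow> 0) at_top" "(F \<longlongrightarrow> 0) at_bot"
  proof -
    have bF: "norm (F x) \<le> norm (?\<phi> x * (m * \<bar>x\<bar> + \<bar>b\<bar>))" for x
    proof -
      have "\<bar>m * x + b\<bar> * E x \<le> (m * \<bar>x\<bar> + \<bar>b\<bar>) * 1"
        using E[of x] m abs_triangle_ineq[of "m * x" b] by (intro mult_mono) (auto simp: abs_mult)
      then show ?thesis using E[of x] m by (simp add: F_def abs_mult mult_left_mono)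
    qed
    have "((\<lambda>x. ?\<phi> x * (m * \<bar>x\<bar> + \<bar>b\<bar>)) \<longlongrightarrow> 0) at_top" unfolding std_normal_density_def by real_asymp
    then show "(F \<longlongrightarrow> 0) at_top" by (rule Lim_null_comparison[rotated, OF tendsto_norm_zero]) (use bF in auto)
    have "((\<lambda>x. ?\<phi> x * (m * \<bar>x\<bar> + \<bar>b\<bar>)) \<longlongrightarrow> 0) at_bot" unfolding std_normal_density_def by real_asymp
    then show "(F \<longlongrightarrow> 0) at_bot" by (rule Lim_null_comparison[rotated, OF tendsto_norm_zero]) (use bF in auto)
  qed
  have "(LBINT x=-\<infinity>..\<infinity>. f x) = 0 - 0"
  proof (rule interval_integral_FTC_integrable)
    show "set_integrable lborel (einterval (-\<infinity>) \<infinity>) f" using intf by (simp add: set_integrable_def)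
    show "(F has_vector_derivative f x) (at x)" for x using F' by (simp add: has_real_derivative_iff_has_vector_derivative)
  qed (use contf limF in \<open>auto simp: ereal_tendsto_simps\<close>)
  then have "(\<integral>x. f x \<partial>lborel) = 0" by (simp add: interval_lebesgue_integral_def set_lebesgue_integral_def)
  then have "(\<integral>x. x * ((m * x + b) * E x) - (m * E x - 2 * s * (m * x + b)\<^sup>2 * E x) \<partial>stdn) = 0"
    unfolding f_def by (subst integral_density) auto
  then show ?thesis using int1 int2 by simp
qed

lemma gauss_coord_sq: "j < q \<Longrightarrow> integrable (gauss q) (\<lambda>z. (z j)\<^sup>2)"
proof -
  assume j: "j < q"
  have "ip q (\<lambda>k. if k = j then 1 else 0) z = z j" for z
    using j by (simp add: ip_def if_distrib[of "\<lambda>x. x * _"] cong: if_cong)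
  then show ?thesis using gauss_ip_sq(1)[of q "\<lambda>k. if k = j then 1 else 0"] by simp
qed

text \<open>One coordinate is integrated first. With the others fixed, |A z|^2 is a quadratic m x^2
  + 2 b x + c in that coordinate, and entry j of A'A z is half its derivative, m x + b.\<close>

lemma gauss_integration_by_parts:
  assumes s: "s \<ge> 0" and j: "j < q"
  shows "(\<integral>z. z j * (adj d A (mv q A z) j * exp (- s * (vnorm d (mv q A z))\<^sup>2)) \<partial>gauss q)
     = (\<integral>z. (\<Sum>i<d. (A i j)\<^sup>2) * exp (- s * (vnorm d (mv q A z))\<^sup>2)
          - 2 * s * (adj d A (mv q A z) j)\<^sup>2 * exp (- s * (vnorm d (mv q A z))\<^sup>2) \<partial>gauss q)"
    and "integrable (gauss q) (\<lambda>z. z j * (adj d A (mv q A z) j * exp (- s * (vnorm d (mv q A z))\<^sup>2)))"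
    and "integrable (gauss q) (\<lambda>z. (adj d A (mv q A z) j)\<^sup>2 * exp (- s * (vnorm d (mv q A z))\<^sup>2))"
    and "integrable (gauss q) (\<lambda>z. exp (- s * (vnorm d (mv q A z))\<^sup>2))"
proof -
  let ?E = "\<lambda>z. exp (- s * (vnorm d (mv q A z))\<^sup>2)"
  let ?W = "\<lambda>z. adj d A (mv q A z) j"
  have [measurable]: "(\<lambda>z. z j) \<in> borel_measurable (Rvec q)" by (rule coord_measurable[OF j])
  have W: "?W z = ip q (\<lambda>k. \<Sum>i<d. A i j * A i k) z" for z
  proof -
    have "?W z = (\<Sum>i<d. \<Sum>k<q. A i j * A i k * z k)"
      by (simp add: adj_def mv_def ip_def sum_distrib_left mult.assoc)
    also have "\<dots> = (\<Sum>k<q. \<Sum>i<d. A i j * A i k * z k)" by (rule sum.swap)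
    finally show ?thesis by (simp add: ip_def sum_distrib_right)
  qed
  have Wm[measurable]: "?W \<in> borel_measurable (Rvec q)" unfolding W by measurable
  have iW: "integrable (gauss q) (\<lambda>z. (?W z)\<^sup>2)" unfolding W by (rule gauss_ip_sq)
  have E01: "0 \<le> ?E z" "?E z \<le> 1" for z using s by auto
  show i1: "integrable (gauss q) (\<lambda>z. z j * (?W z * ?E z))"
  proof (rule Bochner_Integration.integrable_bound[OF Bochner_Integration.integrable_add[OF gauss_coord_sq[OF j] iW]])
    show "AE z in gauss q. norm (z j * (?W z * ?E z)) \<le> norm ((z j)\<^sup>2 + (?W z)\<^sup>2)"
    proof (rule AE_I2)
      fix z
      have "\<bar>z j * ?W z\<bar> \<le> (z j)\<^sup>2 + (?W z)\<^sup>2"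
        using sum_squares_bound[of "z j" "?W z"] sum_squares_bound[of "z j" "- ?W z"] by (simp add: abs_le_iff)
      moreover have "\<bar>z j * ?W z\<bar> * ?E z \<le> \<bar>z j * ?W z\<bar> * 1" by (intro mult_left_mono E01) auto
      ultimately show "norm (z j * (?W z * ?E z)) \<le> norm ((z j)\<^sup>2 + (?W z)\<^sup>2)"
        by (simp add: abs_mult mult.assoc)
    qed
  qed measurable
  show i2: "integrable (gauss q) (\<lambda>z. (?W z)\<^sup>2 * ?E z)"
  proof (rule Bochner_Integration.integrable_bound[OF iW])
    show "AE z in gauss q. norm ((?W z)\<^sup>2 * ?E z) \<le> norm ((?W z)\<^sup>2)"
    proof (rule AE_I2)
      fix z
      have "(?W z)\<^sup>2 * ?E z \<le> (?W z)\<^sup>2 * 1" by (intro mult_left_mono E01) auto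
      then show "norm ((?W z)\<^sup>2 * ?E z) \<le> norm ((?W z)\<^sup>2)" by (simp add: abs_mult)
    qed
  qed measurable
  show i3: "integrable (gauss q) ?E"
    by (rule gauss.integrable_const_bound[of _ 1]) (use E01 in \<open>auto intro!: AE_I2\<close>)
  have i4: "integrable (gauss q) (\<lambda>z. (\<Sum>i<d. (A i j)\<^sup>2) * ?E z - 2 * s * (?W z)\<^sup>2 * ?E z)"
    using i2 i3 by (auto simp: mult.assoc)
  define J where "J = {..<q} - {j}"
  have J: "finite J" "j \<notin> J" "{..<q} = insert j J" using j by (auto simp: J_def)
  define m where "m = (\<Sum>i<d. (A i j)\<^sup>2)"
  define r where "r = (\<lambda>z i. mv q A (z(j := 0)) i)"
  define b where "b = (\<lambda>z. \<Sum>i<d. A i j * r z i)"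
  define c where "c = (\<lambda>z. \<Sum>i<d. (r z i)\<^sup>2)"
  have mvu: "mv q A (z(j := x)) i = A i j * x + r z i" for z x i
  proof -
    have "mv q A (z(j := x)) i = A i j * x + (\<Sum>k\<in>J. A i k * z k)" for x
    proof -
      have "mv q A (z(j := x)) i = A i j * (z(j := x)) j + (\<Sum>k\<in>J. A i k * (z(j := x)) k)"
        using J by (simp add: mv_def ip_def)
      also have "(\<Sum>k\<in>J. A i k * (z(j := x)) k) = (\<Sum>k\<in>J. A i k * z k)"
        using J by (intro sum.cong) auto
      finally show ?thesis by (simp only: fun_upd_same)
    qed
    from this[of x] this[of 0] show ?thesis by (simp add: r_def)
  qed
  have Qu: "(vnorm d (mv q A (z(j := x))))\<^sup>2 = m * x\<^sup>2 + 2 * b z * x + c z" for z x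
    unfolding vnorm_sq_sum mvu m_def b_def c_def
    by (simp add: power2_sum sum.distrib power_mult_distrib sum_distrib_right sum_distrib_left mult_ac)
  have Wu: "adj d A (mv q A (z(j := x))) j = m * x + b z" for z x
    unfolding adj_def mvu m_def b_def
    by (simp add: algebra_simps sum.distrib sum_distrib_right power2_eq_square sum_distrib_left)
  have "(\<integral>z. z j * (?W z * ?E z) \<partial>gauss q) = (\<integral>z. (\<integral>x. (z(j := x)) j * (?W (z(j := x)) * ?E (z(j := x))) \<partial>stdn) \<partial>PiM J (\<lambda>_. stdn))"
    using i1 unfolding gauss_def J(3) by (intro stdn_prod.product_integral_insert J) auto
  also have "\<dots> = (\<integral>z. (\<integral>x. m * ?E (z(j := x)) - 2 * s * (?W (z(j := x)))\<^sup>2 * ?E (z(j := x)) \<partial>stdn) \<partial>PiM J (\<lambda>_. stdn))"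
  proof (rule Bochner_Integration.integral_cong[OF refl])
    fix z :: "nat \<Rightarrow> real"
    have nn: "0 \<le> m * x\<^sup>2 + 2 * b z * x + c z" for x unfolding Qu[symmetric] by simp
    show "(\<integral>x. (z(j := x)) j * (?W (z(j := x)) * ?E (z(j := x))) \<partial>stdn)
        = (\<integral>x. m * ?E (z(j := x)) - 2 * s * (?W (z(j := x)))\<^sup>2 * ?E (z(j := x)) \<partial>stdn)"
      unfolding Qu Wu fun_upd_same
      by (rule stdn_integration_by_parts[OF s _ nn]) (simp add: m_def sum_nonneg)
  qed
  also have "\<dots> = (\<integral>z. m * ?E z - 2 * s * (?W z)\<^sup>2 * ?E z \<partial>gauss q)"
    using i4 unfolding gauss_def J(3) m_def by (intro stdn_prod.product_integral_insert[symmetric] J) auto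
  finally show "(\<integral>z. z j * (?W z * ?E z) \<partial>gauss q)
     = (\<integral>z. (\<Sum>i<d. (A i j)\<^sup>2) * ?E z - 2 * s * (?W z)\<^sup>2 * ?E z \<partial>gauss q)" unfolding m_def .
qed

lemma mv_norm_as_adj: "(vnorm d (mv q A z))\<^sup>2 = (\<Sum>j<q. z j * adj d A (mv q A z) j)"
  using ip_mv_adj[of d "mv q A z" q A z] by (simp add: vnorm_sq ip_def mult.commute)

lemma frob_swap: "frob d q A = (\<Sum>j<q. \<Sum>i<d. (A i j)\<^sup>2)"
  unfolding frob_def vnorm_sq_sum by (rule sum.swap)

text \<open>With Q = |A z|^2, integration by parts summed over the coordinates reads E (Q e^(-s Q))
  = frob E e^(-s Q) - 2 s E (|A'A z|^2 e^(-s Q)), and |A'A z|^2 <= \<sigma> Q. This is a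
  differential inequality for the Laplace transform of Q that avoids the singular values of
  A.\<close>

lemma gauss_quadratic_tilt:
  assumes s: "s \<ge> 0" and \<sigma>: "\<And>v. (vnorm q (adj d A v))\<^sup>2 \<le> \<sigma> * (vnorm d v)\<^sup>2"
  shows "frob d q A * (\<integral>z. exp (- s * (vnorm d (mv q A z))\<^sup>2) \<partial>gauss q)
     \<le> (1 + 2 * s * \<sigma>) * (\<integral>z. (vnorm d (mv q A z))\<^sup>2 * exp (- s * (vnorm d (mv q A z))\<^sup>2) \<partial>gauss q)"
    and "integrable (gauss q) (\<lambda>z. (vnorm d (mv q A z))\<^sup>2 * exp (- s * (vnorm d (mv q A z))\<^sup>2))"
proof -
  let ?E = "\<lambda>z. exp (- s * (vnorm d (mv q A z))\<^sup>2)"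
  let ?Q = "\<lambda>z. (vnorm d (mv q A z))\<^sup>2"
  note ibp = gauss_integration_by_parts[OF s, where A = A and d = d and q = q]
  have Q: "?Q z * ?E z = (\<Sum>j<q. z j * (adj d A (mv q A z) j * ?E z))" for z
    unfolding mv_norm_as_adj[of d q A z] by (simp add: sum_distrib_right mult.assoc)
  show iQ: "integrable (gauss q) (\<lambda>z. ?Q z * ?E z)"
    unfolding Q by (intro Bochner_Integration.integrable_sum ibp) auto
  have "(\<integral>z. ?Q z * ?E z \<partial>gauss q) = (\<Sum>j<q. \<integral>z. z j * (adj d A (mv q A z) j * ?E z) \<partial>gauss q)"
    unfolding Q by (intro Bochner_Integration.integral_sum ibp) auto
  also have "\<dots> = (\<Sum>j<q. (\<Sum>i<d. (A i j)\<^sup>2) * (\<integral>z. ?E z \<partial>gauss q) - 2 * s * (\<integral>z. (adj d A (mv q A z) j)\<^sup>2 * ?E z \<partial>gauss q))"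
    by (intro sum.cong refl) (use ibp in \<open>simp add: mult.assoc\<close>)
  also have "\<dots> = frob d q A * (\<integral>z. ?E z \<partial>gauss q) - 2 * s * (\<Sum>j<q. \<integral>z. (adj d A (mv q A z) j)\<^sup>2 * ?E z \<partial>gauss q)"
    by (simp add: sum_subtractf frob_swap sum_distrib_right sum_distrib_left)
  also have "(\<Sum>j<q. \<integral>z. (adj d A (mv q A z) j)\<^sup>2 * ?E z \<partial>gauss q) = (\<integral>z. (vnorm q (adj d A (mv q A z)))\<^sup>2 * ?E z \<partial>gauss q)"
    unfolding vnorm_sq_sum[of q] sum_distrib_right by (intro Bochner_Integration.integral_sum[symmetric] ibp) auto
  finally have eq: "(\<integral>z. ?Q z * ?E z \<partial>gauss q) = frob d q A * (\<integral>z. ?E z \<partial>gauss q) - 2 * s * (\<integral>z. (vnorm q (adj d A (mv q A z)))\<^sup>2 * ?E z \<partial>gauss q)" .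
  have "(\<integral>z. (vnorm q (adj d A (mv q A z)))\<^sup>2 * ?E z \<partial>gauss q) \<le> (\<integral>z. \<sigma> * (?Q z * ?E z) \<partial>gauss q)"
  proof (rule integral_mono)
    show "integrable (gauss q) (\<lambda>z. (vnorm q (adj d A (mv q A z)))\<^sup>2 * ?E z)"
      unfolding vnorm_sq_sum[of q] sum_distrib_right by (intro Bochner_Integration.integrable_sum ibp) auto
    show "(vnorm q (adj d A (mv q A z)))\<^sup>2 * ?E z \<le> \<sigma> * (?Q z * ?E z)" for z
      unfolding mult.assoc[symmetric] by (intro mult_right_mono \<sigma>) auto
  qed (use iQ in auto)
  also have "\<dots> = \<sigma> * (\<integral>z. ?Q z * ?E z \<partial>gauss q)" by simp
  finally have "2 * s * (\<integral>z. (vnorm q (adj d A (mv q A z)))\<^sup>2 * ?E z \<partial>gauss q) \<le> 2 * s * (\<sigma> * (\<integral>z. ?Q z * ?E z \<partial>gauss q))"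
    using s by (intro mult_left_mono) auto
  with eq show "frob d q A * (\<integral>z. ?E z \<partial>gauss q) \<le> (1 + 2 * s * \<sigma>) * (\<integral>z. ?Q z * ?E z \<partial>gauss q)"
    by (simp add: algebra_simps)
qed

text \<open>That differential inequality is integrated by an Euler scheme: by convexity of exp each
  of N equal steps gains a factor 1 + s \<kappa> / N, and N tends to infinity. No derivative of an
  integral is taken.\<close>

lemma gauss_quadratic_laplace:
  assumes s: "s \<ge> 0" and \<sigma>: "\<And>v. (vnorm q (adj d A v))\<^sup>2 \<le> \<sigma> * (vnorm d v)\<^sup>2" and \<sigma>0: "\<sigma> \<ge> 0"
  shows "(\<integral>z. exp (- s * (vnorm d (mv q A z))\<^sup>2) \<partial>gauss q) \<le> exp (- s * (frob d q A / (1 + 2 * s * \<sigma>)))"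
proof -
  let ?Q = "\<lambda>z. (vnorm d (mv q A z))\<^sup>2"
  define \<psi> where "\<psi> = (\<lambda>s. \<integral>z. exp (- s * ?Q z) \<partial>gauss q)"
  define \<kappa> where "\<kappa> = frob d q A / (1 + 2 * s * \<sigma>)"
  have \<kappa>0: "\<kappa> \<ge> 0" using s \<sigma>0 frob_nonneg[of d q A] by (simp add: \<kappa>_def)
  have iE: "integrable (gauss q) (\<lambda>z. exp (- t * ?Q z))" if "t \<ge> 0" for t
    by (rule gauss.integrable_const_bound[of _ 1]) (use that in \<open>auto intro!: AE_I2\<close>)
  have \<psi>0: "\<psi> t \<ge> 0" for t unfolding \<psi>_def by simp
  have step: "\<psi> t' * (1 + (t' - t) * \<kappa>) \<le> \<psi> t" if t: "0 \<le> t" "t \<le> t'" "t' \<le> s" for t t'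
  proof -
    have t'0: "t' \<ge> 0" using t by simp
    have iQ: "integrable (gauss q) (\<lambda>z. ?Q z * exp (- t' * ?Q z))" by (rule gauss_quadratic_tilt(2)[OF t'0 \<sigma>])
    have "\<kappa> * \<psi> t' \<le> (\<integral>z. ?Q z * exp (- t' * ?Q z) \<partial>gauss q)"
    proof -
      let ?I = "\<integral>z. ?Q z * exp (- t' * ?Q z) \<partial>gauss q"
      have I0: "?I \<ge> 0" by simp
      have "frob d q A * \<psi> t' \<le> (1 + 2 * t' * \<sigma>) * ?I"
        unfolding \<psi>_def by (rule gauss_quadratic_tilt(1)[OF t'0 \<sigma>])
      also have "\<dots> \<le> (1 + 2 * s * \<sigma>) * ?I"
        using t \<sigma>0 I0 by (intro mult_right_mono add_left_mono mult_left_mono) auto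
      finally show ?thesis using s \<sigma>0 by (simp add: \<kappa>_def divide_le_eq add_pos_nonneg mult.commute)
    qed
    then have "(t' - t) * (\<kappa> * \<psi> t') \<le> (t' - t) * (\<integral>z. ?Q z * exp (- t' * ?Q z) \<partial>gauss q)"
      using t by (intro mult_left_mono) auto
    also have "\<dots> = (\<integral>z. (t' - t) * (?Q z * exp (- t' * ?Q z)) \<partial>gauss q)" by simp
    also have "\<dots> \<le> (\<integral>z. exp (- t * ?Q z) - exp (- t' * ?Q z) \<partial>gauss q)"
    proof (rule integral_mono)
      show "(t' - t) * (?Q z * exp (- t' * ?Q z)) \<le> exp (- t * ?Q z) - exp (- t' * ?Q z)" for z
      proof -
        have "(1 + (t' - t) * ?Q z) * exp (- t' * ?Q z) \<le> exp ((t' - t) * ?Q z) * exp (- t' * ?Q z)"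
          by (intro mult_right_mono exp_ge_add_one_self) auto
        also have "\<dots> = exp (- t * ?Q z)" by (simp add: exp_add[symmetric] algebra_simps)
        finally show ?thesis by (simp add: algebra_simps)
      qed
    qed (use iQ iE t t'0 in auto)
    also have "\<dots> = \<psi> t - \<psi> t'" unfolding \<psi>_def using iE t t'0 by simp
    finally show ?thesis by (simp add: algebra_simps)
  qed
  have pow: "\<psi> s * (1 + s * \<kappa> / real N) ^ N \<le> 1" if N: "N \<ge> 1" for N
  proof -
    have "\<psi> (real k * s / real N) * (1 + s * \<kappa> / real N) ^ k \<le> 1" if "k \<le> N" for k
      using that
    proof (induction k)
      case 0 then show ?case by (simp add: \<psi>_def gauss.prob_space)
    next
      case (Suc k)
      let ?a = "1 + s * \<kappa> / real N"
      have le: "real (Suc k) * s / real N \<le> s"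
        using Suc.prems s N mult_right_mono[of "real (Suc k)" "real N" s] by (simp add: divide_le_eq mult.commute)
      have d: "real (Suc k) * s / real N - real k * s / real N = s / real N"
        by (simp add: add_divide_distrib algebra_simps)
      have "\<psi> (real (Suc k) * s / real N) * (1 + (real (Suc k) * s / real N - real k * s / real N) * \<kappa>) \<le> \<psi> (real k * s / real N)"
      proof (rule step[OF _ _ le])
        show "real k * s / real N \<le> real (Suc k) * s / real N" using s by (intro divide_right_mono mult_right_mono) auto
      qed (use s in auto)
      then have "\<psi> (real (Suc k) * s / real N) * ?a \<le> \<psi> (real k * s / real N)" unfolding d by simp
      then have "\<psi> (real (Suc k) * s / real N) * ?a * ?a ^ k \<le> \<psi> (real k * s / real N) * ?a ^ k"
        using s \<kappa>0 by (intro mult_right_mono) auto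
      also have "\<dots> \<le> 1" using Suc by simp
      finally show ?case by (simp add: mult.assoc)
    qed
    from this[of N] N show ?thesis by simp
  qed
  have "(\<lambda>N. \<psi> s * (1 + s * \<kappa> / real N) ^ N) \<longlonglongrightarrow> \<psi> s * exp (s * \<kappa>)"
    by (intro tendsto_mult_left tendsto_exp_limit_sequentially)
  then have "\<psi> s * exp (s * \<kappa>) \<le> 1"
    by (rule LIMSEQ_le_const2) (use pow in auto)
  then have "\<psi> s \<le> exp (- (s * \<kappa>))" by (simp add: exp_minus field_simps)
  then show ?thesis by (simp add: \<psi>_def \<kappa>_def)
qed

text \<open>Chernoff's bound at s = \<eta> / (4 \<sigma>). With \<sigma> the squared operator norm
  of A, the rate is governed by frob / \<sigma>, the effective rank of A A', so the norm of A z
  rarely drops when that rank is large.\<close>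

lemma gauss_lower_tail:
  assumes \<sigma>: "\<And>v. (vnorm q (adj d A v))\<^sup>2 \<le> \<sigma> * (vnorm d v)\<^sup>2" and \<sigma>0: "\<sigma> > 0" and \<eta>: "0 < \<eta>" "\<eta> < 1"
  shows "measure (gauss q) {z\<in>space (gauss q). (vnorm d (mv q A z))\<^sup>2 \<le> (1 - \<eta>) * frob d q A} \<le> exp (- \<eta>\<^sup>2 * frob d q A / (8 * \<sigma>))"
proof -
  let ?Q = "\<lambda>z. (vnorm d (mv q A z))\<^sup>2"
  let ?f = "frob d q A"
  let ?S = "{z\<in>space (gauss q). ?Q z \<le> (1 - \<eta>) * ?f}"
  define s where "s = \<eta> / (4 * \<sigma>)"
  have s: "s > 0" using \<eta> \<sigma>0 by (simp add: s_def)
  have iE: "integrable (gauss q) (\<lambda>z. exp (- s * ?Q z))"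
    by (rule gauss.integrable_const_bound[of _ 1]) (use s in \<open>auto intro!: AE_I2\<close>)
  have [measurable]: "?S \<in> sets (gauss q)" by measurable
  have "measure (gauss q) ?S = (\<integral>z. indicator ?S z \<partial>gauss q)" by simp
  also have "\<dots> \<le> (\<integral>z. exp (s * ((1 - \<eta>) * ?f)) * exp (- s * ?Q z) \<partial>gauss q)"
  proof (rule integral_mono)
    fix z
    have "1 \<le> exp (s * ((1 - \<eta>) * ?f)) * exp (- s * ?Q z)" if "z \<in> ?S"
    proof -
      have "0 \<le> s * ((1 - \<eta>) * ?f - ?Q z)" using that s by (intro mult_nonneg_nonneg) auto
      then show ?thesis by (simp add: exp_add[symmetric] algebra_simps)
    qed
    then show "indicator ?S z \<le> exp (s * ((1 - \<eta>) * ?f)) * exp (- s * ?Q z)" by (auto simp: indicator_def)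
  qed (use iE in \<open>auto intro!: integrable_real_indicator simp: gauss.emeasure_eq_measure\<close>)
  also have "\<dots> = exp (s * ((1 - \<eta>) * ?f)) * (\<integral>z. exp (- s * ?Q z) \<partial>gauss q)" by simp
  also have "\<dots> \<le> exp (s * ((1 - \<eta>) * ?f)) * exp (- s * (?f / (1 + 2 * s * \<sigma>)))"
    using gauss_quadratic_laplace[OF _ \<sigma>] s \<sigma>0 by (intro mult_left_mono) auto
  also have "\<dots> \<le> exp (- \<eta>\<^sup>2 * ?f / (8 * \<sigma>))"
  proof -
    have a: "1 + 2 * s * \<sigma> = 1 + \<eta> / 2" using \<sigma>0 by (simp add: s_def)
    have "(1 - \<eta> / 2) * (1 + \<eta> / 2) \<le> 1" by (simp add: algebra_simps)
    then have "1 - \<eta> / 2 \<le> 1 / (1 + \<eta> / 2)" using \<eta> by (simp add: pos_le_divide_eq)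
    then have "s * ?f * (1 - \<eta> / 2) \<le> s * ?f * (1 / (1 + \<eta> / 2))"
      using s frob_nonneg[of d q A] by (intro mult_left_mono) auto
    then have "s * ((1 - \<eta>) * ?f) - s * (?f / (1 + 2 * s * \<sigma>)) \<le> - (s * ?f * (\<eta> / 2))"
      unfolding a by (simp add: algebra_simps)
    also have "\<dots> = - \<eta>\<^sup>2 * ?f / (8 * \<sigma>)" using \<sigma>0 by (simp add: s_def power2_eq_square)
    finally show ?thesis by (simp add: exp_add[symmetric])
  qed
  finally show ?thesis .
qed

subsection \<open>Dimension-free upper bound for Gaussian sample covariance matrices\<close>

text \<open>Instead of a net of directions, the exponential moment is averaged over a Gaussian direction;
 translating the Gaussian by a multiple of v costs a factor depending only on the effective rank.\<close>

abbreviation gauss_sample :: "nat \<Rightarrow> nat \<Rightarrow> (nat \<Rightarrow> nat \<Rightarrow> real) measure" where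
  "gauss_sample n q \<equiv> PiM {..<n} (\<lambda>_. gauss q)"

lemma prob_space_gauss_sample: "prob_space (gauss_sample n q)"
  by (intro prob_space_PiM prob_space_gauss)

lemma adj_add: "adj d A (\<lambda>i. x i + y i) = (\<lambda>k. adj d A x k + adj d A y k)"
  by (simp add: adj_def distrib_left sum.distrib)

lemma adj_scale: "adj d A (\<lambda>i. c * x i) = (\<lambda>k. c * adj d A x k)"
  by (simp add: adj_def sum_distrib_left mult_ac)

lemma adj_cong: "(\<And>i. i < d \<Longrightarrow> x i = y i) \<Longrightarrow> adj d A x = adj d A y"
  by (auto simp: adj_def)

lemma adj_as_mv: "adj d A v = mv d (\<lambda>k i. A i k) v"
  by (simp add: adj_def mv_def ip_def)

lemma frob_transpose: "frob q d (\<lambda>k i. A i k) = frob d q A"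
  unfolding frob_def vnorm_sq_sum by (rule sum.swap)

lemma gauss_adj_sq:
  "integrable (gauss d) (\<lambda>g. (vnorm q (adj d A g))\<^sup>2)" "(\<integral>g. (vnorm q (adj d A g))\<^sup>2 \<partial>gauss d) = frob d q A"
proof -
  show "integrable (gauss d) (\<lambda>g. (vnorm q (adj d A g))\<^sup>2)" unfolding adj_as_mv by (rule gauss_mv_sq)
  show "(\<integral>g. (vnorm q (adj d A g))\<^sup>2 \<partial>gauss d) = frob d q A"
    unfolding adj_as_mv by (rule trans[OF gauss_mv_sq(2) frob_transpose])
qed

lemma adj_norm_measurable [measurable]: "(\<lambda>g. vnorm q (adj d A g)) \<in> borel_measurable (Rvec d)"
  unfolding adj_as_mv by measurable

lemma ip_adj_pair_measurable:
  assumes "i < n"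
  shows "(\<lambda>p. ip q (adj d A (snd p)) (fst p i)) \<in> borel_measurable (gauss_sample n q \<Otimes>\<^sub>M gauss d)"
proof -
  have "(\<lambda>p. fst p i k) \<in> borel_measurable (gauss_sample n q \<Otimes>\<^sub>M gauss d)" if "k < q" for k
  proof -
    have "(\<lambda>p. fst p i) \<in> measurable (gauss_sample n q \<Otimes>\<^sub>M gauss d) (gauss q)"
      using assms by (intro measurable_compose[OF measurable_fst measurable_component_singleton]) auto
    moreover have "(\<lambda>z. z k) \<in> borel_measurable (gauss q)"
      using coord_measurable[OF that] by (simp add: measurable_cong_sets[OF sets_gauss refl])
    ultimately show ?thesis by (rule measurable_compose)
  qed
  moreover have "(\<lambda>p. adj d A (snd p) k) \<in> borel_measurable (gauss_sample n q \<Otimes>\<^sub>M gauss d)" for k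
    unfolding adj_as_mv
    by (rule measurable_compose[OF measurable_snd]) (simp add: measurable_cong_sets[OF sets_gauss refl] mv_measurable)
  ultimately show ?thesis unfolding ip_def by (intro borel_measurable_sum borel_measurable_times) auto
qed

text \<open>Each factor is at most 1 / sqrt 0.95 <= exp 0.02635, because 1 / 1.0527 <= 0.95 and
  0.0527 is twice 0.02635.\<close>

lemma gauss_sample_exp_sq:
  assumes a: "2 * c * (vnorm q w)\<^sup>2 \<le> 1 / 20"
  shows "(\<integral>\<^sup>+z. ennreal (exp (c * (\<Sum>i<n. (ip q w (z i))\<^sup>2))) \<partial>gauss_sample n q) \<le> ennreal (exp (0.02635 * real n))"
proof -
  interpret P: product_prob_space "\<lambda>_::nat. gauss q" UNIV ..
  have one: "(\<integral>\<^sup>+z. ennreal (exp (c * (ip q w z)\<^sup>2)) \<partial>gauss q) \<le> ennreal (exp 0.02635)"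
  proof -
    have "(\<integral>\<^sup>+z. ennreal (exp (c * (ip q w z)\<^sup>2)) \<partial>gauss q) = ennreal (1 / sqrt (1 - 2 * c * (vnorm q w)\<^sup>2))"
      by (rule gauss_ip_exp_sq) (use a in simp)
    also have "\<dots> \<le> ennreal (exp 0.02635)"
    proof (rule ennreal_leI)
      have "1 / exp 0.0527 \<le> (1::real) / (1 + 0.0527)" by (intro divide_left_mono exp_ge_add_one_self) auto
      also have "\<dots> \<le> 1 - 2 * c * (vnorm q w)\<^sup>2" using a by simp
      finally have le: "sqrt (1 / exp 0.0527) \<le> sqrt (1 - 2 * c * (vnorm q w)\<^sup>2)" by (rule real_sqrt_le_mono)
      have eq: "sqrt (1 / exp 0.0527) = 1 / exp (0.02635::real)"
      proof -
        have "exp (0.0527::real) = (exp 0.02635)\<^sup>2" by (simp add: power2_eq_square flip: exp_add)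
        then show ?thesis by (simp add: real_sqrt_divide)
      qed
      have "1 / exp 0.02635 \<le> sqrt (1 - 2 * c * (vnorm q w)\<^sup>2)" using le unfolding eq .
      moreover have "sqrt (1 - 2 * c * (vnorm q w)\<^sup>2) > 0" using a by simp
      ultimately show "1 / sqrt (1 - 2 * c * (vnorm q w)\<^sup>2) \<le> exp 0.02635" by (simp add: field_simps)
    qed
    finally show ?thesis .
  qed
  have "(\<integral>\<^sup>+z. ennreal (exp (c * (\<Sum>i<n. (ip q w (z i))\<^sup>2))) \<partial>gauss_sample n q)
      = (\<integral>\<^sup>+z. (\<Prod>i<n. ennreal (exp (c * (ip q w (z i))\<^sup>2))) \<partial>gauss_sample n q)"
    by (simp add: sum_distrib_left exp_sum prod_ennreal)
  also have "\<dots> = (\<Prod>i<n. \<integral>\<^sup>+z. ennreal (exp (c * (ip q w z)\<^sup>2)) \<partial>gauss q)"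
    by (intro P.product_nn_integral_prod) auto
  also have "\<dots> \<le> (\<Prod>i<n. ennreal (exp 0.02635))" by (intro prod_mono_ennreal one)
  also have "\<dots> = ennreal (exp 0.02635 ^ n)" by (simp add: ennreal_power)
  also have "exp 0.02635 ^ n = exp (real n * (0.02635 :: real))" by (rule exp_of_nat_mult[symmetric])
  finally show ?thesis by (simp only: mult.commute)
qed

lemma gauss_covariance_upper:
  assumes \<sigma>: "\<And>v. (vnorm q (adj d A v))\<^sup>2 \<le> \<sigma> * (vnorm d v)\<^sup>2" and \<sigma>0: "\<sigma> > 0"
    and \<sigma>\<tau>: "\<sigma> \<le> frob d q A" and \<alpha>: "0 < \<alpha>" "\<alpha> \<le> 1"
  obtains G where "G \<in> sets (gauss_sample n q)" "measure (gauss_sample n q) G \<ge> 1 - \<alpha>"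
    "\<And>z v. z \<in> G \<Longrightarrow> vnorm d v = 1 \<Longrightarrow>
      (\<Sum>i<n. (ip d v (mv q A (z i)))\<^sup>2) \<le> 1.276 * real n * \<sigma> + (4840 + 48.4 * ln (2 / \<alpha>)) * frob d q A"
proof -
  interpret S: prob_space "gauss_sample n q" by (rule prob_space_gauss_sample)
  interpret SG: pair_sigma_finite "gauss_sample n q" "gauss d" ..
  define \<tau> where "\<tau> = frob d q A"
  have \<tau>: "\<tau> > 0" using \<sigma>0 \<sigma>\<tau> by (simp add: \<tau>_def)
  \<comment> \<open>The shift length sqrt \<beta> makes sqrt (2 \<tau>), the bound for |A' g| on
    half of the mass, one tenth of sqrt (\<beta> \<sigma>), the most that the shift contributes.
    Hence K = 1.1^2 \<sigma>, and s is chosen so that 2 s K = 1 / 20.\<close>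
  define \<beta> where "\<beta> = 200 * \<tau> / \<sigma>"
  define K where "K = 1.21 * \<sigma>"
  define s where "s = 0.025 / K"
  have pos: "\<beta> > 0" "K > 0" "s > 0" using \<sigma>0 \<tau> by (auto simp: \<beta>_def K_def s_def)
  let ?w = "adj d A"
  \<comment> \<open>Truncating g to \<open>?C\<close> bounds the exponential moment over the sample
    for every direction that is counted.\<close>
  let ?C = "{g. (vnorm q (?w g))\<^sup>2 \<le> K * \<beta>}"
  define f where "f = (\<lambda>z g. indicator ?C g * ennreal (exp (s / \<beta> * (\<Sum>i<n. (ip q (?w g) (z i))\<^sup>2))))"
  define Zf where "Zf = (\<lambda>z. \<integral>\<^sup>+g. f z g \<partial>gauss d)"
  have fm: "(\<lambda>p. f (fst p) (snd p)) \<in> borel_measurable (gauss_sample n q \<Otimes>\<^sub>M gauss d)"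
  proof -
    have "{g\<in>space (gauss d). (vnorm q (?w g))\<^sup>2 \<le> K * \<beta>} \<in> sets (gauss d)" by measurable
    then have "(\<lambda>g. indicator {g\<in>space (gauss d). (vnorm q (?w g))\<^sup>2 \<le> K * \<beta>} g :: ennreal) \<in> borel_measurable (gauss d)" by simp
    then have "(\<lambda>g. indicator ?C g :: ennreal) \<in> borel_measurable (gauss d)"
      by (rule measurable_cong[THEN iffD1, rotated]) (simp add: indicator_def)
    then have "(\<lambda>p. indicator ?C (snd p) :: ennreal) \<in> borel_measurable (gauss_sample n q \<Otimes>\<^sub>M gauss d)"
      by (rule measurable_compose[OF measurable_snd])
    moreover have "(\<lambda>p. ennreal (exp (s / \<beta> * (\<Sum>i<n. (ip q (?w (snd p)) (fst p i))\<^sup>2)))) \<in> borel_measurable (gauss_sample n q \<Otimes>\<^sub>M gauss d)"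
      by (intro measurable_compose[OF _ measurable_ennreal] measurable_compose[OF _ borel_measurable_exp] borel_measurable_times borel_measurable_const borel_measurable_sum borel_measurable_power ip_adj_pair_measurable) auto
    ultimately show ?thesis unfolding f_def by (intro borel_measurable_times_ennreal)
  qed
  have Zm[measurable]: "Zf \<in> borel_measurable (gauss_sample n q)"
    unfolding Zf_def using gauss.borel_measurable_nn_integral_fst[OF fm] by simp
  have EZ: "(\<integral>\<^sup>+z. Zf z \<partial>gauss_sample n q) \<le> ennreal (exp (0.02635 * real n))"
  proof -
    have "(\<integral>\<^sup>+z. Zf z \<partial>gauss_sample n q) = (\<integral>\<^sup>+g. (\<integral>\<^sup>+z. f z g \<partial>gauss_sample n q) \<partial>gauss d)"
      unfolding Zf_def using SG.Fubini'[of f] fm by (simp add: split_def)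
    also have "\<dots> \<le> (\<integral>\<^sup>+g. ennreal (exp (0.02635 * real n)) \<partial>gauss d)"
    proof (rule nn_integral_mono)
      fix g
      show "(\<integral>\<^sup>+z. f z g \<partial>gauss_sample n q) \<le> ennreal (exp (0.02635 * real n))"
      proof (cases "g \<in> ?C")
        case True
        have "2 * (s / \<beta>) * (vnorm q (?w g))\<^sup>2 \<le> 2 * (s / \<beta>) * (K * \<beta>)"
          using True pos by (intro mult_left_mono) auto
        also have "\<dots> = 1 / 20" using pos by (simp add: s_def)
        finally have le: "2 * (s / \<beta>) * (vnorm q (?w g))\<^sup>2 \<le> 1 / 20" .
        show ?thesis using True gauss_sample_exp_sq[OF le, of n] by (simp add: f_def)
      qed (simp add: f_def)
    qed
    also have "\<dots> = ennreal (exp (0.02635 * real n))" by (simp add: gauss.emeasure_space_1)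
    finally show ?thesis .
  qed
  define c where "c = exp (0.02635 * real n) / \<alpha>"
  have c: "c > 0" using \<alpha> by (simp add: c_def)
  define G where "G = {z\<in>space (gauss_sample n q). Zf z \<le> ennreal c}"
  have G: "G \<in> sets (gauss_sample n q)" unfolding G_def by measurable
  have "emeasure (gauss_sample n q) {z\<in>space (gauss_sample n q). ennreal c \<le> Zf z} \<le> ennreal (1 / c) * (\<integral>\<^sup>+z. Zf z \<partial>gauss_sample n q)"
  proof -
    let ?B = "{z\<in>space (gauss_sample n q). ennreal c \<le> Zf z}"
    have "?B \<in> sets (gauss_sample n q)" by measurable
    then have "emeasure (gauss_sample n q) ?B = (\<integral>\<^sup>+z. indicator ?B z \<partial>gauss_sample n q)" by simp
    also have "\<dots> \<le> (\<integral>\<^sup>+z. ennreal (1 / c) * Zf z \<partial>gauss_sample n q)"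
    proof (rule nn_integral_mono)
      fix z
      have "1 \<le> ennreal (1 / c) * Zf z" if "z \<in> ?B"
      proof -
        have "ennreal (1 / c) * ennreal c \<le> ennreal (1 / c) * Zf z" using that by (intro mult_left_mono) auto
        moreover have "ennreal (1 / c) * ennreal c = 1" using c by (simp add: ennreal_mult[symmetric])
        ultimately show ?thesis by simp
      qed
      then show "indicator ?B z \<le> ennreal (1 / c) * Zf z" by (auto simp: indicator_def)
    qed
    also have "\<dots> = ennreal (1 / c) * (\<integral>\<^sup>+z. Zf z \<partial>gauss_sample n q)" by (rule nn_integral_cmult) measurable
    finally show ?thesis .
  qed
  also have "\<dots> \<le> ennreal (1 / c) * ennreal (exp (0.02635 * real n))" by (intro mult_left_mono EZ) auto
  also have "\<dots> = ennreal \<alpha>" using c \<alpha> by (simp add: ennreal_mult[symmetric] c_def)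
  finally have bad: "S.prob {z\<in>space (gauss_sample n q). ennreal c \<le> Zf z} \<le> \<alpha>"
    using \<alpha> by (simp add: S.emeasure_eq_measure)
  have "1 - \<alpha> \<le> S.prob G"
  proof -
    have m: "{z\<in>space (gauss_sample n q). ennreal c \<le> Zf z} \<in> S.events" by measurable
    have "1 - \<alpha> \<le> 1 - S.prob {z\<in>space (gauss_sample n q). ennreal c \<le> Zf z}" using bad by simp
    also have "\<dots> = S.prob (space (gauss_sample n q) - {z\<in>space (gauss_sample n q). ennreal c \<le> Zf z})"
      using S.prob_compl[OF m] by simp
    also have "\<dots> \<le> S.prob G" by (intro S.finite_measure_mono G) (auto simp: G_def)
    finally show ?thesis .
  qed
  moreover have "(\<Sum>i<n. (ip d v (mv q A (z i)))\<^sup>2) \<le> 1.276 * real n * \<sigma> + (4840 + 48.4 * ln (2 / \<alpha>)) * frob d q A"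
    if z: "z \<in> G" and v: "vnorm d v = 1" for z v
  proof -
    define b where "b = sqrt \<beta>"
    have b: "b > 0" "b\<^sup>2 = \<beta>" using pos by (auto simp: b_def)
    define T where "T = (\<Sum>i<n. (ip d v (mv q A (z i)))\<^sup>2)"
    define W where "W = {g. (vnorm q (?w g))\<^sup>2 \<le> 2 * \<tau>}"
    \<comment> \<open>Collects what is linear in g after the shift by b v: the exponent of the
      density and the cross terms of the squares. It is odd in g and is removed by symmetry.\<close>
    define l where "l = (\<lambda>g. - b * ip d v g + 2 * s / b * (\<Sum>i<n. ip q (?w v) (z i) * ip q (?w g) (z i)))"
    have [measurable]: "l \<in> borel_measurable (Rvec d)"
    proof -
      have "(\<lambda>g. ip q (?w g) (z i)) \<in> borel_measurable (Rvec d)" for i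
        unfolding ip_def adj_as_mv by (intro borel_measurable_sum borel_measurable_times mv_measurable borel_measurable_const)
      then show ?thesis unfolding l_def
        by (intro borel_measurable_add borel_measurable_times borel_measurable_const ip_measurable borel_measurable_sum)
    qed
    have Wm: "{g\<in>space (gauss d). (vnorm q (?w g))\<^sup>2 \<le> 2 * \<tau>} \<in> sets (gauss d)" by measurable
    then have "(\<lambda>g. indicator {g\<in>space (gauss d). (vnorm q (?w g))\<^sup>2 \<le> 2 * \<tau>} g :: ennreal) \<in> borel_measurable (gauss d)" by simp
    then have "(\<lambda>g. indicator W g :: ennreal) \<in> borel_measurable (gauss d)"
      by (rule measurable_cong[THEN iffD1, rotated]) (simp add: indicator_def W_def)
    then have [measurable]: "(\<lambda>g. indicator W g :: ennreal) \<in> borel_measurable (Rvec d)"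
      by (simp add: measurable_cong_sets[OF sets_gauss refl])
    have lneg: "l (\<lambda>j\<in>{..<d}. - g j) = - l g" and wneg: "?w (\<lambda>j\<in>{..<d}. - g j) = (\<lambda>k. - ?w g k)" for g
    proof -
      show w': "?w (\<lambda>j\<in>{..<d}. - g j) = (\<lambda>k. - ?w g k)"
        by (simp add: adj_def sum_negf)
      show "l (\<lambda>j\<in>{..<d}. - g j) = - l g"
        unfolding l_def w' by (simp add: ip_def sum_negf)
    qed
    have Wneg: "indicator W (\<lambda>j\<in>{..<d}. - g j) = (indicator W g :: ennreal)" for g
      unfolding W_def indicator_def mem_Collect_eq wneg by (simp add: vnorm_def)
    have PW: "ennreal (1 / 2) \<le> emeasure (gauss d) {g\<in>space (gauss d). (vnorm q (?w g))\<^sup>2 \<le> 2 * \<tau>}"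
    proof -
      have "gauss.prob d {g\<in>space (gauss d). 2 * \<tau> \<le> (vnorm q (?w g))\<^sup>2} \<le> (\<integral>g. (vnorm q (?w g))\<^sup>2 \<partial>gauss d) / (2 * \<tau>)"
        by (rule integral_Markov_inequality_measure[where A = "space (gauss d)" and u = "\<lambda>g. (vnorm q (?w g))\<^sup>2", simplified])
           (use gauss_adj_sq \<tau> in auto)
      then have "gauss.prob d {g\<in>space (gauss d). 2 * \<tau> \<le> (vnorm q (?w g))\<^sup>2} \<le> 1 / 2"
        using \<tau> by (simp add: gauss_adj_sq \<tau>_def)
      moreover have "gauss.prob d {g\<in>space (gauss d). (vnorm q (?w g))\<^sup>2 \<le> 2 * \<tau>}
          \<ge> gauss.prob d (space (gauss d) - {g\<in>space (gauss d). 2 * \<tau> \<le> (vnorm q (?w g))\<^sup>2})"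
        by (intro gauss.finite_measure_mono Wm) auto
      moreover have "{g\<in>space (gauss d). 2 * \<tau> \<le> (vnorm q (?w g))\<^sup>2} \<in> gauss.events d" by measurable
      ultimately have "1 / 2 \<le> gauss.prob d {g\<in>space (gauss d). (vnorm q (?w g))\<^sup>2 \<le> 2 * \<tau>}"
        using gauss.prob_compl[of "{g\<in>space (gauss d). 2 * \<tau> \<le> (vnorm q (?w g))\<^sup>2}" d] by simp
      then have "ennreal (1 / 2) \<le> ennreal (gauss.prob d {g\<in>space (gauss d). (vnorm q (?w g))\<^sup>2 \<le> 2 * \<tau>})"
        by (rule ennreal_leI)
      then show ?thesis unfolding gauss.emeasure_eq_measure .
    qed
    \<comment> \<open>Both W and the Gaussian law are invariant under g -> - g, while l is odd; so
      exp l may be averaged with exp (- l), and these two add up to at least 2.\<close>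
    have cosh: "emeasure (gauss d) {g\<in>space (gauss d). (vnorm q (?w g))\<^sup>2 \<le> 2 * \<tau>} \<le> (\<integral>\<^sup>+g. indicator W g * ennreal (exp (l g)) \<partial>gauss d)"
    proof -
      let ?I = "\<integral>\<^sup>+g. indicator W g * ennreal (exp (l g)) \<partial>gauss d"
      have sym: "?I = (\<integral>\<^sup>+g. indicator W g * ennreal (exp (- l g)) \<partial>gauss d)"
        by (subst gauss_uminus) (simp_all add: Wneg lneg)
      have "2 * emeasure (gauss d) {g\<in>space (gauss d). (vnorm q (?w g))\<^sup>2 \<le> 2 * \<tau>} = (\<integral>\<^sup>+g. 2 * indicator W g \<partial>gauss d)"
      proof -
        have "(\<integral>\<^sup>+g. 2 * indicator W g \<partial>gauss d) = 2 * (\<integral>\<^sup>+g. indicator {g\<in>space (gauss d). (vnorm q (?w g))\<^sup>2 \<le> 2 * \<tau>} g \<partial>gauss d)"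
          by (subst nn_integral_cmult[symmetric]) (use Wm in \<open>auto simp: W_def indicator_def intro!: nn_integral_cong\<close>)
        then show ?thesis using Wm by simp
      qed
      also have "\<dots> \<le> (\<integral>\<^sup>+g. indicator W g * ennreal (exp (l g)) + indicator W g * ennreal (exp (- l g)) \<partial>gauss d)"
      proof (rule nn_integral_mono)
        fix g
        have "2 \<le> exp (l g) + exp (- l g)"
          using exp_ge_add_one_self[of "l g"] exp_ge_add_one_self[of "- l g"] by linarith
        then have "ennreal 2 \<le> ennreal (exp (l g) + exp (- l g))" by (rule ennreal_leI)
        also have "\<dots> = ennreal (exp (l g)) + ennreal (exp (- l g))" by (rule ennreal_plus) auto
        finally show "2 * indicator W g \<le> indicator W g * ennreal (exp (l g)) + indicator W g * ennreal (exp (- l g))"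
          by (auto simp: indicator_def)
      qed
      also have "\<dots> = ?I + (\<integral>\<^sup>+g. indicator W g * ennreal (exp (- l g)) \<partial>gauss d)"
        by (rule nn_integral_add) measurable
      also have "\<dots> = 2 * ?I" unfolding sym[symmetric] by (simp add: mult_2)
      finally show ?thesis by (simp add: ennreal_mult_le_mult_iff)
    qed
    \<comment> \<open>After the shift, the square of b A' v + A' g splits into b^2 times the wanted
      square, a cross term that goes into l, and a square that is dropped. For g in W the shifted
      vector stays inside \<open>?C\<close>.\<close>
    have low: "ennreal (exp (s * T - \<beta> / 2)) * (indicator W g * ennreal (exp (l g)))
        \<le> ennreal (exp (- ip d (\<lambda>j. b * v j) g - (vnorm d (\<lambda>j. b * v j))\<^sup>2 / 2)) * f z (\<lambda>j\<in>{..<d}. b * v j + g j)" for g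
    proof (cases "g \<in> W")
      case True
      define h where "h = (\<lambda>j\<in>{..<d}. b * v j + g j)"
      have wh: "?w h = (\<lambda>k. b * ?w v k + ?w g k)"
        unfolding h_def by (subst adj_cong[of d _ "\<lambda>j. b * v j + g j"]) (simp_all add: adj_add adj_scale)
      have "h \<in> ?C"
      proof -
        have "vnorm q (?w h) \<le> vnorm q (\<lambda>k. b * ?w v k) + vnorm q (?w g)" unfolding wh by (rule vnorm_triangle)
        also have "vnorm q (\<lambda>k. b * ?w v k) = b * vnorm q (?w v)" using b by (simp add: vnorm_scale)
        also have "vnorm q (?w v) \<le> sqrt \<sigma>" using \<sigma>[of v] v by (simp add: real_le_rsqrt)
        also have "vnorm q (?w g) \<le> sqrt (2 * \<tau>)" using True by (simp add: W_def real_le_rsqrt)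
        also have "sqrt (2 * \<tau>) = 0.1 * (b * sqrt \<sigma>)"
        proof -
          have "2 * \<tau> = (0.1 * (b * sqrt \<sigma>))\<^sup>2"
            using \<sigma>0 b by (simp add: power_mult_distrib \<beta>_def power_divide)
          then show ?thesis using b \<sigma>0 by (simp add: real_sqrt_mult)
        qed
        finally have "vnorm q (?w h) \<le> 1.1 * (b * sqrt \<sigma>)" using b by (simp add: mult_left_mono)
        then have "(vnorm q (?w h))\<^sup>2 \<le> (1.1 * (b * sqrt \<sigma>))\<^sup>2" by (intro power_mono) auto
        also have "\<dots> = K * \<beta>" using \<sigma>0 b by (simp add: power_mult_distrib K_def power_divide)
        finally show ?thesis by simp
      qed
      have "s / \<beta> * (\<Sum>i<n. (ip q (?w h) (z i))\<^sup>2) = s * T + 2 * s / b * (\<Sum>i<n. ip q (?w v) (z i) * ip q (?w g) (z i))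
          + s / \<beta> * (\<Sum>i<n. (ip q (?w g) (z i))\<^sup>2)"
      proof -
        have "(ip q (?w h) (z i))\<^sup>2 = b\<^sup>2 * (ip q (?w v) (z i))\<^sup>2 + 2 * b * (ip q (?w v) (z i) * ip q (?w g) (z i)) + (ip q (?w g) (z i))\<^sup>2" for i
          unfolding wh ip_add_left ip_scale_left by (simp add: power2_sum power_mult_distrib mult_ac)
        then have "(\<Sum>i<n. (ip q (?w h) (z i))\<^sup>2) = b\<^sup>2 * T + 2 * b * (\<Sum>i<n. ip q (?w v) (z i) * ip q (?w g) (z i)) + (\<Sum>i<n. (ip q (?w g) (z i))\<^sup>2)"
          by (simp add: T_def ip_mv_adj sum.distrib sum_distrib_left)
        then show ?thesis using b unfolding b(2)[symmetric] by (simp add: field_simps power2_eq_square)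
      qed
      moreover have "0 \<le> s / \<beta> * (\<Sum>i<n. (ip q (?w g) (z i))\<^sup>2)" using pos by (simp add: sum_nonneg)
      moreover have "(vnorm d (\<lambda>j. b * v j))\<^sup>2 = \<beta>" using v b by (simp add: vnorm_scale power_mult_distrib)
      ultimately have "s * T - \<beta> / 2 + l g \<le> (- ip d (\<lambda>j. b * v j) g - (vnorm d (\<lambda>j. b * v j))\<^sup>2 / 2) + s / \<beta> * (\<Sum>i<n. (ip q (?w h) (z i))\<^sup>2)"
        by (simp add: l_def ip_scale_left)
      then show ?thesis using True \<open>h \<in> ?C\<close>
        unfolding f_def h_def[symmetric] by (simp add: ennreal_mult[symmetric] exp_add[symmetric] ennreal_leI)
    qed (simp add: indicator_def)
    have fz: "f z \<in> borel_measurable (Rvec d)"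
    proof -
      have "z \<in> space (gauss_sample n q)" using z by (simp add: G_def)
      then have "(\<lambda>g. f (fst (z, g)) (snd (z, g))) \<in> borel_measurable (gauss d)"
        by (intro measurable_compose[OF _ fm]) simp
      then show ?thesis by (simp add: measurable_cong_sets[OF sets_gauss refl])
    qed
    have "ennreal (exp (s * T - \<beta> / 2)) * ennreal (1 / 2) \<le> ennreal (exp (s * T - \<beta> / 2)) * (\<integral>\<^sup>+g. indicator W g * ennreal (exp (l g)) \<partial>gauss d)"
      using order_trans[OF PW cosh] by (intro mult_left_mono) auto
    also have "\<dots> = (\<integral>\<^sup>+g. ennreal (exp (s * T - \<beta> / 2)) * (indicator W g * ennreal (exp (l g))) \<partial>gauss d)"
      by (intro nn_integral_cmult[symmetric]) measurable
    also have "\<dots> \<le> (\<integral>\<^sup>+g. ennreal (exp (- ip d (\<lambda>j. b * v j) g - (vnorm d (\<lambda>j. b * v j))\<^sup>2 / 2)) * f z (\<lambda>j\<in>{..<d}. b * v j + g j) \<partial>gauss d)"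
      by (intro nn_integral_mono low)
    also have "\<dots> = Zf z" unfolding Zf_def by (rule gauss_shift[OF fz, symmetric])
    also have "\<dots> \<le> ennreal c" using z by (simp add: G_def)
    finally have "ennreal (exp (s * T - \<beta> / 2) * (1 / 2)) \<le> ennreal c"
      by (simp only: ennreal_mult[symmetric] exp_ge_zero zero_le_divide_1_iff zero_le_numeral)
    then have "exp (s * T - \<beta> / 2) \<le> 2 * c" using c by (simp add: ennreal_le_iff)
    then have "s * T - \<beta> / 2 \<le> ln (2 * c)" using c by (simp add: ln_ge_iff)
    also have "ln (2 * c) = 0.02635 * real n + ln (2 / \<alpha>)"
      using \<alpha> by (simp add: c_def ln_mult ln_div)
    finally have "s * T \<le> 0.02635 * real n + ln (2 / \<alpha>) + \<beta> / 2" by simp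
    \<comment> \<open>Division by s multiplies by (1.21 / 0.025) \<sigma> = 48.4 \<sigma>. The first
      term becomes 1.27534 n \<sigma>, and \<beta> / 2 = 100 \<tau> / \<sigma> becomes 4840
      \<tau>.\<close>
    then have "T \<le> (0.02635 * real n + ln (2 / \<alpha>) + \<beta> / 2) / s" using pos by (simp add: pos_le_divide_eq mult.commute)
    also have "\<dots> = (0.02635 * real n + ln (2 / \<alpha>) + \<beta> / 2) * (48.4 * \<sigma>)" using \<sigma>0 by (simp add: s_def K_def)
    also have "\<dots> = 1.27534 * real n * \<sigma> + 48.4 * ln (2 / \<alpha>) * \<sigma> + 4840 * \<tau>"
      using \<sigma>0 by (simp add: \<beta>_def field_simps)
    also have "48.4 * ln (2 / \<alpha>) * \<sigma> \<le> 48.4 * ln (2 / \<alpha>) * \<tau>"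
      using \<alpha> \<sigma>\<tau> by (intro mult_left_mono) (auto simp: \<tau>_def)
    also have "1.27534 * real n * \<sigma> \<le> 1.276 * real n * \<sigma>" using \<sigma>0 by (intro mult_right_mono) auto
    finally show ?thesis by (simp add: T_def \<tau>_def algebra_simps)
  qed
  ultimately show ?thesis using that[OF G] by blast
qed

section \<open>The elliptical law in terms of Gaussian vectors\<close>

abbreviation radial :: "nat \<Rightarrow> (nat \<Rightarrow> real) \<Rightarrow> nat \<Rightarrow> real" where
  "radial q z \<equiv> \<lambda>j\<in>{..<q}. z j / vnorm q z"

text \<open>Writes the Gaussian density as a mixture of indicators of the balls of radius t.\<close>

lemma exp_sq_layer_cake:
  assumes "\<rho> \<ge> 0"
  shows "(\<integral>\<^sup>+t. ennreal (t * exp (- t\<^sup>2 / 2)) * indicator {\<rho>..} t \<partial>lborel) = ennreal (exp (- \<rho>\<^sup>2 / 2))"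
proof -
  have "(\<integral>\<^sup>+t. ennreal (t * exp (- t\<^sup>2 / 2)) * indicator {\<rho>..} t \<partial>lborel) = ennreal (0 - (- exp (- \<rho>\<^sup>2 / 2)))"
  proof (rule nn_integral_FTC_atLeast)
    show "((\<lambda>t. - exp (- t\<^sup>2 / 2)) has_real_derivative t * exp (- t\<^sup>2 / 2)) (at t)" for t :: real
      by (auto intro!: derivative_eq_intros)
    show "((\<lambda>t::real. - exp (- t\<^sup>2 / 2)) \<longlongrightarrow> 0) at_top" by real_asymp
  qed (use assms in auto)
  then show ?thesis by simp
qed

text \<open>By the layer cake formula the Gaussian law is a mixture of uniform laws on balls of
  radius t. As \<open>radial\<close> is invariant under scaling, every ball yields the same law of
  the direction, weighted by t^q.\<close>

lemma sphere_unif_eq_gauss: "sphere_unif q = distr (gauss q) (Rvec q) (radial q)"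
proof -
  let ?L = "PiM {..<q} (\<lambda>_. lborel :: real measure)"
  let ?B = "{x \<in> space (Rvec q). vnorm q x \<le> 1}"
  interpret L: sigma_finite_measure ?L by (rule lborel_psf.sigma_finite) simp
  interpret PL: pair_sigma_finite lborel ?L ..
  define C where "C = ennreal ((1 / sqrt (2 * pi)) ^ q)"
  define k where "k = (\<lambda>t::real. ennreal (t * exp (- t\<^sup>2 / 2)))"
  have [measurable]: "k \<in> borel_measurable borel" unfolding k_def by measurable
  define c' where "c' = C * (\<integral>\<^sup>+t. k t * ennreal (\<bar>t\<bar> ^ q) \<partial>lborel)"
  have B[measurable]: "?B \<in> sets ?L" by measurable
  have key: "emeasure (distr (gauss q) (Rvec q) (radial q)) A = c' * (\<integral>\<^sup>+z. indicator A (radial q z) * indicator ?B z \<partial>?L)"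
    if A[measurable]: "A \<in> sets (Rvec q)" for A
  proof -
    let ?g = "\<lambda>z. indicator A (radial q z) :: ennreal"
    have [measurable]: "?g \<in> borel_measurable (Rvec q)" by measurable
    have "emeasure (distr (gauss q) (Rvec q) (radial q)) A = (\<integral>\<^sup>+x. indicator A x \<partial>distr (gauss q) (Rvec q) (radial q))"
      by simp
    also have "\<dots> = (\<integral>\<^sup>+z. ?g z \<partial>gauss q)"
      by (rule nn_integral_distr) measurable
    also have "\<dots> = C * (\<integral>\<^sup>+z. ennreal (exp (- (vnorm q z)\<^sup>2 / 2)) * ?g z \<partial>?L)"
      unfolding C_def by (rule nn_integral_gauss) measurable
    also have "(\<integral>\<^sup>+z. ennreal (exp (- (vnorm q z)\<^sup>2 / 2)) * ?g z \<partial>?L)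
        = (\<integral>\<^sup>+z. (\<integral>\<^sup>+t. k t * indicator {vnorm q z..} t * ?g z \<partial>lborel) \<partial>?L)"
    proof (rule nn_integral_cong)
      fix z
      have "(\<integral>\<^sup>+t. k t * indicator {vnorm q z..} t * ?g z \<partial>lborel) = (\<integral>\<^sup>+t. k t * indicator {vnorm q z..} t \<partial>lborel) * ?g z"
        by (rule nn_integral_multc) measurable
      also have "(\<integral>\<^sup>+t. k t * indicator {vnorm q z..} t \<partial>lborel) = ennreal (exp (- (vnorm q z)\<^sup>2 / 2))"
        unfolding k_def by (rule exp_sq_layer_cake) simp
      finally show "ennreal (exp (- (vnorm q z)\<^sup>2 / 2)) * ?g z = (\<integral>\<^sup>+t. k t * indicator {vnorm q z..} t * ?g z \<partial>lborel)" ..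
    qed
    also have "\<dots> = (\<integral>\<^sup>+t. (\<integral>\<^sup>+z. k t * indicator {vnorm q z..} t * ?g z \<partial>?L) \<partial>lborel)"
    proof (rule PL.Fubini')
      have "(\<lambda>(t, z). k t * (if vnorm q z \<le> t then 1 else 0) * ?g z) \<in> borel_measurable (lborel \<Otimes>\<^sub>M ?L)"
        by measurable
      then show "(\<lambda>(t, z). k t * indicator {vnorm q z..} t * ?g z) \<in> borel_measurable (lborel \<Otimes>\<^sub>M ?L)"
        by (simp add: indicator_def)
    qed
    also have "\<dots> = (\<integral>\<^sup>+t. (k t * ennreal (\<bar>t\<bar> ^ q)) * (\<integral>\<^sup>+z. ?g z * indicator ?B z \<partial>?L) \<partial>lborel)"
    proof (rule nn_integral_cong)
      fix t :: real
      show "(\<integral>\<^sup>+z. k t * indicator {vnorm q z..} t * ?g z \<partial>?L) = (k t * ennreal (\<bar>t\<bar> ^ q)) * (\<integral>\<^sup>+z. ?g z * indicator ?B z \<partial>?L)"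
      proof (cases "t > 0")
        case False
        then have "k t = 0" by (simp add: k_def ennreal_neg mult_nonpos_nonneg)
        then show ?thesis by simp
      next
        case True
        have "(\<integral>\<^sup>+z. k t * indicator {vnorm q z..} t * ?g z \<partial>?L) = k t * (\<integral>\<^sup>+z. (if vnorm q z \<le> t then 1 else 0) * ?g z \<partial>?L)"
        proof -
          have "indicator {vnorm q z..} t = (if vnorm q z \<le> t then 1 else 0 :: ennreal)" for z
            by (simp add: indicator_def)
          then have "(\<integral>\<^sup>+z. k t * indicator {vnorm q z..} t * ?g z \<partial>?L) = (\<integral>\<^sup>+z. k t * ((if vnorm q z \<le> t then 1 else 0) * ?g z) \<partial>?L)"
            by (simp only: mult.assoc)
          also have "\<dots> = k t * (\<integral>\<^sup>+z. (if vnorm q z \<le> t then 1 else 0) * ?g z \<partial>?L)"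
            by (rule nn_integral_cmult) measurable
          finally show ?thesis .
        qed
        also have "(\<integral>\<^sup>+z. (if vnorm q z \<le> t then 1 else 0) * ?g z \<partial>?L)
            = ennreal (\<bar>t\<bar> ^ q) * (\<integral>\<^sup>+z. (if vnorm q (\<lambda>j\<in>{..<q}. 0 + t * z j) \<le> t then 1 else 0) * ?g (\<lambda>j\<in>{..<q}. 0 + t * z j) \<partial>?L)"
          using True by (intro nn_integral_PiM_lborel_affine[where t = "\<lambda>_. 0"]) auto
        also have "(\<integral>\<^sup>+z. (if vnorm q (\<lambda>j\<in>{..<q}. 0 + t * z j) \<le> t then 1 else 0) * ?g (\<lambda>j\<in>{..<q}. 0 + t * z j) \<partial>?L)
            = (\<integral>\<^sup>+z. ?g z * indicator ?B z \<partial>?L)"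
        proof (rule nn_integral_cong)
          fix z :: "nat \<Rightarrow> real" assume "z \<in> space ?L"
          then have z: "z \<in> space (Rvec q)" by (simp add: space_PiM_lborel)
          have n: "vnorm q (\<lambda>j\<in>{..<q}. 0 + t * z j) = t * vnorm q z"
          proof -
            have "vnorm q (\<lambda>j\<in>{..<q}. 0 + t * z j) = vnorm q (\<lambda>j. t * z j)" by (rule vnorm_cong) simp
            then show ?thesis using True by (simp add: vnorm_scale)
          qed
          have r: "radial q (\<lambda>j\<in>{..<q}. 0 + t * z j) = radial q z"
            unfolding n using True by (intro ext) (simp add: restrict_def)
          have le: "t * vnorm q z \<le> t \<longleftrightarrow> vnorm q z \<le> 1" using True by simp
          show "(if vnorm q (\<lambda>j\<in>{..<q}. 0 + t * z j) \<le> t then 1 else 0) * ?g (\<lambda>j\<in>{..<q}. 0 + t * z j) = ?g z * indicator ?B z"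
            by (subst r, subst n, subst le) (use z in \<open>simp add: indicator_def\<close>)
        qed
        finally show ?thesis by (simp only: mult.assoc)
      qed
    qed
    also have "\<dots> = (\<integral>\<^sup>+t. k t * ennreal (\<bar>t\<bar> ^ q) \<partial>lborel) * (\<integral>\<^sup>+z. ?g z * indicator ?B z \<partial>?L)"
      by (rule nn_integral_multc) measurable
    finally show ?thesis by (simp only: c'_def mult.assoc)
  qed
  \<comment> \<open>Total mass identifies the constant, and shows at the same time that the volume
    of the unit ball is neither zero nor infinite.\<close>
  have "c' * emeasure ?L ?B = 1"
  proof -
    have "1 = emeasure (distr (gauss q) (Rvec q) (radial q)) (space (Rvec q))"
      using prob_space.emeasure_space_1[OF gauss.prob_space_distr[of "radial q" q "Rvec q"]] by simp
    also have "\<dots> = c' * (\<integral>\<^sup>+z. indicator (space (Rvec q)) (radial q z) * indicator ?B z \<partial>?L)" by (rule key) simp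
    also have "(\<integral>\<^sup>+z. indicator (space (Rvec q)) (radial q z) * indicator ?B z \<partial>?L) = (\<integral>\<^sup>+z. indicator ?B z \<partial>?L)"
      by (intro nn_integral_cong) (auto simp: indicator_def space_PiM)
    finally show ?thesis by simp
  qed
  then have nz: "emeasure ?L ?B \<noteq> 0" "emeasure ?L ?B \<noteq> \<top>" "c' \<noteq> 0"
    by (auto simp: ennreal_mult_top split: if_splits)
  show ?thesis
  proof (rule measure_eqI)
    show "sets (sphere_unif q) = sets (distr (gauss q) (Rvec q) (radial q))" by (simp add: sphere_unif_def)
    fix A assume "A \<in> sets (sphere_unif q)"
    then have A[measurable]: "A \<in> sets (Rvec q)" by (simp add: sphere_unif_def)
    let ?I = "\<integral>\<^sup>+z. indicator A (radial q z) * indicator ?B z \<partial>?L"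
    have "emeasure (sphere_unif q) A = (\<integral>\<^sup>+x. indicator A x \<partial>sphere_unif q)"
      by (simp add: sphere_unif_def)
    also have "\<dots> = (\<integral>\<^sup>+z. indicator A (radial q z) \<partial>uniform_measure ?L ?B)"
      unfolding sphere_unif_def by (rule nn_integral_distr) measurable
    also have "\<dots> = ?I / emeasure ?L ?B"
      by (rule nn_integral_uniform_measure) measurable
    also have "\<dots> = (c' * ?I * emeasure ?L ?B) / emeasure ?L ?B"
    proof -
      have "c' * ?I * emeasure ?L ?B = (c' * emeasure ?L ?B) * ?I" by (simp only: mult_ac)
      also have "\<dots> = ?I" unfolding \<open>c' * emeasure ?L ?B = 1\<close> by simp
      finally show ?thesis by (simp only:)
    qed
    also have "\<dots> = c' * ?I" using nz by (intro mult_divide_eq_ennreal) auto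
    finally show "emeasure (sphere_unif q) A = emeasure (distr (gauss q) (Rvec q) (radial q)) A"
      using key[OF A] by simp
  qed
qed

abbreviation ell_map :: "nat \<Rightarrow> nat \<Rightarrow> (nat \<Rightarrow> real) \<Rightarrow> (nat \<Rightarrow> nat \<Rightarrow> real) \<Rightarrow> real \<times> (nat \<Rightarrow> real) \<Rightarrow> nat \<Rightarrow> real" where
  "ell_map d q mu A \<equiv> \<lambda>(r, z). \<lambda>i\<in>{..<d}. mu i + r * (mv q A z i / vnorm q z)"

lemma ell_law_eq:
  assumes nu: "prob_space nu" and nb: "sets nu = sets borel"
  shows "ell_law d q mu A nu = distr (nu \<Otimes>\<^sub>M gauss q) (Rvec d) (ell_map d q mu A)"
    and "ell_map d q mu A \<in> measurable (nu \<Otimes>\<^sub>M gauss q) (Rvec d)"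
proof -
  interpret nu: prob_space nu by (rule nu)
  have [measurable_cong]: "sets nu = sets borel" by (rule nb)
  let ?f = "\<lambda>(r, u). \<lambda>i\<in>{..<d}. mu i + r * (\<Sum>j<q. A i j * u j)"
  have f: "?f \<in> measurable (nu \<Otimes>\<^sub>M Rvec q) (Rvec d)"
    unfolding split_def
  proof (intro measurable_restrict borel_measurable_add borel_measurable_times borel_measurable_sum borel_measurable_const)
    show "fst \<in> borel_measurable (nu \<Otimes>\<^sub>M Rvec q)" by measurable
    fix j assume "j \<in> {..<q}"
    then show "(\<lambda>x. snd x j) \<in> borel_measurable (nu \<Otimes>\<^sub>M Rvec q)"
      by (intro measurable_compose[OF measurable_snd coord_measurable]) simp
  qed
  have "nu \<Otimes>\<^sub>M sphere_unif q = distr nu nu (\<lambda>r. r) \<Otimes>\<^sub>M distr (gauss q) (Rvec q) (radial q)"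
    by (simp add: sphere_unif_eq_gauss)
  also have "\<dots> = distr (nu \<Otimes>\<^sub>M gauss q) (nu \<Otimes>\<^sub>M Rvec q) (\<lambda>(r, z). (r, radial q z))"
  proof (rule pair_measure_distr)
    show "sigma_finite_measure (distr (gauss q) (Rvec q) (radial q))"
      by (intro prob_space_imp_sigma_finite gauss.prob_space_distr) measurable
  qed auto
  finally have e: "nu \<Otimes>\<^sub>M sphere_unif q = distr (nu \<Otimes>\<^sub>M gauss q) (nu \<Otimes>\<^sub>M Rvec q) (\<lambda>(r, z). (r, radial q z))" .
  have m: "(\<lambda>(r, z). (r, radial q z)) \<in> measurable (nu \<Otimes>\<^sub>M gauss q) (nu \<Otimes>\<^sub>M Rvec q)"
    by measurable
  have comp: "?f \<circ> (\<lambda>(r, z). (r, radial q z)) = ell_map d q mu A"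
    by (auto simp: fun_eq_iff mv_def ip_def restrict_def sum_divide_distrib)
  show "ell_law d q mu A nu = distr (nu \<Otimes>\<^sub>M gauss q) (Rvec d) (ell_map d q mu A)"
    unfolding ell_law_def e by (subst distr_distr[OF f m]) (simp only: comp)
  show "ell_map d q mu A \<in> measurable (nu \<Otimes>\<^sub>M gauss q) (Rvec d)"
    using measurable_comp[OF m f] by (simp only: comp)
qed

text \<open>The small ball bound tends to 0 with its level, so A z is almost surely nonzero once A
  is.\<close>

lemma gauss_mv_pos: assumes "frob d q A > 0" shows "AE z in gauss q. vnorm d (mv q A z) > 0"
proof -
  let ?S = "\<lambda>e. {z\<in>space (gauss q). (vnorm d (mv q A z))\<^sup>2 \<le> e * frob d q A}"
  let ?N = "{z\<in>space (gauss q). vnorm d (mv q A z) = 0}"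
  have N[measurable]: "?N \<in> sets (gauss q)" by measurable
  have le: "gauss.prob q ?N \<le> e" if "e > 0" for e
  proof -
    have "gauss.prob q ?N \<le> gauss.prob q (?S ((e / 2)\<^sup>2))"
    proof (rule gauss.finite_measure_mono)
      show "?S ((e / 2)\<^sup>2) \<in> sets (gauss q)" by measurable
    qed (use assms in auto)
    also have "\<dots> \<le> 2 * sqrt ((e / 2)\<^sup>2)" using that assms by (intro gauss_small_ball) auto
    also have "\<dots> = e" using that by simp
    finally show ?thesis .
  qed
  have "gauss.prob q ?N \<le> 0"
  proof (rule field_le_epsilon)
    fix e :: real assume "0 < e"
    from le[OF this] show "gauss.prob q ?N \<le> 0 + e" by simp
  qed
  then have "gauss.prob q ?N = 0" by (simp add: measure_le_0_iff)
  then have "AE z in gauss q. z \<notin> ?N"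
    by (intro AE_not_in) (auto simp: null_sets_def gauss.emeasure_eq_measure)
  then show ?thesis
    by (rule AE_mp) (use vnorm_nonneg in \<open>auto intro!: AE_I2 simp: less_le\<close>)
qed

lemma mv_idm: "j < q \<Longrightarrow> mv q (idm q) z j = z j"
  by (simp add: mv_def ip_def idm_def if_distrib[of "\<lambda>x. x * _"] cong: if_cong)

lemma vnorm_mv_idm: "vnorm q (mv q (idm q) z) = vnorm q z"
  by (rule vnorm_cong) (rule mv_idm)

lemma frob_idm: "frob q q (idm q) = real q"
proof -
  have "(\<Sum>k<q. (idm q i k)\<^sup>2) = 1" if "i < q" for i
    using that by (simp add: idm_def if_distrib[of "\<lambda>x. x\<^sup>2"] cong: if_cong)
  then show ?thesis by (simp add: frob_def vnorm_sq_sum)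
qed

lemma gauss_norm_small_ball:
  assumes "\<epsilon> > 0" "q > 0"
  shows "gauss.prob q {z\<in>space (gauss q). (vnorm q z)\<^sup>2 \<le> \<epsilon> * real q} \<le> 2 * sqrt \<epsilon>"
  using gauss_small_ball[of \<epsilon> q q "idm q"] assms by (simp add: vnorm_mv_idm frob_idm)

lemma gauss_norm_sq: "integrable (gauss q) (\<lambda>z. (vnorm q z)\<^sup>2)" "(\<integral>z. (vnorm q z)\<^sup>2 \<partial>gauss q) = real q"
  using gauss_mv_sq[of q q "idm q"] by (simp_all add: vnorm_mv_idm frob_idm)

lemma gauss_norm_large:
  assumes "K > 0" "q > 0"
  shows "gauss.prob q {z\<in>space (gauss q). K * real q \<le> (vnorm q z)\<^sup>2} \<le> 1 / K"
proof -
  have "gauss.prob q {z\<in>space (gauss q). K * real q \<le> (vnorm q z)\<^sup>2} \<le> (\<integral>z. (vnorm q z)\<^sup>2 \<partial>gauss q) / (K * real q)"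
    by (rule integral_Markov_inequality_measure[where A = "space (gauss q)" and u = "\<lambda>z. (vnorm q z)\<^sup>2", simplified])
       (use gauss_norm_sq assms in auto)
  then show ?thesis using assms by (simp add: gauss_norm_sq)
qed

lemma gauss_mv_large:
  assumes "K > 0" "frob d q A > 0"
  shows "gauss.prob q {z\<in>space (gauss q). K * frob d q A \<le> (vnorm d (mv q A z))\<^sup>2} \<le> 1 / K"
proof -
  have "gauss.prob q {z\<in>space (gauss q). K * frob d q A \<le> (vnorm d (mv q A z))\<^sup>2} \<le> (\<integral>z. (vnorm d (mv q A z))\<^sup>2 \<partial>gauss q) / (K * frob d q A)"
    by (rule integral_Markov_inequality_measure[where A = "space (gauss q)" and u = "\<lambda>z. (vnorm d (mv q A z))\<^sup>2", simplified])
       (use gauss_mv_sq assms in auto)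
  then show ?thesis using assms by (simp add: gauss_mv_sq)
qed

section \<open>Sign covariance of A z and operator norm of A\<close>

definition gdir :: "nat \<Rightarrow> nat \<Rightarrow> (nat \<Rightarrow> nat \<Rightarrow> real) \<Rightarrow> nat \<Rightarrow> nat \<Rightarrow> real" where
  "gdir d q A = (\<lambda>i j. \<integral>z. ssign d (mv q A z) i * ssign d (mv q A z) j \<partial>gauss q)"

lemma ssign_mv_measurable: "j < d \<Longrightarrow> (\<lambda>z. ssign d (mv q A z) j) \<in> borel_measurable (Rvec q)"
  unfolding ssign_def using mv_measurable[of q A j] vnorm_mv_measurable[of d q A] by measurable

lemma ssign_mv_integrable:
  assumes "i < d" "j < d"
  shows "integrable (gauss q) (\<lambda>z. ssign d (mv q A z) i * ssign d (mv q A z) j)"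
proof (rule gauss.integrable_const_bound[of _ 1])
  show "AE z in gauss q. norm (ssign d (mv q A z) i * ssign d (mv q A z) j) \<le> 1"
    using abs_ssign_le[OF assms(1)] abs_ssign_le[OF assms(2)]
    by (auto intro!: AE_I2 mult_le_one simp: abs_mult)
  show "(\<lambda>z. ssign d (mv q A z) i * ssign d (mv q A z) j) \<in> borel_measurable (gauss q)"
    using ssign_mv_measurable[OF assms(1)] ssign_mv_measurable[OF assms(2)]
    by (simp add: measurable_cong_sets[OF sets_gauss refl])
qed

lemma ip_ssign_sq_integrable:
  "integrable (gauss q) (\<lambda>z. (ip d (ssign d (mv q A z)) v)\<^sup>2)"
  "(\<integral>z. (ip d (ssign d (mv q A z)) v)\<^sup>2 \<partial>gauss q) = qform d (gdir d q A) v"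
proof -
  have e: "(ip d (ssign d (mv q A z)) v)\<^sup>2 = (\<Sum>i<d. \<Sum>j<d. v i * (ssign d (mv q A z) i * ssign d (mv q A z) j) * v j)" for z
    by (simp add: ip_def power2_eq_square sum_product mult_ac)
  show "integrable (gauss q) (\<lambda>z. (ip d (ssign d (mv q A z)) v)\<^sup>2)"
    unfolding e by (intro Bochner_Integration.integrable_sum integrable_mult_left integrable_mult_right ssign_mv_integrable) auto
  show "(\<integral>z. (ip d (ssign d (mv q A z)) v)\<^sup>2 \<partial>gauss q) = qform d (gdir d q A) v"
  proof -
    let ?F = "\<lambda>i j z. v i * (ssign d (mv q A z) i * ssign d (mv q A z) j) * v j"
    have I: "integrable (gauss q) (?F i j)" if "i < d" "j < d" for i j
      by (intro integrable_mult_left integrable_mult_right ssign_mv_integrable that)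
    have "(\<integral>z. (\<Sum>i<d. \<Sum>j<d. ?F i j z) \<partial>gauss q) = (\<Sum>i<d. \<integral>z. (\<Sum>j<d. ?F i j z) \<partial>gauss q)"
      by (intro Bochner_Integration.integral_sum Bochner_Integration.integrable_sum I) auto
    also have "\<dots> = (\<Sum>i<d. \<Sum>j<d. \<integral>z. ?F i j z \<partial>gauss q)"
      by (intro sum.cong refl Bochner_Integration.integral_sum I) auto
    finally show ?thesis unfolding e qform_def gdir_def by simp
  qed
qed

lemma adj_norm_le_frob: "(vnorm q (adj d A v))\<^sup>2 \<le> frob d q A * (vnorm d v)\<^sup>2"
proof -
  have "(adj d A v k)\<^sup>2 \<le> (\<Sum>i<d. (A i k)\<^sup>2) * (vnorm d v)\<^sup>2" for k
    using ip_sq_le[of d "\<lambda>i. A i k" v] by (simp add: ip_def adj_def vnorm_sq_sum)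
  then have "(vnorm q (adj d A v))\<^sup>2 \<le> (\<Sum>k<q. (\<Sum>i<d. (A i k)\<^sup>2) * (vnorm d v)\<^sup>2)"
    unfolding vnorm_sq_sum[of q] by (intro sum_mono)
  then show ?thesis by (simp add: frob_swap sum_distrib_right)
qed

text \<open>The squared operator norm of A, taken through the transpose because the unit vectors of
  the spectral problem live in R^d.\<close>

definition opsq :: "nat \<Rightarrow> nat \<Rightarrow> (nat \<Rightarrow> nat \<Rightarrow> real) \<Rightarrow> real" where
  "opsq d q A = Sup {(vnorm q (adj d A v))\<^sup>2 | v. vnorm d v = 1}"

lemma opsq_upper: "(vnorm q (adj d A v))\<^sup>2 \<le> opsq d q A * (vnorm d v)\<^sup>2"
proof (cases "vnorm d v = 0")
  case True then show ?thesis using adj_norm_le_frob[of q d A v] by simp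
next
  case False
  define c where "c = 1 / vnorm d v"
  have c: "c > 0" using False vnorm_nonneg[of d v] by (simp add: c_def less_le)
  have b: "bdd_above {(vnorm q (adj d A v))\<^sup>2 | v. vnorm d v = 1}"
  proof (rule bdd_aboveI)
    fix x assume "x \<in> {(vnorm q (adj d A v))\<^sup>2 | v. vnorm d v = 1}"
    then obtain w where "vnorm d w = 1" "x = (vnorm q (adj d A w))\<^sup>2" by blast
    then show "x \<le> frob d q A" using adj_norm_le_frob[of q d A w] by simp
  qed
  have "vnorm d (\<lambda>i. c * v i) = 1" using False by (simp only: vnorm_scale) (simp add: c_def)
  then have "(vnorm q (adj d A (\<lambda>i. c * v i)))\<^sup>2 \<le> opsq d q A"
    unfolding opsq_def by (intro cSup_upper b) auto
  then have "c\<^sup>2 * (vnorm q (adj d A v))\<^sup>2 \<le> opsq d q A"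
    by (simp add: adj_scale vnorm_scale power_mult_distrib)
  then show ?thesis using False by (simp add: c_def field_simps)
qed

lemma opsq_least:
  assumes d: "d \<ge> 1" and b: "\<And>v. vnorm d v = 1 \<Longrightarrow> (vnorm q (adj d A v))\<^sup>2 \<le> b"
  shows "opsq d q A \<le> b"
  unfolding opsq_def using unit_vector_exists[OF d] b by (intro cSup_least) auto

lemma opsq_le_frob: "d \<ge> 1 \<Longrightarrow> opsq d q A \<le> frob d q A"
proof (rule opsq_least)
  fix v assume "vnorm d v = 1"
  then show "(vnorm q (adj d A v))\<^sup>2 \<le> frob d q A" using adj_norm_le_frob[of q d A v] by simp
qed

lemma opsq_pos: assumes f: "frob d q A > 0" shows "opsq d q A > 0"
proof (rule ccontr)
  assume "\<not> opsq d q A > 0"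
  have z: "vnorm q (adj d A v) = 0" for v
  proof -
    have "(vnorm q (adj d A v))\<^sup>2 \<le> opsq d q A * (vnorm d v)\<^sup>2" by (rule opsq_upper)
    also have "\<dots> \<le> 0" using \<open>\<not> opsq d q A > 0\<close> by (intro mult_nonpos_nonneg) auto
    finally show ?thesis by simp
  qed
  have "A i k = 0" if "i < d" "k < q" for i k
  proof -
    have "adj d A (\<lambda>j. if j = i then 1 else 0) k = A i k"
      using that by (simp add: adj_def if_distrib[of "\<lambda>x. _ * x"] cong: if_cong)
    moreover have "adj d A (\<lambda>j. if j = i then 1 else 0) k = 0" using z[of "\<lambda>j. if j = i then 1 else 0"] that
      by (simp add: vnorm_zero_iff)
    ultimately show ?thesis by simp
  qed
  then have "frob d q A = 0" by (simp add: frob_def vnorm_sq_sum)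
  then show False using f by simp
qed

text \<open>|A a|^2 = <A'A a, a>; Cauchy-Schwarz and the bound for the transpose apply, and one
  factor |A a|^2 is divided out.\<close>

lemma mv_norm_le_opsq: assumes "frob d q A > 0" shows "(vnorm d (mv q A a))\<^sup>2 \<le> opsq d q A * (vnorm q a)\<^sup>2"
proof (cases "vnorm d (mv q A a) = 0")
  case True then show ?thesis using opsq_pos[OF assms] by simp
next
  case False
  let ?n = "vnorm d (mv q A a)"
  have "?n\<^sup>2 = ip q (adj d A (mv q A a)) a" using ip_mv_adj[of d "mv q A a" q A a] by (simp add: vnorm_sq)
  then have "(?n\<^sup>2)\<^sup>2 \<le> (vnorm q (adj d A (mv q A a)))\<^sup>2 * (vnorm q a)\<^sup>2" by (simp add: ip_sq_le)
  also have "\<dots> \<le> (opsq d q A * ?n\<^sup>2) * (vnorm q a)\<^sup>2" by (intro mult_right_mono opsq_upper) auto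
  finally have "?n\<^sup>2 * ?n\<^sup>2 \<le> (opsq d q A * (vnorm q a)\<^sup>2) * ?n\<^sup>2" by (simp add: power2_eq_square mult_ac)
  then show ?thesis by (rule mult_right_le_imp_le) (use False in simp)
qed

text \<open>The weight of a direction in the spatial-sign covariance controls its weight in the scatter matrix,
  since the fourth moments of a Gaussian vector with large effective rank nearly factorise.\<close>

lemma opsq_le_sign_covariance:
  assumes f: "frob d q A > 0" and d: "d \<ge> 1"
    and l: "\<And>v. vnorm d v = 1 \<Longrightarrow> qform d (gdir d q A) v \<le> l"
  shows "opsq d q A \<le> l * (frob d q A + 2 * opsq d q A)"
proof (rule opsq_least[OF d])
  fix v assume v: "vnorm d v = 1"
  define a where "a = adj d A v"
  define t where "t = frob d q A + 2 * opsq d q A"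
  have t: "t > 0" using f opsq_pos[OF f] by (simp add: t_def)
  let ?n = "\<lambda>z. vnorm d (mv q A z)"
  have prod: "integrable (gauss q) (\<lambda>z. (ip q a z)\<^sup>2 * (?n z)\<^sup>2)"
    "(\<integral>z. (ip q a z)\<^sup>2 * (?n z)\<^sup>2 \<partial>gauss q) \<le> (vnorm q a)\<^sup>2 * t"
  proof -
    have e: "(ip q a z)\<^sup>2 * (?n z)\<^sup>2 = (\<Sum>i<d. (ip q a z)\<^sup>2 * (ip q (A i) z)\<^sup>2)" for z
      by (simp add: vnorm_sq_sum[of d] mv_def sum_distrib_left)
    show "integrable (gauss q) (\<lambda>z. (ip q a z)\<^sup>2 * (?n z)\<^sup>2)"
      unfolding e by (intro Bochner_Integration.integrable_sum gauss_ip_sq_ip_sq)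
    have "(\<integral>z. (ip q a z)\<^sup>2 * (?n z)\<^sup>2 \<partial>gauss q) = (\<Sum>i<d. (vnorm q a)\<^sup>2 * (vnorm q (A i))\<^sup>2 + 2 * (ip q a (A i))\<^sup>2)"
      unfolding e by (simp add: gauss_ip_sq_ip_sq)
    also have "\<dots> = (vnorm q a)\<^sup>2 * frob d q A + 2 * (vnorm d (mv q A a))\<^sup>2"
      by (simp add: sum.distrib frob_def sum_distrib_left vnorm_sq_sum[of d] mv_def ip_commute)
    also have "\<dots> \<le> (vnorm q a)\<^sup>2 * frob d q A + 2 * (opsq d q A * (vnorm q a)\<^sup>2)"
      using mv_norm_le_opsq[OF f, of a] by simp
    also have "\<dots> = (vnorm q a)\<^sup>2 * t" by (simp add: t_def algebra_simps)
    finally show "(\<integral>z. (ip q a z)\<^sup>2 * (?n z)\<^sup>2 \<partial>gauss q) \<le> (vnorm q a)\<^sup>2 * t" .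
  qed
  \<comment> \<open>With u the direction of A z, <a, z>^2 = x y for x = <u, v> and y = |A z| <a, z>.
    AM-GM separates the sign covariance from a fourth moment. As that moment is at most t |a|^2, the
    weight t makes its term return just half of |a|^2.\<close>
  have pw: "(ip q a z)\<^sup>2 \<le> (t * (ip d (ssign d (mv q A z)) v)\<^sup>2 + (1 / t) * ((ip q a z)\<^sup>2 * (?n z)\<^sup>2)) / 2" for z
  proof -
    define x where "x = ip d (ssign d (mv q A z)) v"
    define y where "y = ?n z * ip q a z"
    have "ip q a z = ?n z * x"
    proof -
      have "ip q a z = ip d v (mv q A z)" by (simp add: a_def ip_mv_adj)
      also have "\<dots> = ip d v (\<lambda>j. ?n z * ssign d (mv q A z) j)"
        unfolding ip_def by (intro sum.cong refl) (simp add: ssign_scaled)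
      also have "\<dots> = ?n z * x" by (simp add: ip_scale_right x_def ip_commute)
      finally show ?thesis .
    qed
    then have xy: "(ip q a z)\<^sup>2 = x * y" by (simp add: y_def power2_eq_square)
    have e: "sqrt t * x * (y / sqrt t) = x * y" "(sqrt t * x)\<^sup>2 = t * x\<^sup>2" "(y / sqrt t)\<^sup>2 = y\<^sup>2 / t"
      using t by (simp_all add: power_mult_distrib power_divide)
    have "2 * (x * y) \<le> t * x\<^sup>2 + y\<^sup>2 / t"
      using sum_squares_bound[of "sqrt t * x" "y / sqrt t"] unfolding mult.assoc[of 2] e .
    moreover have "y\<^sup>2 = (ip q a z)\<^sup>2 * (?n z)\<^sup>2" by (simp add: y_def power_mult_distrib mult.commute)
    ultimately show ?thesis unfolding x_def[symmetric] by (simp add: xy)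
  qed
  have "(vnorm q a)\<^sup>2 = (\<integral>z. (ip q a z)\<^sup>2 \<partial>gauss q)" by (simp add: gauss_ip_sq)
  also have "\<dots> \<le> (\<integral>z. (t * (ip d (ssign d (mv q A z)) v)\<^sup>2 + (1 / t) * ((ip q a z)\<^sup>2 * (?n z)\<^sup>2)) / 2 \<partial>gauss q)"
    by (intro integral_mono gauss_ip_sq integrable_divide Bochner_Integration.integrable_add integrable_mult_right prod ip_ssign_sq_integrable pw)
  also have "\<dots> = (t * qform d (gdir d q A) v + (1 / t) * (\<integral>z. (ip q a z)\<^sup>2 * (?n z)\<^sup>2 \<partial>gauss q)) / 2"
    using prod(1) ip_ssign_sq_integrable[of q d A v] by simp
  also have "\<dots> \<le> (t * l + (1 / t) * ((vnorm q a)\<^sup>2 * t)) / 2"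
    using t l[OF v] prod(2) by (intro divide_right_mono add_mono mult_left_mono) auto
  also have "\<dots> = t * l / 2 + (vnorm q a)\<^sup>2 / 2" using t by (simp add: field_simps)
  finally show "(vnorm q (adj d A v))\<^sup>2 \<le> l * (frob d q A + 2 * opsq d q A)"
    by (simp add: a_def t_def mult.commute)
qed

lemma gauss_uminus_distr: "distr (gauss q) (gauss q) (\<lambda>z. \<lambda>j\<in>{..<q}. - z j) = gauss q"
proof (rule measure_eqI)
  have T: "(\<lambda>z. \<lambda>j\<in>{..<q}. - z j) \<in> measurable (Rvec q) (Rvec q)"
    using restrict_affine_measurable[where c = "-1" and t = "\<lambda>_. 0" and q = q] by simp
  then have T'[measurable]: "(\<lambda>z. \<lambda>j\<in>{..<q}. - z j) \<in> measurable (gauss q) (gauss q)"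
    by (simp add: measurable_cong_sets[OF sets_gauss sets_gauss])
  fix B assume "B \<in> sets (distr (gauss q) (gauss q) (\<lambda>z. \<lambda>j\<in>{..<q}. - z j))"
  then have B: "B \<in> sets (gauss q)" by simp
  then have Bm: "indicator B \<in> borel_measurable (Rvec q)" by (simp add: sets_gauss)
  have "emeasure (distr (gauss q) (gauss q) (\<lambda>z. \<lambda>j\<in>{..<q}. - z j)) B
      = (\<integral>\<^sup>+z. indicator B z \<partial>distr (gauss q) (gauss q) (\<lambda>z. \<lambda>j\<in>{..<q}. - z j))" using B by simp
  also have "\<dots> = (\<integral>\<^sup>+z. indicator B (\<lambda>j\<in>{..<q}. - z j) \<partial>gauss q)"
    using B by (intro nn_integral_distr) auto
  also have "\<dots> = (\<integral>\<^sup>+z. indicator B z \<partial>gauss q)" by (rule gauss_uminus[OF Bm, symmetric])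
  finally show "emeasure (distr (gauss q) (gauss q) (\<lambda>z. \<lambda>j\<in>{..<q}. - z j)) B = emeasure (gauss q) B"
    using B by simp
qed simp

lemma ssign_cong: "(\<And>i. i < d \<Longrightarrow> x i = y i) \<Longrightarrow> j < d \<Longrightarrow> ssign d x j = ssign d y j"
  using vnorm_cong[of d x y] by (simp add: ssign_def)

lemma ssign_scale: "c > 0 \<Longrightarrow> ssign d (\<lambda>i. c * x i) j = ssign d x j"
  by (simp add: ssign_def vnorm_scale)

lemma ssign_uminus: "ssign d (\<lambda>i. - x i) j = - ssign d x j"
  using vnorm_scale[of d "-1" x] by (simp add: ssign_def)

section \<open>The elliptical model: law of the directions and reflection symmetry\<close>

abbreviation dirmap :: "nat \<Rightarrow> (nat \<Rightarrow> real) \<Rightarrow> nat \<Rightarrow> real" where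
  "dirmap d x \<equiv> \<lambda>j\<in>{..<d}. ssign d x j"

text \<open>A positive radius makes the direction of X - mu that of A z, and A \<noteq> 0 makes this
  direction well defined almost surely.\<close>

locale elliptical =
  fixes d q :: nat and mu :: "nat \<Rightarrow> real" and A :: "nat \<Rightarrow> nat \<Rightarrow> real" and nu :: "real measure"
  assumes nu: "prob_space nu" and nb: "sets nu = sets borel"
    and r_pos: "AE r in nu. 0 < r"
    and f_pos: "frob d q A > 0"
begin

abbreviation P :: "(nat \<Rightarrow> real) measure" where "P \<equiv> ell_law d q mu A nu"
abbreviation Y :: "(real \<times> (nat \<Rightarrow> real)) measure" where "Y \<equiv> nu \<Otimes>\<^sub>M gauss q"
definition em :: "real \<times> (nat \<Rightarrow> real) \<Rightarrow> nat \<Rightarrow> real" where "em = ell_map d q mu A"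

sublocale nu: prob_space nu by (rule nu)
sublocale Y: pair_prob_space nu "gauss q" ..

lemma q_pos: "q > 0"
  using f_pos by (cases "q = 0") (auto simp: frob_def vnorm_def)

lemma d_pos: "d \<ge> 1"
  using f_pos by (cases "d = 0") (auto simp: frob_def)

lemma P_eq: "P = distr Y (Rvec d) em" and em_measurable: "em \<in> measurable Y (Rvec d)"
  using ell_law_eq[OF nu nb, where d = d and q = q and mu = mu and A = A] unfolding em_def by - assumption+

lemma prob_space_P: "prob_space P"
  unfolding P_eq by (rule Y.prob_space_distr[OF em_measurable])

sublocale P: prob_space P by (rule prob_space_P)

lemma sets_P [measurable_cong]: "sets P = sets (Rvec d)"
  by (simp add: P_eq)

lemma em_diff: "i < d \<Longrightarrow> (em p - mu) i = fst p * inverse (vnorm q (snd p)) * mv q A (snd p) i"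
  by (simp add: em_def split_def divide_inverse mult_ac)

lemma vnorm_em: "vnorm d (em p - mu) = \<bar>fst p\<bar> * (vnorm d (mv q A (snd p)) * inverse (vnorm q (snd p)))"
proof -
  have "vnorm d (em p - mu) = vnorm d (\<lambda>i. fst p * inverse (vnorm q (snd p)) * mv q A (snd p) i)"
    by (rule vnorm_cong) (rule em_diff)
  then show ?thesis by (simp add: vnorm_scale abs_mult mult_ac)
qed

lemma inverse_vnorm_em:
  "inverse (vnorm d (em p - mu)) = inverse \<bar>fst p\<bar> * (vnorm q (snd p) * inverse (vnorm d (mv q A (snd p))))"
  unfolding vnorm_em by (simp add: mult_ac)

lemma distr_snd: "distr Y (gauss q) snd = gauss q"
proof (rule measure_eqI)
  fix B assume "B \<in> sets (distr Y (gauss q) snd)"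
  then have B: "B \<in> sets (gauss q)" by simp
  have "snd -` B \<inter> space Y = space nu \<times> B" using sets.sets_into_space[OF B] by (auto simp: space_pair_measure)
  then show "emeasure (distr Y (gauss q) snd) B = emeasure (gauss q) B"
    using B by (simp add: emeasure_distr gauss.emeasure_pair_measure_Times nu.emeasure_space_1)
qed simp

lemma AE_gauss_pos: "AE z in gauss q. vnorm q z > 0"
  using gauss_mv_pos[of q q "idm q"] q_pos by (simp add: vnorm_mv_idm frob_idm)

lemma AE_Y: "AE p in Y. 0 < fst p \<and> 0 < vnorm q (snd p) \<and> 0 < vnorm d (mv q A (snd p))"
proof -
  have "AE p in Y. 0 < fst p"
  proof -
    have e: "distr Y nu fst = nu" by (rule gauss.distr_pair_fst)
    show ?thesis by (rule AE_distrD[where P = "\<lambda>r. 0 < r" and f = fst and M' = nu]) (simp_all only: e r_pos measurable_fst)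
  qed
  moreover have "AE p in Y. 0 < vnorm q (snd p) \<and> 0 < vnorm d (mv q A (snd p))"
  proof (rule AE_distrD[of snd Y "gauss q"])
    show "AE z in distr Y (gauss q) snd. 0 < vnorm q z \<and> 0 < vnorm d (mv q A z)"
      unfolding distr_snd using AE_gauss_pos gauss_mv_pos[OF f_pos] by simp
  qed simp
  ultimately show ?thesis by auto
qed

lemma ssign_em:
  assumes "0 < fst p" "0 < vnorm q (snd p)" "j < d"
  shows "ssign d (em p - mu) j = ssign d (mv q A (snd p)) j"
proof -
  have "ssign d (em p - mu) j = ssign d (\<lambda>i. (fst p * inverse (vnorm q (snd p))) * mv q A (snd p) i) j"
    by (rule ssign_cong) (use em_diff assms in auto)
  then show ?thesis using assms by (simp add: ssign_scale)
qed

lemma diff_measurable: "j < d \<Longrightarrow> (\<lambda>x. (x - mu) j) \<in> borel_measurable (Rvec d)"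
  using coord_measurable[of j d] by simp

lemma vnorm_diff_measurable [measurable]: "(\<lambda>x. vnorm d (x - mu)) \<in> borel_measurable (Rvec d)"
  unfolding vnorm_def by (intro measurable_compose[OF _ borel_measurable_sqrt] borel_measurable_sum borel_measurable_power diff_measurable) auto

lemma ssign_diff_measurable: "j < d \<Longrightarrow> (\<lambda>x. ssign d (x - mu) j) \<in> borel_measurable (Rvec d)"
  unfolding ssign_def using diff_measurable[of j] by measurable

lemma dirmap_diff_measurable: "(\<lambda>x. dirmap d (x - mu)) \<in> measurable (Rvec d) (Rvec d)"
  by (intro measurable_restrict ssign_diff_measurable) auto

lemma AE_P_pos: "AE x in P. vnorm d (x - mu) > 0"
proof -
  have "AE p in Y. 0 < vnorm d (em p - mu)"
    using AE_Y by eventually_elim (simp add: vnorm_em)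
  then show ?thesis unfolding P_eq
    by (subst AE_distr_iff[OF em_measurable]) measurable
qed

text \<open>The factor r / |z| is positive outside a null event and disappears in the sign.\<close>

lemma direction_law:
  "distr P (Rvec d) (\<lambda>x. dirmap d (x - mu)) = distr (gauss q) (Rvec d) (\<lambda>z. dirmap d (mv q A z))"
proof -
  have m: "(\<lambda>z. dirmap d (mv q A z)) \<in> measurable (gauss q) (Rvec d)"
    by (intro measurable_restrict) (simp add: measurable_cong_sets[OF sets_gauss refl] ssign_mv_measurable)
  have "distr P (Rvec d) (\<lambda>x. dirmap d (x - mu)) = distr Y (Rvec d) ((\<lambda>x. dirmap d (x - mu)) \<circ> em)"
    unfolding P_eq by (rule distr_distr[OF dirmap_diff_measurable em_measurable])
  also have "\<dots> = distr Y (Rvec d) ((\<lambda>z. dirmap d (mv q A z)) \<circ> snd)"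
  proof (rule distr_cong_AE)
    show "AE p in Y. ((\<lambda>x. dirmap d (x - mu)) \<circ> em) p = ((\<lambda>z. dirmap d (mv q A z)) \<circ> snd) p"
      using AE_Y by eventually_elim (auto simp: restrict_def fun_eq_iff ssign_em)
    show "(\<lambda>x. dirmap d (x - mu)) \<circ> em \<in> Y \<rightarrow>\<^sub>M Rvec d"
      by (rule measurable_comp[OF em_measurable dirmap_diff_measurable])
    show "(\<lambda>z. dirmap d (mv q A z)) \<circ> snd \<in> Y \<rightarrow>\<^sub>M Rvec d"
      by (rule measurable_comp[OF measurable_snd m])
  qed auto
  also have "\<dots> = distr (distr Y (gauss q) snd) (Rvec d) (\<lambda>z. dirmap d (mv q A z))"
    by (rule distr_distr[OF m measurable_snd, symmetric])
  also have "distr Y (gauss q) snd = gauss q" by (rule distr_snd)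
  finally show ?thesis .
qed

lemma sscm_eq: assumes "i < d" "j < d" shows "sscm d mu P i j = gdir d q A i j"
proof -
  have m: "(\<lambda>z. dirmap d (mv q A z)) \<in> measurable (gauss q) (Rvec d)"
    by (intro measurable_restrict) (simp add: measurable_cong_sets[OF sets_gauss refl] ssign_mv_measurable)
  have m2: "(\<lambda>x. dirmap d (x - mu)) \<in> measurable P (Rvec d)"
    using dirmap_diff_measurable by (simp add: measurable_cong_sets[OF sets_P refl])
  have uu: "(\<lambda>u. u i * u j) \<in> borel_measurable (Rvec d)"
    using assms by (intro borel_measurable_times coord_measurable) auto
  have "sscm d mu P i j = (\<integral>u. u i * u j \<partial>distr P (Rvec d) (\<lambda>x. dirmap d (x - mu)))"
    unfolding sscm_def by (subst integral_distr[OF m2 uu]) (use assms in simp)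
  also have "\<dots> = gdir d q A i j"
    unfolding direction_law gdir_def by (subst integral_distr[OF m uu]) (use assms in simp)
  finally show ?thesis .
qed

text \<open>The map z -> - z preserves the model and reflects X about mu. This centres the gradient
  of the objective and the first-order terms of the median correction.\<close>

lemma integral_odd_zero:
  assumes F: "F \<in> borel_measurable (Rvec d)"
    and odd: "\<And>x y. (\<And>i. i < d \<Longrightarrow> y i - mu i = - (x i - mu i)) \<Longrightarrow> F y = - F x"
  shows "(\<integral>x. F x \<partial>P) = (0::real)"
proof -
  let ?n = "\<lambda>z. \<lambda>j\<in>{..<q}. - z j"
  have n: "?n \<in> measurable (gauss q) (gauss q)"
    using restrict_affine_measurable[where c = "-1" and t = "\<lambda>_. 0" and q = q]
    by (simp add: measurable_cong_sets[OF sets_gauss sets_gauss])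
  let ?N = "\<lambda>(r, z). (r, ?n z)"
  have N: "?N \<in> measurable Y Y" using n by measurable
  have "distr nu nu (\<lambda>r. r) \<Otimes>\<^sub>M distr (gauss q) (gauss q) ?n = distr Y Y ?N"
    by (rule pair_measure_distr) (use n in \<open>auto simp: gauss_uminus_distr intro: prob_space_imp_sigma_finite[OF prob_space_gauss]\<close>)
  then have inv: "distr Y Y ?N = Y" by (simp add: gauss_uminus_distr)
  have Fe: "(\<lambda>p. F (em p)) \<in> borel_measurable Y" by (rule measurable_compose[OF em_measurable F])
  have sgn: "F (em (?N p)) = - F (em p)" for p
  proof (rule odd)
    fix i assume i: "i < d"
    obtain r z where p: "p = (r, z)" by (cases p)
    have "mv q A (?n z) i = - mv q A z i" by (simp add: mv_def ip_def sum_negf)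
    moreover have "vnorm q (?n z) = vnorm q z" by (simp add: vnorm_def)
    ultimately show "em (?N p) i - mu i = - (em p i - mu i)" using i by (simp add: p em_def)
  qed
  have "(\<integral>x. F x \<partial>P) = (\<integral>p. F (em p) \<partial>Y)" unfolding P_eq by (rule integral_distr[OF em_measurable F])
  also have "\<dots> = (\<integral>p. F (em p) \<partial>distr Y Y ?N)" unfolding inv ..
  also have "\<dots> = (\<integral>p. F (em (?N p)) \<partial>Y)" by (rule integral_distr[OF N Fe])
  also have "\<dots> = - (\<integral>p. F (em p) \<partial>Y)" unfolding sgn by simp
  also have "(\<integral>p. F (em p) \<partial>Y) = (\<integral>x. F x \<partial>P)" unfolding P_eq by (rule integral_distr[OF em_measurable F, symmetric])
  finally show ?thesis by simp
qed

text \<open>Picks one concrete positive radius out of an almost sure statement, so that facts on the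
  product space descend to a section that can be divided by a positive constant.\<close>

lemma ex_r_pos: assumes "AE r in nu. Q r" shows "\<exists>r>0. Q r"
proof (rule ccontr)
  assume "\<not> (\<exists>r>0. Q r)"
  have "AE r in nu. 0 < r \<and> Q r" using r_pos assms by eventually_elim simp
  then have "AE r in nu. False" by eventually_elim (use \<open>\<not> (\<exists>r>0. Q r)\<close> in auto)
  then show False by simp
qed

end

section \<open>Curvature of the population objective at the centre\<close>

definition curv_const :: "real \<Rightarrow> real \<Rightarrow> real" where
  "curv_const \<zeta> \<psi> = \<psi> / 4 * sqrt ((1 / (16 * \<zeta>))\<^sup>2 * (\<psi> / 8)\<^sup>2 / (8 * \<zeta> * (4 / \<psi>)))"

lemma curv_const_pos: "\<zeta> > 0 \<Longrightarrow> \<psi> > 0 \<Longrightarrow> curv_const \<zeta> \<psi> > 0"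
  by (simp add: curv_const_def)

context elliptical
begin

text \<open>The inverse distance of X from mu is the inverse radius times \<open>rho z\<close>, two
  independent factors.\<close>

definition rho :: "(nat \<Rightarrow> real) \<Rightarrow> real" where
  "rho z = vnorm q z * inverse (vnorm d (mv q A z))"

lemma rho_nonneg: "0 \<le> rho z"
  by (simp add: rho_def)

lemma rho_measurable [measurable]: "rho \<in> borel_measurable (Rvec q)"
  unfolding rho_def by measurable

lemma inverse_vnorm_em': "inverse (vnorm d (em p - mu)) = inverse \<bar>fst p\<bar> * rho (snd p)"
  by (simp add: inverse_vnorm_em rho_def)

lemma integral_P: "F \<in> borel_measurable (Rvec d) \<Longrightarrow> (\<integral>x. F x \<partial>P) = (\<integral>p. F (em p) \<partial>Y)" for F :: "(nat \<Rightarrow> real) \<Rightarrow> real"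
  unfolding P_eq by (rule integral_distr[OF em_measurable])

lemma integrable_P_iff: "F \<in> borel_measurable (Rvec d) \<Longrightarrow> integrable P F \<longleftrightarrow> integrable Y (\<lambda>p. F (em p))" for F :: "(nat \<Rightarrow> real) \<Rightarrow> real"
  unfolding P_eq by (rule integrable_distr_eq[OF em_measurable])

lemma integral_split:
  fixes a :: "real \<Rightarrow> real" and b :: "(nat \<Rightarrow> real) \<Rightarrow> real"
  assumes "integrable Y (\<lambda>p. a (fst p) * b (snd p))"
  shows "(\<integral>p. a (fst p) * b (snd p) \<partial>Y) = (\<integral>r. a r \<partial>nu) * (\<integral>z. b z \<partial>gauss q)"
  using Y.integral_fst'[OF assms] by simp

text \<open>Fubini: almost every section of the product is integrable, and a section with a positive
  constant factor can be divided by it.\<close>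

lemma integrable_factors:
  assumes I: "integrable P (\<lambda>x. inverse (vnorm d (x - mu)) ^ k)"
  shows "integrable (gauss q) (\<lambda>z. rho z ^ k)" and "integrable nu (\<lambda>r. inverse \<bar>r\<bar> ^ k)"
    and "zeta d mu P k = (\<integral>r. inverse \<bar>r\<bar> ^ k \<partial>nu) * (\<integral>z. rho z ^ k \<partial>gauss q)"
proof -
  have "integrable Y (\<lambda>p. inverse (vnorm d (em p - mu)) ^ k)"
    using I by (subst (asm) integrable_P_iff) measurable
  then have J: "integrable Y (\<lambda>p. inverse \<bar>fst p\<bar> ^ k * rho (snd p) ^ k)"
    by (simp add: inverse_vnorm_em' power_mult_distrib)
  have "AE r in nu. integrable (gauss q) (\<lambda>z. inverse \<bar>r\<bar> ^ k * rho z ^ k)"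
    using Y.AE_integrable_fst'[OF J] by simp
  from ex_r_pos[OF this] obtain r where "r > 0" "integrable (gauss q) (\<lambda>z. inverse \<bar>r\<bar> ^ k * rho z ^ k)" by blast
  then show "integrable (gauss q) (\<lambda>z. rho z ^ k)" by simp
  interpret GN: pair_sigma_finite "gauss q" nu ..
  have "integrable (gauss q \<Otimes>\<^sub>M nu) (\<lambda>p. inverse \<bar>snd p\<bar> ^ k * rho (fst p) ^ k)"
    using Y.integrable_product_swap[OF J] by (simp add: split_def)
  from GN.AE_integrable_fst'[OF this] have "AE z in gauss q. integrable nu (\<lambda>r. inverse \<bar>r\<bar> ^ k * rho z ^ k)"
    by simp
  moreover have "AE z in gauss q. rho z > 0"
    using AE_gauss_pos gauss_mv_pos[OF f_pos] by eventually_elim (simp add: rho_def)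
  ultimately have "AE z in gauss q. integrable nu (\<lambda>r. inverse \<bar>r\<bar> ^ k)" by eventually_elim simp
  then show "integrable nu (\<lambda>r. inverse \<bar>r\<bar> ^ k)" by simp
  have "zeta d mu P k = (\<integral>p. inverse (vnorm d (em p - mu)) ^ k \<partial>Y)"
    unfolding zeta_def by (rule integral_P) measurable
  also have "\<dots> = (\<integral>p. inverse \<bar>fst p\<bar> ^ k * rho (snd p) ^ k \<partial>Y)"
    by (simp add: inverse_vnorm_em' power_mult_distrib)
  also have "\<dots> = (\<integral>r. inverse \<bar>r\<bar> ^ k \<partial>nu) * (\<integral>z. rho z ^ k \<partial>gauss q)" by (rule integral_split[OF J])
  finally show "zeta d mu P k = (\<integral>r. inverse \<bar>r\<bar> ^ k \<partial>nu) * (\<integral>z. rho z ^ k \<partial>gauss q)" .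
qed

context
  fixes \<zeta> \<psi> :: real
  assumes I1: "integrable P (\<lambda>x. inverse (vnorm d (x - mu)) ^ 1)"
    and I2: "integrable P (\<lambda>x. inverse (vnorm d (x - mu)) ^ 2)"
    and \<zeta>: "\<zeta> > 0" and ratio: "zeta d mu P 2 / zeta d mu P 1 ^ 2 < \<zeta>"
begin

definition "mr = (\<integral>r. inverse \<bar>r\<bar> \<partial>nu)"
definition "mz = (\<integral>z. rho z \<partial>gauss q)"

lemma mr_pos: "mr > 0"
proof -
  have I: "integrable nu (\<lambda>r. inverse \<bar>r\<bar>)" using integrable_factors(2)[OF I1] by simp
  have "mr \<noteq> 0"
  proof
    assume "mr = 0"
    then have "AE r in nu. inverse \<bar>r\<bar> = 0" unfolding mr_def
      using integral_nonneg_eq_0_iff_AE[OF I] by simp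
    from ex_r_pos[OF this] show False by auto
  qed
  moreover have "mr \<ge> 0" by (simp add: mr_def)
  ultimately show ?thesis by simp
qed

lemma mz_pos: "mz > 0"
proof -
  have I: "integrable (gauss q) rho" using integrable_factors(1)[OF I1] by simp
  have ae: "AE z in gauss q. rho z > 0"
    using AE_gauss_pos gauss_mv_pos[OF f_pos] by eventually_elim (simp add: rho_def)
  have "mz \<noteq> 0"
  proof
    assume "mz = 0"
    then have "AE z in gauss q. rho z = 0" unfolding mz_def
      using integral_nonneg_eq_0_iff_AE[OF I] rho_nonneg by simp
    then have "AE z in gauss q. False" using ae by eventually_elim simp
    then show False by simp
  qed
  moreover have "mz \<ge> 0" by (simp add: mz_def rho_nonneg)
  ultimately show ?thesis by simp
qed

lemma zeta1_eq: "zeta d mu P 1 = mr * mz"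
  using integrable_factors(3)[OF I1] by (simp add: mr_def mz_def)

lemma zeta1_pos: "zeta d mu P 1 > 0"
  unfolding zeta1_eq using mr_pos mz_pos by simp

lemma zeta2_le: "zeta d mu P 2 \<le> \<zeta> * (zeta d mu P 1)\<^sup>2"
  using ratio zeta1_pos by (simp add: divide_less_eq)

text \<open>(A1) bounds the product of the moment ratios of the two factors; the ratio of the radial
  factor is at least 1, as a variance is nonnegative, and can be divided out.\<close>

lemma rho_sq_le: "(\<integral>z. rho z ^ 2 \<partial>gauss q) \<le> \<zeta> * mz\<^sup>2"
proof -
  let ?b = "\<integral>z. rho z ^ 2 \<partial>gauss q"
  have b0: "?b \<ge> 0" by simp
  have "mr\<^sup>2 \<le> (\<integral>r. inverse \<bar>r\<bar> ^ 2 \<partial>nu)"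
  proof -
    have I: "integrable nu (\<lambda>r. inverse \<bar>r\<bar>)" "integrable nu (\<lambda>r. (inverse \<bar>r\<bar>)\<^sup>2)"
      using integrable_factors(2)[OF I1] integrable_factors(2)[OF I2] by simp_all
    have "nu.variance (\<lambda>r. inverse \<bar>r\<bar>) \<ge> 0" by simp
    then show ?thesis using nu.variance_eq[OF I] by (simp add: mr_def)
  qed
  then have "mr\<^sup>2 * ?b \<le> (\<integral>r. inverse \<bar>r\<bar> ^ 2 \<partial>nu) * ?b" using b0 by (intro mult_right_mono)
  also have "\<dots> = zeta d mu P 2" using integrable_factors(3)[OF I2] by simp
  also have "\<dots> \<le> \<zeta> * (mr * mz)\<^sup>2" using zeta2_le unfolding zeta1_eq .
  finally have "mr\<^sup>2 * ?b \<le> mr\<^sup>2 * (\<zeta> * mz\<^sup>2)" by (simp add: power_mult_distrib mult_ac)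
  then show ?thesis using mr_pos by (simp add: mult_le_cancel_left_pos)
qed

abbreviation "\<tau> \<equiv> frob d q A"

text \<open>The scale of \<open>rho\<close> is sqrt (q / \<tau>), and a much larger mean would have
  to come from the event |A z| <= \<delta> |z|. Its probability is at most 1 / (4 \<zeta>), and the
  second moment of \<open>rho\<close> is at most \<zeta> times the squared mean, so this event
  carries at most half of the mean. Elsewhere \<open>rho\<close> <= 1 / \<delta>.\<close>

lemma rho_upper_mean: "mz * sqrt ((1 / (16 * \<zeta>))\<^sup>2 * \<tau> / (8 * \<zeta> * real q)) \<le> 2"
proof -
  \<comment> \<open>\<epsilon> and K make the two failure bounds 2 sqrt \<epsilon> and 1 / K both
    equal to 1 / (8 \<zeta>).\<close>
  define \<epsilon> where "\<epsilon> = (1 / (16 * \<zeta>))\<^sup>2"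
  define K where "K = 8 * \<zeta>"
  define \<delta> where "\<delta> = sqrt (\<epsilon> * \<tau> / (K * real q))"
  have pos: "\<epsilon> > 0" "K > 0" using \<zeta> by (auto simp: \<epsilon>_def K_def)
  have \<delta>: "\<delta> > 0" "\<delta>\<^sup>2 = \<epsilon> * \<tau> / (K * real q)" using pos f_pos q_pos by (auto simp: \<delta>_def)
  let ?S = "{z\<in>space (gauss q). vnorm d (mv q A z) \<le> \<delta> * vnorm q z}"
  have Sm: "?S \<in> sets (gauss q)" by measurable
  let ?S1 = "{z\<in>space (gauss q). (vnorm d (mv q A z))\<^sup>2 \<le> \<epsilon> * \<tau>}"
  let ?S2 = "{z\<in>space (gauss q). K * real q \<le> (vnorm q z)\<^sup>2}"
  have S12: "?S1 \<in> sets (gauss q)" "?S2 \<in> sets (gauss q)" by measurable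
  have "?S \<subseteq> ?S1 \<union> ?S2"
  proof safe
    fix z assume z: "vnorm d (mv q A z) \<le> \<delta> * vnorm q z" "\<not> K * real q \<le> (vnorm q z)\<^sup>2"
    have "(vnorm d (mv q A z))\<^sup>2 \<le> (\<delta> * vnorm q z)\<^sup>2" by (intro power_mono z) simp
    also have "\<dots> = \<epsilon> * \<tau> / (K * real q) * (vnorm q z)\<^sup>2" by (simp add: power_mult_distrib \<delta>)
    also have "\<dots> \<le> \<epsilon> * \<tau> / (K * real q) * (K * real q)"
      using z pos f_pos by (intro mult_left_mono) auto
    also have "\<dots> = \<epsilon> * \<tau>" using pos q_pos by simp
    finally show "(vnorm d (mv q A z))\<^sup>2 \<le> \<epsilon> * \<tau>" .
  qed
  then have "gauss.prob q ?S \<le> gauss.prob q (?S1 \<union> ?S2)"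
    using S12 by (intro gauss.finite_measure_mono) auto
  also have "\<dots> \<le> gauss.prob q ?S1 + gauss.prob q ?S2" using S12 by (rule measure_Un_le)
  also have "\<dots> \<le> 2 * sqrt \<epsilon> + 1 / K"
    by (intro add_mono gauss_small_ball gauss_norm_large pos f_pos q_pos)
  also have "sqrt \<epsilon> = 1 / (16 * \<zeta>)" using \<zeta> unfolding \<epsilon>_def real_sqrt_abs by simp
  also have "2 * (1 / (16 * \<zeta>)) + 1 / K = 1 / (4 * \<zeta>)" using \<zeta> by (simp add: K_def field_simps)
  finally have PS: "gauss.prob q ?S \<le> 1 / (4 * \<zeta>)" .
  \<comment> \<open>This AM-GM weight makes both contributions of the event equal to at most
    \<open>mz\<close> / 4.\<close>
  define y where "y = \<zeta> * mz"
  have y: "y > 0" using \<zeta> mz_pos by (simp add: y_def)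
  have ae: "AE z in gauss q. 0 < vnorm d (mv q A z)" by (rule gauss_mv_pos[OF f_pos])
  have pw: "AE z in gauss q. rho z \<le> rho z ^ 2 / (4 * y) + y * indicator ?S z + 1 / \<delta>"
    using ae AE_space
  proof eventually_elim
    fix z assume a: "0 < vnorm d (mv q A z)" and zs: "z \<in> space (gauss q)"
    show "rho z \<le> rho z ^ 2 / (4 * y) + y * indicator ?S z + 1 / \<delta>"
    proof (cases "z \<in> ?S")
      case True
      have "0 \<le> (rho z - 2 * y)\<^sup>2" by simp
      then have "rho z * (4 * y) \<le> rho z ^ 2 + 4 * y\<^sup>2" by (simp add: power2_eq_square algebra_simps)
      then have "rho z \<le> rho z ^ 2 / (4 * y) + y" using y by (simp add: field_simps power2_eq_square)
      moreover have "0 \<le> 1 / \<delta>" using \<delta> by simp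
      moreover have "y * indicator ?S z = y" using True by simp
      ultimately show ?thesis by linarith
    next
      case False
      then have "\<delta> * vnorm q z < vnorm d (mv q A z)" using zs by auto
      then have "rho z \<le> 1 / \<delta>" using a \<delta> by (simp add: rho_def field_simps)
      moreover have "0 \<le> rho z ^ 2 / (4 * y)" using y by simp
      ultimately show ?thesis using False by simp
    qed
  qed
  have i1: "integrable (gauss q) rho" using integrable_factors(1)[OF I1] by simp
  have i2: "integrable (gauss q) (\<lambda>z. rho z ^ 2)" using integrable_factors(1)[OF I2] by simp
  have i3: "integrable (gauss q) (indicator ?S :: _ \<Rightarrow> real)"
    using Sm by (intro integrable_real_indicator) (auto simp: gauss.emeasure_eq_measure)
  have "mz \<le> (\<integral>z. rho z ^ 2 / (4 * y) + y * indicator ?S z + 1 / \<delta> \<partial>gauss q)"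
    unfolding mz_def using i1 i2 i3 pw by (intro integral_mono_AE) auto
  also have "\<dots> = (\<integral>z. rho z ^ 2 \<partial>gauss q) / (4 * y) + y * gauss.prob q ?S + 1 / \<delta>"
    using i2 i3 Sm by (simp add: gauss.prob_space)
  also have "\<dots> \<le> (\<zeta> * mz\<^sup>2) / (4 * y) + y * (1 / (4 * \<zeta>)) + 1 / \<delta>"
    using rho_sq_le PS y \<delta>(1) by (intro add_mono divide_right_mono mult_left_mono) auto
  also have "\<dots> = mz / 2 + 1 / \<delta>" using \<zeta> mz_pos by (simp add: y_def power2_eq_square field_simps)
  finally have "mz / 2 \<le> 1 / \<delta>" by simp
  then have "mz * \<delta> \<le> 2" using \<delta> by (simp add: field_simps)
  then show ?thesis by (simp add: \<delta>_def \<epsilon>_def K_def)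
qed

text \<open>The right side is the Hessian of E |X - m| at m = mu in direction e. The angular weight
  1 - <u, e>^2 has mean at least \<psi>, and \<open>rho\<close> >= 1 / T outside an event of
  probability at most \<psi> / 2, so the weighted mean of \<open>rho\<close> is at least \<psi> / (2
  T). Compared with the upper bound for the mean of \<open>rho\<close>, the scale sqrt (\<tau> / q)
  cancels, and the constant is free of d, q and A.\<close>

lemma curvature:
  assumes \<psi>: "0 < \<psi>" and S: "qform d (gdir d q A) e \<le> 1 - \<psi>" and e: "vnorm d e = 1"
  shows "curv_const \<zeta> \<psi> * zeta d mu P 1 \<le> (\<integral>x. inverse (vnorm d (x - mu)) * (1 - (ip d (ssign d (x - mu)) e)\<^sup>2) \<partial>P)"
proof -
  define \<epsilon> where "\<epsilon> = (\<psi> / 8)\<^sup>2"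
  define K where "K = 4 / \<psi>"
  define T where "T = sqrt (K * \<tau> / (\<epsilon> * real q))"
  have pos: "\<epsilon> > 0" "K > 0" using \<psi> by (auto simp: \<epsilon>_def K_def)
  have T: "T > 0" "T\<^sup>2 = K * \<tau> / (\<epsilon> * real q)" using pos f_pos q_pos by (auto simp: T_def)
  let ?B = "{z\<in>space (gauss q). T * vnorm q z < vnorm d (mv q A z)}"
  have Bm: "?B \<in> sets (gauss q)" by measurable
  let ?B1 = "{z\<in>space (gauss q). K * \<tau> \<le> (vnorm d (mv q A z))\<^sup>2}"
  let ?B2 = "{z\<in>space (gauss q). (vnorm q z)\<^sup>2 \<le> \<epsilon> * real q}"
  have B12: "?B1 \<in> sets (gauss q)" "?B2 \<in> sets (gauss q)" by measurable
  have "?B \<subseteq> ?B1 \<union> ?B2"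
  proof safe
    fix z assume z: "T * vnorm q z < vnorm d (mv q A z)" "\<not> (vnorm q z)\<^sup>2 \<le> \<epsilon> * real q"
    have "K * \<tau> = K * \<tau> / (\<epsilon> * real q) * (\<epsilon> * real q)" using pos q_pos by simp
    also have "\<dots> \<le> K * \<tau> / (\<epsilon> * real q) * (vnorm q z)\<^sup>2"
      using z pos f_pos by (intro mult_left_mono) auto
    also have "\<dots> = (T * vnorm q z)\<^sup>2" by (simp add: power_mult_distrib T)
    also have "\<dots> \<le> (vnorm d (mv q A z))\<^sup>2" using z T by (intro power_mono) auto
    finally show "K * \<tau> \<le> (vnorm d (mv q A z))\<^sup>2" .
  qed
  then have "gauss.prob q ?B \<le> gauss.prob q (?B1 \<union> ?B2)"
    using B12 by (intro gauss.finite_measure_mono) auto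
  also have "\<dots> \<le> gauss.prob q ?B1 + gauss.prob q ?B2" using B12 by (rule measure_Un_le)
  also have "\<dots> \<le> 1 / K + 2 * sqrt \<epsilon>"
    by (intro add_mono gauss_norm_small_ball gauss_mv_large pos f_pos q_pos)
  also have "sqrt \<epsilon> = \<psi> / 8" using \<psi> unfolding \<epsilon>_def real_sqrt_abs by simp
  also have "1 / K + 2 * (\<psi> / 8) = \<psi> / 2" using \<psi> by (simp add: K_def field_simps)
  finally have PB: "gauss.prob q ?B \<le> \<psi> / 2" .
  define w where "w = (\<lambda>z. 1 - (ip d (ssign d (mv q A z)) e)\<^sup>2)"
  have w01: "0 \<le> w z" "w z \<le> 1" for z
  proof -
    have "(ip d (ssign d (mv q A z)) e)\<^sup>2 \<le> (vnorm d (ssign d (mv q A z)))\<^sup>2 * (vnorm d e)\<^sup>2" by (rule ip_sq_le)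
    also have "\<dots> \<le> 1" using e by (simp add: vnorm_ssign)
    finally show "0 \<le> w z" "w z \<le> 1" by (auto simp: w_def)
  qed
  have iw: "integrable (gauss q) w" unfolding w_def using ip_ssign_sq_integrable by simp
  have wm: "w \<in> borel_measurable (gauss q)" using iw by auto
  have Ew: "(\<integral>z. w z \<partial>gauss q) \<ge> \<psi>"
    unfolding w_def using S ip_ssign_sq_integrable by (simp add: gauss.prob_space)
  have i1: "integrable (gauss q) rho" using integrable_factors(1)[OF I1] by simp
  have irw: "integrable (gauss q) (\<lambda>z. rho z * w z)"
  proof (rule Bochner_Integration.integrable_bound[OF i1])
    show "(\<lambda>z. rho z * w z) \<in> borel_measurable (gauss q)" using wm by measurable
    show "AE z in gauss q. norm (rho z * w z) \<le> norm (rho z)"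
      using w01 by (intro AE_I2) (simp add: abs_mult mult_left_le)
  qed
  have i3: "integrable (gauss q) (indicator ?B :: _ \<Rightarrow> real)"
    using Bm by (intro integrable_real_indicator) (auto simp: gauss.emeasure_eq_measure)
  have ae: "AE z in gauss q. 0 < vnorm d (mv q A z)" by (rule gauss_mv_pos[OF f_pos])
  have pw: "AE z in gauss q. (1 / T) * (w z - indicator ?B z) \<le> rho z * w z"
    using ae AE_space
  proof eventually_elim
    fix z assume a: "0 < vnorm d (mv q A z)" and zs: "z \<in> space (gauss q)"
    show "(1 / T) * (w z - indicator ?B z) \<le> rho z * w z"
    proof (cases "z \<in> ?B")
      case True
      then have "(1 / T) * (w z - indicator ?B z) \<le> 0" using w01[of z] T by (simp add: divide_nonpos_pos)
      also have "0 \<le> rho z * w z" using w01 rho_nonneg by simp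
      finally show ?thesis .
    next
      case False
      then have "vnorm d (mv q A z) \<le> T * vnorm q z" using zs by auto
      then have "1 / T \<le> rho z" using a T by (simp add: rho_def field_simps)
      then have "(1 / T) * w z \<le> rho z * w z" using w01 by (intro mult_right_mono)
      then show ?thesis using False by simp
    qed
  qed
  have "(1 / T) * (\<psi> / 2) \<le> (1 / T) * ((\<integral>z. w z \<partial>gauss q) - gauss.prob q ?B)"
    using Ew PB T by (intro mult_left_mono) auto
  also have "\<dots> = (\<integral>z. (1 / T) * (w z - indicator ?B z) \<partial>gauss q)" using iw i3 Bm by simp
  also have "\<dots> \<le> (\<integral>z. rho z * w z \<partial>gauss q)"
    using iw i3 irw pw by (intro integral_mono_AE) auto
  finally have low: "(1 / T) * (\<psi> / 2) \<le> (\<integral>z. rho z * w z \<partial>gauss q)" .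
  let ?F = "\<lambda>x. inverse (vnorm d (x - mu)) * (1 - (ip d (ssign d (x - mu)) e)\<^sup>2)"
  have Fm: "?F \<in> borel_measurable (Rvec d)"
  proof -
    have "(\<lambda>x. ip d (ssign d (x - mu)) e) \<in> borel_measurable (Rvec d)"
      unfolding ip_def by (intro borel_measurable_sum borel_measurable_times ssign_diff_measurable borel_measurable_const) auto
    then show ?thesis by measurable
  qed
  have FY: "AE p in Y. ?F (em p) = inverse \<bar>fst p\<bar> * (rho (snd p) * w (snd p))"
    using AE_Y
  proof eventually_elim
    fix p :: "real \<times> (nat \<Rightarrow> real)" assume p: "0 < fst p \<and> 0 < vnorm q (snd p) \<and> 0 < vnorm d (mv q A (snd p))"
    have "ip d (ssign d (em p - mu)) e = ip d (ssign d (mv q A (snd p))) e"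
      unfolding ip_def by (intro sum.cong refl) (use p ssign_em in auto)
    then show "?F (em p) = inverse \<bar>fst p\<bar> * (rho (snd p) * w (snd p))"
      by (simp only: inverse_vnorm_em' w_def mult.assoc)
  qed
  have iFY: "integrable Y (\<lambda>p. inverse \<bar>fst p\<bar> * (rho (snd p) * w (snd p)))"
  proof (rule Bochner_Integration.integrable_bound)
    show "integrable Y (\<lambda>p. inverse (vnorm d (em p - mu)))"
      using I1 integrable_P_iff[of "\<lambda>x. inverse (vnorm d (x - mu)) ^ 1"] by simp
    have a: "(\<lambda>p. w (snd p)) \<in> borel_measurable Y" using wm by (rule measurable_compose[OF measurable_snd])
    have b: "(\<lambda>p. rho (snd p)) \<in> borel_measurable Y"
      by (rule measurable_compose[OF measurable_snd]) (simp add: measurable_cong_sets[OF sets_gauss refl] rho_measurable)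
    have c: "(\<lambda>p. inverse \<bar>fst p\<bar>) \<in> borel_measurable Y"
      by (rule measurable_compose[OF measurable_fst]) (simp add: measurable_cong_sets[OF nb refl])
    show "(\<lambda>p. inverse \<bar>fst p\<bar> * (rho (snd p) * w (snd p))) \<in> borel_measurable Y"
      by (intro borel_measurable_times a b c)
    show "AE p in Y. norm (inverse \<bar>fst p\<bar> * (rho (snd p) * w (snd p))) \<le> norm (inverse (vnorm d (em p - mu)))"
      unfolding inverse_vnorm_em' using w01 rho_nonneg
      by (intro AE_I2) (simp add: abs_mult mult.assoc[symmetric] mult_left_le)
  qed
  have "(\<integral>x. ?F x \<partial>P) = (\<integral>p. ?F (em p) \<partial>Y)" by (rule integral_P[OF Fm])
  also have "\<dots> = (\<integral>p. inverse \<bar>fst p\<bar> * (rho (snd p) * w (snd p)) \<partial>Y)"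
    by (rule integral_cong_AE[OF measurable_compose[OF em_measurable Fm] borel_measurable_integrable[OF iFY] FY])
  also have "\<dots> = mr * (\<integral>z. rho z * w z \<partial>gauss q)"
    using integral_split[of "\<lambda>r. inverse \<bar>r\<bar>" "\<lambda>z. rho z * w z", OF iFY] by (simp add: mr_def)
  finally have eq: "(\<integral>x. ?F x \<partial>P) = mr * (\<integral>z. rho z * w z \<partial>gauss q)" .
  \<comment> \<open>\<open>curv_const\<close> is \<psi> / 4 times the ratio of the threshold in
    \<open>rho_upper_mean\<close> to T, with \<tau> and q cancelled.\<close>
  have "curv_const \<zeta> \<psi> * zeta d mu P 1 = mr * ((1 / T) * (\<psi> / 2) * (mz * sqrt ((1 / (16 * \<zeta>))\<^sup>2 * \<tau> / (8 * \<zeta> * real q)) / 2))"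
  proof -
    have "sqrt ((1 / (16 * \<zeta>))\<^sup>2 * \<tau> / (8 * \<zeta> * real q)) / T = sqrt ((1 / (16 * \<zeta>))\<^sup>2 * \<epsilon> / (8 * \<zeta> * K))"
    proof -
      have "((1 / (16 * \<zeta>))\<^sup>2 * \<tau> / (8 * \<zeta> * real q)) / (K * \<tau> / (\<epsilon> * real q)) = (1 / (16 * \<zeta>))\<^sup>2 * \<epsilon> / (8 * \<zeta> * K)"
        using f_pos q_pos pos \<zeta> by (simp add: divide_simps)
      then show ?thesis by (simp only: T_def real_sqrt_divide[symmetric])
    qed
    then have "curv_const \<zeta> \<psi> = \<psi> / 4 * (sqrt ((1 / (16 * \<zeta>))\<^sup>2 * \<tau> / (8 * \<zeta> * real q)) / T)"
      by (simp add: curv_const_def \<epsilon>_def K_def)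
    then show ?thesis unfolding zeta1_eq by simp
  qed
  also have "\<dots> \<le> mr * ((1 / T) * (\<psi> / 2) * (2 / 2))"
    using rho_upper_mean mr_pos T \<psi> by (intro mult_left_mono divide_right_mono) auto
  also have "\<dots> \<le> mr * (\<integral>z. rho z * w z \<partial>gauss q)"
    using low mr_pos by (intro mult_left_mono) auto
  finally show ?thesis using eq by simp
qed

end

end

section \<open>Large effective rank: comparison with a Gaussian sample\<close>

lemma rational_directions_suffice:
  assumes "\<And>v. v \<in> PiE {..<d} (\<lambda>_. \<rat>) \<Longrightarrow> (\<Sum>i\<in>I. (ip d (u i) v)\<^sup>2) \<le> b * (vnorm d v)\<^sup>2"
  shows "(\<Sum>i\<in>I. (ip d (u i) v)\<^sup>2) \<le> b * (vnorm d v)\<^sup>2"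
proof -
  have "\<exists>r\<in>\<rat>. \<bar>r - v i\<bar> < 1 / real (Suc k)" for i k
    using rational_approximation[of "1 / real (Suc k)" "v i"] by (auto simp: Rats_def)
  then obtain r where r: "\<And>i k. r i k \<in> \<rat>" "\<And>i k. \<bar>r i k - v i\<bar> < 1 / real (Suc k)" by metis
  define w where "w = (\<lambda>k. \<lambda>i\<in>{..<d}. r i k)"
  have lim: "(\<lambda>k. w k i) \<longlonglongrightarrow> v i" if "i < d" for i
  proof -
    have "(\<lambda>k. r i k - v i) \<longlonglongrightarrow> 0"
      by (rule LIMSEQ_norm_0) (use r in \<open>simp add: less_imp_le\<close>)
    then have "(\<lambda>k. r i k) \<longlonglongrightarrow> v i" by (rule LIM_zero_cancel)
    then show ?thesis using that by (simp add: w_def)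
  qed
  have l1: "(\<lambda>k. \<Sum>i\<in>I. (ip d (u i) (w k))\<^sup>2) \<longlonglongrightarrow> (\<Sum>i\<in>I. (ip d (u i) v)\<^sup>2)"
    unfolding ip_def by (intro tendsto_sum tendsto_power tendsto_mult tendsto_const lim) auto
  have l2: "(\<lambda>k. b * (vnorm d (w k))\<^sup>2) \<longlonglongrightarrow> b * (vnorm d v)\<^sup>2"
    unfolding vnorm_sq_sum by (intro tendsto_sum tendsto_power tendsto_mult tendsto_const lim) auto
  show ?thesis
    by (rule LIMSEQ_le[OF l1 l2]) (use assms[of "w _"] r in \<open>auto simp: w_def\<close>)
qed

context elliptical
begin

text \<open>\<sigma> <= l (\<tau> + 2 \<sigma>) with l <= 1 / 50 gives (1 - 2 / 50) \<sigma> <= l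
  \<tau>, hence 0.96.\<close>

lemma opsq_over_frob_le:
  assumes l: "\<And>v. vnorm d v = 1 \<Longrightarrow> qform d (gdir d q A) v \<le> l" and l2: "l \<le> 1 / 50"
  shows "opsq d q A \<le> l / 0.96 * frob d q A" and "l > 0"
proof -
  have op: "opsq d q A > 0" by (rule opsq_pos[OF f_pos])
  have 1: "opsq d q A \<le> l * (frob d q A + 2 * opsq d q A)"
    by (rule opsq_le_sign_covariance[OF f_pos d_pos l])
  show l0: "l > 0"
  proof (rule ccontr)
    assume "\<not> l > 0"
    then have "l * (frob d q A + 2 * opsq d q A) \<le> 0" using f_pos op by (intro mult_nonpos_nonneg) auto
    then show False using 1 op by linarith
  qed
  have "l * opsq d q A \<le> 1 / 50 * opsq d q A" using op l2 by (intro mult_right_mono) auto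
  then have "0.96 * opsq d q A \<le> l * frob d q A" using 1 by (simp add: algebra_simps)
  then show "opsq d q A \<le> l / 0.96 * frob d q A" by simp
qed

text \<open>The directions of the X i have the joint law of the directions of n independent vectors
  A z, so the covariance bound for A z transfers once all |A z|^2 exceed 0.95 \<tau>. The constants
  combine to 1.276 / (0.96 * 0.95) < 1.4, and the rate 0.0003 = 0.05^2 * 0.96 / 8 is that of the
  lower tail at \<eta> = 0.05.\<close>

lemma high_rank_regime:
  assumes M: "prob_space M"
    and X: "\<And>i. i < n \<Longrightarrow> X i \<in> measurable M (Rvec d)"
    and ind: "prob_space.indep_vars M (\<lambda>_. Rvec d) X {..<n}"
    and law: "\<And>i. i < n \<Longrightarrow> distr M (Rvec d) (X i) = P"
    and n: "n \<ge> 1" and \<alpha>: "0 < \<alpha>" "\<alpha> \<le> 1"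
    and l: "\<And>v. vnorm d v = 1 \<Longrightarrow> qform d (gdir d q A) v \<le> l" and l2: "l \<le> 1 / 50"
    and tail: "real n * exp (- 0.0003 / l) \<le> \<alpha>"
  obtains G where "G \<in> sets M" "measure M G \<ge> 1 - 2 * \<alpha>"
    "\<And>\<omega> v. \<omega> \<in> G \<Longrightarrow> vnorm d v = 1 \<Longrightarrow>
      (\<Sum>i<n. (ip d (ssign d (X i \<omega> - mu)) v)\<^sup>2) \<le> 1.4 * real n * l + (4840 + 48.4 * ln (2 / \<alpha>)) / 0.95"
proof -
  interpret M: prob_space M by (rule M)
  interpret S: prob_space "gauss_sample n q" by (rule prob_space_gauss_sample)
  define \<tau> where "\<tau> = frob d q A"
  define \<sigma> where "\<sigma> = opsq d q A"
  define c where "c = 4840 + 48.4 * ln (2 / \<alpha>)"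
  define b where "b = 1.4 * real n * l + c / 0.95"
  have \<tau>: "\<tau> > 0" using f_pos by (simp add: \<tau>_def)
  have \<sigma>: "\<sigma> > 0" using opsq_pos[OF f_pos] by (simp add: \<sigma>_def)
  have \<sigma>\<tau>: "\<sigma> \<le> l / 0.96 * \<tau>" and l0: "l > 0" using opsq_over_frob_le[OF l l2] by (auto simp: \<sigma>_def \<tau>_def)
  define D where "D = distr (gauss q) (Rvec d) (\<lambda>z. dirmap d (mv q A z))"
  have dm: "(\<lambda>z. dirmap d (mv q A z)) \<in> measurable (gauss q) (Rvec d)"
    by (intro measurable_restrict) (simp add: measurable_cong_sets[OF sets_gauss refl] ssign_mv_measurable)
  have D: "prob_space D" unfolding D_def by (rule gauss.prob_space_distr[OF dm])
  have sD: "sets D = sets (Rvec d)" by (simp add: D_def)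
  define Q where "Q = PiE {..<d} (\<lambda>_. \<rat> :: real set)"
  have Q: "countable Q" unfolding Q_def by (intro countable_PiE countable_rat) auto
  let ?Pi = "PiM {..<n} (\<lambda>_. Rvec d)"
  \<comment> \<open>Rational directions turn the condition on all v into a countable intersection;
    so H is measurable and its probability depends on the joint law alone.\<close>
  define H where "H = {u\<in>space ?Pi. \<forall>v\<in>Q. (\<Sum>i<n. (ip d (u i) v)\<^sup>2) \<le> b * (vnorm d v)\<^sup>2}"
  have H: "H \<in> sets ?Pi"
  proof -
    have m: "(\<lambda>u. \<Sum>i<n. (ip d (u i) v)\<^sup>2) \<in> borel_measurable ?Pi" for v
    proof (intro borel_measurable_sum borel_measurable_power)
      fix i assume "i \<in> {..<n}"
      then have "(\<lambda>u. u i) \<in> measurable ?Pi (Rvec d)" by (rule measurable_component_singleton)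
      moreover have "(\<lambda>x. ip d x v) \<in> borel_measurable (Rvec d)" unfolding ip_commute[of d _ v] by measurable
      ultimately show "(\<lambda>u. ip d (u i) v) \<in> borel_measurable ?Pi" by (rule measurable_compose)
    qed
    have one: "{u\<in>space ?Pi. (\<Sum>i<n. (ip d (u i) v)\<^sup>2) \<le> b * (vnorm d v)\<^sup>2} \<in> sets ?Pi" for v
      using m[of v] by measurable
    have ne: "Q \<noteq> {}" unfolding Q_def by (auto simp: PiE_eq_empty_iff intro: Rats_0)
    have "H = (\<Inter>v\<in>Q. {u\<in>space ?Pi. (\<Sum>i<n. (ip d (u i) v)\<^sup>2) \<le> b * (vnorm d v)\<^sup>2})"
      unfolding H_def using ne by auto
    moreover have "\<dots> \<in> sets ?Pi" using one by (intro sets.countable_INT' Q ne) auto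
    ultimately show ?thesis by simp
  qed
  have lawM: "distr M ?Pi (\<lambda>\<omega>. \<lambda>i\<in>{..<n}. dirmap d (X i \<omega> - mu)) = PiM {..<n} (\<lambda>_. D)"
  proof -
    have iv: "M.indep_vars (\<lambda>_. Rvec d) (\<lambda>i \<omega>. dirmap d (X i \<omega> - mu)) {..<n}"
      by (rule M.indep_vars_compose2[OF ind]) (rule dirmap_diff_measurable)
    have rv: "(\<lambda>\<omega>. dirmap d (X i \<omega> - mu)) \<in> measurable M (Rvec d)" if "i \<in> {..<n}" for i
      using that by (intro measurable_compose[OF X dirmap_diff_measurable]) simp
    have "distr M ?Pi (\<lambda>\<omega>. \<lambda>i\<in>{..<n}. dirmap d (X i \<omega> - mu)) = PiM {..<n} (\<lambda>i. distr M (Rvec d) (\<lambda>\<omega>. dirmap d (X i \<omega> - mu)))"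
    proof -
      have "{..<n} \<noteq> {}" using n by (auto simp: lessThan_empty_iff)
      from M.indep_vars_iff_distr_eq_PiM'[where M' = "\<lambda>_. Rvec d" and X = "\<lambda>i \<omega>. dirmap d (X i \<omega> - mu)", OF this rv] iv
      show ?thesis by blast
    qed
    also have "\<dots> = PiM {..<n} (\<lambda>_. D)"
    proof (rule PiM_cong[OF refl])
      fix i assume i: "i \<in> {..<n}"
      have "distr M (Rvec d) (\<lambda>\<omega>. dirmap d (X i \<omega> - mu)) = distr (distr M (Rvec d) (X i)) (Rvec d) (\<lambda>x. dirmap d (x - mu))"
        using i by (subst distr_distr[OF dirmap_diff_measurable X]) (auto simp: o_def)
      then show "distr M (Rvec d) (\<lambda>\<omega>. dirmap d (X i \<omega> - mu)) = D"
        using i direction_law by (simp add: law D_def)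
    qed
    finally show ?thesis .
  qed
  have lawG: "distr (gauss_sample n q) ?Pi (compose {..<n} (\<lambda>z. dirmap d (mv q A z))) = PiM {..<n} (\<lambda>_. D)"
  proof -
    have "distr (gauss_sample n q) (PiM {..<n} (\<lambda>_. D)) (compose {..<n} (\<lambda>z. dirmap d (mv q A z)))
       = PiM {..<n} (\<lambda>_. distr (gauss q) D (\<lambda>z. dirmap d (mv q A z)))"
      by (rule distr_PiM_finite_prob_space')
         (use D dm in \<open>auto simp: prob_space_gauss measurable_cong_sets[OF refl sD]\<close>)
    moreover have "distr (gauss q) D (\<lambda>z. dirmap d (mv q A z)) = D"
      unfolding D_def by (rule distr_cong) auto
    moreover have "distr (gauss_sample n q) (PiM {..<n} (\<lambda>_. D)) (compose {..<n} (\<lambda>z. dirmap d (mv q A z)))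
      = distr (gauss_sample n q) ?Pi (compose {..<n} (\<lambda>z. dirmap d (mv q A z)))"
    proof -
      have "sets (PiM {..<n} (\<lambda>_. D)) = sets ?Pi" by (intro sets_PiM_cong) (auto simp: sD)
      then show ?thesis by (intro distr_cong refl)
    qed
    ultimately show ?thesis by simp
  qed
  have mG: "compose {..<n} (\<lambda>z. dirmap d (mv q A z)) \<in> measurable (gauss_sample n q) ?Pi"
    unfolding compose_def
  proof (rule measurable_restrict)
    fix i assume "i \<in> {..<n}"
    then have "(\<lambda>z. z i) \<in> measurable (gauss_sample n q) (gauss q)" by (rule measurable_component_singleton)
    then show "(\<lambda>z. dirmap d (mv q A (z i))) \<in> measurable (gauss_sample n q) (Rvec d)"
      by (rule measurable_compose[OF _ dm])
  qed
  have mM: "(\<lambda>\<omega>. \<lambda>i\<in>{..<n}. dirmap d (X i \<omega> - mu)) \<in> measurable M ?Pi"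
    by (intro measurable_restrict measurable_compose[OF X dirmap_diff_measurable]) auto
  obtain G1 where G1: "G1 \<in> sets (gauss_sample n q)" "S.prob G1 \<ge> 1 - \<alpha>"
    and cov: "\<And>z v. z \<in> G1 \<Longrightarrow> vnorm d v = 1 \<Longrightarrow>
      (\<Sum>i<n. (ip d v (mv q A (z i)))\<^sup>2) \<le> 1.276 * real n * \<sigma> + c * \<tau>"
    unfolding \<sigma>_def \<tau>_def c_def
    using gauss_covariance_upper[OF opsq_upper opsq_pos[OF f_pos] opsq_le_frob[OF d_pos] \<alpha>] by blast
  define Bad where "Bad = (\<lambda>i. {z\<in>space (gauss_sample n q). (vnorm d (mv q A (z i)))\<^sup>2 \<le> 0.95 * \<tau>})"
  have Badm: "Bad i \<in> sets (gauss_sample n q)" if "i < n" for i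
  proof -
    have "(\<lambda>z. vnorm d (mv q A (z i))) \<in> borel_measurable (gauss_sample n q)"
      using that by (intro measurable_compose[OF measurable_component_singleton])
        (auto simp: measurable_cong_sets[OF sets_gauss refl])
    then show ?thesis unfolding Bad_def by measurable
  qed
  have Badp: "S.prob (Bad i) \<le> exp (- 0.0003 / l)" if i: "i < n" for i
  proof -
    let ?B = "{z\<in>space (gauss q). (vnorm d (mv q A z))\<^sup>2 \<le> (1 - 0.05) * frob d q A}"
    have "distr (gauss_sample n q) (gauss q) (\<lambda>z. z i) = gauss q"
      using i by (intro distr_PiM_component prob_space_gauss) auto
    then have "gauss.prob q ?B = measure (distr (gauss_sample n q) (gauss q) (\<lambda>z. z i)) ?B" by simp
    also have "\<dots> = S.prob ((\<lambda>z. z i) -` ?B \<inter> space (gauss_sample n q))"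
      using i by (intro measure_distr) (auto, measurable)
    also have "(\<lambda>z. z i) -` ?B \<inter> space (gauss_sample n q) = Bad i"
      using i by (auto simp: Bad_def \<tau>_def space_PiM PiE_def Pi_def)
    finally have "S.prob (Bad i) = gauss.prob q ?B" by simp
    also have "\<dots> \<le> exp (- (0.05)\<^sup>2 * frob d q A / (8 * opsq d q A))"
      by (rule gauss_lower_tail[OF opsq_upper opsq_pos[OF f_pos]]) auto
    also have "\<dots> \<le> exp (- 0.0003 / l)"
    proof -
      have "0.96 * \<sigma> \<le> l * \<tau>" using \<sigma>\<tau> by simp
      then have "0.96 / l \<le> \<tau> / \<sigma>" using \<sigma> l0 by (simp add: field_simps)
      then have "0.0003 / l \<le> (0.05)\<^sup>2 * \<tau> / (8 * \<sigma>)" by (simp add: power2_eq_square)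
      then show ?thesis by (simp add: \<sigma>_def \<tau>_def)
    qed
    finally show ?thesis .
  qed
  define G2 where "G2 = G1 - (\<Union>i<n. Bad i)"
  have BadU: "(\<Union>i<n. Bad i) \<in> sets (gauss_sample n q)" using Badm by auto
  have G2m: "G2 \<in> sets (gauss_sample n q)" unfolding G2_def using G1 BadU by auto
  have "S.prob (\<Union>i<n. Bad i) \<le> (\<Sum>i<n. S.prob (Bad i))"
    using Badm by (intro measure_UNION_le) auto
  also have "\<dots> \<le> (\<Sum>i<n. exp (- 0.0003 / l))" by (intro sum_mono Badp) auto
  also have "\<dots> \<le> \<alpha>" using tail by simp
  finally have "S.prob (\<Union>i<n. Bad i) \<le> \<alpha>" .
  moreover have "S.prob G1 \<le> S.prob G2 + S.prob (\<Union>i<n. Bad i)"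
  proof -
    have "S.prob G1 \<le> S.prob (G2 \<union> (\<Union>i<n. Bad i))"
    proof (rule S.finite_measure_mono)
      show "G2 \<union> (\<Union>i<n. Bad i) \<in> S.events" using G2m BadU by (rule sets.Un)
    qed (auto simp: G2_def)
    also have "\<dots> \<le> S.prob G2 + S.prob (\<Union>i<n. Bad i)" by (rule measure_Un_le[OF G2m BadU])
    finally show ?thesis .
  qed
  ultimately have pG2: "S.prob G2 \<ge> 1 - 2 * \<alpha>" using G1 by linarith
  have sub: "G2 \<subseteq> compose {..<n} (\<lambda>z. dirmap d (mv q A z)) -` H \<inter> space (gauss_sample n q)"
  proof
    fix z assume z: "z \<in> G2"
    have zs: "z \<in> space (gauss_sample n q)" using z G2m sets.sets_into_space by blast
    let ?u = "compose {..<n} (\<lambda>z. dirmap d (mv q A z)) z"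
    have us: "?u \<in> space ?Pi" using measurable_space[OF mG zs] .
    have ui: "ip d (?u i) v = ip d (ssign d (mv q A (z i))) v" if "i < n" for i v
      using that by (simp add: compose_def ip_def)
    have unit: "(\<Sum>i<n. (ip d (?u i) v)\<^sup>2) \<le> b" if v: "vnorm d v = 1" for v
    proof -
      have one: "(ip d (?u i) v)\<^sup>2 \<le> (ip d v (mv q A (z i)))\<^sup>2 / (0.95 * \<tau>)" if i: "i < n" for i
      proof -
        let ?N = "vnorm d (mv q A (z i))"
        have "z \<notin> Bad i" using z i by (auto simp: G2_def)
        then have N: "0.95 * \<tau> < ?N\<^sup>2" using zs by (simp add: Bad_def not_le)
        have "ip d v (mv q A (z i)) = ip d v (\<lambda>j. ?N * ssign d (mv q A (z i)) j)"
          unfolding ip_def by (intro sum.cong refl) (simp add: ssign_scaled)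
        also have "\<dots> = ?N * ip d (ssign d (mv q A (z i))) v" by (simp add: ip_scale_right ip_commute)
        finally have "(ip d v (mv q A (z i)))\<^sup>2 = ?N\<^sup>2 * (ip d (?u i) v)\<^sup>2"
          by (simp add: power_mult_distrib ui[OF i])
        moreover have "0.95 * \<tau> * (ip d (?u i) v)\<^sup>2 \<le> ?N\<^sup>2 * (ip d (?u i) v)\<^sup>2"
          using N by (intro mult_right_mono) auto
        ultimately show ?thesis using \<tau> by (simp add: pos_le_divide_eq mult.commute)
      qed
      have "(\<Sum>i<n. (ip d (?u i) v)\<^sup>2) \<le> (\<Sum>i<n. (ip d v (mv q A (z i)))\<^sup>2 / (0.95 * \<tau>))"
        by (intro sum_mono one) auto
      also have "\<dots> = (\<Sum>i<n. (ip d v (mv q A (z i)))\<^sup>2) / (0.95 * \<tau>)" by (rule sum_divide_distrib[symmetric])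
      also have "\<dots> \<le> (1.276 * real n * \<sigma> + c * \<tau>) / (0.95 * \<tau>)"
        using cov[OF _ v] z \<tau> by (intro divide_right_mono) (auto simp: G2_def)
      also have "\<dots> \<le> (1.276 * real n * (l / 0.96 * \<tau>) + c * \<tau>) / (0.95 * \<tau>)"
        using \<sigma>\<tau> \<tau> by (intro divide_right_mono add_right_mono mult_left_mono) auto
      also have "\<dots> = 1.276 / 0.96 / 0.95 * (real n * l) + c / 0.95" using \<tau> by (simp add: field_simps)
      also have "\<dots> \<le> b" unfolding b_def using l0 by (simp add: mult.assoc)
      finally show ?thesis .
    qed
    have "(\<Sum>i<n. (ip d (?u i) v)\<^sup>2) \<le> b * (vnorm d v)\<^sup>2" for v
    proof (cases "vnorm d v = 0")
      case True
      then have "ip d (?u i) v = 0" for i by (simp add: ip_def vnorm_zero_iff)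
      then show ?thesis using True by simp
    next
      case False
      define e where "e = 1 / vnorm d v"
      have "vnorm d (\<lambda>j. e * v j) = 1" using False by (simp only: vnorm_scale) (simp add: e_def)
      from unit[OF this] have "e\<^sup>2 * (\<Sum>i<n. (ip d (?u i) v)\<^sup>2) \<le> b"
        by (simp add: ip_scale_right power_mult_distrib sum_distrib_left)
      then show ?thesis using False by (simp add: e_def field_simps)
    qed
    then show "z \<in> compose {..<n} (\<lambda>z. dirmap d (mv q A z)) -` H \<inter> space (gauss_sample n q)"
      using us zs by (simp add: H_def)
  qed
  define G where "G = (\<lambda>\<omega>. \<lambda>i\<in>{..<n}. dirmap d (X i \<omega> - mu)) -` H \<inter> space M"
  have Gm: "G \<in> sets M" unfolding G_def by (rule measurable_sets[OF mM H])
  have "M.prob G = measure (distr M ?Pi (\<lambda>\<omega>. \<lambda>i\<in>{..<n}. dirmap d (X i \<omega> - mu))) H"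
    unfolding G_def by (rule measure_distr[OF mM H, symmetric])
  also have "\<dots> = measure (distr (gauss_sample n q) ?Pi (compose {..<n} (\<lambda>z. dirmap d (mv q A z)))) H"
    unfolding lawM lawG ..
  also have "\<dots> = S.prob (compose {..<n} (\<lambda>z. dirmap d (mv q A z)) -` H \<inter> space (gauss_sample n q))"
    by (rule measure_distr[OF mG H])
  also have "\<dots> \<ge> S.prob G2"
    by (rule S.finite_measure_mono[OF sub measurable_sets[OF mG H]])
  finally have pG: "M.prob G \<ge> 1 - 2 * \<alpha>" using pG2 by simp
  show ?thesis
  proof (rule that[OF Gm pG])
    fix \<omega> v assume \<omega>: "\<omega> \<in> G" and v: "vnorm d v = 1"
    let ?u = "\<lambda>i\<in>{..<n}. dirmap d (X i \<omega> - mu)"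
    have "(\<Sum>i<n. (ip d (?u i) v)\<^sup>2) \<le> b * (vnorm d v)\<^sup>2"
      by (rule rational_directions_suffice) (use \<omega> in \<open>auto simp: G_def H_def Q_def\<close>)
    moreover have "(\<Sum>i<n. (ip d (?u i) v)\<^sup>2) = (\<Sum>i<n. (ip d (ssign d (X i \<omega> - mu)) v)\<^sup>2)"
      by (intro sum.cong refl) (simp add: ip_def)
    ultimately show "(\<Sum>i<n. (ip d (ssign d (X i \<omega> - mu)) v)\<^sup>2) \<le> 1.4 * real n * l + (4840 + 48.4 * ln (2 / \<alpha>)) / 0.95"
      using v by (simp add: b_def c_def)
  qed
qed

end

section \<open>The spatial median\<close>

text \<open>With a = r - <u, t> and B = |t|^2 - <u, t>^2 the shifted norm w satisfies w^2 = a^2 + B,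
  and w + a <= 2 (r + |t|) turns this into a lower bound for w - a. Replacing 1 / (r + |t|) by 1 / r
  - |t| / r^2 leaves only the first two inverse powers of r, which can be averaged.\<close>

lemma vnorm_shift_lower:
  assumes x: "vnorm d x > 0"
  shows "vnorm d (\<lambda>j. x j - t j) - vnorm d x + ip d (ssign d x) t
    \<ge> ((vnorm d t)\<^sup>2 - (ip d (ssign d x) t)\<^sup>2) / 2 * (inverse (vnorm d x) - vnorm d t * inverse (vnorm d x) ^ 2)"
proof -
  define r where "r = vnorm d x"
  define s where "s = ip d (ssign d x) t"
  define T where "T = vnorm d t"
  have r: "r > 0" and T: "T \<ge> 0" using x by (auto simp: r_def T_def)
  have xt: "ip d x t = r * s"
  proof -
    have "ip d x t = ip d (\<lambda>j. r * ssign d x j) t"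
      unfolding ip_def r_def by (intro sum.cong refl) (simp add: ssign_scaled)
    then show ?thesis by (simp add: ip_scale_left s_def)
  qed
  have sT: "s\<^sup>2 \<le> T\<^sup>2" using ip_sq_le[of d "ssign d x" t] x by (simp add: vnorm_ssign s_def T_def)
  define a where "a = r - s"
  define B where "B = T\<^sup>2 - s\<^sup>2"
  have B: "B \<ge> 0" using sT by (simp add: B_def)
  define w where "w = vnorm d (\<lambda>j. x j - t j)"
  have w2: "w\<^sup>2 = a\<^sup>2 + B"
    unfolding w_def vnorm_diff_sq xt
    by (simp add: a_def B_def r_def[symmetric] T_def[symmetric] power2_eq_square algebra_simps)
  have w0: "w \<ge> 0" by (simp add: w_def)
  have "a\<^sup>2 \<le> w\<^sup>2" using w2 B by simp
  then have wa: "a \<le> w" using w0 by (rule power2_le_imp_le)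
  have wr: "w \<le> r + T"
    using vnorm_triangle[of d x "\<lambda>j. - t j"] vnorm_scale[of d "-1" t] by (simp add: w_def r_def T_def)
  have aT: "a \<le> r + T"
  proof -
    have "\<bar>s\<bar> \<le> \<bar>T\<bar>" using sT by (simp add: abs_le_square_iff)
    then show ?thesis using T by (simp add: a_def)
  qed
  have "(w - a) * (w + a) = B" using w2 by (simp add: power2_eq_square algebra_simps)
  moreover have "(w - a) * (w + a) \<le> (w - a) * (2 * (r + T))"
    using wa wr aT by (intro mult_left_mono) auto
  ultimately have "B \<le> (w - a) * (2 * (r + T))" by simp
  then have 1: "B / (2 * (r + T)) \<le> w - a" using r T by (simp add: pos_divide_le_eq)
  have "inverse r - T * inverse r ^ 2 \<le> 1 / (r + T)"
  proof -
    have "(inverse r - T * inverse r ^ 2) * (r + T) = 1 - (T / r)\<^sup>2"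
      using r by (simp add: field_simps power2_eq_square)
    also have "\<dots> \<le> 1" by simp
    finally show ?thesis using r T by (simp add: pos_le_divide_eq)
  qed
  then have "B / 2 * (inverse r - T * inverse r ^ 2) \<le> B / 2 * (1 / (r + T))"
    using B by (intro mult_left_mono) auto
  moreover have "B / 2 * (1 / (r + T)) = B / (2 * (r + T))" by simp
  ultimately have "B / 2 * (inverse r - T * inverse r ^ 2) \<le> w - a" using 1 by linarith
  then show ?thesis by (simp add: a_def B_def w_def r_def s_def T_def)
qed

text \<open>If the median were farther away than \<rho>, convexity would give the point at distance
  \<rho> on the segment towards it an objective no larger than at mu. There the second-order lower
  bound forces an increase: by \<open>small\<close> the curvature h outweighs the gradient g and the
  remainder \<rho> k.\<close>

lemma spatial_median_close:
  fixes x :: "nat \<Rightarrow> nat \<Rightarrow> real"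
  assumes med: "is_spatial_median d n x m"
    and pos: "\<And>i. i < n \<Longrightarrow> vnorm d (x i - mu) > 0"
    and n: "n \<ge> 1" and \<rho>: "\<rho> > 0"
    and grad: "vnorm d (\<lambda>j. (\<Sum>i<n. ssign d (x i - mu) j) / real n) \<le> g"
    and hess: "\<And>e. vnorm d e = 1 \<Longrightarrow> h \<le> (\<Sum>i<n. inverse (vnorm d (x i - mu)) * (1 - (ip d (ssign d (x i - mu)) e)\<^sup>2)) / real n"
    and k: "(\<Sum>i<n. inverse (vnorm d (x i - mu)) ^ 2) / real n \<le> k"
    and small: "g < \<rho> / 2 * (h - \<rho> * k)"
  shows "vnorm d (m - mu) \<le> \<rho>"
proof (rule ccontr)
  assume "\<not> vnorm d (m - mu) \<le> \<rho>"
  then have far: "\<rho> < vnorm d (m - mu)" by simp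
  define N where "N = vnorm d (m - mu)"
  define e where "e = (\<lambda>j. (1 / N) * (m - mu) j)"
  have N: "N > 0" using far \<rho> by (simp add: N_def)
  have "vnorm d (\<lambda>j. (m - mu) j) = N" by (simp only: N_def)
  then have e1: "vnorm d e = 1" unfolding e_def vnorm_scale using N by simp
  define t where "t = (\<lambda>j. \<rho> * e j)"
  have tn: "vnorm d t = \<rho>" unfolding t_def vnorm_scale using \<rho> e1 by simp
  define y where "y = (\<lambda>i. x i - mu)"
  define F where "F = (\<lambda>t. \<Sum>i<n. vnorm d (\<lambda>j. y i j - t j))"
  let ?u = "\<lambda>i. ssign d (y i)"
  have n0: "real n > 0" using n by simp
  have Fm: "F (m - mu) \<le> F (\<lambda>_. 0)"
  proof -
    have "(\<Sum>i<n. vnorm d (x i - m)) \<le> (\<Sum>i<n. vnorm d (x i - mu))" using med by (simp add: is_spatial_median_def)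
    moreover have e: "(\<lambda>j. y i j - (m - mu) j) = x i - m" "(\<lambda>j. y i j - 0) = x i - mu" for i
      by (auto simp: y_def)
    ultimately show ?thesis unfolding F_def e by blast
  qed
  have cvx: "F t \<le> F (\<lambda>_. 0)"
  proof -
    define c where "c = \<rho> / N"
    have c: "0 \<le> c" "c \<le> 1" using far \<rho> N by (auto simp: c_def N_def)
    have "vnorm d (\<lambda>j. y i j - t j) \<le> (1 - c) * vnorm d (y i) + c * vnorm d (\<lambda>j. y i j - (m - mu) j)" for i
    proof -
      have "vnorm d (\<lambda>j. y i j - t j) = vnorm d (\<lambda>j. (1 - c) * y i j + c * (y i j - (m - mu) j))"
        by (rule vnorm_cong) (simp add: t_def e_def c_def algebra_simps)
      also have "\<dots> \<le> vnorm d (\<lambda>j. (1 - c) * y i j) + vnorm d (\<lambda>j. c * (y i j - (m - mu) j))" by (rule vnorm_triangle)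
      finally show ?thesis using c by (simp add: vnorm_scale)
    qed
    then have "F t \<le> (\<Sum>i<n. (1 - c) * vnorm d (y i) + c * vnorm d (\<lambda>j. y i j - (m - mu) j))"
      unfolding F_def by (intro sum_mono)
    also have "\<dots> = (1 - c) * F (\<lambda>_. 0) + c * F (m - mu)"
      by (simp add: F_def sum.distrib sum_distrib_left)
    also have "\<dots> \<le> (1 - c) * F (\<lambda>_. 0) + c * F (\<lambda>_. 0)" using Fm c by (intro add_left_mono mult_left_mono) auto
    finally show ?thesis by (simp add: algebra_simps)
  qed
  have termwise: "\<rho>\<^sup>2 / 2 * (inverse (vnorm d (y i)) * (1 - (ip d (?u i) e)\<^sup>2)) - \<rho>^3 / 2 * inverse (vnorm d (y i)) ^ 2 - ip d (?u i) t
      \<le> vnorm d (\<lambda>j. y i j - t j) - vnorm d (y i)" if i: "i < n" for i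
  proof -
    define W where "W = 1 - (ip d (?u i) e)\<^sup>2"
    define R where "R = inverse (vnorm d (y i))"
    have yp: "vnorm d (y i) > 0" using pos[OF i] by (simp add: y_def)
    have W: "0 \<le> W" "W \<le> 1"
      using ip_sq_le[of d "?u i" e] yp e1 by (auto simp: W_def vnorm_ssign)
    have "(vnorm d t)\<^sup>2 - (ip d (?u i) t)\<^sup>2 = \<rho>\<^sup>2 * W"
      unfolding tn unfolding t_def ip_scale_right by (simp add: W_def power_mult_distrib algebra_simps)
    then have "\<rho>\<^sup>2 * W / 2 * (R - \<rho> * R ^ 2) \<le> vnorm d (\<lambda>j. y i j - t j) - vnorm d (y i) + ip d (?u i) t"
      using vnorm_shift_lower[OF yp, of t] by (simp add: tn R_def)
    moreover have "\<rho>^3 / 2 * R ^ 2 * W \<le> \<rho>^3 / 2 * R ^ 2 * 1"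
      using W \<rho> by (intro mult_left_mono) auto
    moreover have "\<rho>\<^sup>2 * W / 2 * (R - \<rho> * R ^ 2) = \<rho>\<^sup>2 / 2 * (R * W) - \<rho>^3 / 2 * R ^ 2 * W"
      by (simp add: algebra_simps power2_eq_square power3_eq_cube add_divide_distrib diff_divide_distrib)
    ultimately show ?thesis unfolding W_def[symmetric] R_def[symmetric] by linarith
  qed
  let ?H = "\<Sum>i<n. inverse (vnorm d (y i)) * (1 - (ip d (?u i) e)\<^sup>2)"
  let ?K = "\<Sum>i<n. inverse (vnorm d (y i)) ^ 2"
  have "(\<Sum>i<n. \<rho>\<^sup>2 / 2 * (inverse (vnorm d (y i)) * (1 - (ip d (?u i) e)\<^sup>2)) - \<rho>^3 / 2 * inverse (vnorm d (y i)) ^ 2 - ip d (?u i) t)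
      \<le> (\<Sum>i<n. vnorm d (\<lambda>j. y i j - t j) - vnorm d (y i))"
    by (intro sum_mono termwise) auto
  also have "\<dots> = F t - F (\<lambda>_. 0)" by (simp add: F_def sum_subtractf)
  also have "\<dots> \<le> 0" using cvx by simp
  finally have 1: "\<rho>\<^sup>2 / 2 * ?H - \<rho>^3 / 2 * ?K - (\<Sum>i<n. ip d (?u i) t) \<le> 0"
    by (simp add: sum_subtractf sum_distrib_left)
  have Hh: "real n * h \<le> ?H" using hess[OF e1] n0 by (simp add: y_def pos_le_divide_eq mult.commute)
  have Kk: "?K \<le> real n * k" using k n0 by (simp add: y_def pos_divide_le_eq mult.commute)
  have Gg: "(\<Sum>i<n. ip d (?u i) t) \<le> real n * (g * \<rho>)"
  proof -
    have "(\<Sum>i<n. ip d (?u i) t) = ip d (\<lambda>j. \<Sum>i<n. ?u i j) t"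
      unfolding ip_def by (simp add: sum_distrib_right sum.swap[of _ _ "{..<d}"])
    also have "\<dots> = real n * ip d (\<lambda>j. (\<Sum>i<n. ?u i j) / real n) t"
      using n0 by (simp add: ip_def sum_distrib_left)
    also have "\<dots> \<le> real n * (vnorm d (\<lambda>j. (\<Sum>i<n. ?u i j) / real n) * vnorm d t)"
      using ip_Cauchy_Schwarz[of d "\<lambda>j. (\<Sum>i<n. ?u i j) / real n" t] n0 by (intro mult_left_mono) auto
    also have "\<dots> \<le> real n * (g * \<rho>)"
      using grad \<rho> n0 unfolding tn y_def by (intro mult_left_mono mult_right_mono) auto
    finally show ?thesis .
  qed
  have "\<rho>\<^sup>2 / 2 * (real n * h) - \<rho>^3 / 2 * (real n * k) - real n * (g * \<rho>) \<le> 0"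
  proof -
    have "\<rho>\<^sup>2 / 2 * (real n * h) \<le> \<rho>\<^sup>2 / 2 * ?H" by (intro mult_left_mono Hh) simp
    moreover have "\<rho>^3 / 2 * ?K \<le> \<rho>^3 / 2 * (real n * k)" using \<rho> by (intro mult_left_mono Kk) simp
    ultimately show ?thesis using 1 Gg by linarith
  qed
  then have "(real n * \<rho>) * (\<rho> / 2 * (h - \<rho> * k) - g) \<le> 0"
    by (simp add: algebra_simps power2_eq_square power3_eq_cube)
  moreover have "(real n * \<rho>) * (\<rho> / 2 * (h - \<rho> * k) - g) > 0"
    using n0 \<rho> small by (intro mult_pos_pos) auto
  ultimately show False by simp
qed

text \<open>The relative shift is s = R |t|. For s >= 1 / 2 the crude bound 1 + 4 s is enough.
  Otherwise M, the squared norm of y - t relative to that of y, is at least 1 / 4; multiplication by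
  M clears the denominator, the terms of order below two cancel, and at most 12 s^2 remains.\<close>

lemma ssign_perturbation:
  assumes y: "vnorm d y > 0" and v: "vnorm d v = 1"
  defines "u \<equiv> ssign d y" and "R \<equiv> inverse (vnorm d y)"
  shows "\<bar>(ip d (ssign d (\<lambda>j. y j - t j)) v)\<^sup>2 - (ip d u v)\<^sup>2 + 2 * R * (ip d u v * ip d t v) - 2 * R * (ip d u t * (ip d u v)\<^sup>2)\<bar>
    \<le> 48 * (vnorm d t)\<^sup>2 * R\<^sup>2"
proof -
  define a where "a = ip d u v"
  define b where "b = R * ip d t v"
  define c where "c = R * ip d u t"
  define s where "s = R * vnorm d t"
  define w where "w = (\<lambda>j. y j - t j)"
  define z where "z = ip d (ssign d w) v"
  have R: "R > 0" using y by (simp add: R_def)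
  have s0: "s \<ge> 0" using R by (simp add: s_def)
  have a1: "\<bar>a\<bar> \<le> 1" using ip_Cauchy_Schwarz[of d u v] y v by (simp add: a_def u_def vnorm_ssign)
  have bs: "\<bar>b\<bar> \<le> s" using ip_Cauchy_Schwarz[of d t v] v R by (simp add: b_def s_def abs_mult)
  have cs: "\<bar>c\<bar> \<le> s" using ip_Cauchy_Schwarz[of d u t] y R by (simp add: c_def s_def abs_mult u_def vnorm_ssign)
  have z1: "\<bar>z\<bar> \<le> 1"
  proof -
    have "\<bar>z\<bar> \<le> vnorm d (ssign d w) * 1" using ip_Cauchy_Schwarz[of d "ssign d w" v] v by (simp add: z_def)
    then show ?thesis using vnorm_ssign_le[of d w] by linarith
  qed
  have a2: "a\<^sup>2 \<le> 1" and z2: "z\<^sup>2 \<le> 1" using a1 z1 by (auto simp: abs_square_le_1)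
  have goal: "\<bar>z\<^sup>2 - a\<^sup>2 + 2 * a * b - 2 * c * a\<^sup>2\<bar> \<le> 48 * s\<^sup>2"
  proof (cases "s \<ge> 1 / 2")
    case True
    have "\<bar>a * b\<bar> \<le> 1 * s" unfolding abs_mult using a1 bs by (intro mult_mono) auto
    moreover have "\<bar>c * a\<^sup>2\<bar> \<le> s * 1" unfolding abs_mult using cs a2 s0 by (intro mult_mono) auto
    moreover have "\<bar>z\<^sup>2 - a\<^sup>2\<bar> \<le> 1" using a2 z2 zero_le_power2[of z] zero_le_power2[of a] unfolding abs_le_iff by (intro conjI; linarith)
    ultimately have "\<bar>z\<^sup>2 - a\<^sup>2 + 2 * a * b - 2 * c * a\<^sup>2\<bar> \<le> 1 + 4 * s" by (simp add: abs_le_iff)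
    also have "\<dots> \<le> 48 * s\<^sup>2"
    proof -
      have "s\<^sup>2 \<ge> 1 / 2 * s" unfolding power2_eq_square using True s0 by (intro mult_right_mono) auto
      then show ?thesis using True by linarith
    qed
    finally show ?thesis .
  next
    case False
    define M where "M = 1 - 2 * c + s\<^sup>2"
    have M: "M \<ge> 1 / 4"
    proof -
      have "(1 - s)\<^sup>2 \<le> M" using cs by (simp add: M_def power2_eq_square algebra_simps abs_le_iff)
      moreover have "(1 / 2)\<^sup>2 \<le> (1 - s)\<^sup>2" using False by (intro power_mono) auto
      ultimately show ?thesis by (simp add: power2_eq_square)
    qed
    have yu: "y j = vnorm d y * u j" if "j < d" for j using ssign_scaled[OF that, of y] by (simp add: u_def)
    have yt: "ip d y t = vnorm d y * ip d u t"
      unfolding ip_scale_left[symmetric] unfolding ip_def by (intro sum.cong refl) (simp add: yu)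
    have yv: "ip d y v = vnorm d y * a"
      unfolding a_def ip_scale_left[symmetric] unfolding ip_def by (intro sum.cong refl) (simp add: yu)
    have w2: "(R * vnorm d w)\<^sup>2 = M"
    proof -
      have "(R * vnorm d w)\<^sup>2 = R\<^sup>2 * ((vnorm d y)\<^sup>2 - 2 * ip d y t + (vnorm d t)\<^sup>2)"
        by (simp add: power_mult_distrib w_def vnorm_diff_sq)
      also have "\<dots> = (R * vnorm d y)\<^sup>2 - 2 * (R * vnorm d y) * (R * ip d u t) + (R * vnorm d t)\<^sup>2"
        by (simp add: yt power2_eq_square algebra_simps)
      also have "R * vnorm d y = 1" using y by (simp add: R_def)
      finally show ?thesis by (simp add: M_def c_def s_def)
    qed
    have wv: "R * ip d w v = a - b"
    proof -
      have "R * ip d w v = (R * vnorm d y) * a - b"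
        by (simp add: w_def ip_diff_left yv b_def algebra_simps)
      then show ?thesis using y by (simp add: R_def)
    qed
    have wp: "vnorm d w \<noteq> 0" using w2 M by auto
    have "z * (R * vnorm d w) = a - b"
    proof -
      have "vnorm d w * z = ip d (\<lambda>j. vnorm d w * ssign d w j) v" by (simp add: z_def ip_scale_left)
      also have "\<dots> = ip d w v" unfolding ip_def by (intro sum.cong refl) (simp add: ssign_scaled)
      finally show ?thesis using wv by (simp add: mult_ac)
    qed
    then have "z\<^sup>2 * M = (a - b)\<^sup>2" using w2 by (metis power_mult_distrib)
    then have num: "(z\<^sup>2 - a\<^sup>2 + 2 * a * b - 2 * c * a\<^sup>2) * M
       = b\<^sup>2 - 4 * (a * b * c) + 4 * (c\<^sup>2 * a\<^sup>2) - s\<^sup>2 * (a\<^sup>2 - 2 * (a * b) + 2 * (c * a\<^sup>2))"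
      by (simp add: M_def algebra_simps power2_eq_square)
    have ab: "\<bar>a * b\<bar> \<le> s" unfolding abs_mult using mult_mono[OF a1 bs] by simp
    have ca: "\<bar>c * a\<^sup>2\<bar> \<le> s" unfolding abs_mult using mult_mono[OF cs, of "\<bar>a\<^sup>2\<bar>" 1] a2 s0 by simp
    have abc: "\<bar>a * b * c\<bar> \<le> s\<^sup>2" unfolding abs_mult[of _ c] power2_eq_square using ab cs s0 by (intro mult_mono) auto
    have c2: "c\<^sup>2 \<le> s\<^sup>2" and b2: "b\<^sup>2 \<le> s\<^sup>2" using cs bs s0 by (auto simp: abs_le_square_iff[symmetric])
    have ca2: "c\<^sup>2 * a\<^sup>2 \<le> s\<^sup>2 * 1" using c2 a2 by (intro mult_mono) auto
    have inner: "\<bar>a\<^sup>2 - 2 * (a * b) + 2 * (c * a\<^sup>2)\<bar> \<le> 3"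
      using a2 ab ca False zero_le_power2[of a] by (intro abs_leI; linarith)
    have "\<bar>s\<^sup>2 * (a\<^sup>2 - 2 * (a * b) + 2 * (c * a\<^sup>2))\<bar> \<le> s\<^sup>2 * 3"
      unfolding abs_mult using inner by (intro mult_mono) auto
    then have "\<bar>(z\<^sup>2 - a\<^sup>2 + 2 * a * b - 2 * c * a\<^sup>2) * M\<bar> \<le> 12 * s\<^sup>2"
      unfolding num using b2 abc ca2 zero_le_power2[of b] mult_nonneg_nonneg[OF zero_le_power2[of c] zero_le_power2[of a]]
      by (intro abs_leI; linarith)
    then have "\<bar>z\<^sup>2 - a\<^sup>2 + 2 * a * b - 2 * c * a\<^sup>2\<bar> * M \<le> 12 * s\<^sup>2"
      using M by (simp add: abs_mult)
    moreover have "\<bar>z\<^sup>2 - a\<^sup>2 + 2 * a * b - 2 * c * a\<^sup>2\<bar> * (1 / 4) \<le> \<bar>z\<^sup>2 - a\<^sup>2 + 2 * a * b - 2 * c * a\<^sup>2\<bar> * M"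
      using M by (intro mult_left_mono) auto
    ultimately have "\<bar>z\<^sup>2 - a\<^sup>2 + 2 * a * b - 2 * c * a\<^sup>2\<bar> * (1 / 4) \<le> 12 * s\<^sup>2" by (rule order_trans[rotated])
    then show ?thesis by simp
  qed
  then show ?thesis
    by (simp add: a_def b_def c_def s_def z_def w_def power_mult_distrib mult_ac)
qed

text \<open>The two first-order terms, averaged, are t paired with the mean of R u and with the mean
  of the third-order tensor built from R and three copies of u. Bounding these in Euclidean norm
  makes the estimate uniform in v and in m, which matters because the median depends on the
  sample.\<close>

lemma sample_sscm_perturbation:
  fixes x :: "nat \<Rightarrow> nat \<Rightarrow> real"
  assumes pos: "\<And>i. i < n \<Longrightarrow> vnorm d (x i - mu) > 0" and n: "n \<ge> 1"
    and v: "vnorm d v = 1" and m: "vnorm d (m - mu) \<le> \<rho>"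
    and g1: "vnorm d (\<lambda>j. (\<Sum>i<n. inverse (vnorm d (x i - mu)) * ssign d (x i - mu) j) / real n) \<le> g1"
    and g3: "(\<Sum>c\<in>{..<d}\<times>{..<d}\<times>{..<d}. ((\<Sum>i<n. inverse (vnorm d (x i - mu)) *
        (ssign d (x i - mu) (fst c) * (ssign d (x i - mu) (fst (snd c)) * ssign d (x i - mu) (snd (snd c))))) / real n)\<^sup>2) \<le> g3\<^sup>2"
    and g30: "g3 \<ge> 0"
    and k: "(\<Sum>i<n. inverse (vnorm d (x i - mu)) ^ 2) / real n \<le> k"
  shows "\<bar>qform d (sample_sscm d n x m) v - qform d (sample_sscm d n x mu) v\<bar> \<le> 2 * \<rho> * g1 + 2 * \<rho> * g3 + 48 * \<rho>\<^sup>2 * k"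
proof -
  define t where "t = m - mu"
  define y where "y = (\<lambda>i. x i - mu)"
  define u where "u = (\<lambda>i. ssign d (y i))"
  define R where "R = (\<lambda>i. inverse (vnorm d (y i)))"
  have n0: "real n > 0" using n by simp
  have T: "vnorm d t \<le> \<rho>" using m by (simp add: t_def)
  have \<rho>0: "\<rho> \<ge> 0" using T vnorm_nonneg[of d t] by linarith
  have xm: "x i - m = (\<lambda>j. y i j - t j)" for i by (auto simp: y_def t_def)
  have qf: "qform d (sample_sscm d n x m') v = (\<Sum>i<n. (ip d (ssign d (x i - m')) v)\<^sup>2) / real n" for m'
    unfolding sample_sscm_def qform_scaleM qform_sum qform_outer by simp
  define G1 where "G1 = (\<lambda>j. (\<Sum>i<n. R i * u i j) / real n)"
  define G3 where "G3 = (\<lambda>c. (\<Sum>i<n. R i * (u i (fst c) * (u i (fst (snd c)) * u i (snd (snd c))))) / real n)"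
  have lin1: "(\<Sum>i<n. R i * (ip d (u i) v * ip d t v)) = real n * (ip d G1 v * ip d t v)"
  proof -
    have G1n: "real n * G1 j = (\<Sum>i<n. R i * u i j)" for j using n0 by (simp add: G1_def)
    have "real n * ip d G1 v = (\<Sum>j<d. (real n * G1 j) * v j)" by (simp add: ip_def sum_distrib_left mult.assoc)
    also have "\<dots> = (\<Sum>j<d. \<Sum>i<n. R i * u i j * v j)" unfolding G1n by (simp add: sum_distrib_right)
    also have "\<dots> = (\<Sum>i<n. \<Sum>j<d. R i * u i j * v j)" by (rule sum.swap)
    also have "\<dots> = (\<Sum>i<n. R i * ip d (u i) v)" by (simp add: ip_def sum_distrib_left mult.assoc)
    finally show ?thesis by (simp add: sum_distrib_right mult.assoc[symmetric])
  qed
  let ?I = "{..<d}\<times>{..<d}\<times>{..<d}"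
  let ?V = "\<lambda>c. t (fst c) * (v (fst (snd c)) * v (snd (snd c)))"
  have lin3: "(\<Sum>i<n. R i * (ip d (u i) t * (ip d (u i) v)\<^sup>2)) = real n * (\<Sum>c\<in>?I. G3 c * ?V c)"
  proof -
    have one: "ip d (u i) t * (ip d (u i) v)\<^sup>2 = (\<Sum>c\<in>?I. (u i (fst c) * (u i (fst (snd c)) * u i (snd (snd c)))) * ?V c)" for i
    proof -
      have "ip d (u i) t * (ip d (u i) v)\<^sup>2 = (\<Sum>a<d. \<Sum>b<d. \<Sum>c<d. (u i a * t a) * ((u i b * v b) * (u i c * v c)))"
        unfolding ip_def power2_eq_square sum_product by (simp add: sum_distrib_left)
      also have "\<dots> = (\<Sum>c\<in>?I. (u i (fst c) * t (fst c)) * ((u i (fst (snd c)) * v (fst (snd c))) * (u i (snd (snd c)) * v (snd (snd c)))))"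
        by (simp add: sum.cartesian_product split_def)
      finally show ?thesis by (simp add: mult_ac)
    qed
    have "(\<Sum>i<n. R i * (ip d (u i) t * (ip d (u i) v)\<^sup>2)) = (\<Sum>i<n. \<Sum>c\<in>?I. (R i * (u i (fst c) * (u i (fst (snd c)) * u i (snd (snd c))))) * ?V c)"
      unfolding one by (simp add: sum_distrib_left mult.assoc)
    also have "\<dots> = (\<Sum>c\<in>?I. \<Sum>i<n. (R i * (u i (fst c) * (u i (fst (snd c)) * u i (snd (snd c))))) * ?V c)" by (rule sum.swap)
    also have "\<dots> = (\<Sum>c\<in>?I. real n * (G3 c * ?V c))"
      using n0 by (simp add: G3_def sum_distrib_right)
    finally show ?thesis by (simp add: sum_distrib_left)
  qed
  have V: "sqrt (\<Sum>c\<in>?I. (?V c)\<^sup>2) = vnorm d t"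
  proof -
    have "(\<Sum>c\<in>?I. (?V c)\<^sup>2) = (\<Sum>a<d. \<Sum>b<d. \<Sum>c<d. (t a)\<^sup>2 * ((v b)\<^sup>2 * (v c)\<^sup>2))"
      by (simp add: sum.cartesian_product split_def power_mult_distrib)
    also have "\<dots> = (vnorm d t)\<^sup>2 * ((vnorm d v)\<^sup>2 * (vnorm d v)\<^sup>2)"
      unfolding vnorm_sq_sum sum_product by (simp add: sum_distrib_left)
    finally show ?thesis using v by simp
  qed
  have b3: "\<bar>\<Sum>c\<in>?I. G3 c * ?V c\<bar> \<le> g3 * \<rho>"
  proof -
    have "(\<Sum>c\<in>?I. (G3 c)\<^sup>2) \<le> g3\<^sup>2" using g3 by (simp add: G3_def R_def u_def y_def)
    then have "sqrt (\<Sum>c\<in>?I. (G3 c)\<^sup>2) \<le> g3" using g30 by (simp add: real_le_lsqrt sum_nonneg)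
    then have "sqrt (\<Sum>c\<in>?I. (G3 c)\<^sup>2) * sqrt (\<Sum>c\<in>?I. (?V c)\<^sup>2) \<le> g3 * \<rho>"
      unfolding V using T g30 by (intro mult_mono) auto
    then show ?thesis using sum_mult_le_sqrt[of G3 ?V ?I] by linarith
  qed
  have b1: "\<bar>ip d G1 v * ip d t v\<bar> \<le> g1 * \<rho>"
  proof -
    have "\<bar>ip d G1 v\<bar> \<le> g1" using ip_Cauchy_Schwarz[of d G1 v] v g1 by (simp add: G1_def R_def u_def y_def)
    moreover have "\<bar>ip d t v\<bar> \<le> \<rho>" using ip_Cauchy_Schwarz[of d t v] v T by simp
    ultimately show ?thesis unfolding abs_mult by (intro mult_mono) auto
  qed
  define E where "E = (\<lambda>i. (ip d (ssign d (x i - m)) v)\<^sup>2 - (ip d (u i) v)\<^sup>2 + 2 * R i * (ip d (u i) v * ip d t v) - 2 * R i * (ip d (u i) t * (ip d (u i) v)\<^sup>2))"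
  have E: "\<bar>E i\<bar> \<le> 48 * \<rho>\<^sup>2 * R i ^ 2" if "i < n" for i
  proof -
    have "\<bar>E i\<bar> \<le> 48 * (vnorm d t)\<^sup>2 * (R i)\<^sup>2"
      unfolding E_def xm u_def R_def by (rule ssign_perturbation[OF _ v]) (use pos[OF that] in \<open>simp only: y_def\<close>)
    also have "\<dots> \<le> 48 * \<rho>\<^sup>2 * (R i)\<^sup>2" using T by (intro mult_right_mono mult_left_mono power_mono) auto
    finally show ?thesis .
  qed
  have "(\<Sum>i<n. (ip d (ssign d (x i - m)) v)\<^sup>2) - (\<Sum>i<n. (ip d (u i) v)\<^sup>2)
     = (\<Sum>i<n. E i) - 2 * (\<Sum>i<n. R i * (ip d (u i) v * ip d t v)) + 2 * (\<Sum>i<n. R i * (ip d (u i) t * (ip d (u i) v)\<^sup>2))"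
    by (simp add: E_def sum.distrib sum_subtractf sum_distrib_left mult.assoc)
  also have "\<dots> = (\<Sum>i<n. E i) - 2 * (real n * (ip d G1 v * ip d t v)) + 2 * (real n * (\<Sum>c\<in>?I. G3 c * ?V c))"
    unfolding lin1 lin3 ..
  finally have eq: "qform d (sample_sscm d n x m) v - qform d (sample_sscm d n x mu) v
     = (\<Sum>i<n. E i) / real n - 2 * (ip d G1 v * ip d t v) + 2 * (\<Sum>c\<in>?I. G3 c * ?V c)"
    using n0 by (simp add: qf u_def y_def field_simps)
  have "\<bar>(\<Sum>i<n. E i)\<bar> \<le> (\<Sum>i<n. 48 * \<rho>\<^sup>2 * R i ^ 2)"
    by (rule order_trans[OF sum_abs]) (intro sum_mono E, simp)
  also have "\<dots> = 48 * \<rho>\<^sup>2 * (\<Sum>i<n. R i ^ 2)" by (simp add: sum_distrib_left)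
  finally have "\<bar>(\<Sum>i<n. E i) / real n\<bar> \<le> 48 * \<rho>\<^sup>2 * ((\<Sum>i<n. R i ^ 2) / real n)"
    using n0 by (simp add: divide_right_mono abs_divide)
  also have "\<dots> \<le> 48 * \<rho>\<^sup>2 * k" using k by (intro mult_left_mono) (auto simp: R_def y_def)
  finally have "\<bar>(\<Sum>i<n. E i) / real n\<bar> \<le> 48 * \<rho>\<^sup>2 * k" .
  then show ?thesis unfolding eq using b1 b3 by (intro abs_leI; argo)
qed

section \<open>Concentration of sample means in Hilbert-Schmidt norm\<close>

text \<open>Independent centred terms are orthogonal, so the mean squared error is at most V / n
  whatever the size of I, and Markov's inequality follows. The absence of the dimension is what lets
  d grow freely.\<close>

lemma (in prob_space) sample_mean_hilbert:
  fixes g :: "'c \<Rightarrow> 'b \<Rightarrow> real"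
  assumes ind: "indep_vars (\<lambda>_. N) X {..<n}"
    and law: "\<And>i. i < n \<Longrightarrow> distr M N (X i) = P"
    and n: "n \<ge> 1" and fin: "finite I"
    and meas: "\<And>c. c \<in> I \<Longrightarrow> g c \<in> borel_measurable N"
    and bound: "\<And>x. (\<Sum>c\<in>I. (g c x)\<^sup>2) \<le> H x"
    and H: "integrable P H" "(\<integral>x. H x \<partial>P) \<le> V" and V: "V > 0" and \<epsilon>: "\<epsilon> > 0"
  obtains G where "G \<in> events" "prob G \<ge> 1 - \<epsilon>"
    "\<And>\<omega>. \<omega> \<in> G \<Longrightarrow> (\<Sum>c\<in>I. ((\<Sum>i<n. g c (X i \<omega>)) / real n - (\<integral>x. g c x \<partial>P))\<^sup>2) \<le> V / (real n * \<epsilon>)"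
proof -
  have X: "X i \<in> measurable M N" if "i < n" for i using ind that by (auto simp: indep_vars_def)
  have n0: "0 < n" using n by simp
  have P: "prob_space P" using prob_space_distr[OF X[OF n0]] law[OF n0] by simp
  interpret P: prob_space P by (rule P)
  have sP: "sets P = sets N" using law[OF n0] by auto
  have gP: "g c \<in> borel_measurable P" if "c \<in> I" for c
    using meas[OF that] by (simp add: measurable_cong_sets[OF sP refl])
  have gH: "(g c x)\<^sup>2 \<le> H x" if "c \<in> I" for c x
    using bound[of x] member_le_sum[of c I "\<lambda>c. (g c x)\<^sup>2"] that fin by fastforce
  have g2: "integrable P (\<lambda>x. (g c x)\<^sup>2)" if "c \<in> I" for c
  proof (rule Bochner_Integration.integrable_bound[OF H(1)])
    show "(\<lambda>x. (g c x)\<^sup>2) \<in> borel_measurable P" using gP[OF that] by measurable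
    show "AE x in P. norm ((g c x)\<^sup>2) \<le> norm (H x)"
      using order_trans[OF gH[OF that] abs_ge_self] by (intro AE_I2) simp
  qed
  have g1: "integrable P (g c)" if "c \<in> I" for c
    by (rule P.square_integrable_imp_integrable[OF gP[OF that] g2[OF that]])
  define f where "f = (\<lambda>c x. g c x - (\<integral>x. g c x \<partial>P))"
  have fN: "f c \<in> borel_measurable N" if "c \<in> I" for c unfolding f_def using meas[OF that] by measurable
  have f1: "integrable P (f c)" if "c \<in> I" for c unfolding f_def using g1[OF that] by simp
  have f0: "(\<integral>x. f c x \<partial>P) = 0" if "c \<in> I" for c unfolding f_def using g1[OF that] by (simp add: P.prob_space)
  have f2: "integrable P (\<lambda>x. (f c x)\<^sup>2)" "(\<integral>x. (f c x)\<^sup>2 \<partial>P) \<le> (\<integral>x. (g c x)\<^sup>2 \<partial>P)" if "c \<in> I" for c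
  proof -
    have e: "(f c x)\<^sup>2 = (g c x)\<^sup>2 - 2 * (\<integral>x. g c x \<partial>P) * g c x + (\<integral>x. g c x \<partial>P)\<^sup>2" for x
      by (simp add: f_def power2_diff)
    show "integrable P (\<lambda>x. (f c x)\<^sup>2)" unfolding e using g1[OF that] g2[OF that] by simp
    show "(\<integral>x. (f c x)\<^sup>2 \<partial>P) \<le> (\<integral>x. (g c x)\<^sup>2 \<partial>P)"
      unfolding e using g1[OF that] g2[OF that] by (simp add: P.prob_space power2_eq_square)
  qed
  have tr: "integrable M (\<lambda>\<omega>. h (X i \<omega>)) \<longleftrightarrow> integrable P h" "(\<integral>\<omega>. h (X i \<omega>) \<partial>M) = (\<integral>x. h x \<partial>P)"
    if "i < n" "h \<in> borel_measurable N" for i and h :: "'b \<Rightarrow> real"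
    using integrable_distr_eq[OF X[OF that(1)] that(2)] integral_distr[OF X[OF that(1)] that(2)] law[OF that(1)] by simp_all
  have cross: "integrable M (\<lambda>\<omega>. f c (X i \<omega>) * f c (X j \<omega>)) \<and>
      (\<integral>\<omega>. f c (X i \<omega>) * f c (X j \<omega>) \<partial>M) = (if i = j then (\<integral>x. (f c x)\<^sup>2 \<partial>P) else 0)"
    if c: "c \<in> I" and ij: "i < n" "j < n" for c i j
  proof (cases "i = j")
    case True
    have m: "(\<lambda>x. (f c x)\<^sup>2) \<in> borel_measurable N" using fN[OF c] by measurable
    show ?thesis using tr[OF ij(1) m] f2[OF c] True by (simp add: power2_eq_square)
  next
    case False
    have iv: "indep_vars (\<lambda>_. borel) (\<lambda>i \<omega>. f c (X i \<omega>)) {i, j}"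
      by (rule indep_vars_compose2[OF indep_vars_subset[OF ind]]) (use ij fN[OF c] in auto)
    have int: "integrable M (\<lambda>\<omega>. f c (X k \<omega>))" if "k \<in> {i, j}" for k
      using that ij tr(1)[OF _ fN[OF c]] f1[OF c] by auto
    have "integrable M (\<lambda>\<omega>. \<Prod>k\<in>{i, j}. f c (X k \<omega>))"
      by (rule indep_vars_integrable[OF _ iv int]) auto
    moreover have "(\<integral>\<omega>. (\<Prod>k\<in>{i, j}. f c (X k \<omega>)) \<partial>M) = (\<Prod>k\<in>{i, j}. \<integral>\<omega>. f c (X k \<omega>) \<partial>M)"
      by (rule indep_vars_lebesgue_integral[OF _ iv int]) auto
    moreover have "(\<integral>\<omega>. f c (X i \<omega>) \<partial>M) = 0" using tr(2)[OF ij(1) fN[OF c]] f0[OF c] by simp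
    ultimately show ?thesis using False by simp
  qed
  define Z where "Z = (\<lambda>\<omega>. \<Sum>c\<in>I. ((\<Sum>i<n. g c (X i \<omega>)) / real n - (\<integral>x. g c x \<partial>P))\<^sup>2)"
  have Zf: "Z \<omega> = (\<Sum>c\<in>I. (\<Sum>i<n. \<Sum>j<n. f c (X i \<omega>) * f c (X j \<omega>)) / (real n)\<^sup>2)" for \<omega>
  proof -
    have "(\<Sum>i<n. g c (X i \<omega>)) / real n - (\<integral>x. g c x \<partial>P) = (\<Sum>i<n. f c (X i \<omega>)) / real n" for c
      using n0 by (simp add: f_def sum_subtractf field_simps)
    then show ?thesis by (simp add: Z_def power_divide power2_eq_square sum_product)
  qed
  have iZ: "integrable M Z"
    unfolding Zf by (intro Bochner_Integration.integrable_sum integrable_divide) (use cross in auto)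
  have "(\<integral>\<omega>. Z \<omega> \<partial>M) = (\<Sum>c\<in>I. (\<Sum>i<n. \<Sum>j<n. \<integral>\<omega>. f c (X i \<omega>) * f c (X j \<omega>) \<partial>M) / (real n)\<^sup>2)"
  proof -
    have "(\<integral>\<omega>. Z \<omega> \<partial>M) = (\<Sum>c\<in>I. \<integral>\<omega>. (\<Sum>i<n. \<Sum>j<n. f c (X i \<omega>) * f c (X j \<omega>)) / (real n)\<^sup>2 \<partial>M)"
      unfolding Zf by (rule Bochner_Integration.integral_sum)
        (intro integrable_divide Bochner_Integration.integrable_sum, use cross in auto)
    also have "\<dots> = (\<Sum>c\<in>I. (\<Sum>i<n. \<Sum>j<n. \<integral>\<omega>. f c (X i \<omega>) * f c (X j \<omega>) \<partial>M) / (real n)\<^sup>2)"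
    proof (rule sum.cong[OF refl])
      fix c assume c: "c \<in> I"
      have "(\<integral>\<omega>. (\<Sum>i<n. \<Sum>j<n. f c (X i \<omega>) * f c (X j \<omega>)) \<partial>M) = (\<Sum>i<n. \<integral>\<omega>. (\<Sum>j<n. f c (X i \<omega>) * f c (X j \<omega>)) \<partial>M)"
        by (rule Bochner_Integration.integral_sum) (intro Bochner_Integration.integrable_sum, use cross c in auto)
      also have "\<dots> = (\<Sum>i<n. \<Sum>j<n. \<integral>\<omega>. f c (X i \<omega>) * f c (X j \<omega>) \<partial>M)"
        by (intro sum.cong refl Bochner_Integration.integral_sum) (use cross c in auto)
      finally show "(\<integral>\<omega>. (\<Sum>i<n. \<Sum>j<n. f c (X i \<omega>) * f c (X j \<omega>)) / (real n)\<^sup>2 \<partial>M) = (\<Sum>i<n. \<Sum>j<n. \<integral>\<omega>. f c (X i \<omega>) * f c (X j \<omega>) \<partial>M) / (real n)\<^sup>2"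
        by simp
    qed
    finally show ?thesis .
  qed
  also have "\<dots> = (\<Sum>c\<in>I. (real n * (\<integral>x. (f c x)\<^sup>2 \<partial>P)) / (real n)\<^sup>2)"
  proof (intro sum.cong refl arg_cong2[of _ _ _ _ "(/)"])
    fix c assume c: "c \<in> I"
    have "(\<Sum>i<n. \<Sum>j<n. \<integral>\<omega>. f c (X i \<omega>) * f c (X j \<omega>) \<partial>M) = (\<Sum>i<n. \<Sum>j<n. if i = j then (\<integral>x. (f c x)\<^sup>2 \<partial>P) else 0)"
      by (intro sum.cong refl) (use cross[OF c] in auto)
    then show "(\<Sum>i<n. \<Sum>j<n. \<integral>\<omega>. f c (X i \<omega>) * f c (X j \<omega>) \<partial>M) = real n * (\<integral>x. (f c x)\<^sup>2 \<partial>P)" by simp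
  qed
  also have "\<dots> = (\<Sum>c\<in>I. (\<integral>x. (f c x)\<^sup>2 \<partial>P)) / real n"
    using n0 by (simp add: sum_divide_distrib power2_eq_square)
  also have "\<dots> \<le> V / real n"
  proof (rule divide_right_mono)
    have "(\<Sum>c\<in>I. (\<integral>x. (f c x)\<^sup>2 \<partial>P)) \<le> (\<Sum>c\<in>I. (\<integral>x. (g c x)\<^sup>2 \<partial>P))" by (intro sum_mono f2)
    also have "\<dots> = (\<integral>x. (\<Sum>c\<in>I. (g c x)\<^sup>2) \<partial>P)" by (rule Bochner_Integration.integral_sum[symmetric, OF g2])
    also have "\<dots> \<le> (\<integral>x. H x \<partial>P)"
      by (intro integral_mono Bochner_Integration.integrable_sum g2 H bound)
    finally show "(\<Sum>c\<in>I. (\<integral>x. (f c x)\<^sup>2 \<partial>P)) \<le> V" using H by simp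
  qed simp
  finally have EZ: "(\<integral>\<omega>. Z \<omega> \<partial>M) \<le> V / real n" .
  define t where "t = V / (real n * \<epsilon>)"
  have t: "t > 0" using V n0 \<epsilon> by (simp add: t_def)
  define G where "G = {\<omega>\<in>space M. Z \<omega> < t}"
  have Zm: "Z \<in> borel_measurable M" using iZ by auto
  have G: "G \<in> events" unfolding G_def using Zm by measurable
  have "prob {\<omega>\<in>space M. t \<le> Z \<omega>} \<le> (\<integral>\<omega>. Z \<omega> \<partial>M) / t"
    by (rule integral_Markov_inequality_measure[where A = "space M" and u = Z, simplified])
       (use iZ t in \<open>auto simp: Z_def sum_nonneg\<close>)
  also have "\<dots> \<le> (V / real n) / t" using EZ t by (intro divide_right_mono) auto
  also have "\<dots> = \<epsilon>" using V n0 \<epsilon> by (simp add: t_def)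
  finally have "prob {\<omega>\<in>space M. t \<le> Z \<omega>} \<le> \<epsilon>" .
  moreover have "prob G = 1 - prob {\<omega>\<in>space M. t \<le> Z \<omega>}"
  proof -
    have "{\<omega>\<in>space M. t \<le> Z \<omega>} \<in> events" using Zm by measurable
    moreover have "G = space M - {\<omega>\<in>space M. t \<le> Z \<omega>}" by (auto simp: G_def)
    ultimately show ?thesis using prob_compl by simp
  qed
  ultimately show ?thesis using that[OF G] by (force simp: G_def Z_def t_def)
qed

lemma (in prob_space) sample_mean_markov:
  assumes X: "\<And>i. i < n \<Longrightarrow> X i \<in> measurable M N"
    and law: "\<And>i. i < n \<Longrightarrow> distr M N (X i) = P"
    and n: "n \<ge> 1" and h: "h \<in> borel_measurable N" "\<And>x. 0 \<le> h x"
    and H: "integrable P h" "(\<integral>x. h x \<partial>P) \<le> V" and V: "V > 0" and \<epsilon>: "\<epsilon> > 0"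
  obtains G where "G \<in> events" "prob G \<ge> 1 - \<epsilon>"
    "\<And>\<omega>. \<omega> \<in> G \<Longrightarrow> (\<Sum>i<n. h (X i \<omega>)) / real n \<le> V / \<epsilon>"
proof -
  have tr: "integrable M (\<lambda>\<omega>. h (X i \<omega>))" "(\<integral>\<omega>. h (X i \<omega>) \<partial>M) = (\<integral>x. h x \<partial>P)" if "i < n" for i
    using integrable_distr_eq[OF X[OF that] h(1)] integral_distr[OF X[OF that] h(1)] law[OF that] H(1) by simp_all
  define Z where "Z = (\<lambda>\<omega>. (\<Sum>i<n. h (X i \<omega>)) / real n)"
  have iZ: "integrable M Z"
    unfolding Z_def by (intro integrable_divide Bochner_Integration.integrable_sum tr) auto
  have "(\<integral>\<omega>. Z \<omega> \<partial>M) = (\<integral>\<omega>. (\<Sum>i<n. h (X i \<omega>)) \<partial>M) / real n" unfolding Z_def by simp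
  also have "(\<integral>\<omega>. (\<Sum>i<n. h (X i \<omega>)) \<partial>M) = (\<Sum>i<n. \<integral>\<omega>. h (X i \<omega>) \<partial>M)"
    by (rule Bochner_Integration.integral_sum) (use tr in auto)
  also have "\<dots> = real n * (\<integral>x. h x \<partial>P)" using tr by simp
  finally have EZ: "(\<integral>\<omega>. Z \<omega> \<partial>M) \<le> V" using H n by simp
  define G where "G = {\<omega>\<in>space M. Z \<omega> < V / \<epsilon>}"
  have Zm: "Z \<in> borel_measurable M" using iZ by auto
  have G: "G \<in> events" unfolding G_def using Zm by measurable
  have t: "V / \<epsilon> > 0" using V \<epsilon> by simp
  have "prob {\<omega>\<in>space M. V / \<epsilon> \<le> Z \<omega>} \<le> (\<integral>\<omega>. Z \<omega> \<partial>M) / (V / \<epsilon>)"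
    by (rule integral_Markov_inequality_measure[where A = "space M" and u = Z, simplified])
       (use iZ t h(2) in \<open>auto simp: Z_def sum_nonneg\<close>)
  also have "\<dots> \<le> V / (V / \<epsilon>)" using EZ t by (intro divide_right_mono) auto
  also have "\<dots> = \<epsilon>" using V \<epsilon> by simp
  finally have "prob {\<omega>\<in>space M. V / \<epsilon> \<le> Z \<omega>} \<le> \<epsilon>" .
  moreover have "prob G = 1 - prob {\<omega>\<in>space M. V / \<epsilon> \<le> Z \<omega>}"
  proof -
    have "{\<omega>\<in>space M. V / \<epsilon> \<le> Z \<omega>} \<in> events" using Zm by measurable
    moreover have "G = space M - {\<omega>\<in>space M. V / \<epsilon> \<le> Z \<omega>}" by (auto simp: G_def)
    ultimately show ?thesis using prob_compl by simp
  qed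
  ultimately show ?thesis using that[OF G] by (force simp: G_def Z_def)
qed

lemma (in prob_space) prob_Int_ge:
  assumes "A \<in> events" "B \<in> events" "prob A \<ge> 1 - a" "prob B \<ge> 1 - b"
  shows "prob (A \<inter> B) \<ge> 1 - (a + b)"
proof -
  have "prob A = prob (A \<inter> B) + prob (A - B)"
  proof -
    have "A \<inter> B \<union> (A - B) = A" by auto
    then show ?thesis using assms finite_measure_Union[of "A \<inter> B" "A - B"] by auto
  qed
  moreover have "prob (A - B) \<le> prob (space M - B)"
    using assms sets.sets_into_space[OF assms(1)] by (intro finite_measure_mono) auto
  moreover have "prob (space M - B) = 1 - prob B" using assms by (simp add: prob_compl)
  ultimately show ?thesis using assms by linarith
qed

section \<open>Replacing the centre by the spatial median\<close>

text \<open>Sets the radius \<rho> = K / (z1 sqrt n), z1 being the mean inverse distance. With c the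
  curvature constant and K = 8 / (c sqrt \<epsilon>), half of the curvature c z1 already yields
  twice the gradient bound 1 / sqrt (n \<epsilon>).\<close>

definition radius_const :: "real \<Rightarrow> real \<Rightarrow> real \<Rightarrow> real" where
  "radius_const \<zeta> \<psi> \<epsilon> = 8 / (curv_const \<zeta> \<psi> * sqrt \<epsilon>)"

text \<open>n times 4 \<rho> \<kappa> + 48 \<rho>^2 V / \<epsilon>, where V = \<zeta> z1^2 and
  \<kappa>^2 = V / (n \<epsilon>) is the squared size of the odd sample means. The scale z1 cancels
  between \<rho> and \<kappa>.\<close>

definition med_const :: "real \<Rightarrow> real \<Rightarrow> real \<Rightarrow> real" where
  "med_const \<zeta> \<psi> \<epsilon> = 4 * radius_const \<zeta> \<psi> \<epsilon> * sqrt (\<zeta> / \<epsilon>) + 48 * (radius_const \<zeta> \<psi> \<epsilon>)\<^sup>2 * (\<zeta> / \<epsilon>)"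

text \<open>From this n on, the fluctuation of the sample curvature and the remainder \<rho> k
  together use up at most half of the curvature constant.\<close>

definition med_size :: "real \<Rightarrow> real \<Rightarrow> real \<Rightarrow> real" where
  "med_size \<zeta> \<psi> \<epsilon> = (2 / curv_const \<zeta> \<psi> * (2 * sqrt (\<zeta> / \<epsilon>) + radius_const \<zeta> \<psi> \<epsilon> * (\<zeta> / \<epsilon>)))\<^sup>2"

lemma sum_ssign_sq_le: "(\<Sum>j<d. (ssign d x j)\<^sup>2) \<le> 1"
  using vnorm_ssign[of d x] unfolding vnorm_sq_sum[symmetric] by simp

lemma sum_Times_mult:
  fixes f :: "'a \<Rightarrow> real" and g :: "'b \<Rightarrow> real"
  shows "(\<Sum>c\<in>A\<times>B. f (fst c) * g (snd c)) = sum f A * sum g B"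
  by (simp add: sum_product sum.cartesian_product split_def)

context elliptical
begin

abbreviation R :: "(nat \<Rightarrow> real) \<Rightarrow> real" where "R x \<equiv> inverse (vnorm d (x - mu))"
abbreviation u :: "(nat \<Rightarrow> real) \<Rightarrow> nat \<Rightarrow> real" where "u x \<equiv> ssign d (x - mu)"

lemma R_odd: "(\<And>i. i < d \<Longrightarrow> y i - mu i = - (x i - mu i)) \<Longrightarrow> R y = R x"
proof -
  assume "\<And>i. i < d \<Longrightarrow> y i - mu i = - (x i - mu i)"
  then have "vnorm d (y - mu) = vnorm d (\<lambda>i. (-1) * (x - mu) i)" by (intro vnorm_cong) simp
  then show ?thesis using vnorm_scale[of d "-1" "x - mu"] by simp
qed

lemma u_odd: "(\<And>i. i < d \<Longrightarrow> y i - mu i = - (x i - mu i)) \<Longrightarrow> j < d \<Longrightarrow> u y j = - u x j"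
proof -
  assume a: "\<And>i. i < d \<Longrightarrow> y i - mu i = - (x i - mu i)" and j: "j < d"
  have "u y j = ssign d (\<lambda>i. - (x - mu) i) j"
    by (rule ssign_cong[OF _ j]) (use a in simp)
  then show ?thesis by (simp only: ssign_uminus)
qed

lemma R_measurable: "R \<in> borel_measurable (Rvec d)"
  by measurable

text \<open>Six sample means are controlled, each failing with probability at most \<epsilon>: the
  gradient (Ga), the two odd means of the first-order terms (Gb, Gc), the scalar and the matrix part
  of the Hessian (Gd, Ge) and the mean of R^2 (Gf). The event Gp, on which no observation equals the
  centre, has probability 1. One event thus serves all directions v and every median m.\<close>

lemma median_effect:
  fixes M :: "'a measure" and X :: "nat \<Rightarrow> 'a \<Rightarrow> nat \<Rightarrow> real"
  assumes M: "prob_space M"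
    and ind: "prob_space.indep_vars M (\<lambda>_. Rvec d) X {..<n}"
    and law: "\<And>i. i < n \<Longrightarrow> distr M (Rvec d) (X i) = P"
    and n: "n \<ge> 1"
    and I1: "integrable P (\<lambda>x. R x ^ 1)" and I2: "integrable P (\<lambda>x. R x ^ 2)"
    and \<zeta>: "\<zeta> > 0" and ratio: "zeta d mu P 2 / zeta d mu P 1 ^ 2 < \<zeta>"
    and \<psi>: "\<psi> > 0" and S: "\<And>e. vnorm d e = 1 \<Longrightarrow> qform d (gdir d q A) e \<le> 1 - \<psi>"
    and \<epsilon>: "\<epsilon> > 0" and size: "med_size \<zeta> \<psi> \<epsilon> \<le> real n"
  obtains G where "G \<in> sets M" "measure M G \<ge> 1 - 6 * \<epsilon>"
    "\<And>\<omega> m v. \<omega> \<in> G \<Longrightarrow> is_spatial_median d n (\<lambda>i. X i \<omega>) m \<Longrightarrow> vnorm d v = 1 \<Longrightarrow>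
      \<bar>qform d (sample_sscm d n (\<lambda>i. X i \<omega>) m) v - qform d (sample_sscm d n (\<lambda>i. X i \<omega>) mu) v\<bar> \<le> med_const \<zeta> \<psi> \<epsilon> / real n"
proof -
  interpret M: prob_space M by (rule M)
  have X: "X i \<in> measurable M (Rvec d)" if "i < n" for i using ind that by (auto simp: M.indep_vars_def)
  have n0: "real n > 0" using n by simp
  define z1 where "z1 = zeta d mu P 1"
  have z1: "z1 > 0" unfolding z1_def by (rule zeta1_pos[OF I1 I2 \<zeta> ratio])
  define V where "V = \<zeta> * z1\<^sup>2"
  have V: "V > 0" using \<zeta> z1 by (simp add: V_def)
  have ER2: "(\<integral>x. R x ^ 2 \<partial>P) \<le> V"
    using zeta2_le[OF I1 I2 \<zeta> ratio] by (simp add: V_def z1_def zeta_def)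
  have IR: "integrable P R" using I1 by simp
  have z1_eq: "z1 = (\<integral>x. R x \<partial>P)" by (simp add: z1_def zeta_def)
  have um: "j < d \<Longrightarrow> (\<lambda>x. u x j) \<in> borel_measurable (Rvec d)" for j by (rule ssign_diff_measurable)
  have R2m: "(\<lambda>x. R x ^ 2) \<in> borel_measurable (Rvec d)" by measurable
  have S1: "(\<Sum>j<d. (u x j)\<^sup>2) \<le> 1" for x by (rule sum_ssign_sq_le)
  have S0: "0 \<le> (\<Sum>j<d. (u x j)\<^sup>2)" for x by (simp add: sum_nonneg)
  note lln = M.sample_mean_hilbert[OF ind law n]
  obtain Ga where Ga: "Ga \<in> M.events" "M.prob Ga \<ge> 1 - \<epsilon>"
    and ga: "\<And>\<omega>. \<omega> \<in> Ga \<Longrightarrow> (\<Sum>j<d. ((\<Sum>i<n. u (X i \<omega>) j) / real n - (\<integral>x. u x j \<partial>P))\<^sup>2) \<le> 1 / (real n * \<epsilon>)"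
    using lln[of "{..<d}" "\<lambda>j x. u x j" "\<lambda>_. 1" 1 \<epsilon>] um S1 \<epsilon> by (auto simp: P.prob_space)
  obtain Gb where Gb: "Gb \<in> M.events" "M.prob Gb \<ge> 1 - \<epsilon>"
    and gb: "\<And>\<omega>. \<omega> \<in> Gb \<Longrightarrow> (\<Sum>j<d. ((\<Sum>i<n. R (X i \<omega>) * u (X i \<omega>) j) / real n - (\<integral>x. R x * u x j \<partial>P))\<^sup>2) \<le> V / (real n * \<epsilon>)"
  proof (rule lln[of "{..<d}" "\<lambda>j x. R x * u x j" "\<lambda>x. R x ^ 2" V \<epsilon>])
    show "(\<lambda>x. R x * u x j) \<in> borel_measurable (Rvec d)" if "j \<in> {..<d}" for j
      using um[of j] that by (intro borel_measurable_times R_measurable) auto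
    show "(\<Sum>j<d. (R x * u x j)\<^sup>2) \<le> R x ^ 2" for x
      using mult_left_mono[OF S1[of x], of "R x ^ 2"] by (simp add: power_mult_distrib sum_distrib_left)
  qed (use I2 ER2 V \<epsilon> in auto)
  let ?I3 = "{..<d}\<times>{..<d}\<times>{..<d}"
  let ?u3 = "\<lambda>c x. u x (fst c) * (u x (fst (snd c)) * u x (snd (snd c)))"
  obtain Gc where Gc: "Gc \<in> M.events" "M.prob Gc \<ge> 1 - \<epsilon>"
    and gc: "\<And>\<omega>. \<omega> \<in> Gc \<Longrightarrow> (\<Sum>c\<in>?I3. ((\<Sum>i<n. R (X i \<omega>) * ?u3 c (X i \<omega>)) / real n - (\<integral>x. R x * ?u3 c x \<partial>P))\<^sup>2) \<le> V / (real n * \<epsilon>)"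
  proof (rule lln[of ?I3 "\<lambda>c x. R x * ?u3 c x" "\<lambda>x. R x ^ 2" V \<epsilon>])
    show "(\<lambda>x. R x * ?u3 c x) \<in> borel_measurable (Rvec d)" if "c \<in> ?I3" for c
      using that by (intro borel_measurable_times R_measurable um) auto
    show "(\<Sum>c\<in>?I3. (R x * ?u3 c x)\<^sup>2) \<le> R x ^ 2" for x
    proof -
      have "(\<Sum>c\<in>?I3. (R x * ?u3 c x)\<^sup>2) = R x ^ 2 * ((\<Sum>j<d. (u x j)\<^sup>2) * ((\<Sum>j<d. (u x j)\<^sup>2) * (\<Sum>j<d. (u x j)\<^sup>2)))"
        using sum_Times_mult[of "\<lambda>j. (u x j)\<^sup>2" "\<lambda>c. (u x (fst c))\<^sup>2 * (u x (snd c))\<^sup>2" "{..<d}" "{..<d}\<times>{..<d}"]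
          sum_Times_mult[of "\<lambda>j. (u x j)\<^sup>2" "\<lambda>j. (u x j)\<^sup>2" "{..<d}" "{..<d}"]
        by (simp only: power_mult_distrib sum_distrib_left[symmetric])
      also have "\<dots> \<le> R x ^ 2 * (1 * (1 * 1))"
        using S1[of x] S0[of x] by (intro mult_left_mono mult_mono) auto
      finally show ?thesis by simp
    qed
  qed (use I2 ER2 V \<epsilon> in auto)
  obtain Gd where Gd: "Gd \<in> M.events" "M.prob Gd \<ge> 1 - \<epsilon>"
    and gd: "\<And>\<omega>. \<omega> \<in> Gd \<Longrightarrow> ((\<Sum>i<n. R (X i \<omega>)) / real n - (\<integral>x. R x \<partial>P))\<^sup>2 \<le> V / (real n * \<epsilon>)"
    using lln[of "{()}" "\<lambda>_ x. R x" "\<lambda>x. R x ^ 2" V \<epsilon>] R_measurable I2 ER2 V \<epsilon> by auto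
  let ?I2 = "{..<d}\<times>{..<d}"
  let ?u2 = "\<lambda>c x. u x (fst c) * u x (snd c)"
  have u2sum: "(\<Sum>c\<in>?I2. (R x * ?u2 c x)\<^sup>2) \<le> R x ^ 2" for x
  proof -
    have "(\<Sum>c\<in>?I2. (R x * ?u2 c x)\<^sup>2) = R x ^ 2 * ((\<Sum>j<d. (u x j)\<^sup>2) * (\<Sum>j<d. (u x j)\<^sup>2))"
      by (simp only: power_mult_distrib sum_distrib_left[symmetric] sum_Times_mult[of "\<lambda>j. (u x j)\<^sup>2" "\<lambda>j. (u x j)\<^sup>2"])
    also have "\<dots> \<le> R x ^ 2 * (1 * 1)"
      using S1[of x] S0[of x] by (intro mult_left_mono mult_mono) auto
    finally show ?thesis by simp
  qed
  have u2m: "(\<lambda>x. R x * ?u2 c x) \<in> borel_measurable (Rvec d)" if "c \<in> ?I2" for c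
    using that by (intro borel_measurable_times R_measurable um) auto
  obtain Ge where Ge: "Ge \<in> M.events" "M.prob Ge \<ge> 1 - \<epsilon>"
    and ge: "\<And>\<omega>. \<omega> \<in> Ge \<Longrightarrow> (\<Sum>c\<in>?I2. ((\<Sum>i<n. R (X i \<omega>) * ?u2 c (X i \<omega>)) / real n - (\<integral>x. R x * ?u2 c x \<partial>P))\<^sup>2) \<le> V / (real n * \<epsilon>)"
    by (rule lln[of ?I2 "\<lambda>c x. R x * ?u2 c x" "\<lambda>x. R x ^ 2" V \<epsilon>]) (use u2m u2sum I2 ER2 V \<epsilon> in auto)
  obtain Gf where Gf: "Gf \<in> M.events" "M.prob Gf \<ge> 1 - \<epsilon>"
    and gf: "\<And>\<omega>. \<omega> \<in> Gf \<Longrightarrow> (\<Sum>i<n. R (X i \<omega>) ^ 2) / real n \<le> V / \<epsilon>"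
    by (rule M.sample_mean_markov[OF X law n R2m _ I2 ER2 V \<epsilon>]) auto
  define Gp where "Gp = {\<omega>\<in>space M. \<forall>i<n. vnorm d (X i \<omega> - mu) > 0}"
  have Xv: "(\<lambda>\<omega>. vnorm d (X i \<omega> - mu)) \<in> borel_measurable M" if "i < n" for i
    by (rule measurable_compose[OF X[OF that] vnorm_diff_measurable])
  have Gp: "Gp \<in> M.events" "M.prob Gp \<ge> 1 - 0"
  proof -
    have "Gp = space M \<inter> (\<Inter>i\<in>{..<n}. {\<omega>\<in>space M. vnorm d (X i \<omega> - mu) > 0})" by (auto simp: Gp_def)
    also have "\<dots> \<in> M.events"
      using Xv n by (intro sets.Int sets.top sets.finite_INT) (auto simp: lessThan_empty_iff)
    finally show Gpm: "Gp \<in> M.events" .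
    have "AE \<omega> in M. vnorm d (X i \<omega> - mu) > 0" if "i < n" for i
    proof (rule AE_distrD[OF X[OF that]])
      show "AE x in distr M (Rvec d) (X i). 0 < vnorm d (x - mu)" unfolding law[OF that] by (rule AE_P_pos)
    qed
    then have "AE \<omega> in M. \<forall>i\<in>{..<n}. vnorm d (X i \<omega> - mu) > 0" by (intro AE_finite_allI) auto
    then have "AE \<omega> in M. \<omega> \<in> Gp" by (rule AE_mp) (auto intro!: AE_I2 simp: Gp_def)
    then have "M.prob Gp = 1" using M.prob_eq_1[OF Gpm] by blast
    then show "M.prob Gp \<ge> 1 - 0" by simp
  qed
  define G where "G = Ga \<inter> (Gb \<inter> (Gc \<inter> (Gd \<inter> (Ge \<inter> (Gf \<inter> Gp)))))"
  have G: "G \<in> sets M" unfolding G_def using Ga Gb Gc Gd Ge Gf Gp by auto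
  have "M.prob G \<ge> 1 - (\<epsilon> + (\<epsilon> + (\<epsilon> + (\<epsilon> + (\<epsilon> + (\<epsilon> + 0))))))"
    unfolding G_def by (intro M.prob_Int_ge sets.Int Ga Gb Gc Gd Ge Gf Gp)
  then have pG: "M.prob G \<ge> 1 - 6 * \<epsilon>" by simp
  have zero_a: "(\<integral>x. u x j \<partial>P) = 0" if "j < d" for j
    by (rule integral_odd_zero[OF um[OF that]]) (use u_odd that in auto)
  have zero_b: "(\<integral>x. R x * u x j \<partial>P) = 0" if "j < d" for j
  proof (rule integral_odd_zero)
    show "(\<lambda>x. R x * u x j) \<in> borel_measurable (Rvec d)" by (intro borel_measurable_times R_measurable um that)
    fix x y :: "nat \<Rightarrow> real" assume a: "\<And>i. i < d \<Longrightarrow> y i - mu i = - (x i - mu i)"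
    show "R y * u y j = - (R x * u x j)" using R_odd[OF a] u_odd[OF a that] by simp
  qed
  have zero_c: "(\<integral>x. R x * ?u3 c x \<partial>P) = 0" if c: "c \<in> ?I3" for c
  proof (rule integral_odd_zero)
    show "(\<lambda>x. R x * ?u3 c x) \<in> borel_measurable (Rvec d)" using c by (intro borel_measurable_times R_measurable um) auto
    fix x y :: "nat \<Rightarrow> real" assume a: "\<And>i. i < d \<Longrightarrow> y i - mu i = - (x i - mu i)"
    have "u y j = - u x j" if "j < d" for j by (rule u_odd[OF a that])
    then show "R y * ?u3 c y = - (R x * ?u3 c x)" using R_odd[OF a] c by auto
  qed
  define \<kappa> where "\<kappa> = sqrt (\<zeta> / \<epsilon>) * z1 / sqrt (real n)"
  have \<kappa>0: "\<kappa> \<ge> 0" using \<zeta> \<epsilon> z1 by (simp add: \<kappa>_def)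
  have \<kappa>2: "V / (real n * \<epsilon>) = \<kappa>\<^sup>2" using \<zeta> \<epsilon> n0 by (simp add: \<kappa>_def V_def power_mult_distrib power_divide)
  define c where "c = curv_const \<zeta> \<psi>"
  have c: "c > 0" using curv_const_pos[OF \<zeta> \<psi>] by (simp add: c_def)
  define K where "K = radius_const \<zeta> \<psi> \<epsilon>"
  have K: "K > 0" "K * c = 8 / sqrt \<epsilon>" using c \<epsilon> by (auto simp: K_def radius_const_def c_def)
  define \<rho> where "\<rho> = K / (z1 * sqrt (real n))"
  have \<rho>: "\<rho> > 0" using K z1 n0 by (simp add: \<rho>_def)
  have ER2i: "integrable P (\<lambda>x. R x * ?u2 p x)" if "p \<in> ?I2" for p
  proof (rule Bochner_Integration.integrable_bound[OF IR])
    show "(\<lambda>x. R x * ?u2 p x) \<in> borel_measurable P" using u2m[OF that] by (simp add: measurable_cong_sets[OF sets_P refl])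
    show "AE x in P. norm (R x * ?u2 p x) \<le> norm (R x)"
    proof (rule AE_I2)
      fix x
      have "\<bar>?u2 p x\<bar> \<le> 1" using abs_ssign_le[of "fst p" d "x - mu"] abs_ssign_le[of "snd p" d "x - mu"] that
        by (auto simp: abs_mult intro!: mult_le_one)
      then show "norm (R x * ?u2 p x) \<le> norm (R x)" by (simp add: abs_mult mult_left_le)
    qed
  qed
  have big: "2 * sqrt (\<zeta> / \<epsilon>) / sqrt (real n) + K * (\<zeta> / \<epsilon>) / sqrt (real n) \<le> c / 2"
  proof -
    have "2 / c * (2 * sqrt (\<zeta> / \<epsilon>) + K * (\<zeta> / \<epsilon>)) \<le> sqrt (real n)"
      using size by (intro real_le_rsqrt) (simp add: med_size_def K_def c_def)
    then have "(2 * sqrt (\<zeta> / \<epsilon>) + K * (\<zeta> / \<epsilon>)) \<le> c / 2 * sqrt (real n)" using c by (simp add: field_simps)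
    then have "(2 * sqrt (\<zeta> / \<epsilon>) + K * (\<zeta> / \<epsilon>)) / sqrt (real n) \<le> c / 2" using n0 by (simp add: pos_divide_le_eq)
    then show ?thesis by (simp add: add_divide_distrib)
  qed
  show ?thesis
  proof (rule that[OF G pG])
    fix \<omega> m v assume \<omega>: "\<omega> \<in> G" and med: "is_spatial_median d n (\<lambda>i. X i \<omega>) m" and v: "vnorm d v = 1"
    have pos: "vnorm d (X i \<omega> - mu) > 0" if "i < n" for i using \<omega> that by (auto simp: G_def Gp_def)
    have gA: "vnorm d (\<lambda>j. (\<Sum>i<n. u (X i \<omega>) j) / real n) \<le> 1 / sqrt (real n * \<epsilon>)"
    proof -
      have "(vnorm d (\<lambda>j. (\<Sum>i<n. u (X i \<omega>) j) / real n))\<^sup>2 \<le> 1 / (real n * \<epsilon>)"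
        unfolding vnorm_sq_sum
      proof (rule order_trans[OF eq_refl ga])
        show "(\<Sum>j<d. ((\<Sum>i<n. u (X i \<omega>) j) / real n)\<^sup>2) = (\<Sum>j<d. ((\<Sum>i<n. u (X i \<omega>) j) / real n - (\<integral>x. u x j \<partial>P))\<^sup>2)"
          by (intro sum.cong refl) (simp only: zero_a lessThan_iff diff_zero)
      qed (use \<omega> in \<open>simp only: G_def Int_iff\<close>)
      also have "\<dots> = (1 / sqrt (real n * \<epsilon>))\<^sup>2" using n0 \<epsilon> by (simp only: power_divide power_one real_sqrt_pow2 mult_nonneg_nonneg less_imp_le)
      finally show ?thesis by (rule power2_le_imp_le) (use n0 \<epsilon> in simp)
    qed
    have gB: "vnorm d (\<lambda>j. (\<Sum>i<n. R (X i \<omega>) * u (X i \<omega>) j) / real n) \<le> \<kappa>"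
    proof -
      have "(vnorm d (\<lambda>j. (\<Sum>i<n. R (X i \<omega>) * u (X i \<omega>) j) / real n))\<^sup>2 \<le> V / (real n * \<epsilon>)"
        unfolding vnorm_sq_sum
      proof (rule order_trans[OF eq_refl gb])
        show "(\<Sum>j<d. ((\<Sum>i<n. R (X i \<omega>) * u (X i \<omega>) j) / real n)\<^sup>2)
          = (\<Sum>j<d. ((\<Sum>i<n. R (X i \<omega>) * u (X i \<omega>) j) / real n - (\<integral>x. R x * u x j \<partial>P))\<^sup>2)"
          by (intro sum.cong refl) (simp only: zero_b lessThan_iff diff_zero)
      qed (use \<omega> in \<open>simp only: G_def Int_iff\<close>)
      then show ?thesis unfolding \<kappa>2 using \<kappa>0 by (rule power2_le_imp_le)
    qed
    have gC: "(\<Sum>c\<in>?I3. ((\<Sum>i<n. R (X i \<omega>) * ?u3 c (X i \<omega>)) / real n)\<^sup>2) \<le> \<kappa>\<^sup>2"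
    proof -
      have "(\<Sum>c\<in>?I3. ((\<Sum>i<n. R (X i \<omega>) * ?u3 c (X i \<omega>)) / real n)\<^sup>2)
        = (\<Sum>c\<in>?I3. ((\<Sum>i<n. R (X i \<omega>) * ?u3 c (X i \<omega>)) / real n - (\<integral>x. R x * ?u3 c x \<partial>P))\<^sup>2)"
        by (intro sum.cong refl) (simp only: zero_c diff_zero)
      also have "\<dots> \<le> V / (real n * \<epsilon>)" by (rule gc) (use \<omega> in \<open>simp add: G_def\<close>)
      finally show ?thesis unfolding \<kappa>2 .
    qed
    have gF: "(\<Sum>i<n. R (X i \<omega>) ^ 2) / real n \<le> V / \<epsilon>" using gf[of \<omega>] \<omega> by (simp add: G_def)
    \<comment> \<open>The sample curvature differs from the population one by at most \<kappa> in
      the scalar part and \<kappa> in the matrix part; the latter is measured in Frobenius norm and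
      therefore uniform in e.\<close>
    have hess: "c * z1 - 2 * \<kappa> \<le> (\<Sum>i<n. R (X i \<omega>) * (1 - (ip d (u (X i \<omega>)) e)\<^sup>2)) / real n" if e: "vnorm d e = 1" for e
    proof -
      let ?m = "(\<Sum>i<n. R (X i \<omega>)) / real n"
      let ?D = "\<lambda>j k. (\<Sum>i<n. R (X i \<omega>) * (u (X i \<omega>) j * u (X i \<omega>) k)) / real n - (\<integral>x. R x * (u x j * u x k) \<partial>P)"
      have "(?m - z1)\<^sup>2 \<le> \<kappa>\<^sup>2" using gd[of \<omega>] \<omega> by (simp add: G_def \<kappa>2 z1_eq)
      then have d1: "\<bar>?m - z1\<bar> \<le> \<kappa>" using \<kappa>0 abs_le_square_iff[of "?m - z1" \<kappa>] by simp
      have "(\<Sum>i<d. \<Sum>j<d. (?D i j)\<^sup>2) \<le> \<kappa>\<^sup>2"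
        using ge[of \<omega>] \<omega> by (simp add: G_def \<kappa>2 sum.cartesian_product split_def)
      then have "sqrt (\<Sum>i<d. \<Sum>j<d. (?D i j)\<^sup>2) \<le> \<kappa>" using \<kappa>0 by (intro real_le_lsqrt) (auto simp: sum_nonneg)
      then have d2: "\<bar>qform d ?D e\<bar> \<le> \<kappa>" using qform_le_frobenius[of d ?D e] e by simp
      have q1: "qform d (\<lambda>j k. (\<Sum>i<n. R (X i \<omega>) * (u (X i \<omega>) j * u (X i \<omega>) k)) / real n) e = (\<Sum>i<n. R (X i \<omega>) * (ip d (u (X i \<omega>)) e)\<^sup>2) / real n"
      proof -
        have "qform d (\<lambda>j k. (\<Sum>i<n. R (X i \<omega>) * (u (X i \<omega>) j * u (X i \<omega>) k)) / real n) e
           = qform d (\<lambda>j k. (1 / real n) * (\<Sum>i<n. R (X i \<omega>) * (u (X i \<omega>) j * u (X i \<omega>) k))) e" by simp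
        also have "\<dots> = (1 / real n) * (\<Sum>i<n. R (X i \<omega>) * (ip d (u (X i \<omega>)) e)\<^sup>2)"
          by (simp only: qform_scaleM qform_sum qform_outer)
        finally show ?thesis by simp
      qed
      have pw: "R x * (ip d (u x) e)\<^sup>2 = (\<Sum>j<d. \<Sum>k<d. e j * (R x * ?u2 (j, k) x) * e k)" for x
        by (simp add: ip_def power2_eq_square sum_product sum_distrib_left mult_ac)
      have iq: "integrable P (\<lambda>x. R x * (ip d (u x) e)\<^sup>2)"
        unfolding pw by (intro Bochner_Integration.integrable_sum integrable_mult_left integrable_mult_right ER2i) auto
      have q2: "(\<integral>x. R x * (ip d (u x) e)\<^sup>2 \<partial>P) = qform d (\<lambda>j k. \<integral>x. R x * (u x j * u x k) \<partial>P) e"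
      proof -
        have I: "integrable P (\<lambda>x. e j * (R x * ?u2 (j, k) x) * e k)" if "j < d" "k < d" for j k
          by (intro integrable_mult_left integrable_mult_right ER2i) (use that in auto)
        have "(\<integral>x. R x * (ip d (u x) e)\<^sup>2 \<partial>P) = (\<Sum>j<d. \<integral>x. (\<Sum>k<d. e j * (R x * ?u2 (j, k) x) * e k) \<partial>P)"
          unfolding pw by (rule Bochner_Integration.integral_sum) (intro Bochner_Integration.integrable_sum I, auto)
        also have "\<dots> = (\<Sum>j<d. \<Sum>k<d. \<integral>x. e j * (R x * ?u2 (j, k) x) * e k \<partial>P)"
          by (intro sum.cong refl Bochner_Integration.integral_sum I) auto
        finally show ?thesis by (simp add: qform_def)
      qed
      have "c * z1 \<le> (\<integral>x. R x * (1 - (ip d (u x) e)\<^sup>2) \<partial>P)"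
        unfolding c_def z1_def by (rule curvature[OF I1 I2 \<zeta> ratio \<psi> S[OF e] e])
      also have "\<dots> = z1 - (\<integral>x. R x * (ip d (u x) e)\<^sup>2 \<partial>P)"
        using IR iq by (simp add: right_diff_distrib z1_eq)
      finally have "c * z1 \<le> z1 - qform d (\<lambda>j k. \<integral>x. R x * (u x j * u x k) \<partial>P) e" unfolding q2 .
      moreover have "qform d ?D e = (\<Sum>i<n. R (X i \<omega>) * (ip d (u (X i \<omega>)) e)\<^sup>2) / real n - qform d (\<lambda>j k. \<integral>x. R x * (u x j * u x k) \<partial>P) e"
        unfolding qform_diff q1 ..
      moreover have "(\<Sum>i<n. R (X i \<omega>) * (1 - (ip d (u (X i \<omega>)) e)\<^sup>2)) / real n = ?m - (\<Sum>i<n. R (X i \<omega>) * (ip d (u (X i \<omega>)) e)\<^sup>2) / real n"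
        by (simp add: right_diff_distrib sum_subtractf diff_divide_distrib)
      ultimately show ?thesis using d1 d2 by linarith
    qed
    have small: "1 / sqrt (real n * \<epsilon>) < \<rho> / 2 * (c * z1 - 2 * \<kappa> - \<rho> * (V / \<epsilon>))"
    proof -
      define sn where "sn = sqrt (real n)"
      have sn: "sn > 0" using n0 by (simp add: sn_def)
      have "c * z1 - 2 * \<kappa> - \<rho> * (V / \<epsilon>) = z1 * (c - (2 * sqrt (\<zeta> / \<epsilon>) / sn + K * (\<zeta> / \<epsilon>) / sn))"
        using z1 sn by (simp add: \<kappa>_def \<rho>_def V_def sn_def[symmetric] field_simps power2_eq_square)
      also have "\<dots> \<ge> z1 * (c / 2)" using big z1 by (intro mult_left_mono) (auto simp: sn_def)
      finally have "\<rho> / 2 * (z1 * (c / 2)) \<le> \<rho> / 2 * (c * z1 - 2 * \<kappa> - \<rho> * (V / \<epsilon>))"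
        using \<rho> by (intro mult_left_mono) auto
      moreover have "\<rho> / 2 * (z1 * (c / 2)) = K * c / (4 * sn)" using z1 sn by (simp add: \<rho>_def sn_def[symmetric] field_simps)
      moreover have "K * c / (4 * sn) = 2 * (1 / sqrt (real n * \<epsilon>))"
        unfolding K by (simp add: sn_def real_sqrt_mult)
      moreover have "1 / sqrt (real n * \<epsilon>) > 0" using n0 \<epsilon> by simp
      ultimately show ?thesis by linarith
    qed
    have close: "vnorm d (m - mu) \<le> \<rho>"
      by (rule spatial_median_close[OF med pos n \<rho> gA hess gF small])
    have "\<bar>qform d (sample_sscm d n (\<lambda>i. X i \<omega>) m) v - qform d (sample_sscm d n (\<lambda>i. X i \<omega>) mu) v\<bar>
      \<le> 2 * \<rho> * \<kappa> + 2 * \<rho> * \<kappa> + 48 * \<rho>\<^sup>2 * (V / \<epsilon>)"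
      by (rule sample_sscm_perturbation[OF pos n v close gB gC \<kappa>0 gF])
    also have "\<dots> = med_const \<zeta> \<psi> \<epsilon> / real n"
    proof -
      have "2 * \<rho> * \<kappa> + 2 * \<rho> * \<kappa> + 48 * \<rho>\<^sup>2 * (V / \<epsilon>) = 4 * (\<rho> * \<kappa>) + 48 * (\<rho>\<^sup>2 * (V / \<epsilon>))" by simp
      moreover have "\<rho> * \<kappa> = K * sqrt (\<zeta> / \<epsilon>) / real n"
        using z1 n0 by (simp add: \<rho>_def \<kappa>_def)
      moreover have "\<rho>\<^sup>2 * (V / \<epsilon>) = K\<^sup>2 * (\<zeta> / \<epsilon>) / real n"
        using z1 n0 by (simp add: \<rho>_def V_def power_divide power_mult_distrib)
      ultimately show ?thesis unfolding med_const_def K_def[symmetric] by (simp only: add_divide_distrib times_divide_eq_right mult.assoc)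
    qed
    finally show "\<bar>qform d (sample_sscm d n (\<lambda>i. X i \<omega>) m) v - qform d (sample_sscm d n (\<lambda>i. X i \<omega>) mu) v\<bar> \<le> med_const \<zeta> \<psi> \<epsilon> / real n" .
  qed
qed

end

section \<open>Deviation of the sample covariance around the true centre\<close>

text \<open>The remainder of the Gaussian covariance bound after division by the lower bound 0.95
  \<tau> of the squared norms.\<close>

definition dev_const :: "real \<Rightarrow> real" where
  "dev_const \<epsilon> = (4840 + 48.4 * ln (2 / \<epsilon>)) / 0.95"

text \<open>The solution l of (1 / (2 \<epsilon>)) * l * 27 / 0.0003^3 = \<epsilon>.\<close>

definition dev_tol :: "real \<Rightarrow> real" where
  "dev_tol \<epsilon> = \<epsilon>\<^sup>2 * 0.0003 ^ 3 * (2 / 27)"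

text \<open>The first entry handles L < 22: then d <= e^22, so l >= e^(-22) and n l >= 5050 L. The
  second makes n l^2 < 1 / (2 \<epsilon>) imply l <= \<open>dev_tol \<epsilon>\<close>.\<close>

definition dev_size :: "real \<Rightarrow> real" where
  "dev_size \<epsilon> = max (5050 * 22 * exp 22) (1 / (2 * \<epsilon> * (dev_tol \<epsilon>)\<^sup>2))"

text \<open>As n l^2 is bounded, a cubic estimate of the exponential is enough: exp x >= (x / 3)^3
  at x = 0.0003 / l leaves n l^2 times a multiple of l, and l is at most
  \<open>dev_tol \<epsilon>\<close>.\<close>

lemma exp_tail_small:
  fixes n l \<epsilon> :: real
  assumes \<epsilon>: "0 < \<epsilon>" and l: "0 < l" and n: "0 < n" and nl: "n * l\<^sup>2 < 1 / (2 * \<epsilon>)"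
    and size: "1 / (2 * \<epsilon> * (dev_tol \<epsilon>)\<^sup>2) \<le> n"
  shows "l \<le> dev_tol \<epsilon>" "n * exp (- 0.0003 / l) \<le> \<epsilon>"
proof -
  have t: "dev_tol \<epsilon> > 0" using \<epsilon> by (simp add: dev_tol_def)
  have "n * l\<^sup>2 < n * (dev_tol \<epsilon>)\<^sup>2"
  proof -
    have "1 / (2 * \<epsilon>) \<le> n * (dev_tol \<epsilon>)\<^sup>2" using size t \<epsilon> by (simp add: field_simps)
    then show ?thesis using nl by linarith
  qed
  then have "l\<^sup>2 < (dev_tol \<epsilon>)\<^sup>2" using n by simp
  then show lt: "l \<le> dev_tol \<epsilon>" using t l by (simp add: power2_less_imp_less less_imp_le)
  define x where "x = 0.0003 / l"
  have x: "x > 0" using l by (simp add: x_def)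
  have "(x / 3) ^ 3 \<le> exp (x / 3) ^ 3"
    using x exp_ge_add_one_self[of "x / 3"] by (intro power_mono; linarith)
  also have "\<dots> = exp x" by (simp flip: exp_of_nat_mult)
  finally have "exp (- x) \<le> 1 / (x / 3) ^ 3"
    using x by (simp add: exp_minus inverse_eq_divide frac_le)
  also have "\<dots> = 27 * l ^ 3 / 0.0003 ^ 3" using l by (simp add: x_def field_simps)
  finally have "n * exp (- x) \<le> n * (27 * l ^ 3 / 0.0003 ^ 3)" using n by (intro mult_left_mono) auto
  also have "\<dots> = (n * l\<^sup>2) * l * (27 / 0.0003 ^ 3)" by (simp add: power3_eq_cube power2_eq_square)
  also have "\<dots> \<le> (1 / (2 * \<epsilon>)) * dev_tol \<epsilon> * (27 / 0.0003 ^ 3)"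
    using nl lt l \<epsilon> by (intro mult_right_mono mult_mono) auto
  also have "\<dots> = \<epsilon>" using \<epsilon> by (simp add: dev_tol_def power2_eq_square)
  finally show "n * exp (- 0.0003 / l) \<le> \<epsilon>" by (simp add: x_def)
qed

context elliptical
begin

abbreviation S :: "nat \<Rightarrow> nat \<Rightarrow> real" where "S \<equiv> sscm d mu P"
abbreviation l :: real where "l \<equiv> specnorm d S"

lemma S_qform: "qform d S v = qform d (gdir d q A) v"
  unfolding qform_def by (intro sum.cong refl) (simp add: sscm_eq)

lemma S_qform_nonneg: "0 \<le> qform d S v"
proof -
  have "0 \<le> (\<integral>z. (ip d (ssign d (mv q A z)) v)\<^sup>2 \<partial>gauss q)" by simp
  then show ?thesis unfolding S_qform by (simp add: ip_ssign_sq_integrable(2))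
qed

lemma S_qform_le: "qform d S v \<le> l * (vnorm d v)\<^sup>2"
  using qform_le_specnorm[of d S v] by linarith

lemma ssign_prod_integrable: "j < d \<Longrightarrow> k < d \<Longrightarrow> integrable P (\<lambda>x. ssign d (x - mu) j * ssign d (x - mu) k)"
proof (rule P.integrable_const_bound[where B = 1])
  assume jk: "j < d" "k < d"
  show "AE x in P. norm (ssign d (x - mu) j * ssign d (x - mu) k) \<le> 1"
    using jk by (intro AE_I2) (auto simp: abs_mult intro!: mult_le_one abs_ssign_le)
  show "(\<lambda>x. ssign d (x - mu) j * ssign d (x - mu) k) \<in> borel_measurable P"
    using jk by (simp add: measurable_cong_sets[OF sets_P refl]) (intro borel_measurable_times ssign_diff_measurable)
qed

lemma S_trace: "mtrace d S = 1"
proof -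
  have "mtrace d S = (\<integral>x. (\<Sum>i<d. ssign d (x - mu) i * ssign d (x - mu) i) \<partial>P)"
    unfolding mtrace_def sscm_def
    by (rule Bochner_Integration.integral_sum[symmetric]) (auto intro: ssign_prod_integrable)
  also have "\<dots> = (\<integral>x. 1 \<partial>P)"
  proof (rule integral_cong_AE)
    show "(\<lambda>x. \<Sum>i<d. ssign d (x - mu) i * ssign d (x - mu) i) \<in> borel_measurable P"
      by (intro borel_measurable_sum borel_measurable_integrable ssign_prod_integrable) auto
    show "AE x in P. (\<Sum>i<d. ssign d (x - mu) i * ssign d (x - mu) i) = 1"
      using AE_P_pos
    proof eventually_elim
      case (elim x)
      then have "(vnorm d (ssign d (x - mu)))\<^sup>2 = 1" by (simp add: vnorm_ssign)
      then show ?case unfolding vnorm_sq_sum by (simp add: power2_eq_square)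
    qed
  qed auto
  also have "\<dots> = 1" by (simp add: P.prob_space)
  finally show ?thesis .
qed

text \<open>The trace is 1 and no diagonal entry exceeds l. Hence a bounded dimension keeps l away
  from 0, and d = 1 forces l >= 1.\<close>

lemma specnorm_S_ge: "1 \<le> l * real d"
proof -
  have "S i i \<le> l" if i: "i < d" for i
  proof -
    let ?e = "\<lambda>j. if j = i then 1 else 0 :: real"
    have "vnorm d ?e = 1" using i by (simp add: vnorm_def if_distrib[of "\<lambda>x. x\<^sup>2"] sum.delta cong: if_cong)
    moreover have "qform d S ?e = S i i"
      using i by (simp add: qform_def if_distrib[of "\<lambda>x. x * _"] if_distrib[of "\<lambda>x. _ * x"] sum.delta cong: if_cong)
    ultimately show ?thesis using S_qform_le[of ?e] by simp
  qed
  then have "mtrace d S \<le> (\<Sum>i<d. l)" unfolding mtrace_def by (intro sum_mono) auto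
  then show ?thesis by (simp add: S_trace mult.commute)
qed

lemma specnorm_S_pos: "0 < l"
  using specnorm_S_ge specnorm_nonneg[OF d_pos, of S] by (cases "l = 0") auto

context
  fixes M :: "'a measure" and X :: "nat \<Rightarrow> 'a \<Rightarrow> nat \<Rightarrow> real" and n :: nat
  assumes M: "prob_space M"
    and ind: "prob_space.indep_vars M (\<lambda>_. Rvec d) X {..<n}"
    and law: "\<And>i. i < n \<Longrightarrow> distr M (Rvec d) (X i) = P"
    and n: "n \<ge> 1"
begin

abbreviation dv :: "'a \<Rightarrow> (nat \<Rightarrow> real) \<Rightarrow> real" where
  "dv \<omega> v \<equiv> qform d (sample_sscm d n (\<lambda>i. X i \<omega>) mu) v - qform d S v"

lemma X_meas: "i < n \<Longrightarrow> X i \<in> measurable M (Rvec d)"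
  using ind by (auto simp: prob_space.indep_vars_def[OF M])

lemma deviation_moment:
  assumes \<alpha>: "\<alpha> > 0" and L: "L \<ge> ln 2" "L = ln (real d) + ln (1 / \<alpha>)"
    and regime: "L < 22 \<and> 5050 * L \<le> real n * l \<or> 22 \<le> L \<and> 2 * L \<le> real n * l"
  obtains G where "G \<in> sets M" "measure M G \<ge> 1 - 0.97 * \<alpha>"
    "\<And>\<omega> v. \<omega> \<in> G \<Longrightarrow> vnorm d v = 1 \<Longrightarrow> \<bar>dv \<omega> v\<bar> \<le> 2 * sqrt (l * L / real n)"
proof -
  interpret M: prob_space M by (rule M)
  define S' where "S' = (\<lambda>j k. if j < d \<and> k < d then S j k else 0)"
  have q': "qform d S' v = qform d S v" for v
    unfolding qform_def by (intro sum.cong refl) (simp add: S'_def)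
  interpret I: indep_directions M n d "Rvec d" X "\<lambda>x. ssign d (x - mu)" S'
  proof unfold_locales
    show "M.indep_vars (\<lambda>_. Rvec d) X {..<n}" by (rule ind)
    show "j < d \<Longrightarrow> (\<lambda>x. ssign d (x - mu) j) \<in> borel_measurable (Rvec d)" for j by (rule ssign_diff_measurable)
    show "vnorm d (ssign d (x - mu)) \<in> {0, 1}" for x by (simp add: vnorm_ssign)
    show "M.expectation (\<lambda>\<omega>. ssign d (X i \<omega> - mu) j * ssign d (X i \<omega> - mu) k) = S' j k"
      if "i < n" "j < d" "k < d" for i j k
    proof -
      have "S j k = (\<integral>x. ssign d (x - mu) j * ssign d (x - mu) k \<partial>distr M (Rvec d) (X i))"
        unfolding law[OF that(1)] sscm_def ..
      also have "\<dots> = M.expectation (\<lambda>\<omega>. ssign d (X i \<omega> - mu) j * ssign d (X i \<omega> - mu) k)"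
        by (rule integral_distr[OF X_meas[OF that(1)]]) (intro borel_measurable_times ssign_diff_measurable that)
      finally show ?thesis using that by (simp add: S'_def)
    qed
    show "cutm d S'" by (auto simp: cutm_def S'_def)
    show "n \<ge> 1" by (rule n)
  qed
  obtain G where G: "G \<in> sets M" "M.prob G \<ge> 1 - 0.97 * \<alpha>"
    and g: "\<And>\<omega> v. \<omega> \<in> G \<Longrightarrow> vnorm d v = 1 \<Longrightarrow> \<bar>qform d (I.D \<omega>) v\<bar> \<le> real n * (2 * sqrt (l * L / real n))"
    using I.spectral_deviation[OF _ specnorm_S_pos L(1) \<alpha> L(2) d_pos regime] S_qform_le unfolding q' by blast
  show ?thesis
  proof (rule that[OF G])
    fix \<omega> v assume "\<omega> \<in> G" "vnorm d v = 1"
    have "qform d (I.D \<omega>) v = qform d (\<lambda>i j. real n * (sample_sscm d n (\<lambda>i. X i \<omega>) mu i j - S i j)) v"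
      unfolding qform_def
    proof (intro sum.cong refl arg_cong2[where f = "(*)"])
      fix i j assume "i \<in> {..<d}" "j \<in> {..<d}"
      then show "I.D \<omega> i j = real n * (sample_sscm d n (\<lambda>i. X i \<omega>) mu i j - S i j)"
        using n unfolding I.dev_def I.cen_def I.proj_def
        by (simp add: S'_def sample_sscm_def sum_subtractf right_diff_distrib)
    qed
    also have "\<dots> = real n * dv \<omega> v" by (simp only: qform_scaleM qform_diff)
    finally have e: "qform d (I.D \<omega>) v = real n * dv \<omega> v" .
    have "real n * \<bar>dv \<omega> v\<bar> \<le> real n * (2 * sqrt (l * L / real n))"
      using g[OF \<open>\<omega> \<in> G\<close> \<open>vnorm d v = 1\<close>] unfolding e by (simp only: abs_mult abs_of_nat)
    then show "\<bar>dv \<omega> v\<bar> \<le> 2 * sqrt (l * L / real n)" using n by (simp only: mult_le_cancel_left_pos of_nat_0_less_iff)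
  qed
qed

text \<open>The matrix u u' has Frobenius norm at most 1, so the mean squared deviation is at most 1
  / n. The bound carries no factor l and serves where 4 l L >= 1 / \<epsilon>.\<close>

lemma deviation_chebyshev:
  assumes \<epsilon>: "\<epsilon> > 0"
  obtains G where "G \<in> sets M" "measure M G \<ge> 1 - \<epsilon>"
    "\<And>\<omega> v. \<omega> \<in> G \<Longrightarrow> vnorm d v = 1 \<Longrightarrow> \<bar>dv \<omega> v\<bar> \<le> sqrt (1 / (real n * \<epsilon>))"
proof -
  interpret M: prob_space M by (rule M)
  let ?g = "\<lambda>c x. u x (fst c) * u x (snd c)"
  obtain G where G: "G \<in> sets M" "M.prob G \<ge> 1 - \<epsilon>"
    and g: "\<And>\<omega>. \<omega> \<in> G \<Longrightarrow> (\<Sum>c\<in>{..<d}\<times>{..<d}. ((\<Sum>i<n. ?g c (X i \<omega>)) / real n - (\<integral>x. ?g c x \<partial>P))\<^sup>2) \<le> 1 / (real n * \<epsilon>)"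
  proof (rule M.sample_mean_hilbert[OF ind law n, of "{..<d}\<times>{..<d}" ?g "\<lambda>_. 1" 1 \<epsilon>])
    show "?g c \<in> borel_measurable (Rvec d)" if "c \<in> {..<d}\<times>{..<d}" for c
      using that by (intro borel_measurable_times ssign_diff_measurable) auto
    show "(\<Sum>c\<in>{..<d}\<times>{..<d}. (?g c x)\<^sup>2) \<le> 1" for x
      using sum_ssign_sq_le[of d "x - mu"]
      by (simp only: power_mult_distrib sum_Times_mult[of "\<lambda>j. (u x j)\<^sup>2" "\<lambda>j. (u x j)\<^sup>2"])
        (intro mult_le_one sum_nonneg, auto)
  qed (use \<epsilon> in \<open>auto simp: P.prob_space\<close>)
  show ?thesis
  proof (rule that[OF G])
    fix \<omega> v assume \<omega>: "\<omega> \<in> G" and v: "vnorm d v = 1"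
    have "dv \<omega> v = qform d (\<lambda>i j. sample_sscm d n (\<lambda>i. X i \<omega>) mu i j - S i j) v" by (simp only: qform_diff)
    then have "\<bar>dv \<omega> v\<bar> \<le> sqrt (\<Sum>i<d. \<Sum>j<d. (sample_sscm d n (\<lambda>i. X i \<omega>) mu i j - S i j)\<^sup>2)"
      using qform_le_frobenius[of d "\<lambda>i j. sample_sscm d n (\<lambda>i. X i \<omega>) mu i j - S i j" v] v by simp
    also have "\<dots> \<le> sqrt (1 / (real n * \<epsilon>))"
      using g[OF \<omega>] by (simp add: sample_sscm_def sscm_def sum.cartesian_product split_def)
    finally show "\<bar>dv \<omega> v\<bar> \<le> sqrt (1 / (real n * \<epsilon>))" .
  qed
qed

text \<open>Both quadratic forms are nonnegative, so their difference is bounded by the larger of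
  the two upper bounds; no concentration around S is used.\<close>

lemma deviation_high_rank:
  assumes \<epsilon>: "0 < \<epsilon>" "\<epsilon> \<le> 1" and l2: "l \<le> 1 / 50" and tail: "real n * exp (- 0.0003 / l) \<le> \<epsilon>"
  obtains G where "G \<in> sets M" "measure M G \<ge> 1 - 2 * \<epsilon>"
    "\<And>\<omega> v. \<omega> \<in> G \<Longrightarrow> vnorm d v = 1 \<Longrightarrow> \<bar>dv \<omega> v\<bar> \<le> 1.4 * l + dev_const \<epsilon> / real n"
proof -
  have ln0: "ln (2 / \<epsilon>) \<ge> 0" using \<epsilon> by simp
  then have c0: "dev_const \<epsilon> \<ge> 0" by (simp add: dev_const_def)
  have l': "qform d (gdir d q A) v \<le> l" if "vnorm d v = 1" for v
    using S_qform_le[of v] that by (simp add: S_qform)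
  obtain G where G: "G \<in> sets M" "measure M G \<ge> 1 - 2 * \<epsilon>"
    and g: "\<And>\<omega> v. \<omega> \<in> G \<Longrightarrow> vnorm d v = 1 \<Longrightarrow>
      (\<Sum>i<n. (ip d (ssign d (X i \<omega> - mu)) v)\<^sup>2) \<le> 1.4 * real n * l + dev_const \<epsilon>"
    using high_rank_regime[OF M X_meas ind law n \<epsilon> l' l2 tail] unfolding dev_const_def by blast
  show ?thesis
  proof (rule that[OF G])
    fix \<omega> v assume \<omega>: "\<omega> \<in> G" and v: "vnorm d v = 1"
    define T where "T = qform d (sample_sscm d n (\<lambda>i. X i \<omega>) mu) v"
    have T: "T = (1 / real n) * (\<Sum>i<n. (ip d (ssign d (X i \<omega> - mu)) v)\<^sup>2)"
      unfolding T_def sample_sscm_def by (simp only: qform_scaleM qform_sum qform_outer)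
    have T0: "0 \<le> T" unfolding T by (intro mult_nonneg_nonneg sum_nonneg) auto
    have "T \<le> (1 / real n) * (1.4 * real n * l + dev_const \<epsilon>)"
      unfolding T by (intro mult_left_mono g \<omega> v) auto
    also have "\<dots> = 1.4 * l + dev_const \<epsilon> / real n" using n by (simp add: field_simps)
    finally have T1: "T \<le> 1.4 * l + dev_const \<epsilon> / real n" .
    have "0 \<le> qform d S v" "qform d S v \<le> l" using S_qform_nonneg[of v] S_qform_le[of v] v by auto
    moreover have "0 \<le> dev_const \<epsilon> / real n" using c0 by simp
    ultimately show "\<bar>dv \<omega> v\<bar> \<le> 1.4 * l + dev_const \<epsilon> / real n"
      using T0 T1 specnorm_S_pos unfolding T_def[symmetric] by (intro abs_leI) linarith+
  qed
qed

text \<open>For L < 22 the moment case always applies: d is bounded, hence l bounded below and n l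
  large. Otherwise n l < 2 L remains, and comparing 4 l L with 1 / \<epsilon> separates Chebyshev
  from the Gaussian bound: below this threshold n l^2 < 2 l L < 1 / (2 \<epsilon>), which is what
  makes l small.\<close>

lemma sample_deviation:
  assumes \<alpha>: "0 < \<alpha>" "\<alpha> \<le> 1" and L: "L = ln (real d) + ln (1 / \<alpha>)" and d2: "d \<ge> 2"
    and \<epsilon>: "\<epsilon> = \<alpha> / 1000" and size: "dev_size \<epsilon> \<le> real n"
  obtains G where "G \<in> sets M" "measure M G \<ge> 1 - 0.97 * \<alpha>"
    "\<And>\<omega> v. \<omega> \<in> G \<Longrightarrow> vnorm d v = 1 \<Longrightarrow> \<bar>dv \<omega> v\<bar> \<le> 2 * sqrt (l * L / real n) + dev_const \<epsilon> / real n"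
proof -
  have n0: "real n > 0" using n by simp
  have \<epsilon>0: "0 < \<epsilon>" "\<epsilon> \<le> 1" using \<alpha> \<epsilon> by auto
  have "ln (2 / \<epsilon>) \<ge> 0" using \<epsilon>0 by simp
  then have c0: "dev_const \<epsilon> / real n \<ge> 0" by (simp add: dev_const_def)
  have L2: "L \<ge> ln 2"
  proof -
    have "ln (real d) \<ge> ln 2" using d2 by simp
    moreover have "ln (1 / \<alpha>) \<ge> 0" using \<alpha> by simp
    ultimately show ?thesis unfolding L by linarith
  qed
  have L0: "L > 0" using L2 by (smt (verit) ln_gt_zero)
  show ?thesis
  proof (cases "L < 22 \<and> 5050 * L \<le> real n * l \<or> 22 \<le> L \<and> 2 * L \<le> real n * l")
    case True
    obtain G where G: "G \<in> sets M" "measure M G \<ge> 1 - 0.97 * \<alpha>"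
      and g: "\<And>\<omega> v. \<omega> \<in> G \<Longrightarrow> vnorm d v = 1 \<Longrightarrow> \<bar>dv \<omega> v\<bar> \<le> 2 * sqrt (l * L / real n)"
      using deviation_moment[OF \<alpha>(1) L2 L True] by blast
    have "\<bar>dv \<omega> v\<bar> \<le> 2 * sqrt (l * L / real n) + dev_const \<epsilon> / real n" if "\<omega> \<in> G" "vnorm d v = 1" for \<omega> v
      using g[OF that] c0 by linarith
    then show ?thesis using G that by blast
  next
    case False
    have L22: "22 \<le> L"
    proof (rule ccontr)
      assume "\<not> 22 \<le> L"
      then have L22: "L < 22" by simp
      have "ln (real d) \<le> 22" using L22 \<alpha> unfolding L by (smt (verit) ln_ge_zero le_divide_eq_1_pos)
      then have "real d \<le> exp 22" using d2 ln_le_cancel_iff[of "real d" "exp 22"] by simp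
      then have "1 \<le> l * exp 22"
        using specnorm_S_ge specnorm_S_pos mult_left_mono[of "real d" "exp 22" l] by linarith
      then have "5050 * 22 * 1 \<le> 5050 * 22 * (l * exp 22)" by (intro mult_left_mono) auto
      also have "\<dots> = (5050 * 22 * exp 22) * l" by simp
      also have "\<dots> \<le> real n * l" using size specnorm_S_pos by (intro mult_right_mono) (auto simp: dev_size_def)
      finally have "5050 * L \<le> real n * l" using L22 by linarith
      then show False using False L22 by blast
    qed
    then have nl: "real n * l < 2 * L" using False by linarith
    show ?thesis
    proof (cases "1 / \<epsilon> \<le> 4 * l * L")
      case True
      obtain G where G: "G \<in> sets M" "measure M G \<ge> 1 - \<epsilon>"
        and g: "\<And>\<omega> v. \<omega> \<in> G \<Longrightarrow> vnorm d v = 1 \<Longrightarrow> \<bar>dv \<omega> v\<bar> \<le> sqrt (1 / (real n * \<epsilon>))"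
        using deviation_chebyshev[OF \<epsilon>0(1)] by blast
      have "sqrt (1 / (real n * \<epsilon>)) \<le> sqrt (4 * (l * L / real n))"
      proof (rule real_sqrt_le_mono)
        have "1 / (real n * \<epsilon>) = 1 / \<epsilon> / real n" by simp
        also have "\<dots> \<le> 4 * l * L / real n" using True n0 by (intro divide_right_mono) auto
        finally show "1 / (real n * \<epsilon>) \<le> 4 * (l * L / real n)" by (simp only: times_divide_eq_right mult.assoc)
      qed
      also have "\<dots> = 2 * sqrt (l * L / real n)" by (simp only: real_sqrt_mult real_sqrt_four)
      finally have "sqrt (1 / (real n * \<epsilon>)) \<le> 2 * sqrt (l * L / real n) + dev_const \<epsilon> / real n" using c0 by linarith
      then have "\<bar>dv \<omega> v\<bar> \<le> 2 * sqrt (l * L / real n) + dev_const \<epsilon> / real n" if "\<omega> \<in> G" "vnorm d v = 1" for \<omega> v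
        using g[OF that] by linarith
      moreover have "measure M G \<ge> 1 - 0.97 * \<alpha>" using G(2) \<epsilon> \<alpha> by simp
      ultimately show ?thesis using G(1) that by blast
    next
      case False
      have "l * (real n * l) < l * (2 * L)" using nl specnorm_S_pos by (intro mult_strict_left_mono)
      then have nl2: "real n * l\<^sup>2 < 1 / (2 * \<epsilon>)" using False by (simp add: power2_eq_square mult_ac)
      have s: "1 / (2 * \<epsilon> * (dev_tol \<epsilon>)\<^sup>2) \<le> real n" using size by (simp add: dev_size_def)
      note t = exp_tail_small[OF \<epsilon>0(1) specnorm_S_pos n0 nl2 s]
      have "\<epsilon>\<^sup>2 \<le> 1" using \<epsilon>0 by (simp add: power_le_one)
      then have "dev_tol \<epsilon> \<le> 1 * 0.0003 ^ 3 * (2 / 27)" unfolding dev_tol_def by (intro mult_right_mono) auto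
      also have "\<dots> \<le> 1 / 50" by (simp add: power3_eq_cube)
      finally have "dev_tol \<epsilon> \<le> 1 / 50" .
      then obtain G where G: "G \<in> sets M" "measure M G \<ge> 1 - 2 * \<epsilon>"
        and g: "\<And>\<omega> v. \<omega> \<in> G \<Longrightarrow> vnorm d v = 1 \<Longrightarrow> \<bar>dv \<omega> v\<bar> \<le> 1.4 * l + dev_const \<epsilon> / real n"
        using deviation_high_rank[OF \<epsilon>0 order_trans[OF t(1)] t(2)] by blast
      have "1.4 * l \<le> 2 * sqrt (l * L / real n)"
      proof -
        \<comment> \<open>From n l < 2 L the main term exceeds sqrt 2 * l, and 1.4 < sqrt 2.\<close>
        have "(0.7 * l)\<^sup>2 \<le> l * (l / 2)" by (simp add: power2_eq_square)
        also have "\<dots> \<le> l * (L / real n)" using nl n0 specnorm_S_pos by (intro mult_left_mono) (auto simp: field_simps)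
        finally have "0.7 * l \<le> sqrt (l * L / real n)" by (intro real_le_rsqrt) simp
        then show ?thesis by simp
      qed
      then have "\<bar>dv \<omega> v\<bar> \<le> 2 * sqrt (l * L / real n) + dev_const \<epsilon> / real n" if "\<omega> \<in> G" "vnorm d v = 1" for \<omega> v
        using g[OF that] by linarith
      moreover have "measure M G \<ge> 1 - 0.97 * \<alpha>" using G(2) \<epsilon> \<alpha> by simp
      ultimately show ?thesis using G(1) that by blast
    qed
  qed
qed

end

end

section \<open>From the model assumptions to the theorem\<close>

lemma mat_rank_zero:
  assumes "\<And>i j. i < m \<Longrightarrow> j < k \<Longrightarrow> B i j = 0"
  shows "mat_rank m k B = 0"
proof -
  have "J = {}" if "J \<subseteq> {..<k}" "cols_indep m B J" for J
  proof -
    have "\<forall>i<m. (\<Sum>j\<in>J. 1 * B i j) = 0" using assms that(1) by (auto intro!: sum.neutral)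
    then have "\<forall>j\<in>J. (1::real) = 0" using that(2) unfolding cols_indep_def by (elim allE[of _ "\<lambda>_. 1"]) blast
    then show ?thesis by auto
  qed
  moreover have "cols_indep m B {}" by (simp add: cols_indep_def)
  ultimately have "{J. J \<subseteq> {..<k} \<and> cols_indep m B J} = {{}}" by blast
  moreover have "{card J | J. J \<subseteq> {..<k} \<and> cols_indep m B J} = card ` {J. J \<subseteq> {..<k} \<and> cols_indep m B J}" by blast
  ultimately have "{card J | J. J \<subseteq> {..<k} \<and> cols_indep m B J} = {0}" by simp
  then show ?thesis by (simp add: mat_rank_def)
qed

text \<open>\<xi> is almost surely nonzero and E \<xi>^2 = q, so q is not 0; A = 0 on its block
  would then give Sigma rank 0 instead of q.\<close>

lemma elliptical_of_model:
  assumes Sig: "\<And>i j. i < d \<Longrightarrow> j < d \<Longrightarrow> Sig i j = (\<Sum>k<q. A i k * A j k)"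
    and rank: "mat_rank d d Sig = q"
    and nu: "prob_space nu" "sets nu = sets borel"
    and nonneg: "AE r in nu. 0 \<le> r" and nonzero: "emeasure nu {0} = 0"
    and second: "(\<integral>\<^sup>+ r. ennreal (r\<^sup>2) \<partial>nu) = of_nat q"
  shows "elliptical d q A nu"
proof (rule elliptical.intro)
  interpret nu: prob_space nu by (rule nu)
  show "prob_space nu" "sets nu = sets borel" by (rule nu)+
  have ne: "AE r in nu. r \<noteq> 0"
    using nonzero nu(2) by (intro AE_I[of _ _ "{0}"]) auto
  show "AE r in nu. 0 < r" using nonneg ne by eventually_elim simp
  have q: "q \<noteq> 0"
  proof
    assume "q = 0"
    have "(\<lambda>r. ennreal (r\<^sup>2)) \<in> borel_measurable nu" unfolding measurable_cong_sets[OF nu(2) refl] by measurable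
    then have "AE r in nu. ennreal (r\<^sup>2) = 0" using second \<open>q = 0\<close> by (simp add: nn_integral_0_iff_AE)
    with ne have "AE r in nu. False" by eventually_elim simp
    then show False by simp
  qed
  show "frob d q A > 0"
  proof (rule ccontr)
    assume "\<not> 0 < frob d q A"
    moreover have "0 \<le> frob d q A" by (simp add: frob_def sum_nonneg)
    ultimately have "frob d q A = 0" by simp
    then have "\<forall>i<d. vnorm q (A i) = 0" by (simp add: frob_def sum_nonneg_eq_0_iff)
    then have "A i k = 0" if "i < d" "k < q" for i k using that by (simp add: vnorm_zero_iff)
    then have "mat_rank d d Sig = 0" by (intro mat_rank_zero) (simp add: Sig)
    then show False using rank q by simp
  qed
qed

text \<open>l^2 (1 + 1 / l) = l + l^2 >= l.\<close>

lemma eff_rank_scale: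
  fixes l L n :: real
  assumes "l > 0" "L \<ge> 0" "n > 0"
  shows "2 * sqrt (l * L / n) \<le> l * sqrt (4 * (1 + 1 / l) * L / n)"
proof -
  have "2 * sqrt (l * L / n) = sqrt (4 * (l * L / n))" by (simp only: real_sqrt_mult real_sqrt_four)
  also have "\<dots> \<le> sqrt (l\<^sup>2 * (4 * (1 + 1 / l) * L / n))"
  proof (rule real_sqrt_le_mono)
    have "l\<^sup>2 * (4 * (1 + 1 / l) * L / n) = 4 * (l * L / n) + 4 * l\<^sup>2 * L / n"
      using assms by (simp add: field_simps power2_eq_square)
    moreover have "4 * l\<^sup>2 * L / n \<ge> 0" using assms by simp
    ultimately show "4 * (l * L / n) \<le> l\<^sup>2 * (4 * (1 + 1 / l) * L / n)" by linarith
  qed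
  also have "\<dots> = l * sqrt (4 * (1 + 1 / l) * L / n)" using assms by (simp only: real_sqrt_mult real_sqrt_abs abs_of_pos)
  finally show ?thesis .
qed

lemma (in elliptical) sample_sscm_bound:
  fixes M :: "'a measure" and X :: "nat \<Rightarrow> 'a \<Rightarrow> nat \<Rightarrow> real"
  assumes M: "prob_space M"
    and ind: "prob_space.indep_vars M (\<lambda>_. Rvec d) X {..<n}"
    and law: "\<And>i. i < n \<Longrightarrow> distr M (Rvec d) (X i) = P"
    and med: "\<And>\<omega>. \<omega> \<in> space M \<Longrightarrow> is_spatial_median d n (\<lambda>i. X i \<omega>) (mh \<omega>)"
    and n: "n \<ge> 1"
    and I1: "integrable P (\<lambda>x. R x ^ 1)" and I2: "integrable P (\<lambda>x. R x ^ 2)"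
    and \<zeta>: "\<zeta> > 0" and ratio: "zeta d mu P 2 / zeta d mu P 1 ^ 2 < \<zeta>"
    and \<psi>: "\<psi> > 0" and l: "l < 1 - \<psi>"
    and \<alpha>: "0 < \<alpha>" "\<alpha> \<le> 1" and \<epsilon>: "\<epsilon> = \<alpha> / 1000"
    and size: "med_size \<zeta> \<psi> \<epsilon> \<le> real n" "dev_size \<epsilon> \<le> real n"
    and \<delta>: "0 < \<delta>" "\<delta> < 1"
  shows "\<exists>E\<in>sets M. measure M E > 1 - \<alpha> \<and>
        E \<subseteq> {\<omega>\<in>space M.
          specnorm d (\<lambda>i j. sample_sscm d n (\<lambda>k. X k \<omega>) (mh \<omega>) i j - S i j)
          \<le> l * sqrt (4 * (1 + eff_rank d S) * (ln (real d) + ln (1 / \<alpha>)) / real n)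
            + (med_const \<zeta> \<psi> \<epsilon> + dev_const \<epsilon>) * real n powr (- (1 + \<delta>) / 2)}"
proof -
  interpret M: prob_space M by (rule M)
  have n0: "real n > 0" using n by simp
  have \<epsilon>0: "\<epsilon> > 0" "\<epsilon> \<le> 1" using \<alpha> \<epsilon> by auto
  \<comment> \<open>In dimension one l >= 1, which (A2) excludes. From d >= 2 comes L >= ln 2, the
    starting point of the moment method.\<close>
  have d2: "d \<ge> 2"
  proof (rule ccontr)
    assume "\<not> d \<ge> 2"
    then have "d = 1" using d_pos by simp
    then show False using specnorm_S_ge l \<psi> by simp
  qed
  define L where "L = ln (real d) + ln (1 / \<alpha>)"
  have L0: "L \<ge> 0" using d2 \<alpha> by (simp add: L_def)
  have S: "qform d (gdir d q A) e \<le> 1 - \<psi>" if "vnorm d e = 1" for e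
    using S_qform_le[of e] that l by (simp add: S_qform)
  obtain G1 where G1: "G1 \<in> sets M" "measure M G1 \<ge> 1 - 6 * \<epsilon>"
    and g1: "\<And>\<omega> m v. \<omega> \<in> G1 \<Longrightarrow> is_spatial_median d n (\<lambda>i. X i \<omega>) m \<Longrightarrow> vnorm d v = 1 \<Longrightarrow>
      \<bar>qform d (sample_sscm d n (\<lambda>i. X i \<omega>) m) v - qform d (sample_sscm d n (\<lambda>i. X i \<omega>) mu) v\<bar> \<le> med_const \<zeta> \<psi> \<epsilon> / real n"
    using median_effect[OF M ind law n I1 I2 \<zeta> ratio \<psi> S \<epsilon>0(1) size(1)] by blast
  obtain G2 where G2: "G2 \<in> sets M" "measure M G2 \<ge> 1 - 0.97 * \<alpha>"
    and g2: "\<And>\<omega> v. \<omega> \<in> G2 \<Longrightarrow> vnorm d v = 1 \<Longrightarrow>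
      \<bar>qform d (sample_sscm d n (\<lambda>i. X i \<omega>) mu) v - qform d S v\<bar> \<le> 2 * sqrt (l * L / real n) + dev_const \<epsilon> / real n"
    using sample_deviation[OF M ind law n \<alpha> L_def d2 \<epsilon> size(2)] by blast
  have c0: "0 \<le> med_const \<zeta> \<psi> \<epsilon> + dev_const \<epsilon>"
  proof -
    have "ln (2 / \<epsilon>) \<ge> 0" using \<epsilon>0 by simp
    then have "dev_const \<epsilon> \<ge> 0" by (simp add: dev_const_def)
    moreover have "med_const \<zeta> \<psi> \<epsilon> \<ge> 0"
      using \<zeta> \<epsilon>0 curv_const_pos[OF \<zeta> \<psi>] by (simp add: med_const_def radius_const_def)
    ultimately show ?thesis by simp
  qed
  have pw: "1 / real n \<le> real n powr (- (1 + \<delta>) / 2)"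
  proof -
    have "1 / real n = real n powr (- 1)" using n0 by (simp add: powr_minus inverse_eq_divide)
    also have "\<dots> \<le> real n powr (- (1 + \<delta>) / 2)" using \<delta> n by (intro powr_mono) auto
    finally show ?thesis .
  qed
  have er: "eff_rank d S = 1 / l" by (simp add: eff_rank_def S_trace)
  show ?thesis
  proof (intro bexI conjI subsetI)
    show "G1 \<inter> G2 \<in> sets M" using G1 G2 by auto
    \<comment> \<open>The total failure probability is 0.006 \<alpha> + 0.97 \<alpha>, which leaves
      a strict inequality.\<close>
    have "M.prob (G1 \<inter> G2) \<ge> 1 - (6 * \<epsilon> + 0.97 * \<alpha>)" by (rule M.prob_Int_ge[OF G1(1) G2(1) G1(2) G2(2)])
    then show "measure M (G1 \<inter> G2) > 1 - \<alpha>" using \<epsilon> \<alpha> by simp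
    fix \<omega> assume "\<omega> \<in> G1 \<inter> G2"
    then have \<omega>: "\<omega> \<in> G1" "\<omega> \<in> G2" "\<omega> \<in> space M" using sets.sets_into_space[OF G1(1)] by auto
    have "specnorm d (\<lambda>i j. sample_sscm d n (\<lambda>k. X k \<omega>) (mh \<omega>) i j - S i j)
      \<le> l * sqrt (4 * (1 + eff_rank d S) * L / real n) + (med_const \<zeta> \<psi> \<epsilon> + dev_const \<epsilon>) * real n powr (- (1 + \<delta>) / 2)"
    proof (rule specnorm_le[OF d_pos])
      show "sample_sscm d n (\<lambda>k. X k \<omega>) (mh \<omega>) i j - S i j = sample_sscm d n (\<lambda>k. X k \<omega>) (mh \<omega>) j i - S j i" for i j
        by (simp add: sample_sscm_def sscm_def mult.commute)
      fix v assume v: "vnorm d v = 1"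
      have "\<bar>qform d (\<lambda>i j. sample_sscm d n (\<lambda>k. X k \<omega>) (mh \<omega>) i j - S i j) v\<bar>
        \<le> 2 * sqrt (l * L / real n) + (med_const \<zeta> \<psi> \<epsilon> + dev_const \<epsilon>) * (1 / real n)"
        using g1[OF \<omega>(1) med[OF \<omega>(3)] v] g2[OF \<omega>(2) v] unfolding qform_diff
        by (simp add: add_divide_distrib)
      also have "\<dots> \<le> l * sqrt (4 * (1 + 1 / l) * L / real n)
          + (med_const \<zeta> \<psi> \<epsilon> + dev_const \<epsilon>) * real n powr (- (1 + \<delta>) / 2)"
        by (intro add_mono eff_rank_scale mult_left_mono specnorm_S_pos L0 n0 pw c0)
      finally show "\<bar>qform d (\<lambda>i j. sample_sscm d n (\<lambda>k. X k \<omega>) (mh \<omega>) i j - S i j) v\<bar>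
        \<le> l * sqrt (4 * (1 + eff_rank d S) * L / real n)
          + (med_const \<zeta> \<psi> \<epsilon> + dev_const \<epsilon>) * real n powr (- (1 + \<delta>) / 2)" unfolding er .
    qed
    then show "\<omega> \<in> {\<omega>\<in>space M. specnorm d (\<lambda>i j. sample_sscm d n (\<lambda>k. X k \<omega>) (mh \<omega>) i j - S i j)
      \<le> l * sqrt (4 * (1 + eff_rank d S) * (ln (real d) + ln (1 / \<alpha>)) / real n)
        + (med_const \<zeta> \<psi> \<epsilon> + dev_const \<epsilon>) * real n powr (- (1 + \<delta>) / 2)}"
      using \<omega>(3) by (simp add: L_def)
  qed
qed

theorem theorem1:
  fixes d q :: "nat \<Rightarrow> nat"
    and mu :: "nat \<Rightarrow> nat \<Rightarrow> real"
    and A Sigma :: "nat \<Rightarrow> nat \<Rightarrow> nat \<Rightarrow> real"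
    and nu :: "nat \<Rightarrow> real measure"
    and M :: "nat \<Rightarrow> 'a measure"
    and X :: "nat \<Rightarrow> nat \<Rightarrow> 'a \<Rightarrow> nat \<Rightarrow> real"
    and muhat :: "nat \<Rightarrow> 'a \<Rightarrow> nat \<Rightarrow> real"
  assumes q_le_d: "\<And>n. q n \<le> d n"
    and Sigma_def: "\<And>n i j. i < d n \<Longrightarrow> j < d n \<Longrightarrow> Sigma n i j = (\<Sum>k<q n. A n i k * A n j k)"
    and Sigma_rank: "\<And>n. mat_rank (d n) (d n) (Sigma n) = q n"
    and nu_prob: "\<And>n. prob_space (nu n)"
    and nu_borel: "\<And>n. sets (nu n) = sets borel"
    and xi_nonneg: "\<And>n. AE r in nu n. 0 \<le> r"
    and xi_nonzero: "\<And>n. emeasure (nu n) {0} = 0"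
    and xi_second_moment: "\<And>n. (\<integral>\<^sup>+ r. ennreal (r\<^sup>2) \<partial>nu n) = of_nat (q n)"
    and M_prob: "\<And>n. prob_space (M n)"
    and X_meas: "\<And>n i. i < n \<Longrightarrow> X n i \<in> measurable (M n) (Rvec (d n))"
    and X_indep: "\<And>n. prob_space.indep_vars (M n) (\<lambda>_. Rvec (d n)) (X n) {..<n}"
    and X_law: "\<And>n i. i < n \<Longrightarrow>
        distr (M n) (Rvec (d n)) (X n i) = ell_law (d n) (q n) (mu n) (A n) (nu n)"
    and muhat_meas: "\<And>n. muhat n \<in> measurable (M n) (Rvec (d n))"
    and muhat_median: "\<And>n \<omega>. \<omega> \<in> space (M n) \<Longrightarrow>
        is_spatial_median (d n) n (\<lambda>i. X n i \<omega>) (muhat n \<omega>)"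
    and A1: "\<exists>\<zeta>>0. \<forall>n. \<forall>k\<in>{1..4::nat}.
        integrable (ell_law (d n) (q n) (mu n) (A n) (nu n))
          (\<lambda>x. inverse (vnorm (d n) (x - mu n)) ^ k) \<and>
        zeta (d n) (mu n) (ell_law (d n) (q n) (mu n) (A n) (nu n)) k
          / zeta (d n) (mu n) (ell_law (d n) (q n) (mu n) (A n) (nu n)) 1 ^ k < \<zeta>"
    and A2: "\<exists>\<psi>>0. limsup (\<lambda>n. ereal (specnorm (d n)
        (sscm (d n) (mu n) (ell_law (d n) (q n) (mu n) (A n) (nu n))))) < ereal (1 - \<psi>)"
  shows "\<forall>\<alpha>>0. \<exists>C>0. \<exists>N. \<forall>n\<ge>N. \<forall>\<delta>\<in>{0<..<1::real}.
     (\<exists>E\<in>sets (M n). prob_space.prob (M n) E > 1 - \<alpha> \<and>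
        E \<subseteq> {\<omega>\<in>space (M n).
          specnorm (d n) (\<lambda>i j. sample_sscm (d n) n (\<lambda>k. X n k \<omega>) (muhat n \<omega>) i j
              - sscm (d n) (mu n) (ell_law (d n) (q n) (mu n) (A n) (nu n)) i j)
          \<le> specnorm (d n) (sscm (d n) (mu n) (ell_law (d n) (q n) (mu n) (A n) (nu n)))
              * sqrt (4 * (1 + eff_rank (d n) (sscm (d n) (mu n) (ell_law (d n) (q n) (mu n) (A n) (nu n))))
                       * (ln (real (d n)) + ln (1 / \<alpha>)) / real n)
            + C * real n powr (- (1 + \<delta>) / 2)})"
proof (intro allI impI)
  fix \<alpha> :: real assume \<alpha>0: "\<alpha> > 0"
  let ?P = "\<lambda>n. ell_law (d n) (q n) (mu n) (A n) (nu n)"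
  show "\<exists>C>0. \<exists>N. \<forall>n\<ge>N. \<forall>\<delta>\<in>{0<..<1::real}.
     (\<exists>E\<in>sets (M n). prob_space.prob (M n) E > 1 - \<alpha> \<and>
        E \<subseteq> {\<omega>\<in>space (M n).
          specnorm (d n) (\<lambda>i j. sample_sscm (d n) n (\<lambda>k. X n k \<omega>) (muhat n \<omega>) i j - sscm (d n) (mu n) (?P n) i j)
          \<le> specnorm (d n) (sscm (d n) (mu n) (?P n))
              * sqrt (4 * (1 + eff_rank (d n) (sscm (d n) (mu n) (?P n)))
                       * (ln (real (d n)) + ln (1 / \<alpha>)) / real n)
            + C * real n powr (- (1 + \<delta>) / 2)})"
  proof (cases "\<alpha> \<le> 1")
    case False
    \<comment> \<open>For \<alpha> > 1 the required probability is negative and the empty event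
      serves.\<close>
    then show ?thesis by (intro exI[of _ 1] exI[of _ 0] conjI allI impI ballI bexI[of _ "{}"]) auto
  next
    case True
    have ell: "elliptical (d n) (q n) (A n) (nu n)" for n
      by (rule elliptical_of_model[OF Sigma_def Sigma_rank nu_prob nu_borel xi_nonneg xi_nonzero xi_second_moment])
    obtain \<zeta> where \<zeta>: "\<zeta> > 0" and z: "\<And>n k. k \<in> {1..4} \<Longrightarrow>
        integrable (?P n) (\<lambda>x. inverse (vnorm (d n) (x - mu n)) ^ k) \<and>
        zeta (d n) (mu n) (?P n) k / zeta (d n) (mu n) (?P n) 1 ^ k < \<zeta>"
      using A1 by blast
    obtain \<psi> where \<psi>: "\<psi> > 0" and lim: "limsup (\<lambda>n. ereal (specnorm (d n) (sscm (d n) (mu n) (?P n)))) < ereal (1 - \<psi>)"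
      using A2 by blast
    have "\<forall>\<^sub>F n in sequentially. ereal (specnorm (d n) (sscm (d n) (mu n) (?P n))) < ereal (1 - \<psi>)"
      by (rule Limsup_lessD[OF lim])
    then obtain N0 where N0: "\<And>n. n \<ge> N0 \<Longrightarrow> specnorm (d n) (sscm (d n) (mu n) (?P n)) < 1 - \<psi>"
      by (auto simp: eventually_sequentially)
    define \<epsilon> where "\<epsilon> = \<alpha> / 1000"
    obtain N1 where N1: "max (med_size \<zeta> \<psi> \<epsilon>) (dev_size \<epsilon>) \<le> real N1" using real_arch_simple by blast
    define C where "C = med_const \<zeta> \<psi> \<epsilon> + dev_const \<epsilon>"
    have "C > 0"
    proof -
      have "\<epsilon> > 0" "ln (2 / \<epsilon>) \<ge> 0" using \<alpha>0 True by (auto simp: \<epsilon>_def)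
      then have "4840 + 48.4 * ln (2 / \<epsilon>) > 0" by linarith
      then have "dev_const \<epsilon> > 0" "med_const \<zeta> \<psi> \<epsilon> \<ge> 0"
        unfolding dev_const_def using \<zeta> curv_const_pos[OF \<zeta> \<psi>] \<open>\<epsilon> > 0\<close> by (simp_all add: med_const_def radius_const_def)
      then show ?thesis by (simp add: C_def)
    qed
    moreover have "\<forall>n\<ge>max 1 (max N0 N1). \<forall>\<delta>\<in>{0<..<1::real}.
     (\<exists>E\<in>sets (M n). prob_space.prob (M n) E > 1 - \<alpha> \<and>
        E \<subseteq> {\<omega>\<in>space (M n).
          specnorm (d n) (\<lambda>i j. sample_sscm (d n) n (\<lambda>k. X n k \<omega>) (muhat n \<omega>) i j - sscm (d n) (mu n) (?P n) i j)
          \<le> specnorm (d n) (sscm (d n) (mu n) (?P n))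
              * sqrt (4 * (1 + eff_rank (d n) (sscm (d n) (mu n) (?P n)))
                       * (ln (real (d n)) + ln (1 / \<alpha>)) / real n)
            + C * real n powr (- (1 + \<delta>) / 2)})"
    proof (intro allI impI ballI)
      fix n and \<delta> :: real assume n: "n \<ge> max 1 (max N0 N1)" and \<delta>: "\<delta> \<in> {0<..<1}"
      have N: "med_size \<zeta> \<psi> \<epsilon> \<le> real n" "dev_size \<epsilon> \<le> real n" using N1 n by auto
      show "\<exists>E\<in>sets (M n). prob_space.prob (M n) E > 1 - \<alpha> \<and>
        E \<subseteq> {\<omega>\<in>space (M n).
          specnorm (d n) (\<lambda>i j. sample_sscm (d n) n (\<lambda>k. X n k \<omega>) (muhat n \<omega>) i j - sscm (d n) (mu n) (?P n) i j)
          \<le> specnorm (d n) (sscm (d n) (mu n) (?P n))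
              * sqrt (4 * (1 + eff_rank (d n) (sscm (d n) (mu n) (?P n)))
                       * (ln (real (d n)) + ln (1 / \<alpha>)) / real n)
            + C * real n powr (- (1 + \<delta>) / 2)}"
        unfolding C_def
        by (rule elliptical.sample_sscm_bound[OF ell M_prob X_indep X_law muhat_median, where \<psi> = \<psi>])
          (use n \<delta> N N0 \<zeta> \<psi> z[of 1] z[of 2] \<alpha>0 True in \<open>auto simp: \<epsilon>_def\<close>)
    qed
    ultimately show ?thesis by blast
  qed
qed

end
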